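(* Let $G$ be a chordless graph with maximum degree $\Delta(G)\geq 3$. Then $G$ is $\Delta(G)$-edge-colourable and $(\Delta(G)+1)$-total-colourable. Moreover, such a $\Delta(G)$-edge-colouring and such a $(\Delta(G)+1)$-total-colouring can be computed in time $O(|V(G)|^3|E(G)|)$.
   Context: All graphs are finite and simple. A cycle $C=v_1v_2\dots v_nv_1$ in $G$ has edges $v_iv_{i+1}$ ($1\le i<n$) and $v_nv_1$; a chord of $C$ is an edge of $G$ with both ends in $C$ that is not an edge of $C$. A graph is chordless if none of its cycles has a chord. A $k$-edge-colouring assigns colours from $\{1,\dots,k\}$ to the edges so that adjacent edges get distinct colours. An element of $G$ is a vertex or an edge; two elements are adjacent if they are adjacent vertices, adjacent edges, or a vertex and an edge incident to it. A $k$-total-colouring assigns colours from $\{1,\dots,k\}$ to all elements so that adjacent elements get distinct colours. *)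

theory Defs
  imports Main
begin

section \<open>Graphs\<close>

definition fin_simple_graph :: "'a set \<Rightarrow> 'a set set \<Rightarrow> bool" where
  "fin_simple_graph V E \<longleftrightarrow> finite V \<and> (\<forall>e\<in>E. e \<subseteq> V \<and> card e = 2)"

definition vdegree :: "'a set set \<Rightarrow> 'a \<Rightarrow> nat" where
  "vdegree E v = card {e \<in> E. v \<in> e}"

text \<open>The inserted 0 only matters for the graph without vertices, where \<open>Max {}\<close> is unspecified.\<close>
definition max_degree :: "'a set \<Rightarrow> 'a set set \<Rightarrow> nat" where
  "max_degree V E = Max (insert 0 (vdegree E ` V))"

definition cycle_edges :: "'a list \<Rightarrow> 'a set set" where
  "cycle_edges vs = {{vs ! i, vs ! Suc i} | i. Suc i < length vs} \<union> {{last vs, hd vs}}"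

definition is_cycle :: "'a set set \<Rightarrow> 'a list \<Rightarrow> bool" where
  "is_cycle E vs \<longleftrightarrow> 3 \<le> length vs \<and> distinct vs \<and> cycle_edges vs \<subseteq> E"

definition is_chord :: "'a set set \<Rightarrow> 'a list \<Rightarrow> 'a set \<Rightarrow> bool" where
  "is_chord E vs e \<longleftrightarrow> e \<in> E \<and> e \<subseteq> set vs \<and> e \<notin> cycle_edges vs"

definition chordless :: "'a set set \<Rightarrow> bool" where
  "chordless E \<longleftrightarrow> (\<forall>vs. is_cycle E vs \<longrightarrow> \<not> (\<exists>e. is_chord E vs e))"

section \<open>Colourings\<close>

definition adjacent_edges :: "'a set \<Rightarrow> 'a set \<Rightarrow> bool" where
  "adjacent_edges e f \<longleftrightarrow> e \<noteq> f \<and> e \<inter> f \<noteq> {}"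

definition edge_colouring :: "'a set set \<Rightarrow> nat \<Rightarrow> ('a set \<Rightarrow> nat) \<Rightarrow> bool" where
  "edge_colouring E k c \<longleftrightarrow>
     (\<forall>e\<in>E. c e \<in> {1..k}) \<and> (\<forall>e\<in>E. \<forall>f\<in>E. adjacent_edges e f \<longrightarrow> c e \<noteq> c f)"

datatype 'a element = Vertex 'a | Edge "'a set"

definition elements :: "'a set \<Rightarrow> 'a set set \<Rightarrow> 'a element set" where
  "elements V E = Vertex ` V \<union> Edge ` E"

fun adjacent_elements :: "'a set set \<Rightarrow> 'a element \<Rightarrow> 'a element \<Rightarrow> bool" where
  "adjacent_elements E (Vertex u) (Vertex v) \<longleftrightarrow> {u, v} \<in> E"
| "adjacent_elements E (Edge e) (Edge f) \<longleftrightarrow> adjacent_edges e f"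
| "adjacent_elements E (Vertex v) (Edge e) \<longleftrightarrow> v \<in> e"
| "adjacent_elements E (Edge e) (Vertex v) \<longleftrightarrow> v \<in> e"

definition total_colouring :: "'a set \<Rightarrow> 'a set set \<Rightarrow> nat \<Rightarrow> ('a element \<Rightarrow> nat) \<Rightarrow> bool" where
  "total_colouring V E k c \<longleftrightarrow>
     (\<forall>x \<in> elements V E. c x \<in> {1..k}) \<and>
     (\<forall>x \<in> elements V E. \<forall>y \<in> elements V E. adjacent_elements E x y \<longrightarrow> c x \<noteq> c y)"

definition edge_colourable :: "'a set set \<Rightarrow> nat \<Rightarrow> bool" where
  "edge_colourable E k \<longleftrightarrow> (\<exists>c. edge_colouring E k c)"

definition total_colourable :: "'a set \<Rightarrow> 'a set set \<Rightarrow> nat \<Rightarrow> bool" where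
  "total_colourable V E k \<longleftrightarrow> (\<exists>c. total_colouring V E k c)"

section \<open>Machine model\<close>

text \<open>
  Running times refer to a structured unit-cost random access machine.  Its memory consists of
  arrays of natural numbers; \<open>s a i\<close> is the content of cell \<open>i\<close> of array \<open>a\<close>, and a scalar
  variable is an array of which only cell 0 is used.  Array names are constants of the program,
  so a program accesses a fixed finite number of arrays, whereas cell indices are computed.
  Constants, memory accesses, additions, truncated subtractions, comparisons, Boolean
  connectives, assignments and control steps cost one time unit each.  Multiplication is not
  primitive.
\<close>

type_synonym store = "nat \<Rightarrow> nat \<Rightarrow> nat"

datatype aexp = Const nat | Load nat aexp | Add aexp aexp | Sub aexp aexp

datatype bexp = Less aexp aexp | Neg bexp | Conj bexp bexp

datatype com =
    Skip
  | Store nat aexp aexp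
  | Seq com com
  | Cond bexp com com
  | While bexp com

primrec aval :: "aexp \<Rightarrow> store \<Rightarrow> nat" where
  "aval (Const n) s = n"
| "aval (Load a i) s = s a (aval i s)"
| "aval (Add e1 e2) s = aval e1 s + aval e2 s"
| "aval (Sub e1 e2) s = aval e1 s - aval e2 s"

primrec acost :: "aexp \<Rightarrow> nat" where
  "acost (Const n) = 1"
| "acost (Load a i) = 1 + acost i"
| "acost (Add e1 e2) = 1 + acost e1 + acost e2"
| "acost (Sub e1 e2) = 1 + acost e1 + acost e2"

primrec bval :: "bexp \<Rightarrow> store \<Rightarrow> bool" where
  "bval (Less e1 e2) s = (aval e1 s < aval e2 s)"
| "bval (Neg b) s = (\<not> bval b s)"
| "bval (Conj b1 b2) s = (bval b1 s \<and> bval b2 s)"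

primrec bcost :: "bexp \<Rightarrow> nat" where
  "bcost (Less e1 e2) = 1 + acost e1 + acost e2"
| "bcost (Neg b) = 1 + bcost b"
| "bcost (Conj b1 b2) = 1 + bcost b1 + bcost b2"

text \<open>\<open>exec p s t s'\<close>: started in \<open>s\<close>, program \<open>p\<close> halts after exactly \<open>t\<close> time units in \<open>s'\<close>.\<close>
inductive exec :: "com \<Rightarrow> store \<Rightarrow> nat \<Rightarrow> store \<Rightarrow> bool" where
  Skip: "exec Skip s 1 s"
| Store: "exec (Store a i e) s (1 + acost i + acost e) (s(a := (s a)(aval i s := aval e s)))"
| Seq: "exec p s t s' \<Longrightarrow> exec q s' t' s'' \<Longrightarrow> exec (Seq p q) s (t + t') s''"
| CondTrue: "bval b s \<Longrightarrow> exec p s t s' \<Longrightarrow> exec (Cond b p q) s (1 + bcost b + t) s'"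
| CondFalse: "\<not> bval b s \<Longrightarrow> exec q s t s' \<Longrightarrow> exec (Cond b p q) s (1 + bcost b + t) s'"
| WhileFalse: "\<not> bval b s \<Longrightarrow> exec (While b p) s (1 + bcost b) s"
| WhileTrue: "bval b s \<Longrightarrow> exec p s t s' \<Longrightarrow> exec (While b p) s' t' s'' \<Longrightarrow>
    exec (While b p) s (1 + bcost b + t + t') s''"

lemma exec_deterministic:
  "exec p s t s' \<Longrightarrow> exec p s u s'' \<Longrightarrow> u = t \<and> s'' = s'"
proof (induction arbitrary: u s'' rule: exec.induct)
  case (Seq p s t s' q t' s2)
  from Seq.prems Seq.IH show ?case by (cases rule: exec.cases) blast+
next
  case (WhileTrue b s p t s' t' s2)
  from WhileTrue.prems WhileTrue.hyps WhileTrue.IH show ?case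
    by (cases rule: exec.cases) blast+
qed (erule exec.cases; force)+

section \<open>Input and output of the algorithms\<close>

definition edge_of :: "'a \<times> 'a \<Rightarrow> 'a set" where
  "edge_of uv = {fst uv, snd uv}"

definition edge_list :: "'a set set \<Rightarrow> ('a \<times> 'a) list \<Rightarrow> bool" where
  "edge_list E es \<longleftrightarrow> distinct (map edge_of es) \<and> set (map edge_of es) = E"

text \<open>
  A graph on the vertices \<open>0, \<dots>, n - 1\<close> is given by an arbitrary list of its edges.  Array 0
  holds the numbers of vertices and edges, arrays 1 and 2 the ends of the edges; all other cells
  are 0.
\<close>
definition input_store :: "nat \<Rightarrow> (nat \<times> nat) list \<Rightarrow> store" where
  "input_store n es = (\<lambda>_ _. 0)
     (0 := (\<lambda>_. 0)(0 := n, 1 := length es),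
      1 := (\<lambda>i. if i < length es then fst (es ! i) else 0),
      2 := (\<lambda>i. if i < length es then snd (es ! i) else 0))"

text \<open>
  On termination array 3 holds the colours of the edges, in the order of the input list, and,
  for total colourings, array 4 the colours of the vertices.
\<close>
definition outputs_edge_colouring :: "nat set set \<Rightarrow> (nat \<times> nat) list \<Rightarrow> nat \<Rightarrow> store \<Rightarrow> bool" where
  "outputs_edge_colouring E es k s \<longleftrightarrow>
     (\<exists>c. edge_colouring E k c \<and> (\<forall>i < length es. s 3 i = c (edge_of (es ! i))))"

definition outputs_total_colouring ::
  "nat \<Rightarrow> nat set set \<Rightarrow> (nat \<times> nat) list \<Rightarrow> nat \<Rightarrow> store \<Rightarrow> bool" where
  "outputs_total_colouring n E es k s \<longleftrightarrow>
     (\<exists>c. total_colouring {..<n} E k c \<and>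
          (\<forall>i < length es. s 3 i = c (Edge (edge_of (es ! i)))) \<and>
          (\<forall>v < n. s 4 v = c (Vertex v)))"

end

theory Submission
  imports Defs
begin

text \<open>
  Unless an edge of a chordless graph is a bridge, its removal leaves its ends separated by a single further
  vertex.  Uncrossing these separators yields, if all degrees are at least 2, a vertex \<open>v\<close> with at most
  one neighbour of degree at least 3.  Unless some edge can be removed and coloured last for reasons of degree,
  \<open>v\<close> has two nonadjacent neighbours \<open>y1\<close>, \<open>y2\<close> of degree 2.  Removing the edges \<open>v y1\<close>, \<open>v y2\<close> and
  identifying \<open>y1\<close> with \<open>y2\<close> gives a smaller graph that is chordless up to edges removable for reasons
  of degree; the identification forces the remaining edges at \<open>y1\<close> and \<open>y2\<close> to get different colours,
  so that the two removed edges can be coloured afterwards.  This settles edge colourings, and total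
  colourings if the maximum degree is at least 4, since vertices of degree 2 are then coloured greedily.

  For total colourings of subcubic graphs with 4 colours, uncrossing edge cuts of size 2 gives one of three
  configurations: a triangle with two vertices of degree 2, a vertex with all neighbours of degree 2, or
  two chains of one or two vertices of degree 2 with common ends.  Each of them can be removed and
  recoloured afterwards.

  The algorithm finds each reduction by exhaustive search over triples of vertices and edges, in time
  \<open>O((n + m)^3)\<close> where \<open>m \<le> 2 n\<close>, and undoes the reductions in reverse order, finding the colours of the
  boundedly many affected elements by exhaustive search as well.
\<close>

section \<open>Running times of programs\<close>

text \<open>Chordless graphs are not closed under the identification of \<open>y1\<close> and
  \<open>y2\<close>: \<open>v\<close> may keep edges that give rise to chords. All but at most one
  of these edges lead to vertices of degree less than 3 and meet the degree condition for removal,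
  which survives the removal of other edges. So the invariant asks for chordlessness only up to
  removable edges, and an identification is made only when no edge is removable, hence when the
  graph is chordless outright.

  The separators to be uncrossed are mixed: one vertex together with one edge. A minimal set with
  such a boundary that meets the vertices of degree at least 3 contains no two adjacent ones of
  them.

  Maximum degree 3 is special for total colourings because a vertex of degree 2 is adjacent to four
  elements, so that greedy colouring needs a fifth colour.

  Throughout, \<open>k\<close> is the maximum degree of the input; reductions keep all degrees at
  most \<open>k\<close>. Existence of the colourings is read off a run of the program, so every
  reduction is proved sound only once.\<close>

definition run :: "com \<Rightarrow> store \<Rightarrow> nat \<Rightarrow> (store \<Rightarrow> bool) \<Rightarrow> bool" where
  "run p s T Q \<longleftrightarrow> (\<exists>t s'. exec p s t s' \<and> t \<le> T \<and> Q s')"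

lemma run_weaken: "run p s T Q \<Longrightarrow> T \<le> T' \<Longrightarrow> (\<And>s'. Q s' \<Longrightarrow> Q' s') \<Longrightarrow> run p s T' Q'"
  unfolding run_def by (meson le_trans)

lemma run_Seq: "run p s T1 (\<lambda>s'. run q s' T2 Q) \<Longrightarrow> run (Seq p q) s (T1 + T2) Q"
  unfolding run_def by (meson add_mono exec.Seq)

lemma run_SeqI:
  assumes "run p s T1 P" "\<And>s'. P s' \<Longrightarrow> run q s' T2 Q" shows "run (Seq p q) s (T1 + T2) Q"
  by (rule run_Seq, rule run_weaken[OF assms(1)]) (use assms(2) in auto)

lemma run_Cond:
  assumes "bval b s \<Longrightarrow> run p s T Q" "\<not> bval b s \<Longrightarrow> run q s T Q"
  shows "run (Cond b p q) s (1 + bcost b + T) Q"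
  using assms unfolding run_def by (cases "bval b s") (meson exec.CondTrue exec.CondFalse add_left_mono)+

fun ev :: "com \<Rightarrow> store \<Rightarrow> store" where
  "ev Skip s = s"
| "ev (Store a i e) s = s(a := (s a)(aval i s := aval e s))"
| "ev (Seq p q) s = ev q (ev p s)"
| "ev (Cond b p q) s = (if bval b s then ev p s else ev q s)"
| "ev (While b p) s = s"

fun loop_free :: "com \<Rightarrow> bool" where
  "loop_free (Seq p q) \<longleftrightarrow> loop_free p \<and> loop_free q"
| "loop_free (Cond b p q) \<longleftrightarrow> loop_free p \<and> loop_free q"
| "loop_free (While b p) \<longleftrightarrow> False"
| "loop_free _ \<longleftrightarrow> True"

text \<open>A conditional is charged for both branches: an upper bound suffices and the programs are
  fixed, so maxima are avoided at the price of a constant factor.\<close>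

fun cost :: "com \<Rightarrow> nat" where
  "cost Skip = 1"
| "cost (Store a i e) = 1 + acost i + acost e"
| "cost (Seq p q) = cost p + cost q"
| "cost (Cond b p q) = 1 + bcost b + (cost p + cost q)"
| "cost (While b p) = 0"

lemma run_ev: "loop_free p \<Longrightarrow> run p s (cost p) (\<lambda>s'. s' = ev p s)"
proof (induction p arbitrary: s)
  case Skip then show ?case unfolding run_def by (auto intro: exec.Skip)
next
  case (Store a i e) then show ?case unfolding run_def by (auto intro!: exI exec.Store)
next
  case (Seq p q)
  show ?case unfolding cost.simps by (rule run_SeqI[OF Seq.IH(1)]) (use Seq in auto)
next
  case (Cond b p q)
  show ?case unfolding cost.simps
    by (rule run_Cond; rule run_weaken[OF Cond.IH(1)] run_weaken[OF Cond.IH(2)]) (use Cond.prems in auto)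
qed simp

lemma run_ev': "loop_free p \<Longrightarrow> Q (ev p s) \<Longrightarrow> run p s (cost p) Q"
  by (rule run_weaken[OF run_ev]) auto

text \<open>Termination is part of the premise on the body, which has to show \<open>i < N\<close>
  whenever the loop continues. A loop may also stop earlier, so the conclusion only knows some final
  index; the searches, which stop at the first success, depend on this.\<close>

lemma run_while:
  assumes body: "\<And>i s. P i s \<Longrightarrow> bval b s \<Longrightarrow> i < N \<and> run p s T (P (Suc i))"
    and "P i s" "i \<le> N"
  shows "run (While b p) s ((N - i) * (T + 1 + bcost b) + 1 + bcost b) (\<lambda>s'. \<exists>i\<le>N. P i s' \<and> \<not> bval b s')"
  using assms(2,3)
proof (induction "N - i" arbitrary: i s)
  case 0
  then have "\<not> bval b s" using body[of i s] by auto
  moreover from this have "exec (While b p) s (1 + bcost b) s" by (rule exec.WhileFalse)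
  ultimately show ?case using 0 unfolding run_def by (intro exI[of _ "1 + bcost b"] exI[of _ s]) auto
next
  case (Suc d)
  show ?case
  proof (cases "bval b s")
    case False
    then have "exec (While b p) s (1 + bcost b) s" by (rule exec.WhileFalse)
    then show ?thesis using Suc False unfolding run_def by (intro exI[of _ "1 + bcost b"] exI[of _ s]) auto
  next
    case True
    from body[OF Suc(3) this] have iN: "i < N" and r: "run p s T (P (Suc i))" by auto
    obtain t s1 where 1: "exec p s t s1" "t \<le> T" "P (Suc i) s1" using r unfolding run_def by blast
    have "d = N - Suc i" using Suc(2) by simp
    from Suc(1)[OF this 1(3)] iN obtain t' s2 where 2: "exec (While b p) s1 t' s2"
      "t' \<le> (N - Suc i) * (T + 1 + bcost b) + 1 + bcost b" "\<exists>i\<le>N. P i s2 \<and> \<not> bval b s2" unfolding run_def by auto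
    from exec.WhileTrue[OF True 1(1) 2(1)] have "exec (While b p) s (1 + bcost b + t + t') s2" .
    moreover have "1 + bcost b + t + t' \<le> (N - i) * (T + 1 + bcost b) + 1 + bcost b"
    proof -
      have "N - i = Suc (N - Suc i)" using iN by simp
      then have "(N - i) * (T + 1 + bcost b) = (T + 1 + bcost b) + (N - Suc i) * (T + 1 + bcost b)" by simp
      then show ?thesis using 1(2) 2(2) by linarith
    qed
    ultimately show ?thesis using 2(3) unfolding run_def by blast
  qed
qed

section \<open>Counting loops\<close>

abbreviation var :: "nat \<Rightarrow> aexp" where "var a \<equiv> Load a (Const 0)"

definition FOR :: "nat \<Rightarrow> aexp \<Rightarrow> com \<Rightarrow> com" where
  "FOR c b body = Seq (Store c (Const 0) (Const 0))
     (While (Less (var c) b) (Seq body (Store c (Const 0) (Add (var c) (Const 1)))))"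

definition set0 :: "nat \<Rightarrow> nat \<Rightarrow> store \<Rightarrow> store" where
  "set0 c x s = s(c := (s c)(0 := x))"

text \<open>The limit \<open>b\<close> is evaluated anew before every round, so the invariant must
  fix its value. The invariant is required after the increment of the counter, which the body itself
  has to leave at \<open>i\<close>. The constant 12 bounds the cost of the loop control.\<close>

lemma run_for:
  assumes P0: "P 0 (set0 c 0 s)"
    and bnd: "\<And>i s. P i s \<Longrightarrow> aval b s = N \<and> s c 0 = i"
    and body: "\<And>i s. i < N \<Longrightarrow> P i s \<Longrightarrow> run body s T (\<lambda>s'. s' c 0 = i \<and> P (Suc i) (set0 c (Suc i) s'))"
  shows "run (FOR c b body) s (N * (T + 12 + acost b) + 12 + acost b) (P N)"
proof -
  have "run (FOR c b body) s (cost (Store c (Const 0) (Const 0)) + (N * ((T + 7) + 1 + (3 + acost b)) + 1 + (3 + acost b))) (P N)"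
    unfolding FOR_def
  proof (rule run_SeqI[OF run_ev])
    fix s' assume s': "s' = ev (Store c (Const 0) (Const 0)) s"
    have "run (While (Less (var c) b) (Seq body (Store c (Const 0) (Add (var c) (Const 1))))) s'
      ((N - 0) * ((T + 7) + 1 + bcost (Less (var c) b)) + 1 + bcost (Less (var c) b))
      (\<lambda>s'. \<exists>i\<le>N. P i s' \<and> \<not> bval (Less (var c) b) s')"
    proof (rule run_while[where P = P])
      fix i s assume Pi: "P i s" and bv: "bval (Less (var c) b) s"
      then have h: "i < N" "P i s" using bnd by auto
      have "run (Seq body (Store c (Const 0) (Add (var c) (Const 1)))) s (T + cost (Store c (Const 0) (Add (var c) (Const 1)))) (P (Suc i))"
      proof (rule run_SeqI[OF body[OF h]])
        fix s' assume "s' c 0 = i \<and> P (Suc i) (set0 c (Suc i) s')"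
        then show "run (Store c (Const 0) (Add (var c) (Const 1))) s' (cost (Store c (Const 0) (Add (var c) (Const 1)))) (P (Suc i))"
          by (intro run_ev') (auto simp: set0_def)
      qed
      then have "run (Seq body (Store c (Const 0) (Add (var c) (Const 1)))) s (T + 7) (P (Suc i))"
        by (rule run_weaken) auto
      then show "i < N \<and> run (Seq body (Store c (Const 0) (Add (var c) (Const 1)))) s (T + 7) (P (Suc i))"
        using h by blast
    qed (use P0 s' in \<open>auto simp: set0_def\<close>)
    then show "run (While (Less (var c) b) (Seq body (Store c (Const 0) (Add (var c) (Const 1))))) s'
      (N * ((T + 7) + 1 + (3 + acost b)) + 1 + (3 + acost b)) (P N)"
      by (rule run_weaken) (use bnd in \<open>auto simp: linorder_not_less\<close>, metis bnd le_antisym)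
  qed simp
  then show ?thesis by (rule run_weaken) (auto simp: algebra_simps)
qed

section \<open>Exhaustive search over memory cells, and what it leaves unchanged\<close>

definition eqx :: "nat set \<Rightarrow> store \<Rightarrow> store \<Rightarrow> bool" where
  "eqx M s t \<longleftrightarrow> (\<forall>a. a \<notin> M \<longrightarrow> s a = t a)"

lemma eqxD: "eqx M s t \<Longrightarrow> a \<notin> M \<Longrightarrow> s a = t a"
  unfolding eqx_def by blast

lemma eqx_refl [simp]: "eqx M s s" by (simp add: eqx_def)

lemma eqx_trans: "eqx M s t \<Longrightarrow> eqx M t u \<Longrightarrow> eqx M s u" unfolding eqx_def by simp

text \<open>
  A slot \<open>(a, b)\<close> denotes the cell of array \<open>a\<close> whose index is the value of the variable \<open>b\<close>.  The program
  \<open>srch l sl bd chk\<close> assigns all combinations of the values 1 to \<open>bd\<close> to the slots, by nested loops with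
  counters \<open>40 + l\<close>, \<open>41 + l\<close>, ..., until \<open>chk\<close> sets the flag, which is variable 9.
\<close>
fun srch :: "nat \<Rightarrow> (nat \<times> nat) list \<Rightarrow> nat \<Rightarrow> com \<Rightarrow> com" where
  "srch l [] bd chk = chk"
| "srch l ((a, b) # sl) bd chk = Seq (Store (40 + l) (Const 0) (Const 0))
     (While (Conj (Less (var (40 + l)) (var bd)) (Less (var 9) (Const 1)))
       (Seq (Seq (Store (40 + l) (Const 0) (Add (var (40 + l)) (Const 1))) (Store a (var b) (var (40 + l))))
          (srch (Suc l) sl bd chk)))"

fun wr :: "(nat \<times> nat) list \<Rightarrow> nat list \<Rightarrow> store \<Rightarrow> store" where
  "wr ((a, b) # sl) (c # cs) s = wr sl cs (s(a := (s a)(s b 0 := c)))"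
| "wr _ _ s = s"

definition cells :: "(nat \<times> nat) list \<Rightarrow> store \<Rightarrow> (nat \<times> nat) set" where
  "cells sl s = (\<lambda>(a, b). (a, s b 0)) ` set sl"

lemma mem_cells: "(a, i) \<in> cells sl s \<longleftrightarrow> (\<exists>b. (a, b) \<in> set sl \<and> i = s b 0)"
  unfolding cells_def by force

lemma cells_Cons: "cells ((a, b) # sl) s = insert (a, s b 0) (cells sl s)"
  unfolding cells_def by simp

lemma not_in_cells: "a \<notin> fst ` set sl \<Longrightarrow> (a, i) \<notin> cells sl s"
  unfolding mem_cells by force

definition temps :: "nat set" where "temps = {9, 10} \<union> {40..<60}"

text \<open>The variables that hold the indices are written neither by the loop control nor through
  any slot, so the slots denote the same cells during the whole search. Two slots may still denote
  the same cell.\<close>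

definition good_slots :: "(nat \<times> nat) list \<Rightarrow> bool" where
  "good_slots sl \<longleftrightarrow> (\<forall>(a, b)\<in>set sl. a \<notin> temps \<and> b \<notin> temps \<and> b \<notin> fst ` set sl)"

definition same_off :: "(nat \<times> nat) set \<Rightarrow> store \<Rightarrow> store \<Rightarrow> bool" where
  "same_off C s t \<longleftrightarrow> (\<forall>a i. a \<notin> temps \<and> (a, i) \<notin> C \<longrightarrow> s a i = t a i)"

lemma same_off_eqx: "same_off {} s t \<longleftrightarrow> eqx temps s t"
  unfolding same_off_def eqx_def by auto

lemma same_off_refl [simp]: "same_off C s s" by (simp add: same_off_def)

lemma same_off_trans: "same_off C s t \<Longrightarrow> same_off C t u \<Longrightarrow> same_off C s u"
  unfolding same_off_def by simp

lemma same_off_sym: "same_off C s t \<Longrightarrow> same_off C t s"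
  unfolding same_off_def by simp

lemma same_off_mono: "same_off C s t \<Longrightarrow> C \<subseteq> D \<Longrightarrow> same_off D s t"
  unfolding same_off_def by blast

lemma cells_cong:
  assumes "good_slots sl" "same_off C s t" "fst ` C \<subseteq> fst ` set sl" "set sl' \<subseteq> set sl"
  shows "cells sl' s = cells sl' t"
proof -
  have "s b 0 = t b 0" if "(a, b) \<in> set sl'" for a b
  proof -
    have "b \<notin> temps" "b \<notin> fst ` set sl" using assms(1,4) that unfolding good_slots_def by auto
    then show ?thesis using assms(2,3) unfolding same_off_def by force
  qed
  then show ?thesis unfolding cells_def by (intro image_cong) auto
qed

lemma good_slots_mono: "good_slots sl0 \<Longrightarrow> set sl \<subseteq> set sl0 \<Longrightarrow> good_slots sl"
  unfolding good_slots_def using image_mono[of "set sl" "set sl0" fst] by blast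

lemma good_slots_Cons: "good_slots (x # sl) \<Longrightarrow> good_slots sl"
  unfolding good_slots_def by auto

text \<open>All cells in which the stores differ are overwritten with the same values, so whatever
  earlier attempts left in the slots is irrelevant.\<close>

lemma wr_cong:
  assumes "good_slots sl" "same_off (cells sl s) s t" "length cs = length sl"
  shows "same_off {} (wr sl cs s) (wr sl cs t)"
  using assms
proof (induction sl arbitrary: cs s t)
  case Nil then show ?case by (simp add: cells_def)
next
  case (Cons x sl)
  obtain a b where x: "x = (a, b)" by (cases x)
  obtain c cs' where cs: "cs = c # cs'" using Cons.prems(3) by (cases cs) auto
  have bt: "b \<notin> temps" "b \<notin> fst ` set (x # sl)" using Cons.prems(1) x unfolding good_slots_def by auto
  have sb: "s b 0 = t b 0" using Cons.prems(2) bt(1) not_in_cells[OF bt(2)] unfolding same_off_def by blast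
  let ?s = "s(a := (s a)(s b 0 := c))" and ?t = "t(a := (t a)(t b 0 := c))"
  have ce: "cells sl ?s = cells sl s"
  proof -
    have "b' \<noteq> a" if "(a', b') \<in> set sl" for a' b' using Cons.prems(1) that x unfolding good_slots_def by force
    then show ?thesis unfolding cells_def by (force simp: image_iff split: prod.splits)
  qed
  have "same_off (cells sl ?s) ?s ?t"
    unfolding ce same_off_def using Cons.prems(2)[unfolded same_off_def] sb by (auto simp: cells_Cons x)
  then have "same_off {} (wr sl cs' ?s) (wr sl cs' ?t)"
    by (rule Cons.IH[OF good_slots_Cons[OF Cons.prems(1)]]) (use Cons.prems(3) cs in simp)
  then show ?case unfolding cs x by (simp only: wr.simps)
qed

text \<open>Every store that differs from the present one only in the slots is reached by some
  combination of values. Since these are read off the target, two slots that denote the same cell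
  receive the same value.\<close>

lemma wr_target:
  assumes "good_slots sl" "same_off (cells sl s) s t"
  shows "same_off {} (wr sl (map (\<lambda>(a, b). t a (s b 0)) sl) s) t"
  using assms
proof (induction sl arbitrary: s)
  case Nil then show ?case by (simp add: cells_def)
next
  case (Cons x sl)
  obtain a b where x: "x = (a, b)" by (cases x)
  let ?s = "s(a := (s a)(s b 0 := t a (s b 0)))"
  have nb: "b' \<noteq> a" if "(a', b') \<in> set sl" for a' b' using Cons.prems(1) that x unfolding good_slots_def by force
  then have ce: "cells sl ?s = cells sl s" unfolding cells_def by (force simp: image_iff split: prod.splits)
  have "same_off (cells sl ?s) ?s t"
    unfolding ce same_off_def using Cons.prems(2)[unfolded same_off_def] by (auto simp: cells_Cons x)
  from Cons.IH[OF good_slots_Cons[OF Cons.prems(1)] this]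
  have "same_off {} (wr sl (map (\<lambda>(a, b). t a (?s b 0)) sl) ?s) t" .
  moreover have "map (\<lambda>(a, b). t a (?s b 0)) sl = map (\<lambda>(a, b). t a (s b 0)) sl"
    by (rule map_cong) (use nb in auto)
  ultimately show ?case unfolding x by (simp del: fun_upd_apply)
qed

fun srch_time :: "nat \<Rightarrow> nat \<Rightarrow> nat \<Rightarrow> nat" where
  "srch_time B T 0 = T"
| "srch_time B T (Suc l) = (B + 1) * (srch_time B T l + 40)"

text \<open>Induction over the remaining slots \<open>sl\<close>; the full list \<open>sl0\<close>
  stays fixed, since the invariant \<open>J\<close> has to tolerate the values already written to
  the outer slots. On success the final store itself is the witness, on failure every combination is
  refuted relative to the initial store. The bound 20 keeps the loop counters inside
  \<open>temps\<close>.\<close>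

lemma run_srch:
  fixes OK :: "store \<Rightarrow> bool"
  assumes chk: "\<And>s. J s \<Longrightarrow> run chk s Tc (\<lambda>s'. eqx {9, 10} s s' \<and> s' 9 0 = of_bool (OK s))"
    and OK: "\<And>s t. eqx temps s t \<Longrightarrow> OK s = OK t"
    and J: "\<And>s t. J s \<Longrightarrow> same_off (cells sl0 s) s t \<Longrightarrow> J t"
    and gs0: "good_slots sl0" and bd: "bd \<notin> temps" "bd \<notin> fst ` set sl0"
    and sl: "set sl \<subseteq> set sl0" "l + length sl \<le> 20"
    and s: "J s" "s 9 0 = 0" "s bd 0 = B"
  shows "run (srch l sl bd chk) s (srch_time B Tc (length sl)) (\<lambda>s'. same_off (cells sl s) s s' \<and> (\<forall>a\<in>{40..<40 + l}. s' a = s a) \<and>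
     ((s' 9 0 = 1 \<and> OK s' \<and> (\<forall>(a, b)\<in>set sl. 1 \<le> s' a (s b 0) \<and> s' a (s b 0) \<le> B)) \<or>
      (s' 9 0 = 0 \<and> (\<forall>cs. length cs = length sl \<and> set cs \<subseteq> {1..B} \<longrightarrow> \<not> OK (wr sl cs s)))))"
  using sl s
proof (induction sl arbitrary: l s)
  case Nil
  have "run chk s Tc (\<lambda>s'. same_off (cells [] s) s s' \<and> (\<forall>a\<in>{40..<40 + l}. s' a = s a) \<and>
     ((s' 9 0 = 1 \<and> OK s') \<or> (s' 9 0 = 0 \<and> \<not> OK s)))"
  proof (rule run_weaken[OF chk[OF Nil(3)] order_refl])
    fix s' assume h: "eqx {9, 10} s s' \<and> s' 9 0 = of_bool (OK s)"
    then have e: "eqx temps s s'" unfolding eqx_def temps_def by auto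
    then have "same_off (cells [] s) s s'" by (simp add: cells_def same_off_eqx)
    moreover have "\<forall>a\<in>{40..<40 + l}. s' a = s a" using h unfolding eqx_def by auto
    ultimately show "same_off (cells [] s) s s' \<and> (\<forall>a\<in>{40..<40 + l}. s' a = s a) \<and>
     ((s' 9 0 = 1 \<and> OK s') \<or> (s' 9 0 = 0 \<and> \<not> OK s))"
      using h OK[OF e] by auto
  qed
  then show ?case unfolding srch.simps list.size srch_time.simps by (rule run_weaken) auto
next
  case (Cons x sl)
  obtain a b where x: "x = (a, b)" by (cases x)
  have gs: "good_slots (x # sl)" "good_slots sl"
    using good_slots_mono[OF gs0 Cons.prems(1)] good_slots_mono[OF gs0, of sl] Cons.prems(1) by auto
  let ?C = "cells (x # sl) s"
  have bT: "b \<notin> temps" "b \<notin> fst ` set sl0" "a \<notin> temps" using gs0 Cons.prems(1) x unfolding good_slots_def by auto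
  have lv: "40 + l \<in> temps" using Cons.prems(2) unfolding temps_def by auto
  let ?c = "40 + l"
  define good where "good s' \<longleftrightarrow> s' 9 0 = 1 \<and> OK s' \<and> (\<forall>(a, b)\<in>set (x # sl). 1 \<le> s' a (s b 0) \<and> s' a (s b 0) \<le> B)" for s'
  define tried where "tried i \<longleftrightarrow> (\<forall>c cs. 1 \<le> c \<and> c \<le> i \<and> length cs = length sl \<and> set cs \<subseteq> {1..B} \<longrightarrow> \<not> OK (wr (x # sl) (c # cs) s))" for i
  define P where "P i s' \<longleftrightarrow> same_off ?C s s' \<and> (\<forall>a\<in>{40..<40 + l}. s' a = s a) \<and> s' ?c 0 = i \<and> i \<le> B \<and>
    (good s' \<or> s' 9 0 = 0 \<and> tried i)" for i s'
  let ?inc = "Seq (Store ?c (Const 0) (Add (var ?c) (Const 1))) (Store a (var b) (var ?c))"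
  let ?b = "Conj (Less (var ?c) (var bd)) (Less (var 9) (Const 1))"
  have fstC: "fst ` ?C \<subseteq> fst ` set (x # sl)" using not_in_cells[of _ "x # sl" _ s] by fastforce
  have CC: "?C \<subseteq> cells sl0 s" using Cons.prems(1) unfolding cells_def by auto
  have sb: "s' b' 0 = s b' 0" if "same_off ?C s s'" "b' \<notin> temps" "b' \<notin> fst ` set sl0" for s' b'
    using that CC not_in_cells[OF that(3), of 0 s] unfolding same_off_def by (metis subsetD)
  have step: "i < B \<and> run (Seq ?inc (srch (Suc l) sl bd chk)) s' (cost ?inc + srch_time B Tc (length sl)) (P (Suc i))"
    if h: "P i s'" "bval ?b s'" for i s'
  proof
    have so: "same_off ?C s s'" using h(1) unfolding P_def by blast
    have bdv: "s' bd 0 = B" using sb[OF so bd] Cons.prems(5) by simp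
    have F0: "s' 9 0 = 0" "tried i" "i < B" "s' ?c 0 = i" using h bdv unfolding P_def good_def by auto
    then show "i < B" by simp
    have lvs: "\<forall>a\<in>{40..<40 + l}. s' a = s a" using h(1) unfolding P_def by blast
    show "run (Seq ?inc (srch (Suc l) sl bd chk)) s' (cost ?inc + srch_time B Tc (length sl)) (P (Suc i))"
    proof (rule run_SeqI[OF run_ev])
      fix s1 assume s1: "s1 = ev ?inc s'"
      have s'b: "s' b 0 = s b 0" using sb[OF so bT(1,2)] .
      have bc: "b \<noteq> ?c" using bT(1) lv by auto
      have ac: "a \<noteq> ?c" using bT(3) lv by auto
      have s1': "s1 = (set0 ?c (Suc i) s')(a := (s' a)(s b 0 := Suc i))"
        using s1 F0(4) s'b bc ac by (auto simp: set0_def)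
      have so1: "same_off ?C s s1"
        using so[unfolded same_off_def x cells_Cons] lv unfolding s1' same_off_def set0_def x cells_Cons by auto
      have J1: "J s1" using J[OF Cons.prems(3) same_off_mono[OF so1 CC]] .
      have s19: "s1 9 0 = 0" using F0(1) bT(3) unfolding s1' set0_def temps_def by auto
      have s1bd: "s1 bd 0 = B" using sb[OF so1 bd] Cons.prems(5) by simp
      have ce: "cells sl s1 = cells sl s"
        by (rule cells_cong[OF gs(1) same_off_sym[OF so1] fstC]) auto
      let ?w = "s(a := (s a)(s b 0 := Suc i))"
      have cw: "cells sl ?w = cells sl s"
        by (rule cells_cong[OF gs(1) _ fstC]) (auto simp: same_off_def x cells_Cons)
      have sw: "same_off (cells sl ?w) ?w s1"
        using so[unfolded same_off_def x cells_Cons] lv unfolding cw s1' same_off_def set0_def by auto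
      have IH: "run (srch (Suc l) sl bd chk) s1 (srch_time B Tc (length sl)) (\<lambda>s'. same_off (cells sl s1) s1 s' \<and> (\<forall>a\<in>{40..<40 + Suc l}. s' a = s1 a) \<and>
         ((s' 9 0 = 1 \<and> OK s' \<and> (\<forall>(a, b)\<in>set sl. 1 \<le> s' a (s1 b 0) \<and> s' a (s1 b 0) \<le> B)) \<or>
          (s' 9 0 = 0 \<and> (\<forall>cs. length cs = length sl \<and> set cs \<subseteq> {1..B} \<longrightarrow> \<not> OK (wr sl cs s1)))))"
        by (rule Cons.IH) (use Cons.prems J1 s19 s1bd in auto)
      show "run (srch (Suc l) sl bd chk) s1 (srch_time B Tc (length sl)) (P (Suc i))"
      proof (rule run_weaken[OF IH order_refl])
        fix s2
        assume 2: "same_off (cells sl s1) s1 s2 \<and> (\<forall>a\<in>{40..<40 + Suc l}. s2 a = s1 a) \<and>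
         ((s2 9 0 = 1 \<and> OK s2 \<and> (\<forall>(a, b)\<in>set sl. 1 \<le> s2 a (s1 b 0) \<and> s2 a (s1 b 0) \<le> B)) \<or>
          (s2 9 0 = 0 \<and> (\<forall>cs. length cs = length sl \<and> set cs \<subseteq> {1..B} \<longrightarrow> \<not> OK (wr sl cs s1))))"
        have so2: "same_off ?C s s2"
          using same_off_trans[OF so1 same_off_mono[of "cells sl s1" s1 s2 ?C]] 2 unfolding ce by (auto simp: cells_def)
        have aux: "a \<noteq> a'" if "a' \<in> {40..<40 + l}" for a' using bT(3) that Cons.prems(2) unfolding temps_def by auto
        have l2: "\<forall>a\<in>{40..<40 + l}. s2 a = s a"
          using 2 lvs aux unfolding s1' set0_def by (auto simp: fun_eq_iff)
        have c2: "s2 ?c 0 = Suc i" using 2 ac unfolding s1' set0_def by auto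
        have b1: "s1 b' 0 = s b' 0" if "(a', b') \<in> set sl" for a' b'
        proof (rule sb[OF so1])
          show "b' \<notin> temps" "b' \<notin> fst ` set sl0" using that gs0 Cons.prems(1) unfolding good_slots_def by force+
        qed
        have "good s2 \<or> s2 9 0 = 0 \<and> tried (Suc i)"
        proof (cases "s2 9 0 = 1")
          case True
          then have v: "OK s2" "\<And>a b. (a, b) \<in> set sl \<Longrightarrow> 1 \<le> s2 a (s b 0) \<and> s2 a (s b 0) \<le> B"
            using 2 b1 by force+
          have "1 \<le> s2 a (s b 0) \<and> s2 a (s b 0) \<le> B"
          \<comment> \<open>A later slot may denote the same cell as the current one; its value is
            then the one chosen by the inner search.\<close>
          proof (cases "(a, s b 0) \<in> cells sl s")
            case True
            then show ?thesis using v(2) unfolding cells_def by force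
          next
            case False
            then have "s2 a (s b 0) = s1 a (s b 0)" using 2 bT(3) ce unfolding same_off_def by auto
            then show ?thesis using F0(3) unfolding s1' by simp
          qed
          then show ?thesis using True v unfolding good_def x by auto
        next
          case False
          then have f: "s2 9 0 = 0" "\<And>cs. length cs = length sl \<Longrightarrow> set cs \<subseteq> {1..B} \<Longrightarrow> \<not> OK (wr sl cs s1)" using 2 by auto
          have "\<not> OK (wr (x # sl) (c # cs) s)" if "1 \<le> c \<and> c \<le> Suc i \<and> length cs = length sl \<and> set cs \<subseteq> {1..B}" for c cs
          proof (cases "c = Suc i")
            case True
            \<comment> \<open>\<open>?w\<close> is the initial store with only the current slot set,
              whereas \<open>s1\<close> still carries the values of earlier rounds in the other
              slots.\<close>
            have "same_off {} (wr sl cs ?w) (wr sl cs s1)" by (rule wr_cong[OF gs(2) sw]) (use that in auto)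
            then have "OK (wr sl cs ?w) = OK (wr sl cs s1)" using OK same_off_eqx by blast
            then show ?thesis using f(2)[of cs] that True x by simp
          next
            case False
            then show ?thesis using F0(2) that unfolding tried_def by auto
          qed
          then show ?thesis using f(1) unfolding tried_def by blast
        qed
        then show "P (Suc i) s2" unfolding P_def using so2 l2 c2 F0(3) by auto
      qed
    qed simp
  qed
  let ?body = "Seq ?inc (srch (Suc l) sl bd chk)"
  have main: "run (srch l (x # sl) bd chk) s (cost (Store ?c (Const 0) (Const 0)) +
     ((B - 0) * (cost ?inc + srch_time B Tc (length sl) + 1 + bcost ?b) + 1 + bcost ?b)) (\<lambda>s'. \<exists>i\<le>B. P i s' \<and> \<not> bval ?b s')"
    unfolding x srch.simps
  proof (rule run_SeqI[OF run_ev])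
    fix s0 assume "s0 = ev (Store ?c (Const 0) (Const 0)) s"
    then have s0: "s0 = set0 ?c 0 s" by (simp add: set0_def)
    have "?c \<noteq> 9" by simp
    then have "P 0 s0" unfolding P_def tried_def s0 set0_def same_off_def using lv Cons.prems(4) by auto
    then show "run (While ?b ?body) s0 ((B - 0) * (cost ?inc + srch_time B Tc (length sl) + 1 + bcost ?b) + 1 + bcost ?b)
       (\<lambda>s'. \<exists>i\<le>B. P i s' \<and> \<not> bval ?b s')"
      by (intro run_while[where P = P]) (use step in auto)
  qed simp
  show ?case
  proof (rule run_weaken[OF main])
    show "cost (Store ?c (Const 0) (Const 0)) + ((B - 0) * (cost ?inc + srch_time B Tc (length sl) + 1 + bcost ?b) + 1 + bcost ?b)
      \<le> srch_time B Tc (length (x # sl))" by (simp add: algebra_simps)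
  next
    fix s' assume "\<exists>i\<le>B. P i s' \<and> \<not> bval ?b s'"
    then obtain i where i: "P i s'" "\<not> bval ?b s'" by blast
    have so: "same_off ?C s s'" "\<forall>a\<in>{40..<40 + l}. s' a = s a" using i(1) unfolding P_def by auto
    have bdv: "s' bd 0 = B" using sb[OF so(1) bd] Cons.prems(5) by simp
    have "good s' \<or> s' 9 0 = 0 \<and> (\<forall>cs. length cs = length (x # sl) \<and> set cs \<subseteq> {1..B} \<longrightarrow> \<not> OK (wr (x # sl) cs s))"
    proof (cases "good s'")
      case False
      then have t: "s' 9 0 = 0" "tried i" "s' ?c 0 = i" "i \<le> B" using i(1) unfolding P_def by auto
      then have "i = B" using i(2) bdv by auto
      have "\<not> OK (wr (x # sl) cs s)" if "length cs = length (x # sl) \<and> set cs \<subseteq> {1..B}" for cs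
        using that t(2) \<open>i = B\<close> unfolding tried_def by (cases cs) auto
      then show ?thesis using t by blast
    qed simp
    then show "same_off ?C s s' \<and> (\<forall>a\<in>{40..<40 + l}. s' a = s a) \<and>
     ((s' 9 0 = 1 \<and> OK s' \<and> (\<forall>(a, b)\<in>set (x # sl). 1 \<le> s' a (s b 0) \<and> s' a (s b 0) \<le> B)) \<or>
      (s' 9 0 = 0 \<and> (\<forall>cs. length cs = length (x # sl) \<and> set cs \<subseteq> {1..B} \<longrightarrow> \<not> OK (wr (x # sl) cs s))))"
      using so unfolding good_def by blast
  qed
qed

section \<open>Chordless graphs\<close>

definition simple_edges :: "'a set set \<Rightarrow> bool" where
  "simple_edges E \<longleftrightarrow> finite E \<and> (\<forall>e\<in>E. card e = 2)"

definition nbrs :: "'a set set \<Rightarrow> 'a \<Rightarrow> 'a set" where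
  "nbrs E v = {u. {v, u} \<in> E}"

definition path_in :: "'a set set \<Rightarrow> 'a list \<Rightarrow> bool" where
  "path_in E xs \<longleftrightarrow> distinct xs \<and> successively (\<lambda>a b. {a, b} \<in> E) xs"

lemma simple_edges_subset: "simple_edges E \<Longrightarrow> F \<subseteq> E \<Longrightarrow> simple_edges F"
  unfolding simple_edges_def by (meson finite_subset subsetD)

lemma simple_edges_neq: "simple_edges E \<Longrightarrow> {a, b} \<in> E \<Longrightarrow> a \<noteq> b"
  unfolding simple_edges_def by fastforce

lemma simple_edges_obtain:
  assumes "simple_edges E" "e \<in> E" obtains a b where "e = {a, b}" "a \<noteq> b"
  using assms unfolding simple_edges_def by (metis card_2_iff)

lemma finite_Union_edges: "simple_edges E \<Longrightarrow> finite (\<Union>E)"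
  unfolding simple_edges_def by (metis card.infinite finite_Union zero_neq_numeral)

lemma nbrs_subset: "nbrs E v \<subseteq> \<Union>E"
  unfolding nbrs_def by auto

lemma finite_nbrs: "simple_edges E \<Longrightarrow> finite (nbrs E v)"
  by (meson finite_Union_edges finite_subset nbrs_subset)

lemma nbrs_sym: "u \<in> nbrs E v \<longleftrightarrow> v \<in> nbrs E u"
  unfolding nbrs_def by (simp add: insert_commute)

lemma nbrs_neq: "simple_edges E \<Longrightarrow> u \<in> nbrs E v \<Longrightarrow> u \<noteq> v"
  unfolding nbrs_def using simple_edges_neq by fastforce

lemma nbrs_mono: "F \<subseteq> E \<Longrightarrow> nbrs F v \<subseteq> nbrs E v"
  unfolding nbrs_def by auto

section \<open>Paths and cycles as lists of vertices\<close>

lemma is_cycle_iff: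
  "is_cycle E vs \<longleftrightarrow> 3 \<le> length vs \<and> path_in E vs \<and> {last vs, hd vs} \<in> E"
  unfolding is_cycle_def cycle_edges_def path_in_def successively_conv_nth by blast

lemma path_in_rev [simp]: "path_in E (rev xs) \<longleftrightarrow> path_in E xs"
  unfolding path_in_def by (simp add: insert_commute)

lemma path_in_append:
  "path_in E (xs @ ys) \<longleftrightarrow> path_in E xs \<and> path_in E ys \<and> set xs \<inter> set ys = {} \<and>
     (xs = [] \<or> ys = [] \<or> {last xs, hd ys} \<in> E)"
  unfolding path_in_def successively_append_iff by auto

lemma path_in_Cons:
  "path_in E (x # ys) \<longleftrightarrow> path_in E ys \<and> x \<notin> set ys \<and> (ys = [] \<or> {x, hd ys} \<in> E)"
  using path_in_append[of E "[x]" ys] by (auto simp: path_in_def)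

lemma path_in_Nil [simp]: "path_in E []"
  by (simp add: path_in_def)

lemma is_cycle_mono: "is_cycle F vs \<Longrightarrow> F \<subseteq> E \<Longrightarrow> is_cycle E vs"
  unfolding is_cycle_def by auto

lemma chordless_subset:
  assumes "chordless E" "F \<subseteq> E" shows "chordless F"
  using assms is_cycle_mono unfolding chordless_def is_chord_def by blast

lemma is_cycle_rotate1: "is_cycle E vs \<Longrightarrow> is_cycle E (rotate1 vs)"
  by (cases vs) (auto simp: is_cycle_iff path_in_append path_in_Cons hd_append last_conv_nth
      split: if_splits)

lemma is_cycle_rotate: "is_cycle E vs \<Longrightarrow> is_cycle E (rotate n vs)"
  by (induction n) (auto simp: is_cycle_rotate1)

lemma is_cycle_rotate_to:
  assumes "is_cycle E vs" "p \<in> set vs"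
  obtains D where "is_cycle E (p # D)" "set (p # D) = set vs"
proof -
  obtain i where i: "i < length vs" "vs ! i = p"
    using assms(2) by (meson in_set_conv_nth)
  have ne: "rotate i vs \<noteq> []" using i by auto
  have "hd (rotate i vs) = p"
    using i ne by (simp add: hd_rotate_conv_nth)
  then have "rotate i vs = p # tl (rotate i vs)" using ne by (metis list.collapse)
  moreover have "set (rotate i vs) = set vs" by simp
  ultimately show ?thesis using that is_cycle_rotate[OF assms(1), of i] by metis
qed

text \<open>One of the two arcs between \<open>p\<close> and \<open>r\<close> contains
  \<open>x\<close>. With \<open>p\<close> rotated to the front it is an initial segment of the list
  or the reversed rest.\<close>

lemma cycle_arc:
  assumes "is_cycle E vs" "p \<in> set vs" "r \<in> set vs" "x \<in> set vs" "p \<noteq> r"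
  obtains Q where "path_in E Q" "Q \<noteq> []" "hd Q = p" "last Q = r" "set Q \<subseteq> set vs" "x \<in> set Q"
proof -
  obtain D where D: "is_cycle E (p # D)" "set (p # D) = set vs"
    using is_cycle_rotate_to assms(1,2) by metis
  then obtain D1 D2 where DD: "D = D1 @ r # D2" using assms(3,5) by (metis set_ConsD split_list)
  have p: "path_in E (p # D)" "{last (p # D), p} \<in> E" using D(1) by (auto simp: is_cycle_iff)
  show ?thesis
  proof (cases "x \<in> set D2")
    case False
    have "path_in E (p # D1 @ [r])"
      using p(1) unfolding DD by (auto simp: path_in_append path_in_Cons hd_append split: if_splits)
    moreover have "x \<in> set (p # D1 @ [r])" using False D(2) DD assms(4) by auto
    ultimately show ?thesis using that[of "p # D1 @ [r]"] D(2) DD by auto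
  next
    case True
    then have ne: "D2 \<noteq> []" by auto
    have "path_in E (p # rev D2 @ [r])"
      using p ne unfolding DD
      by (auto simp: path_in_append path_in_Cons hd_append hd_rev last_rev insert_commute split: if_splits)
    then show ?thesis using that[of "p # rev D2 @ [r]"] D(2) DD True by auto
  qed
qed

lemma path_from_rtrancl:
  assumes "(x, y) \<in> {(a, b). {a, b} \<in> E \<and> b \<noteq> w}\<^sup>*" "x \<noteq> w"
  obtains P where "path_in E P" "P \<noteq> []" "hd P = x" "last P = y" "w \<notin> set P"
proof -
  have "\<exists>P. path_in E P \<and> P \<noteq> [] \<and> hd P = x \<and> last P = y \<and> w \<notin> set P"
    using assms(1)
  proof (induction rule: rtrancl_induct)
    case base
    show ?case using assms(2) by (intro exI[of _ "[x]"]) (auto simp: path_in_def)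
  next
    case (step y z)
    then obtain P where P: "path_in E P" "P \<noteq> []" "hd P = x" "last P = y" "w \<notin> set P" by blast
    show ?case
    proof (cases "z \<in> set P")
      case True
      then obtain P1 P2 where "P = P1 @ z # P2" by (meson split_list)
      then show ?thesis using P
        by (intro exI[of _ "P1 @ [z]"]) (auto simp: path_in_append path_in_Cons hd_append split: if_splits)
    next
      case False
      then show ?thesis using P step(2)
        by (intro exI[of _ "P @ [z]"]) (auto simp: path_in_append path_in_Cons)
    qed
  qed
  then show ?thesis using that by blast
qed

lemma split_at_first:
  assumes "z \<in> set xs" "z \<in> S"
  obtains xs1 b xs2 where "xs = xs1 @ b # xs2" "b \<in> S" "set xs1 \<inter> S = {}"
  using split_list_first_prop[of xs "\<lambda>x. x \<in> S"] assms by blast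

lemma split_at_last:
  assumes "z \<in> set xs" "z \<in> S"
  obtains xs1 b xs2 where "xs = xs1 @ b # xs2" "b \<in> S" "set xs2 \<inter> S = {}"
  using split_list_last_prop[of xs "\<lambda>x. x \<in> S"] assms by blast

text \<open>
  Whitney's argument: along an \<open>x\<close>-\<open>y\<close> path, the last vertex lying on a common cycle with \<open>x\<close>
  is a cut vertex, since a detour around it yields a cycle through \<open>x\<close> and a later vertex.
\<close>
lemma common_cycle:
  assumes xy: "x \<noteq> y" "{x, y} \<notin> E"
    and P: "path_in E P" "P \<noteq> []" "hd P = x" "last P = y"
    and det: "\<And>w. w \<noteq> x \<Longrightarrow> w \<noteq> y \<Longrightarrow>
        \<exists>R. path_in E R \<and> R \<noteq> [] \<and> hd R = x \<and> last R = y \<and> w \<notin> set R"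
  shows "\<exists>vs. is_cycle E vs \<and> x \<in> set vs \<and> y \<in> set vs"
proof (rule ccontr)
  define S where "S = insert x {q. \<exists>vs. is_cycle E vs \<and> x \<in> set vs \<and> q \<in> set vs}"
  assume "\<not> ?thesis"
  then have y: "y \<notin> S" using xy unfolding S_def by auto
  have "x \<in> set P" "x \<in> S" using P S_def by auto
  then obtain P0 p B where PB: "P = P0 @ p # B" "p \<in> S" "set B \<inter> S = {}"
    using split_at_last by metis
  have Bne: "B \<noteq> []" using PB P(4) y by auto
  have lB: "last B = y" and yB: "y \<in> set B" using P(4) PB(1) Bne by auto
  have pB: "path_in E (p # B)" using P(1) unfolding PB(1) by (simp add: path_in_append)
  \<comment> \<open>Closing up: \<open>Q\<close> leads from \<open>p\<close> through
    \<open>x\<close> to \<open>r\<close>, \<open>R1\<close> continues to its first vertex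
    \<open>b\<close> on \<open>B\<close>, and \<open>B\<close> leads back from \<open>b\<close> to
    \<open>p\<close>. This cycle puts \<open>b\<close> into \<open>S\<close>, but \<open>B\<close>
    avoids \<open>S\<close>. The last premise keeps the cycle from degenerating to a single
    edge.\<close>
  have close: False
    if h: "path_in E Q" "Q \<noteq> []" "hd Q = p" "last Q = r" "set Q \<inter> set B = {}"
      "x \<in> set Q" "path_in E (r # R1)" "set R1 \<inter> set Q = {}" "y \<in> set R1"
      "\<not> (p = r \<and> hd B \<in> set R1)" for Q r R1
  proof -
    obtain R2 b R3 where R: "R1 = R2 @ b # R3" "b \<in> set B" "set R2 \<inter> set B = {}"
      using split_at_first[OF h(9) yB] by metis
    obtain B1 B2 where B: "B = B1 @ b # B2" using R(2) by (meson split_list)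
    let ?c = "Q @ R2 @ b # rev B1"
    have "path_in E ?c"
      using h R B pB
      by (auto simp: path_in_append path_in_Cons hd_append hd_rev last_rev insert_commute
          split: if_splits)
    moreover have "{last ?c, hd ?c} \<in> E"
      using h(2,3) pB B by (cases B1) (auto simp: path_in_append path_in_Cons insert_commute last_rev)
    moreover have "3 \<le> length ?c"
    proof (cases "p = r")
      case True
      then have "B1 \<noteq> []" using h(10) R B by auto
      then show ?thesis using h(2) by (cases Q; cases B1; simp)
    next
      case False
      then have "length Q \<ge> 2" using h(2-4)
        by (metis One_nat_def Suc_leI hd_conv_nth last_conv_nth length_greater_0_conv diff_self_eq_0 less_one linorder_not_less nat_less_le one_add_one plus_1_eq_Suc)
      then show ?thesis by simp
    qed
    ultimately have "is_cycle E ?c" by (simp add: is_cycle_iff)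
    then have "b \<in> S" using h(6) unfolding S_def by (auto intro!: exI[of _ ?c])
    then show False using PB(3) R(2) by auto
  qed
  show False
  \<comment> \<open>For \<open>p = x\<close> no detour around \<open>p\<close> is available; the
    detour avoids the successor of \<open>x\<close> on the path instead.\<close>
  proof (cases "p = x")
    case True
    let ?w = "hd B"
    have "?w \<in> set B" using Bne by simp
    then have wx: "?w \<noteq> x" using PB(3) S_def by auto
    have wy: "?w \<noteq> y" using pB Bne True xy(2) by (auto simp: path_in_Cons)
    obtain R where R: "path_in E R" "R \<noteq> []" "hd R = x" "last R = y" "?w \<notin> set R"
      using det[OF wx wy] by blast
    obtain R1 where RR: "R = x # R1" using R(2,3) by (metis list.collapse)
    have "y \<in> set R1" using RR R(4) xy(1) by (metis last.simps last_in_set)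
    then show False
      using close[of "[x]" x R1] R RR True PB S_def by (auto simp: path_in_Cons)
  next
    case False
    then obtain vs where vs: "is_cycle E vs" "x \<in> set vs" "p \<in> set vs"
      using PB(2) S_def by auto
    have vsS: "set vs \<subseteq> S" using vs S_def by auto
    have "p \<noteq> y" using y PB(2) by auto
    then obtain R where R: "path_in E R" "R \<noteq> []" "hd R = x" "last R = y" "p \<notin> set R"
      using det False by metis
    have "x \<in> set R" using R by auto
    then obtain R0 r R1 where R1: "R = R0 @ r # R1" "r \<in> set vs" "set R1 \<inter> set vs = {}"
      using split_at_last vs(2) by metis
    have "R1 \<noteq> []" using R1 R(4) y vsS by auto
    then have yR: "y \<in> set R1" using R1 R(4) by auto
    have pr: "p \<noteq> r" using R(5) R1 by auto
    obtain Q where Q: "path_in E Q" "Q \<noteq> []" "hd Q = p" "last Q = r" "set Q \<subseteq> set vs" "x \<in> set Q"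
      using cycle_arc[OF vs(1,3) R1(2) vs(2) pr] by metis
    have "path_in E (r # R1)" using R(1) R1(1) by (simp add: path_in_append)
    then show False
      using close[OF Q(1-4) _ Q(6) _ _ yR] Q(5) R1(3) PB(3) vsS pr by blast
  qed
qed

section \<open>Separating the ends of an edge by one further vertex\<close>

definition bridgeless :: "'a set set \<Rightarrow> bool" where
  "bridgeless E \<longleftrightarrow> \<not> (\<exists>S a b. a \<in> S \<and> b \<notin> S \<and> {a, b} \<in> E \<and>
     (\<forall>a'\<in>S. \<forall>b'. b' \<notin> S \<and> {a', b'} \<in> E \<longrightarrow> a' = a \<and> b' = b))"

lemma bridgelessD:
  assumes "bridgeless E" "a \<in> S" "b \<notin> S" "{a, b} \<in> E"
  shows "\<exists>a'\<in>S. \<exists>b'. b' \<notin> S \<and> {a', b'} \<in> E \<and> \<not> (a' = a \<and> b' = b)"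
  using assms unfolding bridgeless_def by blast

text \<open>A cycle of \<open>E - {{x, y}}\<close> through \<open>x\<close> and \<open>y\<close>
  would have the chord \<open>{x, y}\<close>. So a premise of \<open>common_cycle\<close> must fail
  there: some \<open>w\<close> lies on all paths from \<open>x\<close> to \<open>y\<close>, and
  \<open>X\<close> is what \<open>x\<close> reaches without entering \<open>w\<close>.\<close>

lemma edge_separation:
  assumes ch: "chordless E" and xy: "{x, y} \<in> E" "x \<noteq> y" and bl: "bridgeless E"
  obtains w X where "x \<in> X" "y \<notin> X" "w \<notin> X" "w \<noteq> y"
    "\<And>a b. a \<in> X \<Longrightarrow> b \<notin> X \<Longrightarrow> {a, b} \<in> E \<Longrightarrow> b = w \<or> (a = x \<and> b = y)"
proof -
  let ?F = "E - {{x, y}}"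
  let ?R = "\<lambda>w. {(a, b). {a, b} \<in> ?F \<and> b \<noteq> w}"
  have out: "b = w \<or> (a = x \<and> b = y)"
    if "a \<in> (?R w)\<^sup>* `` {x}" "b \<notin> (?R w)\<^sup>* `` {x}" "{a, b} \<in> E" "y \<notin> (?R w)\<^sup>* `` {x}" for a b w
  proof (rule ccontr)
    assume n: "\<not> ?thesis"
    show False
    proof (cases "{a, b} = {x, y}")
      case True
      then show False using n that by (auto simp: doubleton_eq_iff)
    next
      case False
      then have "(a, b) \<in> ?R w" using n that(3) by auto
      then show False using that(1,2) by (auto intro: rtrancl_into_rtrancl)
    qed
  qed
  have "\<exists>w. w \<noteq> x \<and> w \<noteq> y \<and> y \<notin> (?R w)\<^sup>* `` {x}"
  proof (rule ccontr)
    assume "\<not> ?thesis"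
    then have det: "\<And>w. w \<noteq> x \<Longrightarrow> w \<noteq> y \<Longrightarrow> (x, y) \<in> (?R w)\<^sup>*" by auto
    \<comment> \<open>\<open>common_cycle\<close> needs one path from \<open>x\<close> to
      \<open>y\<close> to start from. Without it \<open>{x, y}\<close> would be the only edge
      leaving the set of vertices reachable from \<open>x\<close>, that is, a bridge.\<close>
    have "\<exists>P. path_in ?F P \<and> P \<noteq> [] \<and> hd P = x \<and> last P = y"
    proof (rule ccontr)
      assume no: "\<not> ?thesis"
      let ?S = "{(a, b). {a, b} \<in> ?F}\<^sup>* `` {x}"
      have path: "\<exists>P. path_in ?F P \<and> P \<noteq> [] \<and> hd P = x \<and> last P = z" if "z \<in> ?S" for z
      proof -
        have "(x, z) \<in> {(a, b). {a, b} \<in> ?F}\<^sup>*" using that by simp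
        then show ?thesis
        proof (induction rule: rtrancl_induct)
          case base show ?case by (intro exI[of _ "[x]"]) (auto simp: path_in_def)
        next
          case (step y z)
          then obtain P where P: "path_in ?F P" "P \<noteq> []" "hd P = x" "last P = y" by blast
          show ?case
          proof (cases "z \<in> set P")
            case True
            then obtain P1 P2 where "P = P1 @ z # P2" by (meson split_list)
            then show ?thesis using P
              by (intro exI[of _ "P1 @ [z]"]) (auto simp: path_in_append path_in_Cons hd_append split: if_splits)
          next
            case False
            then show ?thesis using P step(2)
              by (intro exI[of _ "P @ [z]"]) (auto simp: path_in_append path_in_Cons)
          qed
        qed
      qed
      have yS: "y \<notin> ?S" using path no by blast
      obtain a b where ab: "a \<in> ?S" "b \<notin> ?S" "{a, b} \<in> E" "\<not> (a = x \<and> b = y)"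
        using bridgelessD[OF bl, of x ?S y] yS xy by blast
      have "(a, b) \<in> {(a, b). {a, b} \<in> ?F}" using ab yS by (auto simp: doubleton_eq_iff)
      then show False using ab(1,2) by (auto intro: rtrancl_into_rtrancl)
    qed
    then obtain P where P: "path_in ?F P" "P \<noteq> []" "hd P = x" "last P = y" by blast
    have "\<exists>vs. is_cycle ?F vs \<and> x \<in> set vs \<and> y \<in> set vs"
    proof (rule common_cycle[OF xy(2) _ P])
      fix w assume "w \<noteq> x" "w \<noteq> y"
      then show "\<exists>R. path_in ?F R \<and> R \<noteq> [] \<and> hd R = x \<and> last R = y \<and> w \<notin> set R"
        using path_from_rtrancl[OF det] by metis
    qed simp
    then obtain vs where vs: "is_cycle ?F vs" "x \<in> set vs" "y \<in> set vs" by blast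
    then have "is_chord E vs {x, y}" using xy unfolding is_chord_def is_cycle_def by auto
    then show False using ch is_cycle_mono[OF vs(1), of E] unfolding chordless_def by blast
  qed
  then obtain w where w: "w \<noteq> x" "w \<noteq> y" "y \<notin> (?R w)\<^sup>* `` {x}" by blast
  have "w \<notin> (?R w)\<^sup>* `` {x}" using w(1) by (auto elim: rtranclE)
  then show ?thesis using that[of "(?R w)\<^sup>* `` {x}" w] w out by blast
qed

text \<open>The kind of boundary that \<open>edge_separation\<close> produces: the leaving edges go
  to one vertex \<open>w\<close>, with at most one exception \<open>u v\<close>.\<close>

definition thin :: "'a set set \<Rightarrow> 'a set \<Rightarrow> bool" where
  "thin E A \<longleftrightarrow> (\<exists>w u v. \<forall>a\<in>A. \<forall>b. b \<notin> A \<and> {a, b} \<in> E \<longrightarrow> b = w \<or> (a = u \<and> b = v))"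

lemma thinI:
  "(\<And>a b. a \<in> A \<Longrightarrow> b \<notin> A \<Longrightarrow> {a, b} \<in> E \<Longrightarrow> b = w \<or> (a = u \<and> b = v)) \<Longrightarrow> thin E A"
  unfolding thin_def by blast

text \<open>Uncrossing. The edge \<open>{x, y}\<close> provides a second separation, and unless
  there is a bridge, one of the two parts into which it cuts \<open>A\<close> is thin again. This
  part is smaller than \<open>A\<close> but contains \<open>x\<close> or \<open>y\<close>, against
  minimality.\<close>

lemma thin_minimal_independent:
  assumes ch: "chordless E" and bl: "bridgeless E" and A: "thin E A"
    and min: "\<And>B. B \<subset> A \<Longrightarrow> thin E B \<Longrightarrow> B \<inter> T = {}"
    and xy: "{x, y} \<in> E" "x \<noteq> y" "x \<in> A" "y \<in> A" "x \<in> T" "y \<in> T"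
  shows False
proof -
  obtain w u v where ex: "\<And>a b. a \<in> A \<Longrightarrow> b \<notin> A \<Longrightarrow> {a, b} \<in> E \<Longrightarrow> b = w \<or> (a = u \<and> b = v)"
    using A unfolding thin_def by blast
  obtain s X where X: "x \<in> X" "y \<notin> X" "s \<notin> X" "s \<noteq> y"
    and sep: "\<And>a b. a \<in> X \<Longrightarrow> b \<notin> X \<Longrightarrow> {a, b} \<in> E \<Longrightarrow> b = s \<or> (a = x \<and> b = y)"
    using edge_separation[OF ch xy(1,2) bl] by metis
  \<comment> \<open>The two sides of the separation play symmetric roles, so \<open>X\<close> may be
    taken as a side that does not contain \<open>w\<close>.\<close>
  have side: False
    if h: "p \<in> X" "q \<in> Y" "X \<inter> Y = {}" "\<And>c. c \<in> X \<or> c \<in> Y \<or> c = s" "s \<notin> X" "s \<notin> Y"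
      and cr: "\<And>a b. a \<in> X \<Longrightarrow> b \<in> Y \<Longrightarrow> {a, b} \<in> E \<Longrightarrow> a = p \<and> b = q"
      and pq: "p \<in> A" "q \<in> A" "p \<in> T" "q \<in> T" and w: "w \<notin> X" for p q X Y
  \<comment> \<open>Unless the exceptional edge \<open>u v\<close> leaves \<open>A\<close> within
    \<open>X\<close>, every edge leaving \<open>A \<inter> X\<close> leaves \<open>X\<close> as
    well, so it goes to \<open>s\<close> or is \<open>p q\<close>. In the remaining case the other
    part \<open>A \<inter> Y\<close> has lost the edge \<open>u v\<close>.\<close>
  proof (cases "u \<in> X \<and> v \<in> X \<and> u \<in> A \<and> v \<notin> A \<and> {u, v} \<in> E")
    case False
    have "thin E (A \<inter> X)"
    proof (rule thinI)
      fix a b assume ab: "a \<in> A \<inter> X" "b \<notin> A \<inter> X" "{a, b} \<in> E"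
      then show "b = s \<or> (a = p \<and> b = q)"
        using h(4)[of b] cr[of a b] ex[of a b] w False by blast
    qed
    moreover have "A \<inter> X \<subset> A" using h pq by blast
    ultimately show False using min h pq by blast
  next
    case True
    have psub: "A \<inter> Y \<subset> A" using h pq by blast
    have qT: "(A \<inter> Y) \<inter> T \<noteq> {}" using h pq by blast
    have yx: "a = q \<and> b = p" if "a \<in> Y" "b \<in> X" "{a, b} \<in> E" for a b
      using cr[of b a] that by (simp add: insert_commute)
    consider "w = s" | "w \<noteq> s" "s \<notin> A" | "w \<noteq> s" "s \<in> A" by blast
    then show False
    proof cases
      case 1
      have "thin E (A \<inter> Y)"
      proof (rule thinI)
        fix a b assume ab: "a \<in> A \<inter> Y" "b \<notin> A \<inter> Y" "{a, b} \<in> E"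
        then show "b = s \<or> (a = q \<and> b = p)"
          using h(3) h(4)[of b] yx[of a b] ex[of a b] 1 True by blast
      qed
      then show False using min psub qT by blast
    next
      case 2
      have "thin E (A \<inter> Y)"
      proof (rule thinI)
        fix a b assume ab: "a \<in> A \<inter> Y" "b \<notin> A \<inter> Y" "{a, b} \<in> E"
        then show "b = w \<or> (a = q \<and> b = p)"
          using h(3) h(4)[of b] yx[of a b] ex[of a b] 2 True by blast
      qed
      then show False using min psub qT by blast
    next
      case 3
      have wY: "w \<in> Y" using w h(4)[of w] 3 by blast
      \<comment> \<open>With \<open>s\<close> in \<open>A\<close> and \<open>w\<close> in
        \<open>Y\<close>, the set \<open>X - A\<close> is left by the edge \<open>v u\<close> alone,
        which would be a bridge.\<close>
      obtain a b where ab: "a \<in> X - A" "b \<notin> X - A" "{a, b} \<in> E" "\<not> (a = v \<and> b = u)"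
        using bridgelessD[OF bl, of v "X - A" u] True by (auto simp: insert_commute)
      have ba: "{b, a} \<in> E" using ab(3) by (simp add: insert_commute)
      show False
        using h(4)[of b] ab ba cr[of a b] ex[of b a] wY h(3,6) pq 3 True by blast
    qed
  qed
  let ?Y = "- X - {s}"
  show False
  proof (cases "w \<in> X")
    case False
    show False
      by (rule side[of x X y ?Y]) (use False X sep xy in auto)
  next
    case True
    have sep': "a = y \<and> b = x" if "a \<in> ?Y" "b \<in> X" "{a, b} \<in> E" for a b
      using sep[of b a] that by (auto simp: insert_commute)
    show False
      by (rule side[of y ?Y x X]) (use True X xy sep' in auto)
  qed
qed

lemma ex_minimal_set:
  assumes "finite A0" "P A0" "A0 \<inter> T \<noteq> {}"
  obtains A where "A \<subseteq> A0" "P A" "A \<inter> T \<noteq> {}" "\<And>B. B \<subset> A \<Longrightarrow> P B \<Longrightarrow> B \<inter> T = {}"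
proof -
  let ?Q = "\<lambda>A. A \<subseteq> A0 \<and> P A \<and> A \<inter> T \<noteq> {}"
  obtain A where A: "?Q A" and min: "\<And>B. ?Q B \<Longrightarrow> card A \<le> card B"
    using ex_has_least_nat[of ?Q A0 card] assms by blast
  have "B \<inter> T = {}" if "B \<subset> A" "P B" for B
    using min[of B] that A psubset_card_mono[of A B] finite_subset[of A A0] assms(1)
    by (meson leD psubset_imp_subset subset_trans)
  then show ?thesis using that A by blast
qed

lemma card_ge_2_obtain:
  assumes "2 \<le> card S" obtains p q where "p \<in> S" "q \<in> S" "p \<noteq> q"
  using assms by (metis card_2_iff' card_le_Suc_iff insertCI numeral_2_eq_2)

text \<open>The vertex \<open>z\<close> stands for the end of a bridge of a larger graph and counts
  as big, since its degree may be smaller here than there. If all other vertices had two neighbours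
  in \<open>T\<close>, consider a minimal thin set \<open>A\<close> meeting \<open>T\<close>. By
  independence, a vertex of \<open>A\<close> in \<open>T\<close> has two neighbours in
  \<open>T\<close> outside \<open>A\<close>; the boundary allows this only for \<open>u\<close>,
  with the neighbours \<open>w\<close> and \<open>v\<close>. A third neighbour \<open>y\<close> of
  \<open>u\<close> is then joined to \<open>w\<close> too, and the separation for the edge
  \<open>{u, w}\<close> exposes \<open>{u, v}\<close> as a bridge.\<close>

lemma bridgeless_leaf:
  fixes E :: "'a set set" and z :: 'a
  assumes se: "simple_edges E" and ch: "chordless E" and bl: "bridgeless E" and ne: "E \<noteq> {}"
  defines "T \<equiv> insert z {t. 3 \<le> card (nbrs E t)}"
  shows "\<exists>v\<in>\<Union>E. v \<noteq> z \<and> card (nbrs E v \<inter> T) \<le> 1"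
proof (rule ccontr)
  assume "\<not> ?thesis"
  then have two: "\<exists>p q. p \<in> nbrs E v \<inter> T \<and> q \<in> nbrs E v \<inter> T \<and> p \<noteq> q" if "v \<in> \<Union>E" "v \<noteq> z" for v
    using that card_ge_2_obtain[of "nbrs E v \<inter> T"]
    by (metis Suc_1 not_less_eq_eq)
  let ?A0 = "\<Union>E - {z}"
  have t0: "thin E ?A0" by (rule thinI[of _ _ z]) auto
  have "?A0 \<inter> T \<noteq> {}"
  proof -
    obtain e where "e \<in> E" using ne by auto
    then obtain a b where ab: "{a, b} \<in> E" "a \<noteq> b" using se simple_edges_obtain by metis
    then obtain c where "c \<in> \<Union>E" "c \<noteq> z" by (metis UnionI insertI1 insertI2)
    from two[OF this] show ?thesis using nbrs_subset[of E] by blast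
  qed
  then obtain A where A: "A \<subseteq> ?A0" "thin E A" "A \<inter> T \<noteq> {}"
    and min: "\<And>B. B \<subset> A \<Longrightarrow> thin E B \<Longrightarrow> B \<inter> T = {}"
    using ex_minimal_set[of ?A0 "thin E" T] t0 finite_Union_edges[OF se] by (metis finite_Diff)
  have indep: "y \<notin> T" if "x \<in> A" "y \<in> A" "x \<in> T" "{x, y} \<in> E" for x y
    using thin_minimal_independent[OF ch bl A(2) min, of x y] that simple_edges_neq[OF se that(4)]
    by blast
  obtain w u v where ex: "\<And>a b. a \<in> A \<Longrightarrow> b \<notin> A \<Longrightarrow> {a, b} \<in> E \<Longrightarrow> b = w \<or> (a = u \<and> b = v)"
    using A(2) unfolding thin_def by blast
  have zA: "z \<notin> A" and AV: "\<And>a. a \<in> A \<Longrightarrow> a \<in> \<Union>E" using A(1) by auto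
  have onlyu: "t = u \<and> {u, w} \<in> E \<and> {u, v} \<in> E \<and> w \<noteq> v \<and> w \<notin> A \<and> v \<notin> A" if h: "t \<in> A" "t \<in> T" for t
  proof -
    obtain p q where pq: "p \<in> nbrs E t \<inter> T" "q \<in> nbrs E t \<inter> T" "p \<noteq> q"
      using two[of t] AV[OF h(1)] zA h(1) by blast
    then have e: "{t, p} \<in> E" "{t, q} \<in> E" unfolding nbrs_def by auto
    have "p \<notin> A" "q \<notin> A" using indep[OF h(1) _ h(2)] e pq by blast+
    then show ?thesis using ex[OF h(1) _ e(1)] ex[OF h(1) _ e(2)] pq(3) e by blast
  qed
  obtain t where t: "t \<in> A" "t \<in> T" using A(3) by blast
  have u: "u \<in> A" "u \<in> T" "{u, w} \<in> E" "{u, v} \<in> E" "w \<noteq> v" "w \<notin> A" "v \<notin> A"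
    using onlyu[OF t] t by auto
  have yw: "y \<notin> T \<and> {y, w} \<in> E" if h: "y \<in> A" "{u, y} \<in> E" for y
  proof -
    have yT: "y \<notin> T" using indep[OF u(1) h(1) u(2) h(2)] .
    have yu: "y \<noteq> u" using yT u by auto
    obtain p q where pq: "p \<in> nbrs E y \<inter> T" "q \<in> nbrs E y \<inter> T" "p \<noteq> q"
      using two[of y] AV[OF h(1)] zA h(1) by blast
    then have e: "{y, p} \<in> E" "{y, q} \<in> E" unfolding nbrs_def by auto
    have "c = u \<or> c = w" if "{y, c} \<in> E" "c \<in> T" for c
      using onlyu[of c] ex[OF \<open>y \<in> A\<close> _ that(1)] that(2) yu by blast
    then have "p = w \<or> q = w" using pq e by blast
    then show ?thesis using e yT by auto
  qed
  have "3 \<le> card (nbrs E u)" using u(1,2) zA unfolding T_def by auto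
  moreover have "card {w, v} \<le> 2" by (simp add: card_insert_if)
  ultimately have "\<not> nbrs E u \<subseteq> {w, v}"
    using card_mono[of "{w, v}" "nbrs E u"] by auto
  then obtain y where y: "{u, y} \<in> E" "y \<noteq> w" "y \<noteq> v" unfolding nbrs_def by auto
  have yA: "y \<in> A" using ex[OF u(1) _ y(1)] y by blast
  have yT: "y \<notin> T" "{y, w} \<in> E" using yw[OF yA y(1)] by auto
  have yn: "c = u \<or> c = w" if "{y, c} \<in> E" for c
  proof (rule ccontr)
    assume "\<not> ?thesis"
    moreover have "u \<noteq> w" using u by auto
    moreover have "{u, w, c} \<subseteq> nbrs E y" using that yT y(1) unfolding nbrs_def by (auto simp: insert_commute)
    ultimately have "3 \<le> card (nbrs E y)"
      using card_mono[OF finite_nbrs[OF se, of y], of "{u, w, c}"] by auto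
    then show False using yT unfolding T_def by auto
  qed
  have uw: "u \<noteq> w" using u by auto
  obtain s X where X: "u \<in> X" "w \<notin> X" "s \<notin> X" "s \<noteq> w"
    and sep: "\<And>a b. a \<in> X \<Longrightarrow> b \<notin> X \<Longrightarrow> {a, b} \<in> E \<Longrightarrow> b = s \<or> (a = u \<and> b = w)"
    using edge_separation[OF ch u(3) uw bl] by metis
  have nw: "c \<notin> X" if "c \<in> A" "{u, c} \<in> E" for c
    using sep[of c w] yw[OF that] X(2,4) simple_edges_neq[OF se that(2)] by blast
  \<comment> \<open>The path \<open>u y w\<close> bypasses the edge \<open>{u, w}\<close>, so the
    separating vertex has to lie on it.\<close>
  have sy: "s = y" using sep[of u y] nw[OF yA y(1)] X y by blast
  have "v \<in> X - {u}" using sep[of u v] u X y sy simple_edges_neq[OF se u(4)] yA by blast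
  then obtain a b where ab: "a \<in> X - {u}" "b \<notin> X - {u}" "{a, b} \<in> E" "\<not> (a = v \<and> b = u)"
    using bridgelessD[OF bl, of v "X - {u}" u] u(4) by (auto simp: insert_commute)
  show False
  proof (cases "b = u")
    case True
    then have ua: "{u, a} \<in> E" using ab(3) by (simp add: insert_commute)
    then show False using nw[of a] ex[OF u(1) _ ua] ab True X by blast
  next
    case False
    then have "b = y" using sep[of a b] ab sy by blast
    then show False using yn[of a] ab X by (auto simp: insert_commute)
  qed
qed

text \<open>
  Passing to a minimal set of vertices that is left by at most one edge disposes of the bridges.
\<close>
lemma end_piece:
  assumes se: "simple_edges E" and ne: "E \<noteq> {}" and deg: "\<And>v. v \<in> \<Union>E \<Longrightarrow> 2 \<le> card (nbrs E v)"
  obtains Z z z' where "Z \<subseteq> \<Union>E" "bridgeless {e \<in> E. e \<subseteq> Z}" "{e \<in> E. e \<subseteq> Z} \<noteq> {}"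
    "\<And>a b. a \<in> Z \<Longrightarrow> b \<notin> Z \<Longrightarrow> {a, b} \<in> E \<Longrightarrow> a = z \<and> b = z'"
proof -
  let ?P = "\<lambda>Z. \<exists>z z'. \<forall>a\<in>Z. \<forall>b. b \<notin> Z \<and> {a, b} \<in> E \<longrightarrow> a = z \<and> b = z'"
  have P0: "?P (\<Union>E)" by blast
  obtain e where e: "e \<in> E" using ne by auto
  then have "e \<noteq> {}" using se unfolding simple_edges_def by auto
  then have N0: "\<Union>E \<inter> UNIV \<noteq> {}" using e by auto
  obtain Z where Z: "Z \<subseteq> \<Union>E" "?P Z" "Z \<inter> UNIV \<noteq> {}"
    and min: "\<And>B. B \<subset> Z \<Longrightarrow> ?P B \<Longrightarrow> B \<inter> UNIV = {}"
    by (rule ex_minimal_set[of "\<Union>E" ?P UNIV, OF finite_Union_edges[OF se] P0 N0]) (rule that)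
  obtain z z' where ex: "\<And>a b. a \<in> Z \<Longrightarrow> b \<notin> Z \<Longrightarrow> {a, b} \<in> E \<Longrightarrow> a = z \<and> b = z'"
    using Z(2) by blast
  let ?H = "{e \<in> E. e \<subseteq> Z}"
  have "bridgeless ?H" unfolding bridgeless_def
  proof (rule notI, elim exE conjE)
    fix S a b
    assume S: "a \<in> S" "b \<notin> S" "{a, b} \<in> ?H"
      and u: "\<forall>a'\<in>S. \<forall>b'. b' \<notin> S \<and> {a', b'} \<in> ?H \<longrightarrow> a' = a \<and> b' = b"
    show False
    \<comment> \<open>A bridge would cut the piece in two. The part without \<open>z\<close> is left
      by that bridge alone, against minimality.\<close>
    proof (cases "z \<in> S")
      case True
      have "?P (Z - S)"
      proof (intro exI ballI allI impI)
        fix c d assume cd: "c \<in> Z - S" "d \<notin> Z - S \<and> {c, d} \<in> E"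
        then have "d \<in> Z" using ex[of c d] True by blast
        then have "{d, c} \<in> ?H" using cd by (auto simp: insert_commute)
        then show "c = b \<and> d = a" using u cd \<open>d \<in> Z\<close> by blast
      qed
      then show False using min[of "Z - S"] S by blast
    next
      case False
      have "?P (Z \<inter> S)"
      proof (intro exI ballI allI impI)
        fix c d assume cd: "c \<in> Z \<inter> S" "d \<notin> Z \<inter> S \<and> {c, d} \<in> E"
        then have "d \<in> Z" using ex[of c d] False by blast
        then show "c = a \<and> d = b" using u cd by blast
      qed
      then show False using min[of "Z \<inter> S"] S by blast
    qed
  qed
  moreover have "?H \<noteq> {}"
  proof -
    obtain v where v: "v \<in> Z" using Z(3) by blast
    then obtain p q where "p \<in> nbrs E v" "q \<in> nbrs E v" "p \<noteq> q"
      using deg Z(1) card_ge_2_obtain by (metis subsetD)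
    then have "\<exists>p. {v, p} \<in> E \<and> p \<in> Z" using ex v unfolding nbrs_def by blast
    then show ?thesis using v by blast
  qed
  ultimately show ?thesis using that Z(1) ex by blast
qed

lemma end_piece_nbrs:
  assumes "\<And>a b. a \<in> Z \<Longrightarrow> b \<notin> Z \<Longrightarrow> {a, b} \<in> E \<Longrightarrow> a = z \<and> b = z'"
    and "v \<in> Z" "v \<noteq> z \<or> {z, z'} \<notin> E \<or> z' \<in> Z"
  shows "nbrs {e \<in> E. e \<subseteq> Z} v = nbrs E v"
  using assms unfolding nbrs_def by blast

text \<open>The vertices of an end piece other than \<open>z\<close> keep all their neighbours,
  hence their degrees. As \<open>z\<close> is counted as big in the piece whatever its degree there,
  the bound found in the piece holds in the whole graph.\<close>

theorem vertex_with_few_big_nbrs: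
  assumes se: "simple_edges E" and ch: "chordless E" and ne: "E \<noteq> {}"
    and deg: "\<And>v. v \<in> \<Union>E \<Longrightarrow> 2 \<le> card (nbrs E v)"
  shows "\<exists>v\<in>\<Union>E. card (nbrs E v \<inter> {t. 3 \<le> card (nbrs E t)}) \<le> 1"
proof -
  obtain Z z z' where Z: "Z \<subseteq> \<Union>E" "bridgeless {e \<in> E. e \<subseteq> Z}" "{e \<in> E. e \<subseteq> Z} \<noteq> {}"
    and ex: "\<And>a b. a \<in> Z \<Longrightarrow> b \<notin> Z \<Longrightarrow> {a, b} \<in> E \<Longrightarrow> a = z \<and> b = z'"
    by (rule end_piece[OF se ne deg]) (assumption, rule that)
  let ?H = "{e \<in> E. e \<subseteq> Z}"
  have sH: "simple_edges ?H" using simple_edges_subset[OF se] by auto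
  have "chordless ?H" using chordless_subset[OF ch] by auto
  from bridgeless_leaf[OF sH this Z(2,3), of z]
  obtain v where v: "v \<in> \<Union>?H" "v \<noteq> z"
    "card (nbrs ?H v \<inter> insert z {t. 3 \<le> card (nbrs ?H t)}) \<le> 1" by blast
  have vZ: "v \<in> Z" using v(1) by auto
  have eq: "nbrs ?H c = nbrs E c" if "c \<in> Z" "c \<noteq> z" for c
    using end_piece_nbrs[of Z E z z' c] ex that by blast
  have "nbrs E v \<inter> {t. 3 \<le> card (nbrs E t)} \<subseteq> nbrs ?H v \<inter> insert z {t. 3 \<le> card (nbrs ?H t)}"
  proof
    fix t assume t: "t \<in> nbrs E v \<inter> {t. 3 \<le> card (nbrs E t)}"
    then have "t \<in> nbrs ?H v" using eq[OF vZ v(2)] by auto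
    moreover have "t \<in> Z" using calculation unfolding nbrs_def by auto
    ultimately show "t \<in> nbrs ?H v \<inter> insert z {t. 3 \<le> card (nbrs ?H t)}" using t eq[of t] by (cases "t = z") auto
  qed
  from card_mono[OF _ this] have "card (nbrs E v \<inter> {t. 3 \<le> card (nbrs E t)}) \<le> 1"
    using v(3) finite_nbrs[OF sH, of v] by auto
  moreover have "v \<in> \<Union>E" using v(1) by blast
  ultimately show ?thesis by blast
qed

section \<open>Subcubic chordless graphs\<close>

text \<open>The two exceptional edges are compared as unordered pairs. They may coincide or fail to
  be edges, so cuts with fewer edges are included.\<close>

definition cut2 :: "'a set set \<Rightarrow> 'a set \<Rightarrow> bool" where
  "cut2 E A \<longleftrightarrow> (\<exists>e f. \<forall>a\<in>A. \<forall>b. b \<notin> A \<and> {a, b} \<in> E \<longrightarrow> {a, b} = e \<or> {a, b} = f)"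

lemma cut2I:
  "(\<And>a b. a \<in> A \<Longrightarrow> b \<notin> A \<Longrightarrow> {a, b} \<in> E \<Longrightarrow> {a, b} = e \<or> {a, b} = f) \<Longrightarrow> cut2 E A"
  unfolding cut2_def by (rule exI[of _ e], rule exI[of _ f]) simp

lemma card_le_1_cases:
  assumes "finite S" "card S \<le> 1" obtains q where "S \<subseteq> {q}"
proof (cases "S = {}")
  case False
  then have "card S = 1" using assms by (simp add: Suc_leI card_gt_0_iff le_antisym)
  then show ?thesis using that by (metis card_1_singletonE order_refl)
qed (use that in auto)

lemma card_le_2_cases:
  assumes "finite S" "card S \<le> 2" obtains p q where "S \<subseteq> {p, q}"
proof (cases "card S = 2")
  case True
  then obtain p q where "S = {p, q}" by (auto simp: card_2_iff)
  then show ?thesis using that by blast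
next
  case False
  then have "card S \<le> 1" using assms(2) by linarith
  then obtain p where "S \<subseteq> {p}" using card_le_1_cases[OF assms(1)] by blast
  then show ?thesis using that[of p p] by simp
qed

text \<open>The separating vertex \<open>w\<close> has at most three neighbours, hence at most one
  on one of its sides. Putting \<open>w\<close> on the other side replaces it by a single
  edge.\<close>

lemma edge_cut2:
  assumes se: "simple_edges E" and ch: "chordless E" and bl: "bridgeless E"
    and deg: "\<And>v. card (nbrs E v) \<le> 3" and xy: "{x, y} \<in> E"
  obtains X f where "x \<in> X" "y \<notin> X"
    "\<And>a b. a \<in> X \<Longrightarrow> b \<notin> X \<Longrightarrow> {a, b} \<in> E \<Longrightarrow> {a, b} = {x, y} \<or> {a, b} = f"
proof -
  have ne: "x \<noteq> y" using simple_edges_neq[OF se xy] .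
  obtain w X where X: "x \<in> X" "y \<notin> X" "w \<notin> X" "w \<noteq> y"
    and sep: "\<And>a b. a \<in> X \<Longrightarrow> b \<notin> X \<Longrightarrow> {a, b} \<in> E \<Longrightarrow> b = w \<or> (a = x \<and> b = y)"
    by (rule edge_separation[OF ch xy ne bl]) (rule that)
  have fin: "finite (nbrs E w)" using finite_nbrs[OF se] .
  have "card (nbrs E w) = card (nbrs E w \<inter> X) + card (nbrs E w - X)"
    using card_Int_Diff[OF fin] .
  then consider "card (nbrs E w \<inter> X) \<le> 1" | "card (nbrs E w - X) \<le> 1" using deg[of w] by linarith
  then show ?thesis
  proof cases
    case 1
    then obtain p where p: "nbrs E w \<inter> X \<subseteq> {p}" using card_le_1_cases fin by (metis finite_Int)
    show ?thesis
    proof (rule that[OF X(1,2)])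
      fix a b assume ab: "a \<in> X" "b \<notin> X" "{a, b} \<in> E"
      show "{a, b} = {x, y} \<or> {a, b} = {w, p}"
      proof (cases "b = w")
        case True
        then have "a \<in> nbrs E w \<inter> X" using ab unfolding nbrs_def by (auto simp: insert_commute)
        then show ?thesis using True p by auto
      next
        case False then show ?thesis using sep[OF ab] by auto
      qed
    qed
  next
    case 2
    then obtain p where p: "nbrs E w - X \<subseteq> {p}" using card_le_1_cases fin by (metis finite_Diff)
    show ?thesis
    proof (rule that[of "insert w X"])
      fix a b assume ab: "a \<in> insert w X" "b \<notin> insert w X" "{a, b} \<in> E"
      show "{a, b} = {x, y} \<or> {a, b} = {w, p}"
      proof (cases "a = w")
        case True
        then have "b \<in> nbrs E w - X" using ab unfolding nbrs_def by auto
        then show ?thesis using True p by auto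
      next
        case False then show ?thesis using sep[of a b] ab by auto
      qed
    qed (use X in auto)
  qed
qed

text \<open>Uncrossing of \<open>A\<close> with the cut \<open>X\<close> through
  \<open>{x, y}\<close> and \<open>f\<close>. If \<open>f\<close> does not lie inside
  \<open>A\<close>, only \<open>{x, y}\<close> joins the two parts of \<open>A\<close>; as at most
  two edges leave \<open>A\<close>, one of the parts has at most one of them and is again cut off by
  two edges. If \<open>f\<close> lies inside \<open>A\<close>, edges leaving \<open>A\<close> do not
  cross \<open>X\<close>: either some part is cut off by \<open>{x, y}\<close> and \<open>f\<close>
  alone, or each part has exactly one further leaving edge and the one from
  \<open>A \<inter> X\<close> is a bridge.\<close>

lemma cut2_minimal_independent:
  assumes se: "simple_edges E" and ch: "chordless E" and bl: "bridgeless E"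
    and deg: "\<And>v. card (nbrs E v) \<le> 3" and A: "cut2 E A"
    and min: "\<And>B. B \<subset> A \<Longrightarrow> cut2 E B \<Longrightarrow> B \<inter> T = {}"
    and xy: "{x, y} \<in> E" "x \<in> A" "y \<in> A" "x \<in> T" "y \<in> T"
  shows False
proof -
  obtain g h where ex: "\<And>a b. a \<in> A \<Longrightarrow> b \<notin> A \<Longrightarrow> {a, b} \<in> E \<Longrightarrow> {a, b} = g \<or> {a, b} = h"
    using A unfolding cut2_def by meson
  obtain X f where X: "x \<in> X" "y \<notin> X"
    and cut: "\<And>a b. a \<in> X \<Longrightarrow> b \<notin> X \<Longrightarrow> {a, b} \<in> E \<Longrightarrow> {a, b} = {x, y} \<or> {a, b} = f"
    by (rule edge_cut2[OF se ch bl deg xy(1)]) (rule that)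
  have cut': "{a, b} = {x, y} \<or> {a, b} = f" if "a \<notin> X" "b \<in> X" "{a, b} \<in> E" for a b
    using cut[of b a] that by (auto simp: insert_commute)
  have sub: "A \<inter> X \<subset> A" "A - X \<subset> A" using X xy by auto
  have nX: "\<not> cut2 E (A \<inter> X)" "\<not> cut2 E (A - X)" using min sub X xy by blast+
  show False
  proof (cases "f \<subseteq> A")
    case False
    have only: "cut2 E B"
      if "B = A \<inter> X \<or> B = A - X" and k: "\<And>a b. a \<in> B \<Longrightarrow> b \<notin> A \<Longrightarrow> {a, b} \<in> E \<Longrightarrow> {a, b} = k" for B k
    proof (rule cut2I)
      fix a b assume ab: "a \<in> B" "b \<notin> B" "{a, b} \<in> E"
      show "{a, b} = {x, y} \<or> {a, b} = k"
      proof (cases "b \<in> A")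
        case True
        then have "{a, b} = {x, y} \<or> {a, b} = f"
          using that(1) ab cut[of a b] cut'[of a b] by blast
        then show ?thesis using False True ab that(1) by blast
      next
        case False then show ?thesis using k ab by blast
      qed
    qed
    have "\<exists>a\<in>A \<inter> X. \<exists>b. b \<notin> A \<and> {a, b} \<in> E \<and> {a, b} \<noteq> h" using only[of "A \<inter> X" h] nX by blast
    moreover have "\<exists>a\<in>A \<inter> X. \<exists>b. b \<notin> A \<and> {a, b} \<in> E \<and> {a, b} \<noteq> g" using only[of "A \<inter> X" g] nX by blast
    ultimately obtain a b c d where *: "a \<in> A \<inter> X" "b \<notin> A" "{a, b} = g" "c \<in> A \<inter> X" "d \<notin> A" "{c, d} = h"
      using ex by blast
    have "cut2 E (A - X)"
    proof (rule only[of _ "{}"])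
      fix p q assume pq: "p \<in> A - X" "q \<notin> A" "{p, q} \<in> E"
      then have "{p, q} = {a, b} \<or> {p, q} = {c, d}" using ex * by blast
      then show "{p, q} = {}" using pq * by (auto simp: doubleton_eq_iff)
    qed simp
    then show False using nX by blast
  next
    case fA: True
    have exit: "\<exists>a\<in>B. \<exists>b. b \<notin> A \<and> {a, b} \<in> E \<and> b \<in> A \<union> B' "
      if "B = A \<inter> X \<and> B' = X \<or> B = A - X \<and> B' = - X" for B B'
    proof (rule ccontr)
      assume n: "\<not> ?thesis"
      have "b \<in> B'" if "a \<in> B" "b \<notin> A" "{a, b} \<in> E" for a b
      proof (rule ccontr)
        assume "b \<notin> B'"
        then have "{a, b} = {x, y} \<or> {a, b} = f"
          using that cut[of a b] cut'[of a b] \<open>B = A \<inter> X \<and> B' = X \<or> B = A - X \<and> B' = - X\<close> by blast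
        then have "b \<in> {x, y} \<or> b \<in> f" by (metis insertCI)
        then show False using that(2) fA xy by auto
      qed
      then have "\<And>a b. a \<in> B \<Longrightarrow> b \<notin> A \<Longrightarrow> {a, b} \<in> E \<Longrightarrow> False" using n by blast
      then have "cut2 E B"
        by (intro cut2I[of _ _ "{x, y}" f]) (use that cut cut' in blast)
      then show False using that nX by blast
    qed
    obtain a b where ab: "a \<in> A \<inter> X" "b \<notin> A" "{a, b} \<in> E" "b \<in> X"
      using exit[of "A \<inter> X" X] by blast
    obtain c d where cd: "c \<in> A - X" "d \<notin> A" "{c, d} \<in> E" "d \<notin> X"
      using exit[of "A - X" "- X"] by blast
    have ne: "{a, b} \<noteq> {c, d}" using ab cd by (auto simp: doubleton_eq_iff)
    have g1: "{a, b} = g \<or> {a, b} = h" and g2: "{c, d} = g \<or> {c, d} = h"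
      using ex[of a b] ex[of c d] ab cd by simp_all
    have ex2: "{p, q} = {a, b} \<or> {p, q} = {c, d}" if "p \<in> A" "q \<notin> A" "{p, q} \<in> E" for p q
      using ex[OF that] g1 g2 ne by metis
    obtain p q where pq: "p \<in> X - A" "q \<notin> X - A" "{p, q} \<in> E" "\<not> (p = b \<and> q = a)"
      using bridgelessD[OF bl, of b "X - A" a] ab by (auto simp: insert_commute)
    show False
    proof (cases "q \<in> A")
      case True
      then have "{q, p} = {a, b} \<or> {q, p} = {c, d}" using ex2[of q p] pq by (auto simp: insert_commute)
      then show False using True pq ab cd by (auto simp: doubleton_eq_iff)
    next
      case False
      then have "{p, q} = {x, y} \<or> {p, q} = f" using cut[of p q] pq by blast
      then have "q \<in> {x, y} \<or> q \<in> f" by (metis insertCI)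
      then show False using False fA xy by auto
    qed
  qed
qed

text \<open>Chains from \<open>v\<close> to \<open>W\<close> with one or two inner vertices of
  degree 2. In the case of one inner vertex the degree of \<open>W\<close> is not 2, so that a chain
  is always followed past a second vertex of degree 2.\<close>

definition chain_to :: "'a set set \<Rightarrow> 'a \<Rightarrow> 'a \<Rightarrow> 'a \<Rightarrow> bool" where
  "chain_to E v y W \<longleftrightarrow> nbrs E y = {v, W} \<and> card (nbrs E W) \<noteq> 2 \<or>
     (\<exists>w. nbrs E y = {v, w} \<and> nbrs E w = {y, W} \<and> w \<noteq> v \<and> W \<noteq> y)"

lemma card_2_other:
  assumes "card S = 2" "a \<in> S" obtains b where "S = {a, b}" "b \<noteq> a"
  using assms by (metis card_2_iff doubleton_eq_iff insertE singletonD)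

text \<open>If the conclusion fails, every vertex has a neighbour of degree 3. In an end piece, let
  \<open>A\<close> be minimal among the sets that at most two edges leave and that meet
  \<open>T\<close>. The vertices of \<open>T\<close> in \<open>A\<close> are pairwise nonadjacent,
  so each of them is an end of a leaving edge. Hence such a vertex \<open>t\<close> has two
  neighbours of degree 2 in \<open>A\<close>, from which chains reach \<open>T\<close> after one or
  two steps. Two leaving edges suffice only if both chains stay in \<open>A\<close> and end in the
  same vertex.\<close>

theorem subcubic_configuration:
  assumes se: "simple_edges E" and ch: "chordless E" and ne: "E \<noteq> {}"
    and deg2: "\<And>v. v \<in> \<Union>E \<Longrightarrow> 2 \<le> card (nbrs E v)" and deg3: "\<And>v. card (nbrs E v) \<le> 3"
  shows "\<exists>v y1 y2. y1 \<in> nbrs E v \<and> y2 \<in> nbrs E v \<and> y1 \<noteq> y2 \<and>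
    card (nbrs E y1) = 2 \<and> card (nbrs E y2) = 2 \<and>
    (y1 \<in> nbrs E y2 \<or> (\<forall>x\<in>nbrs E v. card (nbrs E x) < 3) \<or>
     (\<exists>W. W \<noteq> v \<and> W \<notin> nbrs E v \<and> chain_to E v y1 W \<and> chain_to E v y2 W))"
proof (rule ccontr)
  assume no: "\<not> ?thesis"
  have noD: "\<not> (y1 \<in> nbrs E y2 \<or> (\<forall>x\<in>nbrs E v. card (nbrs E x) < 3) \<or>
     (\<exists>W. W \<noteq> v \<and> W \<notin> nbrs E v \<and> chain_to E v y1 W \<and> chain_to E v y2 W))"
    if "y1 \<in> nbrs E v" "y2 \<in> nbrs E v" "y1 \<noteq> y2" "card (nbrs E y1) = 2" "card (nbrs E y2) = 2" for v y1 y2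
    using no that by blast
  define T where "T = {t. 3 \<le> card (nbrs E t)}"
  have nT: "card (nbrs E v) = 2" if "v \<notin> T" "v \<in> \<Union>E" for v
    using deg2[OF that(2)] that(1) unfolding T_def by auto
  have nV: "u \<in> \<Union>E" if "u \<in> nbrs E v" for u v using that nbrs_subset[of E] by blast
  have tri: False if "y1 \<in> nbrs E v" "y2 \<in> nbrs E v" "y1 \<noteq> y2" "y1 \<notin> T" "y2 \<notin> T" "y1 \<in> nbrs E y2" for v y1 y2
    using noD[OF that(1-3)] that nT nV by blast
  have iso: "nbrs E v \<inter> T \<noteq> {}" if h: "v \<in> \<Union>E" for v
  proof
    assume e: "nbrs E v \<inter> T = {}"
    obtain p q where pq: "p \<in> nbrs E v" "q \<in> nbrs E v" "p \<noteq> q"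
      using card_ge_2_obtain[OF deg2[OF h]] by blast
    have "p \<notin> T" "q \<notin> T" using pq e by auto
    then have c: "card (nbrs E p) = 2" "card (nbrs E q) = 2" using nT nV pq by blast+
    have "\<forall>x\<in>nbrs E v. card (nbrs E x) < 3" using e unfolding T_def by auto
    then show False using noD[OF pq c] by blast
  qed
  obtain Z z z' where Z: "Z \<subseteq> \<Union>E" "bridgeless {e \<in> E. e \<subseteq> Z}" "{e \<in> E. e \<subseteq> Z} \<noteq> {}"
    and ex: "\<And>a b. a \<in> Z \<Longrightarrow> b \<notin> Z \<Longrightarrow> {a, b} \<in> E \<Longrightarrow> a = z \<and> b = z'"
    by (rule end_piece[OF se ne deg2]) (assumption, rule that)
  let ?H = "{e \<in> E. e \<subseteq> Z}"
  have sH: "simple_edges ?H" using simple_edges_subset[OF se] by auto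
  have cH: "chordless ?H" using chordless_subset[OF ch] by auto
  have HE: "nbrs ?H v \<subseteq> nbrs E v" for v by (rule nbrs_mono) auto
  have dH: "card (nbrs ?H v) \<le> 3" for v
    using card_mono[OF finite_nbrs[OF se] HE, of v] deg3[of v] by linarith
  define out where "out \<longleftrightarrow> z \<in> Z \<and> z' \<notin> Z \<and> {z, z'} \<in> E"
  \<comment> \<open>If a bridge leaves the piece at \<open>z\<close>, then \<open>z\<close> has at
    most two neighbours inside. Dropping \<open>z\<close> yields a set that at most two edges leave
    and whose vertices keep all their neighbours within the piece.\<close>
  define Z0 where "Z0 = (if out then Z - {z} else Z)"
  have Z0Z: "Z0 \<subseteq> Z" unfolding Z0_def by auto
  have nb: "u \<in> Z" if "v \<in> Z0" "u \<in> nbrs E v" for u v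
    using that ex[of v u] unfolding Z0_def out_def nbrs_def by (auto split: if_splits)
  have nbe: "{v, u} \<in> ?H" if "v \<in> Z0" "u \<in> nbrs E v" for u v
    using nb[OF that] that Z0Z unfolding nbrs_def by auto
  have "cut2 ?H Z0"
  proof (cases out)
    case False
    then show ?thesis unfolding Z0_def by (intro cut2I) auto
  next
    case True
    have "z' \<in> nbrs E z" "z' \<notin> nbrs ?H z" using True unfolding out_def nbrs_def by simp_all
    then have "nbrs ?H z \<subset> nbrs E z" using HE[of z] by blast
    then have "card (nbrs ?H z) < card (nbrs E z)" by (rule psubset_card_mono[OF finite_nbrs[OF se]])
    then have "card (nbrs ?H z) \<le> 2" using deg3[of z] by linarith
    then obtain p q where pq: "nbrs ?H z \<subseteq> {p, q}"
      using card_le_2_cases[OF finite_nbrs[OF sH, of z]] by blast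
    show ?thesis
    proof (rule cut2I)
      fix a b assume ab: "a \<in> Z0" "b \<notin> Z0" "{a, b} \<in> ?H"
      then have "b = z" using True unfolding Z0_def by auto
      then have "a \<in> nbrs ?H z" using ab unfolding nbrs_def by (auto simp: insert_commute)
      then show "{a, b} = {z, p} \<or> {a, b} = {z, q}" using pq \<open>b = z\<close> by auto
    qed
  qed
  \<comment> \<open>Otherwise \<open>z\<close> is the only neighbour of degree 3 of every vertex of
    \<open>Z0\<close>, and a vertex of \<open>Z0\<close> forms a triangle with its second neighbour
    and \<open>z\<close>, which is one of the excluded configurations.\<close>
  moreover have "Z0 \<inter> T \<noteq> {}"
  proof
    assume e: "Z0 \<inter> T = {}"
    obtain e where "e \<in> ?H" using Z(3) by blast
    then obtain a b where "{a, b} \<in> ?H" "a \<noteq> b" using simple_edges_obtain[OF sH] by metis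
    then have "a \<in> Z0 \<or> b \<in> Z0" unfolding Z0_def by auto
    then obtain v where v: "v \<in> Z0" by blast
    have vz: "z \<in> nbrs E v \<and> out \<and> z \<in> T" if h: "v \<in> Z0" for v
    proof -
      obtain t where t: "t \<in> nbrs E v" "t \<in> T" using iso[of v] h Z0Z Z(1) by blast
      then have "t \<in> Z" "t \<notin> Z0" using nb[OF h] e by auto
      then show ?thesis using t unfolding Z0_def by (auto split: if_splits)
    qed
    have "card (nbrs E v) = 2" using nT[of v] v e Z0Z Z(1) by blast
    then obtain v' where v': "nbrs E v = {z, v'}" "v' \<noteq> z" using vz[OF v] card_2_other by metis
    have "v' \<in> Z0" using nb[OF v, of v'] v' vz[OF v] unfolding Z0_def by auto
    then show False
      using tri[of v z v'] vz[of v] vz[of v'] v v' e nbrs_neq[OF se, of v' v]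
      by (metis disjoint_iff insertCI nbrs_sym)
  qed
  ultimately obtain A where A: "A \<subseteq> Z0" "cut2 ?H A" "A \<inter> T \<noteq> {}"
    and min: "\<And>B. B \<subset> A \<Longrightarrow> cut2 ?H B \<Longrightarrow> B \<inter> T = {}"
    using ex_minimal_set[of Z0 "cut2 ?H" T] finite_subset[OF subset_trans[OF Z0Z Z(1)] finite_Union_edges[OF se]]
    by blast
  have indep: False if "x \<in> A" "y \<in> A" "x \<in> T" "y \<in> T" "y \<in> nbrs E x" for x y
    using cut2_minimal_independent[OF sH cH Z(2) dH A(2) min, of x y] that nbe[of x y] A(1) by blast
  obtain g h where exA0: "\<And>a b. a \<in> A \<Longrightarrow> b \<notin> A \<Longrightarrow> {a, b} \<in> ?H \<Longrightarrow> {a, b} = g \<or> {a, b} = h"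
    using A(2) unfolding cut2_def by meson
  have exA: "{a, b} = g \<or> {a, b} = h" if "a \<in> A" "b \<notin> A" "b \<in> nbrs E a" for a b
    using exA0[of a b] nbe[of a b] that A(1) by blast
  have AV: "a \<in> \<Union>E" if "a \<in> A" for a using that A(1) Z0Z Z(1) by blast
  have three: False
    if "e1 = g \<or> e1 = h" "e2 = g \<or> e2 = h" "e3 = g \<or> e3 = h" "e1 \<noteq> e2" "e1 \<noteq> e3" "e2 \<noteq> e3" for e1 e2 e3
    using that by auto
  have outT: "\<exists>x. x \<in> nbrs E t \<and> x \<in> T \<and> x \<notin> A" if "t \<in> A" "t \<in> T" for t
    using iso[OF AV[OF that(1)]] indep[OF that(1) _ that(2)] by blast
  obtain t where t: "t \<in> A" "t \<in> T" using A(3) by blast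
  then obtain x where x: "x \<in> nbrs E t" "x \<in> T" "x \<notin> A" using outT by blast
  have fint: "finite (nbrs E t)" using finite_nbrs[OF se] .
  have ct: "card (nbrs E t) = 3" using deg3[of t] t(2) unfolding T_def by auto
  \<comment> \<open>If both leaving edges were at \<open>t\<close>, then \<open>A - {t}\<close>
    would be attached by the single edge \<open>{y, t}\<close>, a bridge.\<close>
  have inA: "u \<in> A" if u: "u \<in> nbrs E t" "u \<noteq> x" for u
  proof (rule ccontr)
    assume uA: "u \<notin> A"
    have eq: "e = {t, x} \<or> e = {t, u}" if "e = g \<or> e = h" for e
      using exA[OF t(1) uA u(1)] exA[OF t(1) x(3,1)] u(2) that by (metis doubleton_eq_iff)
    have "\<not> nbrs E t \<subseteq> {x, u}" using ct card_mono[of "{x, u}" "nbrs E t"] u(2) by auto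
    then obtain y where y: "y \<in> nbrs E t" "y \<noteq> x" "y \<noteq> u" by auto
    have yA: "y \<in> A" using exA[OF t(1) _ y(1)] eq y by (metis doubleton_eq_iff)
    have yt: "y \<noteq> t" using nbrs_neq[OF se y(1)] .
    have "{y, t} \<in> ?H" using nbe[of t y] t(1) A(1) y(1) by (auto simp: insert_commute)
    then obtain a b where ab: "a \<in> A - {t}" "b \<notin> A - {t}" "{a, b} \<in> ?H" "\<not> (a = y \<and> b = t)"
      using bridgelessD[OF Z(2), of y "A - {t}" t] yA yt by blast
    have ba: "b \<in> nbrs E a" using ab(3) unfolding nbrs_def by auto
    show False
    proof (cases "b = t")
      case True
      then have "a \<in> nbrs E t" using ba nbrs_sym by metis
      moreover have "a \<noteq> x" "a \<noteq> u" "a \<noteq> y" using ab x uA True by auto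
      ultimately have "{x, u, y, a} \<subseteq> nbrs E t" using x u y by auto
      moreover have "card {x, u, y, a} = 4" using \<open>a \<noteq> x\<close> \<open>a \<noteq> u\<close> \<open>a \<noteq> y\<close> y u by auto
      ultimately show False using card_mono[OF fint, of "{x, u, y, a}"] ct by auto
    next
      case False
      then have "{a, b} = g \<or> {a, b} = h" using exA[of a b] ab ba by blast
      then show False using eq[of "{a, b}"] ab False by (auto simp: doubleton_eq_iff)
    qed
  qed
  have "card (nbrs E t - {x}) = 2" using ct x(1) fint by simp
  then obtain y1 y2 where yy: "nbrs E t - {x} = {y1, y2}" "y1 \<noteq> y2" by (meson card_2_iff)
  have y: "y1 \<in> nbrs E t" "y2 \<in> nbrs E t" "y1 \<in> A" "y2 \<in> A" "y1 \<noteq> x" "y2 \<noteq> x"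
    using yy inA by blast+
  have nt: "nbrs E t = {x, y1, y2}" using yy x by blast
  have yT: "y1 \<notin> T" "y2 \<notin> T" using indep[OF t(1) _ t(2)] y by blast+
  have nadj: "y1 \<notin> nbrs E y2" "y2 \<notin> nbrs E y1"
    using tri[OF y(1,2) yy(2) yT] nbrs_sym[of y1 E y2] by auto
  text \<open>Every chain leaving \<open>t\<close> inside \<open>A\<close> ends in \<open>T\<close>, and either stays in \<open>A\<close> or uses an edge leaving \<open>A\<close>.\<close>
  have chain: "\<exists>W. W \<in> T \<and> W \<noteq> t \<and> chain_to E t y W \<and>
      (W \<in> A \<or> (\<exists>a b. a \<in> A \<and> b \<notin> A \<and> b \<in> nbrs E a \<and> a \<noteq> t \<and> b \<noteq> t \<and> a \<notin> T \<and> (a = y \<or> nbrs E a = {y, b} \<and> b \<in> T \<and> a \<in> nbrs E y)))"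
    if h: "y \<in> nbrs E t" "y \<in> A" "y \<notin> T" "\<And>y'. y' \<in> nbrs E t \<Longrightarrow> y' \<notin> T \<Longrightarrow> y' \<notin> nbrs E y" for y
  proof -
    have "card (nbrs E y) = 2" "t \<in> nbrs E y" using nT[OF h(3) AV[OF h(2)]] h(1) nbrs_sym by metis+
    then obtain w where w: "nbrs E y = {t, w}" "w \<noteq> t" using card_2_other by metis
    have wy: "w \<in> nbrs E y" using w by auto
    show ?thesis
    proof (cases "w \<in> T")
      case True
      then have "chain_to E t y w" using w unfolding chain_to_def T_def by auto
      moreover have "y \<noteq> t" using nbrs_neq[OF se h(1)] .
      ultimately show ?thesis using True w(2) wy h(2,3) by blast
    next
      case False
      have wV: "w \<in> \<Union>E" using nV[OF wy] .
      have "card (nbrs E w) = 2" "y \<in> nbrs E w" using nT[OF False wV] wy nbrs_sym by metis+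
      then obtain W where W: "nbrs E w = {y, W}" "W \<noteq> y" using card_2_other by metis
      have WT: "W \<in> T" using iso[OF wV] W h(3) by auto
      have wt: "w \<notin> nbrs E t" using h(4)[of w] wy False by blast
      then have "W \<noteq> t" using W nbrs_sym[of w E t] by auto
      moreover have "chain_to E t y W" using w W unfolding chain_to_def by auto
      moreover have "W \<in> nbrs E w" "y \<noteq> t" using W nbrs_neq[OF se h(1)] by auto
      ultimately show ?thesis using W w WT False wy h(2,3) by blast
    qed
  qed
  have irr: "y1 \<notin> nbrs E y1" "y2 \<notin> nbrs E y2" using nbrs_neq[OF se] by metis+
  have hy1: "\<And>y'. y' \<in> nbrs E t \<Longrightarrow> y' \<notin> T \<Longrightarrow> y' \<notin> nbrs E y1"
    and hy2: "\<And>y'. y' \<in> nbrs E t \<Longrightarrow> y' \<notin> T \<Longrightarrow> y' \<notin> nbrs E y2"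
    using nt x(2) nadj irr by auto
  obtain W1 where W1: "W1 \<in> T" "W1 \<noteq> t" "chain_to E t y1 W1" and
    e1: "W1 \<in> A \<or> (\<exists>a b. a \<in> A \<and> b \<notin> A \<and> b \<in> nbrs E a \<and> a \<noteq> t \<and> b \<noteq> t \<and> a \<notin> T \<and> (a = y1 \<or> nbrs E a = {y1, b} \<and> b \<in> T \<and> a \<in> nbrs E y1))"
    using chain[OF y(1,3) yT(1) hy1] by blast
  obtain W2 where W2: "W2 \<in> T" "W2 \<noteq> t" "chain_to E t y2 W2" and
    e2: "W2 \<in> A \<or> (\<exists>a b. a \<in> A \<and> b \<notin> A \<and> b \<in> nbrs E a \<and> a \<noteq> t \<and> b \<noteq> t \<and> a \<notin> T \<and> (a = y2 \<or> nbrs E a = {y2, b} \<and> b \<in> T \<and> a \<in> nbrs E y2))"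
    using chain[OF y(2,4) yT(2) hy2] by blast
  have tx: "{t, x} = g \<or> {t, x} = h" using exA[OF t(1) x(3,1)] .
  \<comment> \<open>Here and in \<open>both\<close>, \<open>{t, x}\<close> is one leaving edge of
    \<open>A\<close>, and two more would exceed the number allowed: one from a chain and one from
    \<open>W\<close> here, one from each chain there.\<close>
  have one: False
    if "a \<in> A" "b \<notin> A" "b \<in> nbrs E a" "a \<noteq> t" "b \<noteq> t" "a \<notin> T" and W: "W \<in> A" "W \<in> T" "W \<noteq> t" for a b W
  proof -
    obtain x' where x': "x' \<in> nbrs E W" "x' \<notin> A" using outT[OF W(1,2)] by blast
    show False
    proof (rule three[of "{t, x}" "{a, b}" "{W, x'}"])
      show "{a, b} = g \<or> {a, b} = h" using exA that by blast
      show "{W, x'} = g \<or> {W, x'} = h" using exA W x' by blast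
    qed (use tx that W x x' t in \<open>auto simp: doubleton_eq_iff\<close>)
  qed
  have both: False
    if "a \<in> A" "b \<notin> A" "b \<in> nbrs E a" "a \<noteq> t" "b \<noteq> t" "c \<in> A" "d \<notin> A" "d \<in> nbrs E c" "c \<noteq> t" "d \<noteq> t" "a \<noteq> c" for a b c d
  proof (rule three[of "{t, x}" "{a, b}" "{c, d}"])
    show "{a, b} = g \<or> {a, b} = h" "{c, d} = g \<or> {c, d} = h" using exA that by blast+
  qed (use tx that t in \<open>auto simp: doubleton_eq_iff\<close>)
  have W1A: "W1 \<in> A"
  proof (rule ccontr)
    assume "W1 \<notin> A"
    then obtain a b where ab: "a \<in> A" "b \<notin> A" "b \<in> nbrs E a" "a \<noteq> t" "b \<noteq> t" "a \<notin> T"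
      "a = y1 \<or> nbrs E a = {y1, b} \<and> b \<in> T \<and> a \<in> nbrs E y1" using e1 by blast
    then have "W2 \<notin> A" using one W2 by blast
    then obtain c d where cd: "c \<in> A" "d \<notin> A" "d \<in> nbrs E c" "c \<noteq> t" "d \<noteq> t" "c \<notin> T"
      "c = y2 \<or> nbrs E c = {y2, d} \<and> d \<in> T \<and> c \<in> nbrs E y2" using e2 by blast
    have "a \<noteq> c"
      using ab(7) cd(7) yy(2) nadj yT by (metis doubleton_eq_iff)
    then show False using both ab cd by blast
  qed
  have W2A: "W2 \<in> A"
    using e2 one[OF _ _ _ _ _ _ W1A W1(1,2)] by blast
  have "W1 = W2"
  proof (rule ccontr)
    assume n: "W1 \<noteq> W2"
    obtain x1 x2 where "x1 \<in> nbrs E W1" "x1 \<notin> A" "x2 \<in> nbrs E W2" "x2 \<notin> A"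
      using outT[OF W1A W1(1)] outT[OF W2A W2(1)] by blast
    then show False
      using three[of "{t, x}" "{W1, x1}" "{W2, x2}"] exA[OF W1A] exA[OF W2A] tx n W1(2) W2(2) x t W1A W2A
      by (auto simp: doubleton_eq_iff)
  qed
  moreover have "W1 \<notin> nbrs E t" using indep[OF t(1) W1A t(2) W1(1)] by blast
  moreover have "card (nbrs E y1) = 2" "card (nbrs E y2) = 2" using nT[OF yT(1)] nT[OF yT(2)] AV y by blast+
  ultimately show False using noD[OF y(1,2) yy(2)] W1(2,3) W2(3) by blast
qed

section \<open>Vertices of degree at most 2 and a linear bound on the number of edges\<close>

lemma vdegree_eq_card_nbrs:
  assumes "simple_edges E" shows "vdegree E v = card (nbrs E v)"
proof -
  have "{e \<in> E. v \<in> e} = (\<lambda>u. {v, u}) ` nbrs E v"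
  proof
    show "{e \<in> E. v \<in> e} \<subseteq> (\<lambda>u. {v, u}) ` nbrs E v"
    proof
      fix e assume e: "e \<in> {e \<in> E. v \<in> e}"
      then obtain a b where ab: "e = {a, b}" using simple_edges_obtain[OF assms] by (metis CollectD)
      then have "e = {v, a} \<or> e = {v, b}" using e by auto
      then show "e \<in> (\<lambda>u. {v, u}) ` nbrs E v" using e unfolding nbrs_def by auto
    qed
  qed (auto simp: nbrs_def)
  moreover have "inj_on (\<lambda>u. {v, u}) (nbrs E v)" by (auto simp: inj_on_def doubleton_eq_iff)
  ultimately show ?thesis unfolding vdegree_def by (simp add: card_image)
qed

text \<open>If all degrees are at least 2, a vertex with at most one big neighbour has at least one
  neighbour that is not big.\<close>

lemma low_degree_vertex:
  assumes se: "simple_edges E" and ch: "chordless E" and ne: "E \<noteq> {}"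
  shows "\<exists>v\<in>\<Union>E. card (nbrs E v) \<le> 2"
proof (cases "\<forall>v\<in>\<Union>E. 2 \<le> card (nbrs E v)")
  case True
  then obtain v where v: "v \<in> \<Union>E" "card (nbrs E v \<inter> {t. 3 \<le> card (nbrs E t)}) \<le> 1"
    using vertex_with_few_big_nbrs[OF se ch ne] by blast
  show ?thesis
  proof (cases "nbrs E v \<subseteq> {t. 3 \<le> card (nbrs E t)}")
    case True
    then have "card (nbrs E v) \<le> 1" using v(2) by (simp add: Int_absorb2)
    then show ?thesis using v(1) by force
  next
    case False
    then obtain u where "u \<in> nbrs E v" "\<not> 3 \<le> card (nbrs E u)" by auto
    then have "u \<in> nbrs E v" "card (nbrs E u) \<le> 2" by simp_all
    then show ?thesis using nbrs_subset[of E v] by blast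
  qed
qed force

text \<open>Vertices of degree at most 2 are deleted one after another. The bound turns running
  times of order \<open>(n + m) ^ 3\<close> into the order \<open>n ^ 3\<close>.\<close>

lemma chordless_card_edges:
  assumes "finite V" "simple_edges E" "chordless E" "\<Union>E \<subseteq> V"
  shows "card E \<le> 2 * card V"
  using assms
proof (induction "card V" arbitrary: V E)
  case 0
  then have "\<Union>E = {}" by auto
  then have "E = {}" using 0(3) unfolding simple_edges_def by (metis Sup_bot_conv(1) card.empty equals0I zero_neq_numeral)
  then show ?case by simp
next
  case (Suc n)
  show ?case
  proof (cases "E = {}")
    case False
    obtain v where v: "v \<in> \<Union>E" "card (nbrs E v) \<le> 2"
      using low_degree_vertex[OF Suc(4,5) False] by blast
    let ?E = "{e \<in> E. v \<notin> e}"
    have sub: "?E \<subseteq> E" by auto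
    have vV: "v \<in> V" using v Suc(6) by auto
    have "card ?E \<le> 2 * card (V - {v})"
    proof (rule Suc(1))
      show "n = card (V - {v})" using Suc(2,3) vV by simp
      show "\<Union>?E \<subseteq> V - {v}" using Suc(6) by auto
    qed (use Suc(3) simple_edges_subset[OF Suc(4) sub] chordless_subset[OF Suc(5) sub] in auto)
    moreover have "card E = card ?E + card {e \<in> E. v \<in> e}"
      using Suc(4) card_Int_Diff[of E "{e. v \<notin> e}"] unfolding simple_edges_def
      by (simp add: Int_def set_diff_eq)
    moreover have "card {e \<in> E. v \<in> e} \<le> 2"
      using vdegree_eq_card_nbrs[OF Suc(4), of v] v(2) unfolding vdegree_def by simp
    moreover have "card V = Suc (card (V - {v}))" using Suc(3) vV by (metis card.remove)
    ultimately show ?thesis by linarith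
  qed simp
qed

section \<open>Chordlessness after identifying two vertices\<close>

lemma is_cycle_Diff:
  "is_cycle (E - {e}) vs \<longleftrightarrow> is_cycle E vs \<and> e \<notin> cycle_edges vs"
  unfolding is_cycle_def by blast

text \<open>A chord is an edge with both ends on a cycle that survives its deletion. This form does
  not mention the edges of the cycle and suits graphs whose edges are changed.\<close>

lemma chordless_iff:
  "chordless E \<longleftrightarrow> (\<forall>vs. \<forall>e\<in>E. is_cycle (E - {e}) vs \<longrightarrow> \<not> e \<subseteq> set vs)"
  unfolding chordless_def is_chord_def is_cycle_Diff by blast

lemma path_in_cong:
  assumes "path_in E xs" "\<And>a b. a \<in> set xs \<Longrightarrow> b \<in> set xs \<Longrightarrow> {a, b} \<in> E \<Longrightarrow> {a, b} \<in> F"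
  shows "path_in F xs"
  using assms unfolding path_in_def successively_conv_nth
  by (metis (no_types, lifting) Suc_lessD nth_mem)

lemma is_cycle_cong:
  assumes "is_cycle E xs" "\<And>a b. a \<in> set xs \<Longrightarrow> b \<in> set xs \<Longrightarrow> {a, b} \<in> E \<Longrightarrow> {a, b} \<in> F"
  shows "is_cycle F xs"
proof -
  have "xs \<noteq> []" using assms(1) unfolding is_cycle_def by auto
  then show ?thesis using assms path_in_cong[of E xs F] unfolding is_cycle_iff by auto
qed

lemma is_cycle_Cons_ends:
  assumes "is_cycle E (p # D)"
  shows "hd D \<in> nbrs E p" "last D \<in> nbrs E p" "hd D \<noteq> last D" "path_in E D" "D \<noteq> []" "p \<notin> set D"
proof -
  have l: "2 \<le> length D" "path_in E (p # D)" "{last (p # D), p} \<in> E"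
    using assms unfolding is_cycle_iff by auto
  show "D \<noteq> []" using l by auto
  then show "hd D \<in> nbrs E p" "last D \<in> nbrs E p" "path_in E D" "p \<notin> set D"
    using l(2,3) unfolding nbrs_def by (auto simp: path_in_Cons insert_commute)
  have "distinct D" using l(2) unfolding path_in_def by auto
  then show "hd D \<noteq> last D" using l(1) \<open>D \<noteq> []\<close>
    by (metis One_nat_def Suc_1 diff_is_0_eq distinct_conv_nth hd_conv_nth last_conv_nth length_greater_0_conv diff_less not_less_eq_eq zero_less_one nat_less_le)
qed

lemma on_cycle_nbrs:
  assumes "is_cycle E vs" "p \<in> set vs"
  obtains a b where "a \<in> nbrs E p" "b \<in> nbrs E p" "a \<noteq> b"
  using is_cycle_rotate_to[OF assms] is_cycle_Cons_ends by metis

text \<open>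
  Identifying the degree 2 neighbours \<open>y1\<close> and \<open>y2\<close> of \<open>v\<close> shortens the path
  \<open>w1 y1 v y2 w2\<close> to \<open>w1 y1 w2\<close>; no cycle uses \<open>v\<close> otherwise.
\<close>
lemma chordless_merge:
  assumes se: "simple_edges E" and ch: "chordless E"
    and y: "nbrs E y1 = {v, w1}" "nbrs E y2 = {v, w2}"
    and d: "y1 \<noteq> y2" "w1 \<noteq> w2" "v \<noteq> y1" "v \<noteq> y2" "w2 \<noteq> y2" "w1 \<noteq> y2"
    and E': "E' \<subseteq> insert {y1, w2} (E - {{v, y1}, {v, y2}, {y2, w2}})"
    and v: "card (nbrs E' v) \<le> 1" "finite (nbrs E' v)"
  shows "chordless E'"
  unfolding chordless_iff
proof (intro allI ballI impI notI)
  fix vs e assume e: "e \<in> E'" and cyc: "is_cycle (E' - {e}) vs" and sub: "e \<subseteq> set vs"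
  have nb: "nbrs (E' - {e}) p \<subseteq> nbrs E' p" for p by (rule nbrs_mono) auto
  have vn: "v \<notin> set vs"
  proof
    assume "v \<in> set vs"
    then obtain a b where "a \<in> nbrs (E' - {e}) v" "b \<in> nbrs (E' - {e}) v" "a \<noteq> b"
      by (rule on_cycle_nbrs[OF cyc])
    then show False using nb[of v] v by (metis card_le_Suc0_iff_eq One_nat_def subsetD)
  qed
  have y2E: "nbrs E' y2 = {}"
  proof -
    have "u \<notin> nbrs E' y2" for u
    proof
      assume "u \<in> nbrs E' y2"
      then have "{y2, u} \<in> E'" unfolding nbrs_def by auto
      moreover have "{y2, u} \<noteq> {y1, w2}" using d by (auto simp: doubleton_eq_iff)
      ultimately have "{y2, u} \<in> E" "{y2, u} \<noteq> {v, y2}" "{y2, u} \<noteq> {y2, w2}" using E' by auto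
      moreover from this(1) have "u \<in> {v, w2}" using y(2) unfolding nbrs_def by blast
      ultimately show False by (auto simp: insert_commute)
    qed
    then show ?thesis by blast
  qed
  have y2n: "y2 \<notin> set vs"
  proof
    assume "y2 \<in> set vs"
    then obtain a b where "a \<in> nbrs (E' - {e}) y2" "b \<in> nbrs (E' - {e}) y2" "a \<noteq> b"
      by (rule on_cycle_nbrs[OF cyc])
    then show False using nb[of y2] y2E by blast
  qed
  have y1E: "nbrs E' y1 \<subseteq> {w1, w2}"
  proof
    fix u assume "u \<in> nbrs E' y1"
    then have "{y1, u} \<in> E'" unfolding nbrs_def by auto
    then have "{y1, u} = {y1, w2} \<or> {y1, u} \<in> E \<and> {y1, u} \<noteq> {v, y1}" using E' by auto
    then show "u \<in> {w1, w2}" using y(1) unfolding nbrs_def by (auto simp: doubleton_eq_iff)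
  qed
  show False
  proof (cases "y1 \<in> set vs")
    case False
    have inE: "f \<in> E" if "f \<in> E'" "f \<subseteq> set vs" for f using that False E' by auto
    have "is_cycle (E - {e}) vs" by (rule is_cycle_cong[OF cyc]) (use inE in auto)
    then show False using ch inE[OF e sub] sub unfolding chordless_iff by blast
  next
    case True
    obtain D where D: "is_cycle (E' - {e}) (y1 # D)" "set (y1 # D) = set vs"
      by (rule is_cycle_rotate_to[OF cyc True])
    note DD = is_cycle_Cons_ends[OF D(1)]
    have ends: "hd D \<in> {w1, w2}" "last D \<in> {w1, w2}" using DD nb[of y1] y1E by blast+
    \<comment> \<open>The cycle passes through \<open>y1\<close> and uses both edges there. So the
      chord, which is not on the cycle, cannot end in \<open>y1\<close>.\<close>
    have ew: "e \<noteq> {y1, w1}" "e \<noteq> {y1, w2}"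
      using DD(1-3) ends unfolding nbrs_def by auto
    have y1e: "y1 \<notin> e"
    proof
      assume "y1 \<in> e"
      obtain u where "e = {y1, u}"
      proof -
        have "e = {y1, w2} \<or> e \<in> E" using e E' by auto
        then obtain a b where "e = {a, b}" using simple_edges_obtain[OF se] by metis
        then show ?thesis using that[of a] that[of b] \<open>y1 \<in> e\<close> by auto
      qed
      then show False using e y1E ew unfolding nbrs_def by auto
    qed
    have eE: "e \<in> E" using e E' ew by auto
    obtain D' where D': "path_in (E' - {e}) D'" "D' \<noteq> []" "hd D' = w2" "last D' = w1" "set D' = set D"
    proof (cases "hd D = w2")
      case True
      then show ?thesis using that[of D] ends DD by auto
    next
      case False
      then show ?thesis using that[of "rev D"] ends DD by (auto simp: hd_rev last_rev)
    qed
    have pD: "path_in (E - {e}) D'"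
    proof (rule path_in_cong[OF D'(1)])
      fix a b assume ab: "a \<in> set D'" "b \<in> set D'" "{a, b} \<in> E' - {e}"
      then have "y1 \<notin> {a, b}" using D'(5) DD(6) by auto
      then show "{a, b} \<in> E - {e}" using ab(3) E' by auto
    qed
    have ne: "v \<notin> e" "y2 \<notin> e" using sub vn y2n by auto
    have es: "{y1, v} \<in> E" "{v, y2} \<in> E" "{y2, w2} \<in> E" "{w1, y1} \<in> E"
      using y unfolding nbrs_def by (auto simp: insert_commute)
    have nD: "v \<notin> set D'" "y2 \<notin> set D'" "y1 \<notin> set D'" using D(2) D'(5) vn y2n DD(6) by auto
    have "is_cycle (E - {e}) ([y1, v, y2] @ D')"
      unfolding is_cycle_iff path_in_append path_in_Cons
      using pD D' es ne y1e nD d by (auto simp: insert_commute)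
    moreover have "e \<subseteq> set ([y1, v, y2] @ D')" using sub D(2) D'(5) by auto
    ultimately show False using ch eE unfolding chordless_iff by blast
  qed
qed

section \<open>Partial colourings\<close>

definition inc :: "nat set \<Rightarrow> (nat \<Rightarrow> nat set) \<Rightarrow> nat \<Rightarrow> nat set" where
  "inc S ed v = {i \<in> S. v \<in> ed i}"

text \<open>
  Edges are numbered: \<open>ed i\<close> is the set of ends of edge \<open>i\<close>, and \<open>S\<close> is the set of edges
  present.  The colour 0 means uncoloured.
\<close>
definition proper :: "nat set \<Rightarrow> (nat \<Rightarrow> nat set) \<Rightarrow> (nat \<Rightarrow> nat) \<Rightarrow> (nat \<Rightarrow> nat) \<Rightarrow> bool" where
  "proper S ed ce cv \<longleftrightarrow>
     (\<forall>v. \<forall>i\<in>inc S ed v. \<forall>j\<in>inc S ed v. i \<noteq> j \<and> ce i = ce j \<longrightarrow> ce i = 0) \<and>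
     (\<forall>v. \<forall>i\<in>inc S ed v. ce i = cv v \<longrightarrow> ce i = 0) \<and>
     (\<forall>i\<in>S. \<forall>u\<in>ed i. \<forall>v\<in>ed i. u \<noteq> v \<and> cv u = cv v \<longrightarrow> cv u = 0)"

lemma proper_edges:
  "proper S ed ce cv \<Longrightarrow> i \<in> inc S ed v \<Longrightarrow> j \<in> inc S ed v \<Longrightarrow> i \<noteq> j \<Longrightarrow> ce i = ce j \<Longrightarrow> ce i = 0"
  unfolding proper_def by metis

lemma proper_ends:
  "proper S ed ce cv \<Longrightarrow> i \<in> inc S ed v \<Longrightarrow> ce i = cv v \<Longrightarrow> ce i = 0"
  unfolding proper_def by metis

lemma proper_nbrs:
  "proper S ed ce cv \<Longrightarrow> i \<in> S \<Longrightarrow> u \<in> ed i \<Longrightarrow> v \<in> ed i \<Longrightarrow> u \<noteq> v \<Longrightarrow> cv u = cv v \<Longrightarrow> cv u = 0"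
  unfolding proper_def by metis

lemma proper_set_edge:
  assumes "proper S ed ce cv" "ed e = {u, v}"
    and "\<And>i. i \<in> inc S ed u \<Longrightarrow> i \<noteq> e \<Longrightarrow> ce i \<noteq> c" "\<And>i. i \<in> inc S ed v \<Longrightarrow> i \<noteq> e \<Longrightarrow> ce i \<noteq> c"
    and "cv u \<noteq> c" "cv v \<noteq> c"
  shows "proper S ed (ce(e := c)) cv"
proof -
  have "x = u \<or> x = v" if "e \<in> inc S ed x" for x using that assms(2) unfolding inc_def by auto
  then show ?thesis using assms unfolding proper_def by (auto; metis)
qed

lemma proper_set_vertex:
  assumes "proper S ed ce cv"
    and "\<And>i. i \<in> inc S ed u \<Longrightarrow> ce i \<noteq> c"
    and "\<And>i x. i \<in> inc S ed u \<Longrightarrow> x \<in> ed i \<Longrightarrow> x \<noteq> u \<Longrightarrow> cv x \<noteq> c"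
  shows "proper S ed ce (cv(u := c))"
  using assms unfolding proper_def inc_def by (auto; metis)

text \<open>The way back from a reduced graph \<open>S'\<close>, \<open>ed'\<close> to
  \<open>S\<close>, \<open>ed\<close>. The vertices of \<open>W\<close> lose their colours, so at
  them only pairs of edges can conflict, and at most one edge there is still coloured. Outside
  \<open>W\<close> a coloured edge has the same ends in both graphs; this admits an edge whose end
  in \<open>W\<close> was moved by an identification.\<close>

lemma proper_restore:
  assumes P: "proper S' ed' ce cv"
    and W0: "\<And>w. w \<in> W \<Longrightarrow> cv0 w = 0" and W1: "\<And>v. v \<notin> W \<Longrightarrow> cv0 v = cv v"
    and e0: "\<And>i. i \<in> S \<Longrightarrow> ce0 i \<noteq> 0 \<Longrightarrow> i \<in> S' \<and> ce0 i = ce i"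
    and e1: "\<And>i p. i \<in> S \<Longrightarrow> ce0 i \<noteq> 0 \<Longrightarrow> p \<in> ed i \<Longrightarrow> p \<notin> W \<Longrightarrow> p \<in> ed' i"
    and w: "\<And>w i j. w \<in> W \<Longrightarrow> i \<in> inc S ed w \<Longrightarrow> j \<in> inc S ed w \<Longrightarrow> ce0 i \<noteq> 0 \<Longrightarrow> ce0 j \<noteq> 0 \<Longrightarrow> i = j"
    and two: "\<And>i. i \<in> S \<Longrightarrow> card (ed i) = 2"
    and f: "\<And>i. i \<in> S \<Longrightarrow> ed i \<inter> W = {} \<Longrightarrow> i \<in> S' \<and> ed' i = ed i"
  shows "proper S ed ce0 cv0"
  unfolding proper_def
proof (intro conjI allI ballI impI)
  fix v i j assume a: "i \<in> inc S ed v" "j \<in> inc S ed v" "i \<noteq> j \<and> ce0 i = ce0 j"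
  show "ce0 i = 0"
  proof (rule ccontr)
    assume n: "ce0 i \<noteq> 0"
    then have n': "ce0 j \<noteq> 0" using a by simp
    show False
    proof (cases "v \<in> W")
      case True then show False using w[OF True a(1,2) n n'] a(3) by blast
    next
      case False
      have iS: "i \<in> S" "v \<in> ed i" "j \<in> S" "v \<in> ed j" using a(1,2) unfolding inc_def by auto
      have ij: "i \<in> S'" "ce0 i = ce i" "j \<in> S'" "ce0 j = ce j" using e0[OF iS(1) n] e0[OF iS(3) n'] by auto
      have vv: "v \<in> ed' i" "v \<in> ed' j" using e1[OF iS(1) n iS(2) False] e1[OF iS(3) n' iS(4) False] .
      have "i \<in> inc S' ed' v" "j \<in> inc S' ed' v" using ij(1,3) vv unfolding inc_def by simp_all
      moreover have "ce i = ce j" "ce i \<noteq> 0" using a(3) n ij(2,4) by linarith+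
      moreover have "i \<noteq> j" using a(3) by simp
      ultimately show False using proper_edges[OF P, of i v j] by simp
    qed
  qed
next
  fix v i assume a: "i \<in> inc S ed v" "ce0 i = cv0 v"
  show "ce0 i = 0"
  proof (rule ccontr)
    assume n: "ce0 i \<noteq> 0"
    then have "v \<notin> W" using W0[of v] a by auto
    note vW = this
    have iS: "i \<in> S" "v \<in> ed i" using a(1) unfolding inc_def by auto
    have ij: "i \<in> S'" "ce0 i = ce i" using e0[OF iS(1) n] by auto
    have "i \<in> inc S' ed' v" using ij(1) e1[OF iS(1) n iS(2) vW] unfolding inc_def by simp
    moreover have "ce i = cv v" "ce i \<noteq> 0" using a(2) n ij(2) W1[OF vW] by linarith+
    ultimately show False using proper_ends[OF P, of i v] by simp
  qed
next
  fix i u v assume a: "i \<in> S" "u \<in> ed i" "v \<in> ed i" "u \<noteq> v \<and> cv0 u = cv0 v"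
  show "cv0 u = 0"
  proof (cases "u \<in> W \<or> v \<in> W")
    case True then show ?thesis using W0 a by auto
  next
    case uv: False
    show ?thesis
    proof (cases "ed i \<inter> W = {}")
      case True
      then have "i \<in> S'" "ed' i = ed i" using f a by blast+
      then show ?thesis using proper_nbrs[OF P, of i u v] a W1 uv by auto
    next
      case False
      obtain p q where "ed i = {p, q}" using two[OF a(1)] by (auto simp: card_2_iff)
      then have "ed i = {u, v}" using a by auto
      then show ?thesis using False uv by auto
    qed
  qed
qed

lemma ex_free_colour:
  assumes "finite F" "card F < K" shows "\<exists>c. 1 \<le> c \<and> c \<le> K \<and> c \<notin> F"
proof (rule ccontr)
  assume "\<not> ?thesis"
  then have "{1..K} \<subseteq> F" by auto
  then show False using card_mono[OF assms(1), of "{1..K}"] assms(2) by simp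
qed

declare [[linarith_neq_limit = 0]]

section \<open>Local extension problems with four colours\<close>

definition colour4 :: "nat \<Rightarrow> bool" where "colour4 c \<longleftrightarrow> 1 \<le> c \<and> c \<le> 4"

lemma not_colour4_0 [simp]: "\<not> colour4 0"
  by (simp add: colour4_def)

lemma free4: "\<exists>c. colour4 c \<and> c \<noteq> x \<and> c \<noteq> y \<and> c \<noteq> z"
proof -
  have "card {x, y, z} < 4" by (simp add: card_insert_if)
  from ex_free_colour[OF _ this] show ?thesis by (auto simp: colour4_def)
qed

text \<open>
  \<open>link a p b q\<close>: a path of one inner vertex, whose ends are coloured \<open>a\<close>, \<open>b\<close> and whose edges
  are coloured \<open>p\<close>, \<open>q\<close> in this order, has a colour left for its inner vertex.
\<close>
definition link :: "nat \<Rightarrow> nat \<Rightarrow> nat \<Rightarrow> nat \<Rightarrow> bool" where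
  "link a p b q \<longleftrightarrow> p \<noteq> q \<and> (a = b \<or> a = q \<or> p = b)"

text \<open>One of the three equations leaves at most three different colours forbidden at the inner
  vertex.\<close>

lemma link_inner:
  assumes "link a p b q" shows "\<exists>s. colour4 s \<and> s \<noteq> a \<and> s \<noteq> p \<and> s \<noteq> b \<and> s \<noteq> q"
  using assms free4[of a p q] free4[of a p b] unfolding link_def by metis

text \<open>Paths with two inner vertices, coloured \<open>s\<close> and \<open>t\<close>, and the
  middle edge \<open>f\<close>. If \<open>a = q\<close> and \<open>p = b\<close>, then
  \<open>s\<close>, \<open>f\<close>, \<open>t\<close> would have to be three different colours
  outside \<open>{a, p}\<close>, which do not exist; otherwise a choice is possible whenever a
  single inner vertex could be coloured.\<close>

lemma link2_inner:
  assumes l: "link a p b q" and n: "\<not> (a = q \<and> p = b)" and c: "colour4 a" "colour4 p" "colour4 b" "colour4 q"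
    and d: "a \<noteq> p" "b \<noteq> q"
  shows "\<exists>s f t. colour4 s \<and> colour4 f \<and> colour4 t \<and> s \<notin> {a, p, f, t} \<and> f \<notin> {p, q, t} \<and> t \<notin> {q, b}"
proof -
  from l consider "a = b" | "a = q" "p \<noteq> b" | "p = b" "a \<noteq> q" using n unfolding link_def by blast
  then show ?thesis
  proof cases
    case 1
    obtain r where r: "colour4 r" "r \<noteq> a" "r \<noteq> p" "r \<noteq> q" using free4 by blast
    show ?thesis
      by (rule exI[of _ q], rule exI[of _ r], rule exI[of _ p]) (use 1 r c d l in \<open>auto simp: link_def\<close>)
  next
    case 2
    obtain r where r: "colour4 r" "r \<noteq> a" "r \<noteq> p" "r \<noteq> b" using free4 by blast
    show ?thesis
      by (rule exI[of _ b], rule exI[of _ r], rule exI[of _ p]) (use 2 r c d l in \<open>auto simp: link_def\<close>)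
  next
    case 3
    obtain r where r: "colour4 r" "r \<noteq> a" "r \<noteq> p" "r \<noteq> q" using free4 by blast
    show ?thesis
      by (rule exI[of _ q], rule exI[of _ r], rule exI[of _ a]) (use 3 r c d l in \<open>auto simp: link_def\<close>)
  qed
qed

lemma pigeon4:
  assumes "colour4 q1" "colour4 q2" "colour4 q3" "colour4 b" "colour4 b'"
    and "q1 \<noteq> q2" "q1 \<noteq> q3" "q2 \<noteq> q3" "b \<notin> {q1, q2, q3}" "b' \<notin> {q1, q2, q3}"
  shows "b = b'"
proof (rule ccontr)
  assume "b \<noteq> b'"
  then have "card {q1, q2, q3, b, b'} = 5" using assms(6-) by (auto simp: card_insert_if)
  moreover have "{q1, q2, q3, b, b'} \<subseteq> {1..4}" using assms(1-5) unfolding colour4_def by auto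
  ultimately show False using card_mono[of "{1..4}" "{q1, q2, q3, b, b'}"] by simp
qed

text \<open>A star with three arms: \<open>a\<close> is the colour of the centre, \<open>p1\<close>,
  \<open>p2\<close>, \<open>p3\<close> are those of its edges, while \<open>b1\<close>,
  \<open>b2\<close>, \<open>b3\<close> and \<open>q1\<close>, \<open>q2\<close>, \<open>q3\<close>
  are the given colours of the ends of the arms and of their outer edges. Centre and inner edges use
  up all four colours.\<close>

definition star_solvable :: "nat \<Rightarrow> nat \<Rightarrow> nat \<Rightarrow> nat \<Rightarrow> nat \<Rightarrow> nat \<Rightarrow> bool" where
  "star_solvable b1 q1 b2 q2 b3 q3 \<longleftrightarrow> (\<exists>a p1 p2 p3. distinct [a, p1, p2, p3] \<and>
     colour4 a \<and> colour4 p1 \<and> colour4 p2 \<and> colour4 p3 \<and>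
     link a p1 b1 q1 \<and> link a p2 b2 q2 \<and> link a p3 b3 q3)"

lemma star_solvable_sym:
  "star_solvable b1 q1 b2 q2 b3 q3 \<Longrightarrow> star_solvable b2 q2 b1 q1 b3 q3"
  "star_solvable b1 q1 b2 q2 b3 q3 \<Longrightarrow> star_solvable b1 q1 b3 q3 b2 q2"
  "star_solvable b1 q1 b2 q2 b3 q3 \<Longrightarrow> star_solvable b3 q3 b2 q2 b1 q1"
  "star_solvable b1 q1 b2 q2 b3 q3 \<Longrightarrow> star_solvable b2 q2 b3 q3 b1 q1"
  "star_solvable b1 q1 b2 q2 b3 q3 \<Longrightarrow> star_solvable b3 q3 b1 q1 b2 q2"
  unfolding star_solvable_def distinct.simps list.set by blast+

text \<open>An arm whose outer edge has the colour of the centre is linked whatever its inner edge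
  is, so this edge can take the colour left over.\<close>

lemma star_solvableI:
  assumes c: "colour4 a" "colour4 p2" "colour4 p3" "a \<noteq> p2" "a \<noteq> p3" "p2 \<noteq> p3"
    and l: "link a p2 b2 q2" "link a p3 b3 q3" and q: "q1 = a"
  shows "star_solvable b1 q1 b2 q2 b3 q3"
proof -
  obtain p1 where p1: "colour4 p1" "p1 \<noteq> a" "p1 \<noteq> p2" "p1 \<noteq> p3" using free4[of a p2 p3] by blast
  have "link a p1 b1 q1" using q p1 unfolding link_def by auto
  then show ?thesis using c l p1 unfolding star_solvable_def
    by (intro exI[of _ a] exI[of _ p1] exI[of _ p2] exI[of _ p3]) auto
qed

text \<open>The colour of an outer edge is given to the centre if this settles two arms: if it
  occurs on another outer edge or at the end of another arm. Otherwise \<open>q1\<close>,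
  \<open>q2\<close>, \<open>q3\<close> are distinct and all ends have the fourth colour; the centre
  takes it too, and the inner edges get a cyclic shift of \<open>q1\<close>, \<open>q2\<close>,
  \<open>q3\<close>.\<close>

lemma star_solvable:
  assumes "colour4 b1" "colour4 q1" "b1 \<noteq> q1" "colour4 b2" "colour4 q2" "b2 \<noteq> q2"
    and "colour4 b3" "colour4 q3" "b3 \<noteq> q3"
  shows "star_solvable b1 q1 b2 q2 b3 q3"
proof -
  have same: "star_solvable b1 q1 b2 q2 b3 q3"
    if h: "colour4 q1" "colour4 b3" "colour4 q3" "b3 \<noteq> q3" "q1 = q2" for b1 q1 b2 q2 b3 q3
  proof -
    have "\<exists>p3. colour4 p3 \<and> p3 \<noteq> q1 \<and> link q1 p3 b3 q3"
    proof (cases "b3 = q1")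
      case True
      then show ?thesis using free4[of q1 q3 q3] unfolding link_def by metis
    next
      case False
      then show ?thesis using h unfolding link_def by auto
    qed
    then obtain p3 where p3: "colour4 p3" "p3 \<noteq> q1" "link q1 p3 b3 q3" by blast
    obtain p2 where "colour4 p2" "p2 \<noteq> q1" "p2 \<noteq> p3" using free4[of q1 p3 p3] by blast
    then show ?thesis
      using p3 h(1,5) by (intro star_solvableI[of q1 p2 p3]) (auto simp: link_def)
  qed
  have cross: "star_solvable b1 q1 b2 q2 b3 q3"
    if h: "colour4 q1" "colour4 q2" "colour4 b3" "colour4 q3" "b3 \<noteq> q3" "b2 \<noteq> q2" "q1 = b2" "q1 \<noteq> q3" "q2 \<noteq> q3" for b1 q1 b2 q2 b3 q3
  proof (cases "b3 = q1")
    case True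
    then show ?thesis using h by (intro star_solvableI[of q1 q3 q2]) (auto simp: link_def)
  next
    case False
    obtain p2 where "colour4 p2" "p2 \<noteq> q1" "p2 \<noteq> b3" "p2 \<noteq> q2" using free4 by blast
    then show ?thesis using h False by (intro star_solvableI[of q1 p2 b3]) (auto simp: link_def)
  qed
  consider "q1 = q2" | "q1 = q3" | "q2 = q3"
    | "q1 \<noteq> q2" "q1 \<noteq> q3" "q2 \<noteq> q3" "q1 = b2 \<or> q1 = b3 \<or> q2 = b1 \<or> q2 = b3 \<or> q3 = b1 \<or> q3 = b2"
    | "q1 \<noteq> q2" "q1 \<noteq> q3" "q2 \<noteq> q3" "q1 \<noteq> b2" "q1 \<noteq> b3" "q2 \<noteq> b1" "q2 \<noteq> b3" "q3 \<noteq> b1" "q3 \<noteq> b2" by blast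
  then show ?thesis
  proof cases
    case 1 then show ?thesis using same assms by blast
  next
    case 2 then show ?thesis using same[of q1 b2 q2 q3 b1 b3] assms star_solvable_sym(2) by blast
  next
    case 3 then show ?thesis using same[of q2 b1 q1 q3 b2 b3] assms star_solvable_sym(5) by blast
  next
    case 4
    from 4(4) show ?thesis
    proof (elim disjE)
      assume "q1 = b2" then show ?thesis using 4 assms by (intro cross) simp_all
    next
      assume "q1 = b3" then show ?thesis using 4 assms by (intro star_solvable_sym(2)[OF cross]) simp_all
    next
      assume "q2 = b1" then show ?thesis using 4 assms by (intro star_solvable_sym(1)[OF cross]) simp_all
    next
      assume "q2 = b3" then show ?thesis using 4 assms by (intro star_solvable_sym(5)[OF cross]) simp_all
    next
      assume "q3 = b1" then show ?thesis using 4 assms by (intro star_solvable_sym(4)[OF cross]) simp_all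
    next
      assume "q3 = b2" then show ?thesis using 4 assms by (intro star_solvable_sym(3)[OF cross]) simp_all
    qed
  next
    case 5
    have "b2 = b1" "b3 = b1"
      using pigeon4[of q1 q2 q3 b2 b1] pigeon4[of q1 q2 q3 b3 b1] 5 assms by simp_all
    then show ?thesis using 5 assms unfolding star_solvable_def
      by (intro exI[of _ b1] exI[of _ q2] exI[of _ q3] exI[of _ q1]) (auto simp: link_def)
  qed
qed

text \<open>Two chains between two vertices with colours \<open>a\<close> and \<open>b\<close>;
  \<open>g\<close> and \<open>ax\<close> are the colours of the third edge at the former and of its
  other end, \<open>h\<close> and \<open>az\<close> those at the latter. A colour different from all
  four serves for both vertices. Otherwise these four are all the colours, and the two vertices take
  \<open>az\<close> and \<open>ax\<close>. The two negated conditions allow chains with two inner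
  vertices.\<close>

lemma double_link_solvable:
  assumes "colour4 ax" "colour4 g" "ax \<noteq> g" "colour4 az" "colour4 h" "az \<noteq> h"
  obtains a p1 p2 b q1 q2 where "distinct [g, a, p1, p2]" "distinct [h, b, q1, q2]" "a \<noteq> ax" "b \<noteq> az"
    "colour4 a" "colour4 p1" "colour4 p2" "colour4 b" "colour4 q1" "colour4 q2"
    "link a p1 b q1" "link a p2 b q2" "\<not> (a = q1 \<and> p1 = b)" "\<not> (a = q2 \<and> p2 = b)"
proof (cases "\<exists>c. colour4 c \<and> c \<notin> {ax, g, az, h}")
  case True
  then obtain c where c: "colour4 c" "c \<notin> {ax, g, az, h}" by blast
  show ?thesis
  proof (cases "g = h")
    case True
    obtain d where d: "colour4 d" "d \<noteq> c" "d \<noteq> g" using free4[of c g g] by blast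
    obtain e where e: "colour4 e" "e \<noteq> c" "e \<noteq> g" "e \<noteq> d" using free4[of c g d] by blast
    show ?thesis by (rule that[of c d e c e d]) (use c d e True in \<open>auto simp: link_def\<close>)
  next
    case False
    obtain d where d: "colour4 d" "d \<noteq> c" "d \<noteq> g" "d \<noteq> h" using free4[of c g h] by blast
    show ?thesis by (rule that[of c h d c d g]) (use c d assms False in \<open>auto simp: link_def\<close>)
  qed
next
  case False
  then have "{1..4} \<subseteq> {ax, g, az, h}" unfolding colour4_def by auto
  then have "4 \<le> card {ax, g, az, h}" using card_mono[of "{ax, g, az, h}" "{1..4}"] by simp
  then have "distinct [ax, g, az, h]" by (auto simp: card_insert_if split: if_splits)
  then show ?thesis by (intro that[of az ax h ax g az]) (use assms in \<open>auto simp: link_def\<close>)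
qed

lemma colour4_pos [simp]: "colour4 c \<Longrightarrow> 0 < c"
  by (simp add: colour4_def)

section \<open>Undoing the removal of one edge or of a pair of edges\<close>

definition numbered_graph :: "nat \<Rightarrow> nat set \<Rightarrow> (nat \<Rightarrow> nat set) \<Rightarrow> bool" where
  "numbered_graph n S ed \<longleftrightarrow> finite S \<and> inj_on ed S \<and> (\<forall>i\<in>S. card (ed i) = 2 \<and> ed i \<subseteq> {..<n})"

text \<open>For edge colourings all vertices have colour 0. As \<open>proper\<close> ignores this
  colour, edge and total colourings share the same lemmas and the same program.\<close>

definition coloured :: "bool \<Rightarrow> nat \<Rightarrow> nat \<Rightarrow> nat set \<Rightarrow> (nat \<Rightarrow> nat) \<Rightarrow> (nat \<Rightarrow> nat) \<Rightarrow> bool" where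
  "coloured tot K n S ce cv \<longleftrightarrow> (\<forall>i\<in>S. 1 \<le> ce i \<and> ce i \<le> K) \<and>
     (\<forall>v<n. if tot then 1 \<le> cv v \<and> cv v \<le> K else cv v = 0)"

lemma numbered_graph_ends:
  assumes "numbered_graph n S ed" "i \<in> S" "v \<in> ed i"
  obtains x where "ed i = {v, x}" "x \<noteq> v" "x < n" "v < n"
proof -
  have c: "card (ed i) = 2" "ed i \<subseteq> {..<n}" using assms(1,2) unfolding numbered_graph_def by auto
  obtain x where "ed i = {v, x}" "x \<noteq> v" by (rule card_2_other[OF c(1) assms(3)])
  then show ?thesis using that c(2) by auto
qed

lemma finite_inc: "numbered_graph n S ed \<Longrightarrow> finite (inc S ed v)"
  unfolding numbered_graph_def inc_def by auto

text \<open>Every edge at \<open>u\<close> excludes two colours: its own and that of its other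
  end.\<close>

lemma ex_vertex_colour:
  assumes P: "proper S ed ce cv" and G: "numbered_graph n S ed" and d: "2 * card (inc S ed u) < K"
  shows "\<exists>c. 1 \<le> c \<and> c \<le> K \<and> proper S ed ce (cv(u := c))"
proof -
  let ?I = "inc S ed u"
  let ?X = "\<Union>i\<in>?I. ed i - {u}"
  have fin: "finite ?I" by (rule finite_inc[OF G])
  have c1: "card (ed i - {u}) = 1" "finite (ed i)" if "i \<in> ?I" for i
    using that G unfolding numbered_graph_def inc_def
    by (auto simp: card_Diff_singleton_if intro: card_ge_0_finite)
  have "card ?X \<le> (\<Sum>i\<in>?I. card (ed i - {u}))" by (rule card_UN_le[OF fin])
  also have "\<dots> = card ?I" using c1 by simp
  finally have X: "card ?X \<le> card ?I" .
  have finX: "finite ?X" using fin c1 by auto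
  have "card (ce ` ?I \<union> cv ` ?X) \<le> card (ce ` ?I) + card (cv ` ?X)" by (rule card_Un_le)
  also have "\<dots> \<le> card ?I + card ?X" by (intro add_mono card_image_le fin finX)
  finally have "card (ce ` ?I \<union> cv ` ?X) < K" using X d by linarith
  then obtain c where c: "1 \<le> c" "c \<le> K" "c \<notin> ce ` ?I \<union> cv ` ?X"
    using ex_free_colour[of "ce ` ?I \<union> cv ` ?X" K] fin finX by auto
  have "proper S ed ce (cv(u := c))"
    by (rule proper_set_vertex[OF P]) (use c(3) in auto)
  then show ?thesis using c by blast
qed

text \<open>The bound \<open>k + 1\<close> on the sum of degrees means that at most
  \<open>k - 1\<close> other edges are adjacent to \<open>e\<close>. Afterwards \<open>u\<close> is
  recoloured greedily: degree 2 excludes four colours, which needs \<open>k\<close> to be at least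
  4; with four colours in all, \<open>u\<close> must have degree 1.\<close>

definition single_step :: "nat \<Rightarrow> bool \<Rightarrow> nat set \<Rightarrow> (nat \<Rightarrow> nat set) \<Rightarrow> nat \<Rightarrow> nat \<Rightarrow> bool" where
  "single_step k tot S ed e u \<longleftrightarrow> e \<in> S \<and> (\<exists>v. v \<noteq> u \<and> ed e = {v, u} \<and>
     card (inc S ed v) + card (inc S ed u) \<le> k + 1 \<and> card (inc S ed u) \<le> 2 \<and>
     (tot \<and> k < 4 \<longrightarrow> card (inc S ed u) = 1))"

text \<open>The colour of \<open>u\<close> is given up, since it may agree with that of
  \<open>v\<close>. At most \<open>k - 1\<close> edges and, for total colourings, the vertex
  \<open>v\<close> restrict the colour of \<open>e\<close>.\<close>

lemma single_step_edge:
  assumes st: "single_step k tot S ed e u" and G: "numbered_graph n S ed"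
    and P: "proper (S - {e}) ed ce cv" and C: "coloured tot (k + of_bool tot) n (S - {e}) ce cv"
  shows "proper S ed (ce(e := 0)) (cv(u := 0)) \<and>
    (\<exists>c. 1 \<le> c \<and> c \<le> k + of_bool tot \<and> proper S ed (ce(e := c)) (cv(u := 0)))"
proof -
  obtain v where v: "e \<in> S" "v \<noteq> u" "ed e = {v, u}" "card (inc S ed v) + card (inc S ed u) \<le> k + 1"
    "card (inc S ed u) \<le> 2" using st unfolding single_step_def by blast
  have fin: "finite (inc S ed v)" "finite (inc S ed u)" using finite_inc[OF G] by auto
  have e: "e \<in> inc S ed v" "e \<in> inc S ed u" using v unfolding inc_def by auto
  let ?ce = "ce(e := 0)" and ?cv = "cv(u := 0)"
  have P0: "proper S ed ?ce ?cv"
  proof (rule proper_restore[OF P, of "{u}"])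
    fix w i j assume "w \<in> {u}" "i \<in> inc S ed w" "j \<in> inc S ed w" "?ce i \<noteq> 0" "?ce j \<noteq> 0"
    then have a: "i \<in> inc S ed u - {e}" "j \<in> inc S ed u - {e}" by (auto split: if_splits)
    have "card (inc S ed u - {e}) \<le> 1" using e fin v(5) by simp
    then show "i = j" using a fin by (metis One_nat_def card_le_Suc0_iff_eq finite_Diff)
  next
    fix i assume "i \<in> S" then show "card (ed i) = 2" using G unfolding numbered_graph_def by auto
  qed (use v in \<open>auto split: if_splits\<close>)
  let ?A = "inc S ed v - {e}" and ?B = "inc S ed u - {e}"
  have cA: "card ?A = card (inc S ed v) - 1" "card ?B = card (inc S ed u) - 1" "0 < card (inc S ed v)" "0 < card (inc S ed u)"
    using e fin by (auto simp: card_gt_0_iff)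
  let ?F = "ce ` ?A \<union> ce ` ?B \<union> (if tot then {cv v} else {})"
  have "card ?F \<le> card (ce ` ?A \<union> ce ` ?B) + card (if tot then {cv v} else {})" by (rule card_Un_le)
  also have "\<dots> \<le> card (ce ` ?A) + card (ce ` ?B) + of_bool tot" using card_Un_le[of "ce ` ?A" "ce ` ?B"] by auto
  also have "\<dots> \<le> card ?A + card ?B + of_bool tot" by (intro add_mono card_image_le) (use fin in auto)
  finally have "card ?F < k + of_bool tot" using cA v(4) by linarith
  moreover have "finite ?F" using fin by (cases tot) simp_all
  ultimately obtain c where c: "1 \<le> c" "c \<le> k + of_bool tot" "c \<notin> ?F"
    using ex_free_colour[of ?F "k + of_bool tot"] by blast
  have vn: "v < n" using G v unfolding numbered_graph_def by auto
  have cv: "cv v \<noteq> c" using c(1,3) C vn unfolding coloured_def by (auto split: if_splits)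
  have "proper S ed (?ce(e := c)) ?cv"
    by (rule proper_set_edge[OF P0 v(3)]) (use c cv v in auto)
  then show ?thesis using P0 c by auto
qed

text \<open>The identification is carried out by moving the edge \<open>f2\<close> from
  \<open>y2\<close> to \<open>y1\<close>. For \<open>w1 = w2\<close> nothing is moved: this would
  create a parallel edge, and \<open>f1\<close> and \<open>f2\<close> are adjacent anyway.\<close>

definition pair_step ::
  "nat \<Rightarrow> bool \<Rightarrow> nat set \<Rightarrow> (nat \<Rightarrow> nat set) \<Rightarrow> nat \<Rightarrow> nat \<Rightarrow> nat \<Rightarrow> nat \<Rightarrow> (nat \<Rightarrow> nat set) \<Rightarrow> bool" where
  "pair_step k tot S ed e1 e2 y1 y2 ed' \<longleftrightarrow> (\<exists>v f1 f2 w1 w2.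
     inc S ed y1 = {e1, f1} \<and> inc S ed y2 = {e2, f2} \<and>
     ed e1 = {v, y1} \<and> ed e2 = {v, y2} \<and> ed f1 = {y1, w1} \<and> ed f2 = {y2, w2} \<and>
     distinct [e1, e2, f1, f2] \<and> distinct [v, y1, y2] \<and> w1 \<notin> {v, y1, y2} \<and> w2 \<notin> {v, y1, y2} \<and>
     card (inc S ed v) \<le> k \<and> (tot \<longrightarrow> 4 \<le> k) \<and>
     (\<forall>i\<in>S - {e1, e2}. ed' i = (if i = f2 \<and> w1 \<noteq> w2 then {y1, w2} else ed i)))"


text \<open>The other edges at \<open>v\<close>, at most \<open>k - 2\<close>, and for total
  colourings \<open>v\<close> itself leave two colours \<open>g\<close> and \<open>h\<close>. As
  \<open>f1\<close> and \<open>f2\<close> have different colours, one of the two ways to distribute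
  \<open>g\<close> and \<open>h\<close> over \<open>e1\<close> and \<open>e2\<close> avoids both
  conflicts.\<close>

lemma pair_step_edges:
  assumes st: "pair_step k tot S ed e1 e2 y1 y2 ed'" and G: "numbered_graph n S ed"
    and P: "proper (S - {e1, e2}) ed' ce cv" and C: "coloured tot (k + of_bool tot) n (S - {e1, e2}) ce cv"
  shows "proper S ed (ce(e1 := 0, e2 := 0)) (cv(y1 := 0, y2 := 0)) \<and>
    (\<exists>c d. 1 \<le> c \<and> c \<le> k + of_bool tot \<and> 1 \<le> d \<and> d \<le> k + of_bool tot \<and>
       proper S ed (ce(e1 := c, e2 := d)) (cv(y1 := 0, y2 := 0)))"
proof -
  obtain v f1 f2 w1 w2 where i: "inc S ed y1 = {e1, f1}" "inc S ed y2 = {e2, f2}"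
    and ed: "ed e1 = {v, y1}" "ed e2 = {v, y2}" "ed f1 = {y1, w1}" "ed f2 = {y2, w2}"
    and d: "distinct [e1, e2, f1, f2]" "distinct [v, y1, y2]" "w1 \<notin> {v, y1, y2}" "w2 \<notin> {v, y1, y2}"
    and k: "card (inc S ed v) \<le> k"
    and ed0: "\<forall>i\<in>S - {e1, e2}. ed' i = (if i = f2 \<and> w1 \<noteq> w2 then {y1, w2} else ed i)"
    using st unfolding pair_step_def by (elim exE conjE) (rule that)
  note ed' = bspec[OF ed0]
  let ?K = "k + of_bool tot" and ?S = "S - {e1, e2}"
  have "e1 \<in> inc S ed y1" "e2 \<in> inc S ed y2" "f1 \<in> inc S ed y1" "f2 \<in> inc S ed y2" unfolding i by simp_all
  then have S: "e1 \<in> S" "e2 \<in> S" "f1 \<in> S" "f2 \<in> S" by (simp_all add: inc_def)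
  have f: "f1 \<in> ?S" "f2 \<in> ?S" using S d(1) by auto
  have fin: "finite (inc S ed v)" using finite_inc[OF G] by auto
  have cf: "1 \<le> ce f1" "1 \<le> ce f2" using C f unfolding coloured_def by auto
  \<comment> \<open>In the reduced graph \<open>f1\<close> and \<open>f2\<close> meet: at
    \<open>w1\<close> if their outer ends agree, and otherwise at \<open>y1\<close>, where
    \<open>f2\<close> was moved.\<close>
  have q: "ce f1 \<noteq> ce f2"
  proof (cases "w1 = w2")
    case True
    then have "f1 \<in> inc ?S ed' w1" "f2 \<in> inc ?S ed' w1" using f ed' ed unfolding inc_def by auto
    then show ?thesis using proper_edges[OF P, of f1 w1 f2] d(1) cf by auto
  next
    case False
    then have "f1 \<in> inc ?S ed' y1" "f2 \<in> inc ?S ed' y1" using f ed' ed d(1) unfolding inc_def by auto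
    then show ?thesis using proper_edges[OF P, of f1 y1 f2] d(1) cf by auto
  qed
  let ?ce = "ce(e1 := 0, e2 := 0)" and ?cv = "cv(y1 := 0, y2 := 0)"
  have P0: "proper S ed ?ce ?cv"
  proof (rule proper_restore[OF P, of "{y1, y2}"])
    fix w i j assume "w \<in> {y1, y2}" "i \<in> inc S ed w" "j \<in> inc S ed w" "?ce i \<noteq> 0" "?ce j \<noteq> 0"
    then show "i = j" using i by (auto split: if_splits)
  next
    fix i assume "i \<in> S" then show "card (ed i) = 2" using G unfolding numbered_graph_def by auto
  next
    fix j assume j: "j \<in> S" "ed j \<inter> {y1, y2} = {}"
    then have "j \<noteq> e1" "j \<noteq> e2" "j \<noteq> f2" using ed by auto
    then show "j \<in> ?S \<and> ed' j = ed j" using j(1) ed'[of j] by simp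
  next
    fix j p assume j: "j \<in> S" "?ce j \<noteq> 0" "p \<in> ed j" "p \<notin> {y1, y2}"
    then have "j \<in> ?S" by (auto split: if_splits)
    then show "p \<in> ed' j" using j(3,4) ed(4) ed'[of j] by (cases "j = f2 \<and> w1 \<noteq> w2") auto
  qed (auto split: if_splits)
  let ?A = "inc S ed v - {e1, e2}"
  have e: "e1 \<in> inc S ed v" "e2 \<in> inc S ed v" using S ed unfolding inc_def by auto
  have "card {e1, e2} = 2" using d(1) by simp
  then have cA: "card ?A + 2 \<le> k" using card_Diff_subset[of "{e1, e2}" "inc S ed v"] card_mono[of "inc S ed v" "{e1, e2}"] e fin k by auto
  let ?F = "ce ` ?A \<union> (if tot then {cv v} else {})"
  have "card ?F \<le> card (ce ` ?A) + card (if tot then {cv v} else {})" by (rule card_Un_le)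
  also have "\<dots> \<le> card ?A + of_bool tot" using card_image_le[of ?A ce] fin by auto
  finally have F: "card ?F + 2 \<le> ?K" using cA by linarith
  have finF: "finite ?F" using fin by (cases tot) simp_all
  obtain g where g: "1 \<le> g" "g \<le> ?K" "g \<notin> ?F" using ex_free_colour[OF finF, of ?K] F by (metis add_2_eq_Suc' Suc_le_lessD Suc_lessD)
  have "card (insert g ?F) < ?K" using F finF by (simp add: card_insert_if)
  then obtain h where h: "1 \<le> h" "h \<le> ?K" "h \<notin> ?F" "h \<noteq> g" using ex_free_colour[of "insert g ?F" ?K] finF by (metis finite_insert insert_iff)
  have vn: "v < n" using G S ed unfolding numbered_graph_def by (metis insert_subset lessThan_iff)
  have nv: "cv v \<noteq> c" if "1 \<le> c" "c \<notin> ?F" for c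
    using that C vn unfolding coloured_def by (auto split: if_splits)
  have assign: "proper S ed (ce(e1 := c, e2 := c')) ?cv"
    if c: "1 \<le> c" "c \<notin> ?F" "c \<noteq> ce f1" "1 \<le> c'" "c' \<notin> ?F" "c' \<noteq> ce f2" "c \<noteq> c'" for c c'
  proof -
    have P1: "proper S ed (?ce(e1 := c)) ?cv"
      by (rule proper_set_edge[OF P0 ed(1)]) (use c nv i d in auto)
    have "proper S ed (?ce(e1 := c, e2 := c')) ?cv"
      by (rule proper_set_edge[OF P1 ed(2)]) (use c nv i d in auto)
    moreover have "?ce(e1 := c, e2 := c') = ce(e1 := c, e2 := c')" using d(1) by auto
    ultimately show ?thesis by simp
  qed
  have "(g \<noteq> ce f1 \<and> h \<noteq> ce f2) \<or> (h \<noteq> ce f1 \<and> g \<noteq> ce f2)" using q h(4) by auto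
  then show ?thesis using P0 assign[of g h] assign[of h g] g h by metis
qed

section \<open>Undoing the removal of the configurations for four colours\<close>

lemma restore4:
  assumes G: "numbered_graph n S ed" and P: "proper (S - R) ed ce cv"
    and meet: "\<And>i. i \<in> R \<Longrightarrow> ed i \<inter> U \<noteq> {}" and few: "\<And>u. u \<in> U \<Longrightarrow> card (inc S ed u - R) \<le> 1"
  shows "proper S ed (\<lambda>i. if i \<in> R then 0 else ce i) (\<lambda>v. if v \<in> U then 0 else cv v)"
proof (rule proper_restore[OF P, of U])
  fix w i j
  assume h: "w \<in> U" "i \<in> inc S ed w" "j \<in> inc S ed w" "(if i \<in> R then 0 else ce i) \<noteq> 0" "(if j \<in> R then 0 else ce j) \<noteq> 0"
  then have "i \<in> inc S ed w - R" "j \<in> inc S ed w - R" by (auto split: if_splits)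
  then show "i = j" using few[OF h(1)] finite_inc[OF G, of w] by (metis One_nat_def card_le_Suc0_iff_eq finite_Diff)
next
  fix i assume "i \<in> S" then show "card (ed i) = 2" using G unfolding numbered_graph_def by auto
next
  fix i assume "i \<in> S" "ed i \<inter> U = {}"
  then show "i \<in> S - R \<and> ed i = ed i" using meet by blast
qed (auto split: if_splits)

text \<open>At most one edge joins \<open>v\<close> to the part that stays. If there is none, two
  arbitrary different colours take the place of \<open>ax\<close> and \<open>g\<close>, so that
  degrees 2 and 3 need no distinction later.\<close>

lemma ex_stub:
  assumes G: "numbered_graph n S ed" and P: "proper (S - R) ed ce cv" and C: "coloured True 4 n (S - R) ce cv"
    and few: "card (inc S ed v - R) \<le> 1"
    and far: "\<And>i x. i \<in> inc S ed v - R \<Longrightarrow> x \<in> ed i \<Longrightarrow> x \<noteq> v \<Longrightarrow> x \<notin> U"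
  obtains ax g where "colour4 ax" "colour4 g" "ax \<noteq> g"
    "\<And>i. i \<in> inc S ed v \<Longrightarrow> i \<notin> R \<Longrightarrow> ce i = g"
    "\<And>i x. i \<in> inc S ed v \<Longrightarrow> i \<notin> R \<Longrightarrow> x \<in> ed i \<Longrightarrow> x \<noteq> v \<Longrightarrow> x \<notin> U \<and> cv x = ax"
proof (cases "inc S ed v - R = {}")
  case True
  then show ?thesis using that[of 1 2] by (auto simp: colour4_def)
next
  case False
  then obtain e where e: "e \<in> inc S ed v - R" by blast
  have only: "i = e" if "i \<in> inc S ed v" "i \<notin> R" for i
    using that e few finite_inc[OF G, of v] by (metis DiffI One_nat_def card_le_Suc0_iff_eq finite_Diff)
  have eS: "e \<in> S" "v \<in> ed e" "e \<notin> R" using e unfolding inc_def by auto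
  obtain x where x: "ed e = {v, x}" "x \<noteq> v" "x < n" by (rule numbered_graph_ends[OF G eS(1,2)])
  have c: "colour4 (ce e)" "colour4 (cv x)" using C eS x(3) unfolding coloured_def colour4_def by auto
  have "e \<in> inc (S - R) ed x" using eS x unfolding inc_def by auto
  then have "cv x \<noteq> ce e" using proper_ends[OF P, of e x] c by auto
  then show ?thesis using that[of "cv x" "ce e"] c only x far[OF e] by auto
qed

text \<open>Every colouring of the rest extends to the removed edges \<open>R\<close> after
  recolouring only the vertices \<open>U\<close>. The first conjunct is about the state from which
  the search for colours starts, where \<open>R\<close> and \<open>U\<close> are uncoloured.\<close>

definition recolourable :: "nat \<Rightarrow> nat set \<Rightarrow> (nat \<Rightarrow> nat set) \<Rightarrow> nat set \<Rightarrow> nat set \<Rightarrow> bool" where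
  "recolourable n S ed R U \<longleftrightarrow> (\<forall>ce cv. proper (S - R) ed ce cv \<and> coloured True 4 n (S - R) ce cv \<longrightarrow>
     proper S ed (\<lambda>i. if i \<in> R then 0 else ce i) (\<lambda>v. if v \<in> U then 0 else cv v) \<and>
     (\<exists>ce' cv'. (\<forall>i. i \<notin> R \<longrightarrow> ce' i = ce i) \<and> (\<forall>v. v \<notin> U \<longrightarrow> cv' v = cv v) \<and>
        (\<forall>i\<in>R. colour4 (ce' i)) \<and> (\<forall>v\<in>U. colour4 (cv' v)) \<and> proper S ed ce' cv'))"

lemma recolourable_single:
  assumes "single_step 3 True S ed e u" "numbered_graph n S ed"
  shows "recolourable n S ed {e} {u}"
  unfolding recolourable_def
proof (intro allI impI, elim conjE)
  fix ce cv assume h: "proper (S - {e}) ed ce cv" "coloured True 4 n (S - {e}) ce cv"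
  have f: "(\<lambda>i. if i \<in> {e} then 0 else ce i) = ce(e := 0)" "(\<lambda>i. if i \<in> {u} then 0 else cv i) = cv(u := 0)" by auto
  obtain c where P0: "proper S ed (ce(e := 0)) (cv(u := 0))"
    and c: "colour4 c" "proper S ed (ce(e := c)) (cv(u := 0))"
    using single_step_edge[OF assms h(1)] h(2) by (auto simp: colour4_def)
  have "card (inc S ed u) = 1" using assms(1) unfolding single_step_def by auto
  then obtain d where d: "colour4 d" "proper S ed (ce(e := c)) ((cv(u := 0))(u := d))"
    using ex_vertex_colour[OF c(2) assms(2), of u 4] by (auto simp: colour4_def)
  show "proper S ed (\<lambda>i. if i \<in> {e} then 0 else ce i) (\<lambda>v. if v \<in> {u} then 0 else cv v) \<and>
     (\<exists>ce' cv'. (\<forall>i. i \<notin> {e} \<longrightarrow> ce' i = ce i) \<and> (\<forall>v. v \<notin> {u} \<longrightarrow> cv' v = cv v) \<and>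
        (\<forall>i\<in>{e}. colour4 (ce' i)) \<and> (\<forall>v\<in>{u}. colour4 (cv' v)) \<and> proper S ed ce' cv')"
    unfolding f by (rule conjI[OF P0], rule exI[of _ "ce(e := c)"], rule exI[of _ "cv(u := d)"]) (use c d in auto)
qed

text \<open>The colours \<open>a\<close>, \<open>p1\<close>, \<open>p2\<close> and \<open>g\<close>
  are distinct, where \<open>g\<close> is that of the third edge at \<open>v\<close>, or arbitrary.
  The edge opposite to \<open>v\<close> repeats the colour \<open>a\<close> of \<open>v\<close>,
  which leaves \<open>g\<close> for \<open>y1\<close> and \<open>p1\<close> for
  \<open>y2\<close>.\<close>

lemma recolourable_triangle:
  assumes G: "numbered_graph n S ed"
    and i: "inc S ed y1 = {e1, f}" "inc S ed y2 = {e2, f}" "e1 \<in> inc S ed v" "e2 \<in> inc S ed v"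
    and ed: "ed e1 = {v, y1}" "ed e2 = {v, y2}" "ed f = {y1, y2}"
    and d: "distinct [e1, e2, f]" "distinct [v, y1, y2]" and k: "card (inc S ed v) \<le> 3"
  shows "recolourable n S ed {e1, e2, f} {v, y1, y2}"
  unfolding recolourable_def
proof (intro allI impI, elim conjE)
  let ?R = "{e1, e2, f}" and ?U = "{v, y1, y2}"
  fix ce cv assume P: "proper (S - ?R) ed ce cv" and C: "coloured True 4 n (S - ?R) ce cv"
  let ?ce = "\<lambda>i. if i \<in> ?R then 0 else ce i" and ?cv = "\<lambda>v. if v \<in> ?U then 0 else cv v"
  have fv: "f \<notin> inc S ed v" using ed d unfolding inc_def by auto
  have "inc S ed v - ?R = inc S ed v - {e1, e2}" using fv by auto
  then have few: "card (inc S ed v - ?R) \<le> 1"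
    using k i d finite_inc[OF G, of v] by (simp add: card_Diff_subset)
  have P0: "proper S ed ?ce ?cv"
    by (rule restore4[OF G P]) (use few i ed in auto)
  have far: "x \<notin> ?U" if "j \<in> inc S ed v - ?R" "x \<in> ed j" "x \<noteq> v" for j x
  proof
    assume "x \<in> ?U"
    then have "j \<in> inc S ed y1 \<or> j \<in> inc S ed y2" using that unfolding inc_def by auto
    then show False using that i by auto
  qed
  obtain ax g where st: "colour4 ax" "colour4 g" "ax \<noteq> g"
    "\<And>i. i \<in> inc S ed v \<Longrightarrow> i \<notin> ?R \<Longrightarrow> ce i = g"
    "\<And>i x. i \<in> inc S ed v \<Longrightarrow> i \<notin> ?R \<Longrightarrow> x \<in> ed i \<Longrightarrow> x \<noteq> v \<Longrightarrow> x \<notin> ?U \<and> cv x = ax"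
    by (rule ex_stub[OF G P C few far]) (assumption+, rule that)
  obtain a where a: "colour4 a" "a \<noteq> ax" "a \<noteq> g" using free4[of ax g g] by blast
  obtain p1 where p1: "colour4 p1" "p1 \<noteq> a" "p1 \<noteq> g" using free4[of a g g] by blast
  obtain p2 where p2: "colour4 p2" "p2 \<noteq> a" "p2 \<noteq> g" "p2 \<noteq> p1" using free4[of a g p1] by blast
  have iv: "j \<in> inc S ed v \<Longrightarrow> j = e1 \<or> j = e2 \<or> j \<notin> ?R" for j using fv by auto
  have P1: "proper S ed ?ce (?cv(v := a))"
  proof (rule proper_set_vertex[OF P0])
    fix j assume j: "j \<in> inc S ed v" then show "?ce j \<noteq> a" using a st(4)[OF j] by auto
  next
    fix j x assume j: "j \<in> inc S ed v" "x \<in> ed j" "x \<noteq> v"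
    then show "?cv x \<noteq> a" using a st(5)[OF j(1) _ j(2,3)] iv[OF j(1)] ed by auto
  qed
  have P2: "proper S ed (?ce(e1 := p1)) (?cv(v := a))"
    by (rule proper_set_edge[OF P1 ed(1)]) (use p1 a st(4) i d in auto)
  have P3: "proper S ed (?ce(e1 := p1, e2 := p2)) (?cv(v := a))"
    by (rule proper_set_edge[OF P2 ed(2)]) (use p1 p2 a st(4) i d in auto)
  have P4: "proper S ed (?ce(e1 := p1, e2 := p2, f := a)) (?cv(v := a))"
    by (rule proper_set_edge[OF P3 ed(3)]) (use p1 p2 a i d in auto)
  have P5: "proper S ed (?ce(e1 := p1, e2 := p2, f := a)) (?cv(v := a, y1 := g))"
    by (rule proper_set_vertex[OF P4]) (use p1 p2 a i d ed st(1-3) in auto)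
  have P6: "proper S ed (?ce(e1 := p1, e2 := p2, f := a)) (?cv(v := a, y1 := g, y2 := p1))"
    by (rule proper_set_vertex[OF P5]) (use p1 p2 a i d ed st(1-3) in auto)
  show "proper S ed ?ce ?cv \<and> (\<exists>ce' cv'. (\<forall>i. i \<notin> ?R \<longrightarrow> ce' i = ce i) \<and> (\<forall>v. v \<notin> ?U \<longrightarrow> cv' v = cv v) \<and>
        (\<forall>i\<in>?R. colour4 (ce' i)) \<and> (\<forall>v\<in>?U. colour4 (cv' v)) \<and> proper S ed ce' cv')"
  proof (rule conjI[OF P0], rule exI[of _ "?ce(e1 := p1, e2 := p2, f := a)"],
      rule exI[of _ "?cv(v := a, y1 := g, y2 := p1)"], intro conjI P6)
  qed (use p1 p2 a st(1-3) d in auto)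
qed

text \<open>A centre of degree 2 is treated as a star in which the third arm coincides with the arm
  of \<open>e1\<close>.\<close>

lemma recolourable_star:
  assumes G: "numbered_graph n S ed"
    and iv: "inc S ed v = {e1, e2, e3}" and i: "inc S ed y1 = {e1, f1}" "inc S ed y2 = {e2, f2}" "inc S ed y3 = {e3, f3}"
    and ed: "ed e1 = {v, y1}" "ed e2 = {v, y2}" "ed e3 = {v, y3}" "ed f1 = {y1, w1}" "ed f2 = {y2, w2}" "ed f3 = {y3, w3}"
    and w: "{w1, w2, w3} \<inter> {v, y1, y2, y3} = {}" and f: "{f1, f2, f3} \<inter> {e1, e2, e3} = {}"
    and d: "distinct [v, y1, y2]" "e1 \<noteq> e2" "e3 = e1 \<and> y3 = y1 \<or> distinct [e1, e2, e3] \<and> distinct [v, y1, y2, y3]"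
  shows "recolourable n S ed {e1, e2, e3} {v, y1, y2, y3}"
  unfolding recolourable_def
proof (intro allI impI, elim conjE)
  let ?R = "{e1, e2, e3}" and ?U = "{v, y1, y2, y3}"
  fix ce cv assume P: "proper (S - ?R) ed ce cv" and C: "coloured True 4 n (S - ?R) ce cv"
  let ?ce = "\<lambda>i. if i \<in> ?R then 0 else ce i" and ?cv = "\<lambda>v. if v \<in> ?U then 0 else cv v"
  have c1: "card ({a, b} - insert a X) \<le> 1" for a b :: nat and X
  proof -
    have "{a, b} - insert a X \<subseteq> {b}" by auto
    then show ?thesis using card_mono[of "{b}" "{a, b} - insert a X"] by simp
  qed
  have P0: "proper S ed ?ce ?cv"
  proof (rule restore4[OF G P])
    fix u assume "u \<in> ?U"
    moreover have "card ({e1, f1} - ?R) \<le> 1" "card ({e2, f2} - ?R) \<le> 1" "card ({e3, f3} - ?R) \<le> 1"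
      using c1[of e1 f1 ?R] c1[of e2 f2 ?R] c1[of e3 f3 ?R] by (simp_all add: insert_absorb)
    ultimately show "card (inc S ed u - ?R) \<le> 1" using i iv by auto
  qed (use ed in auto)
  have "f1 \<in> inc S ed y1" "f2 \<in> inc S ed y2" "f3 \<in> inc S ed y3" unfolding i by simp_all
  then have fS: "f1 \<in> S - ?R" "f2 \<in> S - ?R" "f3 \<in> S - ?R" using f by (auto simp: inc_def)
  have stub: "colour4 (cv w) \<and> colour4 (ce f) \<and> cv w \<noteq> ce f" if "f \<in> S - ?R" "w \<in> ed f" for f w
  proof -
    have "w < n" using that G unfolding numbered_graph_def by auto
    then have "colour4 (cv w) \<and> colour4 (ce f)" using C that unfolding coloured_def colour4_def by auto
    moreover have "f \<in> inc (S - ?R) ed w" using that unfolding inc_def by auto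
    ultimately show ?thesis using proper_ends[OF P, of f w] by auto
  qed
  have s1: "colour4 (cv w1) \<and> colour4 (ce f1) \<and> cv w1 \<noteq> ce f1" using stub[OF fS(1)] ed by auto
  have s2: "colour4 (cv w2) \<and> colour4 (ce f2) \<and> cv w2 \<noteq> ce f2" using stub[OF fS(2)] ed by auto
  have s3: "colour4 (cv w3) \<and> colour4 (ce f3) \<and> cv w3 \<noteq> ce f3" using stub[OF fS(3)] ed by auto
  have "star_solvable (cv w1) (ce f1) (cv w2) (ce f2) (cv w3) (ce f3)"
    using star_solvable s1 s2 s3 by auto
  then obtain a p1 p2 p3 where p: "distinct [a, p1, p2, p3]" "colour4 a" "colour4 p1" "colour4 p2" "colour4 p3"
    and l: "link a p1 (cv w1) (ce f1)" "link a p2 (cv w2) (ce f2)" "link a p3 (cv w3) (ce f3)"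
    unfolding star_solvable_def by blast
  have pf: "p1 \<noteq> ce f1" "p2 \<noteq> ce f2" "p3 \<noteq> ce f3" using l unfolding link_def by auto
  obtain t1 where t1: "colour4 t1" "t1 \<noteq> a" "t1 \<noteq> p1" "t1 \<noteq> cv w1" "t1 \<noteq> ce f1" using link_inner[OF l(1)] by blast
  obtain t2 where t2: "colour4 t2" "t2 \<noteq> a" "t2 \<noteq> p2" "t2 \<noteq> cv w2" "t2 \<noteq> ce f2" using link_inner[OF l(2)] by blast
  obtain t3 where t3: "colour4 t3" "t3 \<noteq> a" "t3 \<noteq> p3" "t3 \<noteq> cv w3" "t3 \<noteq> ce f3" using link_inner[OF l(3)] by blast
  have P1: "proper S ed ?ce (?cv(v := a))"
    by (rule proper_set_vertex[OF P0]) (use p iv ed in auto)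
  \<comment> \<open>The third arm precedes the others, so that the colours of the arm of
    \<open>e1\<close> prevail when the two coincide.\<close>
  have P2: "proper S ed (?ce(e3 := p3)) (?cv(v := a))"
    by (rule proper_set_edge[OF P1 ed(3)]) (use p pf iv i f d in auto)
  have P3: "proper S ed (?ce(e3 := p3, e1 := p1)) (?cv(v := a))"
    by (rule proper_set_edge[OF P2 ed(1)]) (use p pf iv i f d in auto)
  have P4: "proper S ed (?ce(e3 := p3, e1 := p1, e2 := p2)) (?cv(v := a))"
    by (rule proper_set_edge[OF P3 ed(2)]) (use p pf iv i f d in auto)
  let ?c = "?ce(e3 := p3, e1 := p1, e2 := p2)"
  define s3 where "s3 = (if e3 = e1 then t1 else t3)"
  have P5: "proper S ed ?c (?cv(v := a, y3 := s3))"
    by (rule proper_set_vertex[OF P4]) (use p pf t1 t3 i ed f w d in \<open>auto simp: s3_def\<close>)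
  have P6: "proper S ed ?c (?cv(v := a, y3 := s3, y1 := t1))"
    by (rule proper_set_vertex[OF P5]) (use p pf t1 t3 i ed f w d in \<open>auto simp: s3_def\<close>)
  have P7: "proper S ed ?c (?cv(v := a, y3 := s3, y1 := t1, y2 := t2))"
    by (rule proper_set_vertex[OF P6]) (use p pf t1 t2 t3 i ed f w d in \<open>auto simp: s3_def\<close>)
  show "proper S ed ?ce ?cv \<and> (\<exists>ce' cv'. (\<forall>i. i \<notin> ?R \<longrightarrow> ce' i = ce i) \<and> (\<forall>v. v \<notin> ?U \<longrightarrow> cv' v = cv v) \<and>
        (\<forall>i\<in>?R. colour4 (ce' i)) \<and> (\<forall>v\<in>?U. colour4 (cv' v)) \<and> proper S ed ce' cv')"
  proof (rule conjI[OF P0], rule exI[of _ ?c],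
      rule exI[of _ "?cv(v := a, y3 := s3, y1 := t1, y2 := t2)"], intro conjI P7)
  qed (use p t1 t2 t3 d in \<open>auto simp: s3_def\<close>)
qed

text \<open>The case of one inner vertex is \<open>w = W\<close> with \<open>f = l\<close>. The
  intersection \<open>{y} \<inter> {y. w = W}\<close> is \<open>{y}\<close> in this case and empty
  otherwise, so \<open>l\<close> joins \<open>W\<close> to \<open>y\<close> or to \<open>w\<close>
  as required.\<close>

definition chain_ix :: "nat set \<Rightarrow> (nat \<Rightarrow> nat set) \<Rightarrow> nat \<Rightarrow> nat \<Rightarrow> nat \<Rightarrow> nat \<Rightarrow> nat \<Rightarrow> nat \<Rightarrow> nat \<Rightarrow> bool" where
  "chain_ix S ed v y w W e f l \<longleftrightarrow> ed e = {v, y} \<and> ed l = {w, W} \<union> {y} \<inter> {y. w = W} \<and> e \<noteq> l \<and> distinct [v, y, W] \<and>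
     (w = W \<and> f = l \<and> inc S ed y = {e, l} \<or>
      inc S ed y = {e, f} \<and> inc S ed w = {f, l} \<and> ed f = {y, w} \<and> f \<noteq> e \<and> f \<noteq> l \<and> w \<notin> {v, y, W})"

lemma chain_fill:
  assumes ch: "chain_ix S ed v y w W e f l" and P: "proper S ed ce cv"
    and c: "colour4 (cv v)" "colour4 (ce e)" "colour4 (cv W)" "colour4 (ce l)"
    and l: "link (cv v) (ce e) (cv W) (ce l)" "\<not> (cv v = ce l \<and> ce e = cv W)"
    and n: "cv v \<noteq> ce e" "cv W \<noteq> ce l"
    and u: "cv y = 0" "w \<noteq> W \<longrightarrow> ce f = 0 \<and> cv w = 0"
  shows "\<exists>ce' cv'. (\<forall>i. i \<noteq> f \<or> f = l \<longrightarrow> ce' i = ce i) \<and> (\<forall>x. x \<noteq> y \<and> (x \<noteq> w \<or> w = W) \<longrightarrow> cv' x = cv x) \<and>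
    colour4 (ce' f) \<and> colour4 (cv' y) \<and> colour4 (cv' w) \<and> proper S ed ce' cv'"
proof (cases "w = W")
  case True
  have h: "ed e = {v, y}" "ed l = {y, W}" "inc S ed y = {e, l}" "f = l" "e \<noteq> l" "distinct [v, y, W]"
    using ch True unfolding chain_ix_def by auto
  obtain s where s: "colour4 s" "s \<noteq> cv v" "s \<noteq> ce e" "s \<noteq> cv W" "s \<noteq> ce l" using link_inner[OF l(1)] by blast
  have "proper S ed ce (cv(y := s))"
    by (rule proper_set_vertex[OF P]) (use s h in auto)
  then show ?thesis
    by - (rule exI[of _ ce], rule exI[of _ "cv(y := s)"], use s c h True in auto)
next
  case False
  have h: "ed e = {v, y}" "ed l = {w, W}" "inc S ed y = {e, f}" "inc S ed w = {f, l}" "ed f = {y, w}"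
    "distinct [e, f, l]" "distinct [v, y, w, W]"
    using ch False unfolding chain_ix_def by auto
  have u: "cv y = 0" "ce f = 0" "cv w = 0" using u False by auto
  obtain s m t where s: "colour4 s" "colour4 m" "colour4 t" "s \<notin> {cv v, ce e, m, t}" "m \<notin> {ce e, ce l, t}" "t \<notin> {ce l, cv W}"
    using link2_inner[OF l c n] by blast
  have P1: "proper S ed (ce(f := m)) cv"
    by (rule proper_set_edge[OF P h(5)]) (use s h u in auto)
  have P2: "proper S ed (ce(f := m)) (cv(y := s))"
    by (rule proper_set_vertex[OF P1]) (use s h u in auto)
  have P3: "proper S ed (ce(f := m)) (cv(y := s, w := t))"
    by (rule proper_set_vertex[OF P2]) (use s h u in auto)
  show ?thesis
    by (rule exI[of _ "ce(f := m)"], rule exI[of _ "cv(y := s, w := t)"]) (use P3 s h False in auto)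
qed

text \<open>The two ends \<open>v\<close> and \<open>W\<close> and the chain edges at them are
  coloured according to \<open>double_link_solvable\<close>; as \<open>v\<close> and
  \<open>W\<close> are not adjacent, their colours do not interfere. The interiors of the two chains
  are then filled independently of each other.\<close>

lemma recolourable_double_chain:
  assumes G: "numbered_graph n S ed"
    and ch: "chain_ix S ed v y1 w1 W e1 f1 l1" "chain_ix S ed v y2 w2 W e2 f2 l2"
    and iv: "e1 \<in> inc S ed v" "e2 \<in> inc S ed v" "card (inc S ed v) \<le> 3"
    and iW: "l1 \<in> inc S ed W" "l2 \<in> inc S ed W" "card (inc S ed W) \<le> 3"
    and d: "distinct [e1, e2, l1, l2]" "f1 \<notin> {e1, e2, l2}" "f2 \<notin> {e1, e2, l1}" "f1 \<noteq> f2" "y1 \<noteq> y2"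
      "w1 \<noteq> W \<Longrightarrow> w1 \<noteq> y2" "w2 \<noteq> W \<Longrightarrow> w2 \<noteq> y1" "w1 \<noteq> W \<Longrightarrow> w1 \<noteq> w2" "w1 = W \<Longrightarrow> w2 = W \<Longrightarrow> f1 = l1 \<and> f2 = l2"
    and vW: "inc S ed v \<inter> inc S ed W = {}"
  shows "recolourable n S ed {e1, e2, f1, f2, l1, l2} {v, y1, y2, w1, w2, W}"
  unfolding recolourable_def
proof (intro allI impI, elim conjE)
  let ?R = "{e1, e2, f1, f2, l1, l2}" and ?U = "{v, y1, y2, w1, w2, W}"
  fix ce cv assume P: "proper (S - ?R) ed ce cv" and C: "coloured True 4 n (S - ?R) ce cv"
  let ?ce = "\<lambda>i. if i \<in> ?R then 0 else ce i" and ?cv = "\<lambda>v. if v \<in> ?U then 0 else cv v"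
  have V: "v \<noteq> y1" "v \<noteq> y2" "v \<noteq> W" "y1 \<noteq> W" "y2 \<noteq> W" "v \<noteq> w1" "v \<noteq> w2" "w1 \<noteq> y1" "w2 \<noteq> y2"
    using ch unfolding chain_ix_def by auto
  have ed: "ed e1 = {v, y1}" "ed e2 = {v, y2}" using ch unfolding chain_ix_def by auto
  have yin: "inc S ed y1 \<subseteq> ?R" "inc S ed y2 \<subseteq> ?R"
    "w1 \<noteq> W \<Longrightarrow> inc S ed w1 \<subseteq> ?R" "w2 \<noteq> W \<Longrightarrow> inc S ed w2 \<subseteq> ?R"
    using ch unfolding chain_ix_def by auto
  obtain z1 where z1: "ed l1 = {z1, W}" "z1 = (if w1 = W then y1 else w1)" "inc S ed z1 = (if w1 = W then {e1, l1} else {f1, l1})"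
    using ch(1) unfolding chain_ix_def by (cases "w1 = W") auto
  obtain z2 where z2: "ed l2 = {z2, W}" "z2 = (if w2 = W then y2 else w2)" "inc S ed z2 = (if w2 = W then {e2, l2} else {f2, l2})"
    using ch(2) unfolding chain_ix_def by (cases "w2 = W") auto
  have fe: "w1 = W \<and> f1 = l1 \<or> ed f1 = {y1, w1} \<and> w1 \<noteq> W" "w2 = W \<and> f2 = l2 \<or> ed f2 = {y2, w2} \<and> w2 \<noteq> W"
    using ch unfolding chain_ix_def by auto
  have fl: "w1 \<noteq> W \<Longrightarrow> f1 \<noteq> l1" "w2 \<noteq> W \<Longrightarrow> f2 \<noteq> l2" using ch unfolding chain_ix_def by auto
  have fv: "f1 \<notin> inc S ed v" "f2 \<notin> inc S ed v" "l1 \<notin> inc S ed v" "l2 \<notin> inc S ed v"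
    using fe z1 z2 V unfolding inc_def by (auto split: if_splits)
  have fW: "e1 \<notin> inc S ed W" "e2 \<notin> inc S ed W" "f1 \<in> inc S ed W \<Longrightarrow> f1 = l1" "f2 \<in> inc S ed W \<Longrightarrow> f2 = l2"
    using fe ed V unfolding inc_def by (auto split: if_splits)
  have "inc S ed v - ?R = inc S ed v - {e1, e2}" using fv by auto
  then have few1: "card (inc S ed v - ?R) \<le> 1"
    using iv d(1) finite_inc[OF G, of v] by (simp add: card_Diff_subset)
  have "inc S ed W - ?R = inc S ed W - {l1, l2}" using fW by auto
  then have few2: "card (inc S ed W - ?R) \<le> 1"
    using iW d(1) finite_inc[OF G, of W] by (simp add: card_Diff_subset)
  have e0: "inc S ed y1 - ?R = {}" "inc S ed y2 - ?R = {}" "w1 \<noteq> W \<Longrightarrow> inc S ed w1 - ?R = {}" "w2 \<noteq> W \<Longrightarrow> inc S ed w2 - ?R = {}"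
    using yin by blast+
  have P0: "proper S ed ?ce ?cv"
  proof (rule restore4[OF G P])
    fix u assume "u \<in> ?U"
    then have "u = v \<or> u = W \<or> u = y1 \<or> u = y2 \<or> (u = w1 \<and> w1 \<noteq> W) \<or> (u = w2 \<and> w2 \<noteq> W)" by auto
    then consider "u = v" | "u = W" | "inc S ed u - ?R = {}" using e0 by metis
    then show "card (inc S ed u - ?R) \<le> 1"
    proof cases
      case 3 then show ?thesis by (metis card.empty zero_le)
    qed (use few1 few2 in simp_all)
  next
    have "v \<in> ed e1" "v \<in> ed e2" "W \<in> ed l1" "W \<in> ed l2" "f1 = l1 \<or> y1 \<in> ed f1" "f2 = l2 \<or> y2 \<in> ed f2"
      using ed z1(1) z2(1) fe by auto
    moreover fix i assume "i \<in> ?R"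
    ultimately show "ed i \<inter> ?U \<noteq> {}" by blast
  qed
  have far: "x \<notin> ?U" if h: "j \<in> inc S ed u - ?R" "x \<in> ed j" "x \<noteq> u" "u = v \<or> u = W" for j x u
  proof
    assume "x \<in> ?U"
    moreover have xj: "j \<in> inc S ed x" using h unfolding inc_def by auto
    moreover have "x \<noteq> v \<or> u = v" "x \<noteq> W \<or> u = W" using xj h(1,4) vW by auto
    ultimately show False using h yin by blast
  qed
  obtain ax g where st: "colour4 ax" "colour4 g" "ax \<noteq> g"
    "\<And>i. i \<in> inc S ed v \<Longrightarrow> i \<notin> ?R \<Longrightarrow> ce i = g"
    "\<And>i x. i \<in> inc S ed v \<Longrightarrow> i \<notin> ?R \<Longrightarrow> x \<in> ed i \<Longrightarrow> x \<noteq> v \<Longrightarrow> x \<notin> ?U \<and> cv x = ax"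
    by (rule ex_stub[OF G P C few1 far]) (assumption+, simp, rule that)
  obtain az h where sW: "colour4 az" "colour4 h" "az \<noteq> h"
    "\<And>i. i \<in> inc S ed W \<Longrightarrow> i \<notin> ?R \<Longrightarrow> ce i = h"
    "\<And>i x. i \<in> inc S ed W \<Longrightarrow> i \<notin> ?R \<Longrightarrow> x \<in> ed i \<Longrightarrow> x \<noteq> W \<Longrightarrow> x \<notin> ?U \<and> cv x = az"
    by (rule ex_stub[OF G P C few2 far]) (assumption+, simp, rule that)
  obtain a p1 p2 b q1 q2 where p: "distinct [g, a, p1, p2]" "distinct [h, b, q1, q2]" "a \<noteq> ax" "b \<noteq> az"
    "colour4 a" "colour4 p1" "colour4 p2" "colour4 b" "colour4 q1" "colour4 q2"
    and lk: "link a p1 b q1" "link a p2 b q2" "\<not> (a = q1 \<and> p1 = b)" "\<not> (a = q2 \<and> p2 = b)"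
    by (rule double_link_solvable[OF st(1-3) sW(1-3)]) (rule that)
  have pq: "p1 \<noteq> q1" "p2 \<noteq> q2" using lk unfolding link_def by auto
  have iv': "j = e1 \<or> j = e2 \<or> j \<notin> ?R" if "j \<in> inc S ed v" for j using that fv by auto
  have iW': "j = l1 \<or> j = l2 \<or> j \<notin> ?R" if "j \<in> inc S ed W" for j using that fW by auto
  have gv: "?ce j \<noteq> c" if "j \<in> inc S ed v" "c \<noteq> g" "colour4 c" for j c
    using st(4)[OF that(1)] that(2,3) by auto
  have gW: "?ce j \<noteq> c" if "j \<in> inc S ed W" "c \<noteq> h" "colour4 c" for j c
    using sW(4)[OF that(1)] that(2,3) by auto
  have P1: "proper S ed ?ce (?cv(v := a))"
  proof (rule proper_set_vertex[OF P0])
    fix j assume j: "j \<in> inc S ed v" show "?ce j \<noteq> a" by (rule gv[OF j]) (use p in auto)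
  next
    fix j x assume j: "j \<in> inc S ed v" "x \<in> ed j" "x \<noteq> v"
    show "?cv x \<noteq> a"
    proof (cases "x \<in> ?U")
      case True then show ?thesis using p(5) by auto
    next
      case False
      then have "j \<notin> ?R" using iv'[OF j(1)] ed j by auto
      then show ?thesis using st(5)[OF j(1) _ j(2,3)] False p(3) by auto
    qed
  qed
  let ?cv1 = "?cv(v := a)"
  have P2: "proper S ed (?ce(e1 := p1)) ?cv1"
  proof (rule proper_set_edge[OF P1 ed(1)])
    fix j assume j: "j \<in> inc S ed v" show "?ce j \<noteq> p1" by (rule gv[OF j]) (use p in auto)
  next
    fix j assume "j \<in> inc S ed y1" "j \<noteq> e1" then show "?ce j \<noteq> p1" using yin(1) p(6) by auto
  qed (use p V in auto)
  have P3: "proper S ed (?ce(e1 := p1, e2 := p2)) ?cv1"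
  proof (rule proper_set_edge[OF P2 ed(2)])
    fix j assume j: "j \<in> inc S ed v"
    have "?ce j \<noteq> p2" by (rule gv[OF j]) (use p in auto)
    then show "(?ce(e1 := p1)) j \<noteq> p2" using p(1) by (cases "j = e1") auto
  next
    fix j assume j: "j \<in> inc S ed y2" "j \<noteq> e2"
    then have "j \<in> ?R" "j \<noteq> e1" using yin(2) ed V d(5) unfolding inc_def by auto
    then show "(?ce(e1 := p1)) j \<noteq> p2" using p(7) by auto
  qed (use p V in auto)
  let ?ce1 = "?ce(e1 := p1, e2 := p2)"
  have eqW: "?ce1 j = ?ce j" if "j \<in> inc S ed W" for j using that fW by auto
  have P4: "proper S ed ?ce1 (?cv1(W := b))"
  proof (rule proper_set_vertex[OF P3])
    fix j assume j: "j \<in> inc S ed W" show "?ce1 j \<noteq> b" unfolding eqW[OF j] by (rule gW[OF j]) (use p in auto)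
  next
    fix j x assume j: "j \<in> inc S ed W" "x \<in> ed j" "x \<noteq> W"
    have xv: "x \<noteq> v" using j vW unfolding inc_def by auto
    show "?cv1 x \<noteq> b"
    proof (cases "x \<in> ?U")
      case True then show ?thesis using p(8) xv by auto
    next
      case False
      then have "j \<notin> ?R" using iW'[OF j(1)] z1 z2 j by (auto split: if_splits)
      then show ?thesis using sW(5)[OF j(1) _ j(2,3)] False p(4) xv by auto
    qed
  qed
  let ?cv2 = "?cv1(W := b)"
  have zz: "z1 \<noteq> v" "z1 \<noteq> W" "z2 \<noteq> v" "z2 \<noteq> W" "z1 \<in> ?U" "z2 \<in> ?U" using z1 z2 V by (auto split: if_splits)
  have P5: "proper S ed (?ce1(l1 := q1)) ?cv2"
  proof (rule proper_set_edge[OF P4 z1(1)])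
    fix j assume j: "j \<in> inc S ed W" "j \<noteq> l1" show "?ce1 j \<noteq> q1" unfolding eqW[OF j(1)] by (rule gW[OF j(1)]) (use p in auto)
  next
    fix j assume "j \<in> inc S ed z1" "j \<noteq> l1"
    then show "?ce1 j \<noteq> q1" using z1(3) d p(9) pq by (auto split: if_splits)
  qed (use p zz in auto)
  have P6: "proper S ed (?ce1(l1 := q1, l2 := q2)) ?cv2"
  proof (rule proper_set_edge[OF P5 z2(1)])
    fix j assume j: "j \<in> inc S ed W" "j \<noteq> l2"
    have "?ce1 j \<noteq> q2" unfolding eqW[OF j(1)] by (rule gW[OF j(1)]) (use p in auto)
    then show "(?ce1(l1 := q1)) j \<noteq> q2" using p(2) by (cases "j = l1") auto
  next
    fix j assume "j \<in> inc S ed z2" "j \<noteq> l2"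
    then show "(?ce1(l1 := q1)) j \<noteq> q2" using z2(3) d p(10) pq by (auto split: if_splits)
  qed (use p zz in auto)
  define c1 where "c1 = ?ce1(l1 := q1, l2 := q2)"
  define v1 where "v1 = ?cv2"
  have c1: "c1 e1 = p1" "c1 e2 = p2" "c1 l1 = q1" "c1 l2 = q2" "w1 \<noteq> W \<Longrightarrow> c1 f1 = 0" "w2 \<noteq> W \<Longrightarrow> c1 f2 = 0"
    "\<And>i. i \<notin> ?R \<Longrightarrow> c1 i = ce i" using d(1-4) fl unfolding c1_def by auto
  have v1: "v1 v = a" "v1 W = b" "v1 y1 = 0" "v1 y2 = 0" "w1 \<noteq> W \<Longrightarrow> v1 w1 = 0" "w2 \<noteq> W \<Longrightarrow> v1 w2 = 0"
    "\<And>x. x \<notin> ?U \<Longrightarrow> v1 x = cv x" using V unfolding v1_def by auto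
  have Pc: "proper S ed c1 v1" using P6 unfolding c1_def v1_def .
  have np: "a \<noteq> p1" "a \<noteq> p2" "b \<noteq> q1" "b \<noteq> q2" using p by auto
  have u1: "w1 \<noteq> W \<longrightarrow> c1 f1 = 0 \<and> v1 w1 = 0" using c1(5) v1(5) by blast
  obtain c2 v2 where y2: "\<forall>i. i \<noteq> f1 \<or> f1 = l1 \<longrightarrow> c2 i = c1 i" "\<forall>x. x \<noteq> y1 \<and> (x \<noteq> w1 \<or> w1 = W) \<longrightarrow> v2 x = v1 x"
    "colour4 (c2 f1)" "colour4 (v2 y1)" "colour4 (v2 w1)" "proper S ed c2 v2"
    using chain_fill[OF ch(1) Pc, unfolded c1(1,3) v1(1,2), OF p(5,6,8,9) lk(1,3) np(1,3) v1(3) u1]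
    by (elim exE conjE) (rule that)
  have x2: "\<And>i. i \<noteq> f1 \<or> f1 = l1 \<Longrightarrow> c2 i = c1 i" "\<And>x. x \<noteq> y1 \<and> (x \<noteq> w1 \<or> w1 = W) \<Longrightarrow> v2 x = v1 x"
    "colour4 (c2 f1)" "colour4 (v2 y1)" "colour4 (v2 w1)" "proper S ed c2 v2" using y2 by simp_all
  have w12: "w1 \<noteq> W \<Longrightarrow> w1 \<notin> {v, y2, w2, W}" "w2 \<noteq> W \<Longrightarrow> w2 \<notin> {v, y1, w1, W}" using V d by auto
  have c2: "c2 e1 = p1" "c2 e2 = p2" "c2 l1 = q1" "c2 l2 = q2" "w2 \<noteq> W \<Longrightarrow> c2 f2 = 0"
    using x2(1)[of e1] x2(1)[of e2] x2(1)[of l1] x2(1)[of l2] x2(1)[of f2] c1(1-6) d(2,4) by auto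
  have v2: "v2 v = a" "v2 W = b" "v2 y2 = 0" "w2 \<noteq> W \<Longrightarrow> v2 w2 = 0"
    using x2(2)[of v] x2(2)[of W] x2(2)[of y2] x2(2)[of w2] v1(1-6) V d(5) w12 by auto
  have u2: "w2 \<noteq> W \<longrightarrow> c2 f2 = 0 \<and> v2 w2 = 0" using c2(5) v2(4) by blast
  obtain c3 v3 where y3: "\<forall>i. i \<noteq> f2 \<or> f2 = l2 \<longrightarrow> c3 i = c2 i" "\<forall>x. x \<noteq> y2 \<and> (x \<noteq> w2 \<or> w2 = W) \<longrightarrow> v3 x = v2 x"
    "colour4 (c3 f2)" "colour4 (v3 y2)" "colour4 (v3 w2)" "proper S ed c3 v3"
    using chain_fill[OF ch(2) x2(6), unfolded c2(2,4) v2(1,2), OF p(5,7,8,10) lk(2,4) np(2,4) v2(3) u2]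
    by (elim exE conjE) (rule that)
  have x3: "\<And>i. i \<noteq> f2 \<or> f2 = l2 \<Longrightarrow> c3 i = c2 i" "\<And>x. x \<noteq> y2 \<and> (x \<noteq> w2 \<or> w2 = W) \<Longrightarrow> v3 x = v2 x"
    "colour4 (c3 f2)" "colour4 (v3 y2)" "colour4 (v3 w2)" "proper S ed c3 v3" using y3 by simp_all
  have r1: "c3 i = ce i" if "i \<notin> ?R" for i using x3(1)[of i] x2(1)[of i] c1(7)[OF that] that by auto
  have r2: "v3 x = cv x" if "x \<notin> ?U" for x using x3(2)[of x] x2(2)[of x] v1(7)[OF that] that by auto
  have "c3 e1 = p1" "c3 e2 = p2" "c3 l1 = q1" "c3 f1 = c2 f1"
    using x3(1)[of e1] x3(1)[of e2] x3(1)[of l1] x3(1)[of f1] c2 d(3,4) by auto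
  moreover have "c3 l2 = q2" using x3(1)[of l2] c2(4) by (cases "f2 = l2") auto
  ultimately have r3: "colour4 (c3 i)" if "i \<in> ?R" for i using that x2(3) x3(3) p by auto
  have "v3 v = a" "v3 W = b" using x3(2)[of v] x3(2)[of W] v2(1,2) V by auto
  moreover have "v3 y1 = v2 y1" using x3(2)[of y1] d(5) w12(2) by auto
  moreover have "colour4 (v3 w1)"
  proof (cases "w1 = W")
    case True then show ?thesis using \<open>v3 W = b\<close> p by simp
  next
    case False then show ?thesis using x3(2)[of w1] w12(1) x2(5) by auto
  qed
  ultimately have r4: "colour4 (v3 x)" if "x \<in> ?U" for x using that x2(4) x3(4,5) p by auto
  show "proper S ed ?ce ?cv \<and> (\<exists>ce' cv'. (\<forall>i. i \<notin> ?R \<longrightarrow> ce' i = ce i) \<and> (\<forall>v. v \<notin> ?U \<longrightarrow> cv' v = cv v) \<and>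
        (\<forall>i\<in>?R. colour4 (ce' i)) \<and> (\<forall>v\<in>?U. colour4 (cv' v)) \<and> proper S ed ce' cv')"
    by (rule conjI[OF P0], rule exI[of _ c3], rule exI[of _ v3]) (use r1 r2 r3 r4 x3(6) in blast)
qed

declare [[linarith_neq_limit = 9]]

section \<open>Reductions\<close>

definition deg :: "nat set \<Rightarrow> (nat \<Rightarrow> nat set) \<Rightarrow> nat \<Rightarrow> nat" where
  "deg S ed v = card (inc S ed v)"

text \<open>
  The other end of an edge and the other edge at a vertex of degree 2 (meaningless otherwise) are
  expressed by sums because the program can tabulate these.
\<close>
definition oth :: "(nat \<Rightarrow> nat set) \<Rightarrow> nat \<Rightarrow> nat \<Rightarrow> nat" where
  "oth ed i v = \<Sum>(ed i) - v"

definition nxt :: "nat set \<Rightarrow> (nat \<Rightarrow> nat set) \<Rightarrow> nat \<Rightarrow> nat \<Rightarrow> nat" where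
  "nxt S ed i y = \<Sum>(inc S ed y) - i"

definition big_nbrs :: "nat set \<Rightarrow> (nat \<Rightarrow> nat set) \<Rightarrow> nat \<Rightarrow> nat" where
  "big_nbrs S ed v = card {i \<in> inc S ed v. 3 \<le> deg S ed (oth ed i v)}"

lemma oth_eq: "ed i = {v, x} \<Longrightarrow> v \<noteq> x \<Longrightarrow> oth ed i v = x"
  unfolding oth_def by simp

lemma nxt_eq: "inc S ed y = {i, j} \<Longrightarrow> i \<noteq> j \<Longrightarrow> nxt S ed i y = j"
  unfolding nxt_def by simp

context
  fixes n :: nat and S :: "nat set" and ed :: "nat \<Rightarrow> nat set"
  assumes G: "numbered_graph n S ed"
begin

lemma ed_oth:
  assumes "i \<in> S" "v \<in> ed i"
  shows "ed i = {v, oth ed i v}" "oth ed i v \<noteq> v" "oth ed i v < n" "v < n" "i \<in> inc S ed (oth ed i v)" "i \<in> inc S ed v"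
proof -
  obtain x where x: "ed i = {v, x}" "x \<noteq> v" "x < n" "v < n" by (rule numbered_graph_ends[OF G assms])
  then have "oth ed i v = x" using oth_eq by metis
  then show "ed i = {v, oth ed i v}" "oth ed i v \<noteq> v" "oth ed i v < n" "v < n" "i \<in> inc S ed (oth ed i v)" "i \<in> inc S ed v"
    using x assms unfolding inc_def by auto
qed

lemma inc_nxt:
  assumes "i \<in> inc S ed y" "deg S ed y = 2"
  shows "inc S ed y = {i, nxt S ed i y}" "nxt S ed i y \<noteq> i" "nxt S ed i y \<in> S" "y \<in> ed (nxt S ed i y)"
proof -
  obtain j where j: "inc S ed y = {i, j}" "j \<noteq> i"
    using assms unfolding deg_def by (metis card_2_other)
  then have "nxt S ed i y = j" using nxt_eq by metis
  then show a: "inc S ed y = {i, nxt S ed i y}" and "nxt S ed i y \<noteq> i" using j by auto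
  have "nxt S ed i y \<in> inc S ed y" using a by auto
  then show "nxt S ed i y \<in> S" "y \<in> ed (nxt S ed i y)" unfolding inc_def by auto
qed

lemma inj_ed: "i \<in> S \<Longrightarrow> j \<in> S \<Longrightarrow> ed i = ed j \<Longrightarrow> i = j"
  using G unfolding numbered_graph_def inj_on_def by blast

lemma simple_edges_ed: "simple_edges (ed ` S)"
  using G unfolding numbered_graph_def simple_edges_def by auto

lemma nbrs_ed: "nbrs (ed ` S) v = (\<lambda>i. oth ed i v) ` inc S ed v"
proof
  show "nbrs (ed ` S) v \<subseteq> (\<lambda>i. oth ed i v) ` inc S ed v"
  proof
    fix x assume "x \<in> nbrs (ed ` S) v"
    then obtain i where i: "i \<in> S" "ed i = {v, x}" unfolding nbrs_def by auto
    then have "v \<noteq> x" using simple_edges_neq[OF simple_edges_ed, of v x] by (metis imageI)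
    then have "oth ed i v = x" using i oth_eq by metis
    then show "x \<in> (\<lambda>i. oth ed i v) ` inc S ed v" using i unfolding inc_def by auto
  qed
  show "(\<lambda>i. oth ed i v) ` inc S ed v \<subseteq> nbrs (ed ` S) v"
  proof
    fix x assume "x \<in> (\<lambda>i. oth ed i v) ` inc S ed v"
    then obtain i where i: "i \<in> S" "v \<in> ed i" "x = oth ed i v" unfolding inc_def by auto
    then have "{v, x} = ed i" using ed_oth(1) by metis
    then show "x \<in> nbrs (ed ` S) v" using i(1) unfolding nbrs_def by auto
  qed
qed

lemma inj_oth: "inj_on (\<lambda>i. oth ed i v) (inc S ed v)"
  unfolding inj_on_def inc_def using ed_oth(1) inj_ed by (metis (mono_tags, lifting) mem_Collect_eq)

lemma card_nbrs_ed: "card (nbrs (ed ` S) v) = deg S ed v"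
  unfolding nbrs_ed deg_def by (rule card_image[OF inj_oth])

lemma card_big_nbrs: "card (nbrs (ed ` S) v \<inter> {t. 3 \<le> card (nbrs (ed ` S) t)}) = big_nbrs S ed v"
proof -
  have "nbrs (ed ` S) v \<inter> {t. 3 \<le> card (nbrs (ed ` S) t)} = (\<lambda>i. oth ed i v) ` {i \<in> inc S ed v. 3 \<le> deg S ed (oth ed i v)}"
    unfolding card_nbrs_ed unfolding nbrs_ed by auto
  then show ?thesis unfolding big_nbrs_def
    using card_image[OF inj_on_subset[OF inj_oth, of "{i \<in> inc S ed v. 3 \<le> deg S ed (oth ed i v)}" v]] by auto
qed

lemma nbrs_index:
  assumes "x \<in> nbrs (ed ` S) v" obtains i where "i \<in> S" "v \<in> ed i" "oth ed i v = x" "i \<in> inc S ed v" "i \<in> inc S ed x"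
  using assms unfolding nbrs_ed inc_def using ed_oth(5) by (auto simp: inc_def)

lemma vertices_ed: "v \<in> \<Union>(ed ` S) \<longleftrightarrow> inc S ed v \<noteq> {}"
  unfolding inc_def by auto

lemma deg_pos: "i \<in> inc S ed v \<Longrightarrow> 1 \<le> deg S ed v"
  unfolding deg_def using finite_inc[OF G, of v] by (metis One_nat_def Suc_leI card_gt_0_iff empty_iff)

end

section \<open>The invariant of the reductions and the existence of a next one\<close>

definition pre_conf :: "nat set \<Rightarrow> (nat \<Rightarrow> nat set) \<Rightarrow> nat \<Rightarrow> nat \<Rightarrow> nat \<Rightarrow> bool" where
  "pre_conf S ed v i j \<longleftrightarrow> i \<in> S \<and> j \<in> S \<and> i \<noteq> j \<and> v \<in> ed i \<and> v \<in> ed j \<and>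
     deg S ed (oth ed i v) = 2 \<and> deg S ed (oth ed j v) = 2"

text \<open>\<open>F\<close> contains the edges in whose presence chordlessness may fail; all of
  them can be removed singly. An identification is made only when no such edge exists, so that
  \<open>F\<close> is empty then.\<close>

definition step_inv :: "nat \<Rightarrow> bool \<Rightarrow> nat \<Rightarrow> nat set \<Rightarrow> (nat \<Rightarrow> nat set) \<Rightarrow> bool" where
  "step_inv k tot n S ed \<longleftrightarrow> numbered_graph n S ed \<and> (\<forall>v. deg S ed v \<le> k) \<and>
     (\<exists>F\<subseteq>S. (\<forall>e\<in>F. \<exists>u. single_step k tot S ed e u) \<and> chordless (ed ` (S - F)))"

lemma inc_subset: "S' \<subseteq> S \<Longrightarrow> inc S' ed v \<subseteq> inc S ed v"
  unfolding inc_def by auto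

lemma numbered_graph_subset: "numbered_graph n S ed \<Longrightarrow> S' \<subseteq> S \<Longrightarrow> numbered_graph n S' ed"
  unfolding numbered_graph_def by (meson finite_subset inj_on_subset subsetD)

text \<open>Removing other edges only lowers degrees, while \<open>e\<close> itself keeps the degree
  of \<open>u\<close> positive, so even the equation for four colours survives.\<close>

lemma single_step_mono:
  assumes G: "numbered_graph n S ed" and s: "single_step k tot S ed e u" and S': "S' \<subseteq> S" "e \<in> S'"
  shows "single_step k tot S' ed e u"
proof -
  obtain v where v: "v \<noteq> u" "ed e = {v, u}" "card (inc S ed v) + card (inc S ed u) \<le> k + 1"
    "card (inc S ed u) \<le> 2" "tot \<and> k < 4 \<longrightarrow> card (inc S ed u) = 1"
    using s unfolding single_step_def by blast
  have le: "card (inc S' ed x) \<le> card (inc S ed x)" for x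
    by (rule card_mono[OF finite_inc[OF G] inc_subset[OF S'(1)]])
  have "e \<in> inc S' ed u" using v S' unfolding inc_def by auto
  then have "1 \<le> card (inc S' ed u)" using deg_pos[OF numbered_graph_subset[OF G S'(1)]] unfolding deg_def by auto
  then have "tot \<and> k < 4 \<longrightarrow> card (inc S' ed u) = 1" using v(5) le[of u] by linarith
  then show ?thesis unfolding single_step_def using S'(2) v le[of u] le[of v] by (meson add_mono le_trans)
qed

lemma step_inv_subset:
  assumes I: "step_inv k tot n S ed" and S': "S' \<subseteq> S"
  shows "step_inv k tot n S' ed"
proof -
  have G: "numbered_graph n S ed" using I unfolding step_inv_def by blast
  obtain F where F: "F \<subseteq> S" "\<And>e. e \<in> F \<Longrightarrow> \<exists>u. single_step k tot S ed e u" "chordless (ed ` (S - F))"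
    using I unfolding step_inv_def by blast
  have "deg S' ed v \<le> k" for v
    using card_mono[OF finite_inc[OF G] inc_subset[OF S'], of v] I unfolding step_inv_def deg_def by (meson le_trans)
  moreover have "chordless (ed ` (S' - F \<inter> S'))" by (rule chordless_subset[OF F(3)]) (use S' in auto)
  moreover have "\<exists>u. single_step k tot S' ed e u" if "e \<in> F \<inter> S'" for e
    using F(2)[of e] single_step_mono[OF G _ S'] that by blast
  ultimately show ?thesis unfolding step_inv_def using numbered_graph_subset[OF G S']
    by (intro conjI allI exI[of _ "F \<inter> S'"]) auto
qed

text \<open>The set \<open>F\<close> of the invariant must be empty. A vertex of degree 1 would
  allow the removal of its edge, because the degree of its neighbour is at most
  \<open>k\<close>.\<close>

lemma no_single_step:
  assumes I: "step_inv k tot n S ed" and no: "\<And>e u. \<not> single_step k tot S ed e u"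
  shows "chordless (ed ` S)" "\<And>v. inc S ed v \<noteq> {} \<Longrightarrow> 2 \<le> deg S ed v"
proof -
  have G: "numbered_graph n S ed" and dk: "\<And>v. deg S ed v \<le> k" using I unfolding step_inv_def by auto
  obtain F where F: "F \<subseteq> S" "\<And>e. e \<in> F \<Longrightarrow> \<exists>u. single_step k tot S ed e u" "chordless (ed ` (S - F))"
    using I unfolding step_inv_def by blast
  have "F = {}" using F(2) no by blast
  then show "chordless (ed ` S)" using F(3) by simp
  fix v assume "inc S ed v \<noteq> {}"
  then obtain i where i: "i \<in> inc S ed v" by blast
  show "2 \<le> deg S ed v"
  proof (rule ccontr)
    assume "\<not> ?thesis"
    then have 1: "deg S ed v = 1" using deg_pos[OF G i] by linarith
    have iS: "i \<in> S" "v \<in> ed i" using i unfolding inc_def by auto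
    have e: "ed i = {oth ed i v, v}" using ed_oth(1)[OF G iS] by (simp add: insert_commute)
    have "single_step k tot S ed i v" unfolding single_step_def
      by (intro conjI exI[of _ "oth ed i v"])
        (use e 1 iS dk[of "oth ed i v"] ed_oth(2)[OF G iS] in \<open>auto simp: deg_def\<close>)
    then show False using no by blast
  qed
qed

lemma pre_conf_unpack:
  assumes G: "numbered_graph n S ed" and c: "pre_conf S ed v i j"
  defines "y1 \<equiv> oth ed i v" and "y2 \<equiv> oth ed j v"
  defines "f1 \<equiv> nxt S ed i y1" and "f2 \<equiv> nxt S ed j y2"
  defines "w1 \<equiv> oth ed f1 y1" and "w2 \<equiv> oth ed f2 y2"
  shows "inc S ed y1 = {i, f1}" "inc S ed y2 = {j, f2}" "ed i = {v, y1}" "ed j = {v, y2}"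
    "ed f1 = {y1, w1}" "ed f2 = {y2, w2}" "f1 \<in> S" "f2 \<in> S" "f1 \<noteq> i" "f2 \<noteq> j" "f1 \<noteq> j" "f2 \<noteq> i"
    "distinct [v, y1, y2]" "w1 \<noteq> y1" "w2 \<noteq> y2" "w1 \<noteq> v" "w2 \<noteq> v" "w1 = y2 \<longleftrightarrow> f1 = f2" "w2 = y1 \<longleftrightarrow> f1 = f2"
    "i \<in> inc S ed v" "j \<in> inc S ed v" "y1 < n" "y2 < n" "v < n" "w1 < n" "w2 < n" "f1 \<in> inc S ed w1" "f2 \<in> inc S ed w2"
proof -
  have c': "i \<in> S" "j \<in> S" "i \<noteq> j" "v \<in> ed i" "v \<in> ed j" "deg S ed y1 = 2" "deg S ed y2 = 2"
    using c unfolding pre_conf_def y1_def y2_def by auto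
  note oi = ed_oth[OF G c'(1,4), folded y1_def] and oj = ed_oth[OF G c'(2,5), folded y2_def]
  note ni = inc_nxt[OF G oi(5) c'(6), folded f1_def] and nj = inc_nxt[OF G oj(5) c'(7), folded f2_def]
  note of1 = ed_oth[OF G ni(3,4), folded w1_def] and of2 = ed_oth[OF G nj(3,4), folded w2_def]
  show "inc S ed y1 = {i, f1}" "inc S ed y2 = {j, f2}" "ed i = {v, y1}" "ed j = {v, y2}"
    "ed f1 = {y1, w1}" "ed f2 = {y2, w2}" "f1 \<in> S" "f2 \<in> S" "f1 \<noteq> i" "f2 \<noteq> j" "w1 \<noteq> y1" "w2 \<noteq> y2"
    "i \<in> inc S ed v" "j \<in> inc S ed v" "y1 < n" "y2 < n" "v < n" "w1 < n" "w2 < n" "f1 \<in> inc S ed w1" "f2 \<in> inc S ed w2"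
    by (fact oi oj ni nj of1 of2)+
  have yy: "y1 \<noteq> y2" using inj_ed[OF G c'(1,2)] oi(1) oj(1) c'(3) by auto
  then show d: "distinct [v, y1, y2]" using oi(2) oj(2) by auto
  show "w1 \<noteq> v" using inj_ed[OF G c'(1) ni(3)] oi(1) of1(1) ni(2) by (auto simp: insert_commute)
  show "w2 \<noteq> v" using inj_ed[OF G c'(2) nj(3)] oj(1) of2(1) nj(2) by (auto simp: insert_commute)
  show "f1 \<noteq> j" using of1(1) oj(1) d by (auto simp: doubleton_eq_iff)
  show "f2 \<noteq> i" using of2(1) oi(1) d by (auto simp: doubleton_eq_iff)
  show "w1 = y2 \<longleftrightarrow> f1 = f2"
  proof
    assume "w1 = y2"
    then have "f1 \<in> inc S ed y2" using of1(5) by simp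
    then show "f1 = f2" using nj(1) \<open>f1 \<noteq> j\<close> by auto
  next
    assume "f1 = f2" then show "w1 = y2" using of1(1) of2(1) yy by (auto simp: doubleton_eq_iff)
  qed
  show "w2 = y1 \<longleftrightarrow> f1 = f2"
  proof
    assume "w2 = y1"
    then have "f2 \<in> inc S ed y1" using of2(5) by simp
    then show "f1 = f2" using ni(1) \<open>f2 \<noteq> i\<close> by auto
  next
    assume "f1 = f2" then show "w2 = y1" using of1(1) of2(1) yy by (auto simp: doubleton_eq_iff)
  qed
qed

text \<open>A vertex \<open>v\<close> with at most one big neighbour has a neighbour of degree 2. As
  the edge between them cannot be removed singly, \<open>v\<close> has degree at least
  \<open>k\<close>, hence at least 3, and so two neighbours of degree 2.\<close>

lemma ex_pair_conf:
  assumes I: "step_inv k tot n S ed" and no: "\<And>e u. \<not> single_step k tot S ed e u" and ne: "S \<noteq> {}"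
    and k: "3 \<le> k" "tot \<longrightarrow> 4 \<le> k"
  shows "\<exists>v i j. pre_conf S ed v i j \<and> big_nbrs S ed v \<le> 1"
proof -
  have G: "numbered_graph n S ed" and dk: "\<And>v. deg S ed v \<le> k" using I unfolding step_inv_def by auto
  note ns = no_single_step[OF I no]
  have "\<exists>v\<in>\<Union>(ed ` S). card (nbrs (ed ` S) v \<inter> {t. 3 \<le> card (nbrs (ed ` S) t)}) \<le> 1"
    by (rule vertex_with_few_big_nbrs[OF simple_edges_ed[OF G] ns(1)])
      (use ne ns(2) vertices_ed[OF G] card_nbrs_ed[OF G] in auto)
  then obtain v where v: "inc S ed v \<noteq> {}" "big_nbrs S ed v \<le> 1"
    unfolding card_big_nbrs[OF G] using vertices_ed[OF G] by blast
  let ?B = "{i \<in> inc S ed v. 3 \<le> deg S ed (oth ed i v)}"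
  have fin: "finite (inc S ed v)" by (rule finite_inc[OF G])
  have small: "deg S ed (oth ed i v) = 2 \<and> k \<le> deg S ed v" if "i \<in> inc S ed v - ?B" for i
  proof -
    have iS: "i \<in> S" "v \<in> ed i" using that unfolding inc_def by auto
    note o = ed_oth[OF G iS]
    have "inc S ed (oth ed i v) \<noteq> {}" using o(5) by auto
    then have d2: "deg S ed (oth ed i v) = 2" using ns(2)[of "oth ed i v"] that by auto
    have "\<not> single_step k tot S ed i (oth ed i v)" using no by blast
    then have "\<not> deg S ed v + 2 \<le> k + 1"
      using iS o(1,2) d2 k unfolding single_step_def deg_def by (metis Suc_1 lessI linorder_not_less order_le_less)
    then show ?thesis using d2 by linarith
  qed
  have "card (inc S ed v - ?B) = deg S ed v - big_nbrs S ed v"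
    unfolding deg_def big_nbrs_def by (rule card_Diff_subset) (use fin in auto)
  then have "1 \<le> card (inc S ed v - ?B)" using ns(2)[OF v(1)] v(2) by linarith
  then obtain i where "i \<in> inc S ed v - ?B" by (metis card.empty equals0I not_one_le_zero)
  then have "k \<le> deg S ed v" using small by blast
  then have "2 \<le> card (inc S ed v - ?B)" using \<open>card (inc S ed v - ?B) = _\<close> v(2) k(1) by linarith
  then obtain i j where ij: "i \<in> inc S ed v - ?B" "j \<in> inc S ed v - ?B" "i \<noteq> j" by (rule card_ge_2_obtain)
  then have "pre_conf S ed v i j" using small[OF ij(1)] small[OF ij(2)] unfolding pre_conf_def inc_def by auto
  then show ?thesis using v(2) by blast
qed

lemma pair_conf_step:
  assumes I: "step_inv k tot n S ed" and no: "\<And>e u. \<not> single_step k tot S ed e u"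
    and k: "3 \<le> k" "tot \<longrightarrow> 4 \<le> k" and c: "pre_conf S ed v i j" and big: "big_nbrs S ed v \<le> 1"
  defines "y1 \<equiv> oth ed i v" and "y2 \<equiv> oth ed j v"
  defines "f1 \<equiv> nxt S ed i y1" and "f2 \<equiv> nxt S ed j y2"
  defines "w1 \<equiv> oth ed f1 y1" and "w2 \<equiv> oth ed f2 y2"
  defines "ed' \<equiv> (if w1 = w2 then ed else ed(f2 := {y1, w2}))"
  shows "pair_step k tot S ed i j y1 y2 ed'" "step_inv k tot n (S - {i, j}) ed'" "ed f2 = {y2, w2}" "f2 \<in> S - {i, j}"
proof -
  have G: "numbered_graph n S ed" and dk: "\<And>v. deg S ed v \<le> k" using I unfolding step_inv_def by auto
  note ns = no_single_step[OF I no]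
  note u = pre_conf_unpack[OF G c, folded y1_def y2_def, folded f1_def f2_def, folded w1_def w2_def]
  have iS: "i \<in> S" "j \<in> S" "i \<noteq> j" using c unfolding pre_conf_def by auto
  have d2: "deg S ed y1 = 2" "deg S ed y2 = 2" using c unfolding pre_conf_def y1_def y2_def by auto
  \<comment> \<open>Otherwise \<open>y1\<close> and \<open>y2\<close> are adjacent vertices of
    degree 2, and the edge between them could be removed singly.\<close>
  have ff: "f1 \<noteq> f2"
  proof
    assume e: "f1 = f2"
    then have "w1 = y2" using u by blast
    then have "ed f1 = {y1, y2}" using u by auto
    then have "single_step k tot S ed f1 y2" unfolding single_step_def
      using u(7) d2 k u(13) unfolding deg_def
      by (intro conjI exI[of _ y1]) (simp_all add: linorder_not_less)
    then show False using no by blast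
  qed
  show st: "pair_step k tot S ed i j y1 y2 ed'"
    unfolding pair_step_def
    by (rule exI[of _ v], rule exI[of _ f1], rule exI[of _ f2], rule exI[of _ w1], rule exI[of _ w2])
      (use u iS ff dk[of v] k in \<open>auto simp: ed'_def deg_def\<close>)
  show f2: "ed f2 = {y2, w2}" "f2 \<in> S - {i, j}" using u by auto
  let ?S = "S - {i, j}"
  show "step_inv k tot n ?S ed'"
  proof -
    have inc': "inc ?S ed' x = inc ?S ed x" if "x \<noteq> y1" "x \<noteq> y2" for x
      using that u(6) unfolding inc_def ed'_def by auto
    have y1': "inc ?S ed' y1 \<subseteq> {f1, f2}"
    proof
      fix l assume "l \<in> inc ?S ed' y1"
      then have "l = f2 \<or> l \<in> inc S ed y1 - {i, j}" unfolding inc_def ed'_def by (auto split: if_splits)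
      then show "l \<in> {f1, f2}" using u(1) by auto
    qed
    have y2': "inc ?S ed' y2 \<subseteq> {f2}"
    proof
      fix l assume "l \<in> inc ?S ed' y2"
      then have "l = f2 \<or> l \<in> inc S ed y2 - {i, j}" unfolding inc_def ed'_def by (auto split: if_splits)
      then show "l \<in> {f2}" using u(2) by auto
    qed
    have G': "numbered_graph n ?S ed'"
    proof (cases "w1 = w2")
      case True then show ?thesis unfolding ed'_def using numbered_graph_subset[OF G, of ?S] by auto
    next
      case False
      have "w2 \<noteq> y1" using u ff by auto
      \<comment> \<open>The moved edge is not parallel to an old one: the only old edge left at
        \<open>y1\<close> is \<open>f1\<close>, and it ends in \<open>w1\<close>.\<close>
      have new: "ed l \<noteq> {y1, w2}" if "l \<in> ?S" for l
      proof
        assume e: "ed l = {y1, w2}"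
        then have "l \<in> inc S ed y1 - {i, j}" using that unfolding inc_def by auto
        then have "l = f1" using u(1) by auto
        then show False using e u(5) False by (auto simp: doubleton_eq_iff)
      qed
      have "inj_on ed' ?S"
      proof (rule inj_onI)
        fix a b assume ab: "a \<in> ?S" "b \<in> ?S" "ed' a = ed' b"
        show "a = b"
        proof (cases "a = f2 \<or> b = f2")
          case True then show ?thesis using ab new[of a] new[of b] False unfolding ed'_def by (auto split: if_splits)
        next
          case F: False
          then have "ed a = ed b" using ab(3) unfolding ed'_def by (auto split: if_splits)
          then show ?thesis using inj_ed[OF G, of a b] ab by auto
        qed
      qed
      then show ?thesis using G u(22,26) \<open>w2 \<noteq> y1\<close> unfolding numbered_graph_def ed'_def by auto
    qed
    have le: "card (inc ?S ed' x) \<le> card (inc S ed x)" if "x \<noteq> y1" "x \<noteq> y2" for x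
      unfolding inc'[OF that] by (rule card_mono[OF finite_inc[OF G] inc_subset]) auto
    have ly1: "card (inc ?S ed' y1) \<le> 2" using card_mono[OF _ y1'] by (simp add: card_insert_if split: if_splits)
    have ly2: "card (inc ?S ed' y2) \<le> 1" using card_mono[OF _ y2'] by simp
    have deg': "deg ?S ed' x \<le> k" for x
      using le[of x] ly1 ly2 dk[of x] k(1) unfolding deg_def by (cases "x = y1"; cases "x = y2") auto
    let ?I = "inc S ed v - {i, j}"
    \<comment> \<open>The edges left at \<open>v\<close> that lead to vertices of degree less than
      3. Since \<open>v\<close> has lost two edges, they can be removed singly. Without them
      \<open>v\<close> has degree at most 1, so no cycle passes through it, as
      \<open>chordless_merge\<close> requires.\<close>
    let ?F = "{l \<in> ?I. deg S ed (oth ed l v) < 3}"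
    have vy: "v \<noteq> y1" "v \<noteq> y2" using u(13) by auto
    have iv: "inc ?S ed' v = ?I" using inc'[OF vy] unfolding inc_def by auto
    have cI: "card ?I + 2 \<le> k"
    proof -
      have "card {i, j} = 2" using iS by simp
      then show ?thesis using card_Diff_subset[of "{i, j}" "inc S ed v"] card_mono[of "inc S ed v" "{i, j}"] u(20,21) finite_inc[OF G, of v] dk[of v]
        unfolding deg_def by auto
    qed
    have Fsingle: "\<exists>x. single_step k tot ?S ed' l x" if l: "l \<in> ?F" for l
    proof -
      have lS: "l \<in> S" "v \<in> ed l" "l \<noteq> i" "l \<noteq> j" using l unfolding inc_def by auto
      let ?x = "oth ed l v"
      note o = ed_oth[OF G lS(1,2)]
      have xy: "?x \<noteq> y1" "?x \<noteq> y2" using inj_ed[OF G lS(1) iS(1)] inj_ed[OF G lS(1) iS(2)] o(1) u(3,4) lS by auto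
      have lf: "l \<noteq> f2" using o(1) u(6) vy u(17) by (auto simp: doubleton_eq_iff)
      have e: "ed' l = {v, ?x}" using o(1) lf unfolding ed'_def by auto
      have "card (inc ?S ed' ?x) \<le> 2" using le[OF xy] l unfolding deg_def by auto
      moreover have "card (inc ?S ed' v) + 2 \<le> k" using cI iv by simp
      ultimately show ?thesis unfolding single_step_def
        using lS e o(2) k by (intro exI[of _ ?x] conjI exI[of _ v]) auto
    qed
    have Fsub: "?F \<subseteq> ?S" unfolding inc_def by auto
    have "chordless (ed' ` (?S - ?F))"
    proof (cases "w1 = w2")
      case True
      then have "ed' ` (?S - ?F) \<subseteq> ed ` S" unfolding ed'_def by auto
      then show ?thesis using chordless_subset[OF ns(1)] by blast
    next
      case False
      have G'': "numbered_graph n (?S - ?F) ed'" by (rule numbered_graph_subset[OF G']) auto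
      have nb: "nbrs (ed ` S) y1 = {v, w1}" "nbrs (ed ` S) y2 = {v, w2}"
        unfolding nbrs_ed[OF G] u(1,2)
        using oth_eq[of ed i y1 v] oth_eq[of ed j y2 v] u(3,4) vy w1_def w2_def by (auto simp: insert_commute)
      show ?thesis
      proof (rule chordless_merge[OF simple_edges_ed[OF G] ns(1) nb])
        show "ed' ` (?S - ?F) \<subseteq> insert {y1, w2} (ed ` S - {{v, y1}, {v, y2}, {y2, w2}})"
        proof
          fix e assume "e \<in> ed' ` (?S - ?F)"
          then obtain l where l: "l \<in> ?S" "e = ed' l" by auto
          show "e \<in> insert {y1, w2} (ed ` S - {{v, y1}, {v, y2}, {y2, w2}})"
          proof (cases "l = f2")
            case True then show ?thesis using l False unfolding ed'_def by auto
          next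
            case nf: False
            then have e: "e = ed l" using l unfolding ed'_def by auto
            have "ed l \<noteq> ed i" "ed l \<noteq> ed j" "ed l \<noteq> ed f2" using inj_ed[OF G] l iS nf u(8) by blast+
            then show ?thesis using e l u(3,4,6) by auto
          qed
        qed
        have "inc (?S - ?F) ed' v \<subseteq> {l \<in> inc S ed v. 3 \<le> deg S ed (oth ed l v)}"
        proof
          fix l assume l: "l \<in> inc (?S - ?F) ed' v"
          then have "l \<in> inc ?S ed' v" "l \<notin> ?F" unfolding inc_def by auto
          then show "l \<in> {l \<in> inc S ed v. 3 \<le> deg S ed (oth ed l v)}" using iv by auto
        qed
        from card_mono[OF _ this] have "card (inc (?S - ?F) ed' v) \<le> 1"
          using big finite_inc[OF G, of v] unfolding big_nbrs_def by auto
        then have "deg (?S - ?F) ed' v \<le> 1" unfolding deg_def[of "?S - ?F" ed' v] .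
        then show "card (nbrs (ed' ` (?S - ?F)) v) \<le> 1" using card_nbrs_ed[OF G'', of v] by simp
        show "finite (nbrs (ed' ` (?S - ?F)) v)" by (rule finite_nbrs[OF simple_edges_ed[OF G'']])
      qed (use u(13,15,18) False ff in auto)
    qed
    then show ?thesis unfolding step_inv_def
      by (intro conjI allI exI[of _ ?F] ballI G' deg' Fsub Fsingle)
  qed
qed

section \<open>The configurations for four colours in terms of edge numbers\<close>

definition third :: "nat set \<Rightarrow> (nat \<Rightarrow> nat set) \<Rightarrow> nat \<Rightarrow> nat \<Rightarrow> nat \<Rightarrow> nat" where
  "third S ed v i j = (if deg S ed v = 3 then \<Sum>(inc S ed v) - (i + j) else i)"

definition far_edge :: "nat set \<Rightarrow> (nat \<Rightarrow> nat set) \<Rightarrow> nat \<Rightarrow> nat \<Rightarrow> nat" where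
  "far_edge S ed f w = (if deg S ed w = 2 then nxt S ed f w else f)"

definition far_end :: "nat set \<Rightarrow> (nat \<Rightarrow> nat set) \<Rightarrow> nat \<Rightarrow> nat \<Rightarrow> nat" where
  "far_end S ed f w = (if deg S ed w = 2 then oth ed (nxt S ed f w) w else w)"

text \<open>The disjuncts are the triangle, the star and the two chains. In a star, neither
  \<open>y1\<close> nor \<open>y2\<close> may be adjacent to the third neighbour \<open>x\<close> of
  \<open>v\<close>. If \<open>v\<close> has degree 2, \<open>third\<close> repeats the edge
  \<open>i\<close>, so \<open>x\<close> is \<open>y1\<close> and the star has two equal
  arms.\<close>

definition conf4 :: "nat set \<Rightarrow> (nat \<Rightarrow> nat set) \<Rightarrow> nat \<Rightarrow> nat \<Rightarrow> nat \<Rightarrow> nat \<Rightarrow> nat \<Rightarrow> nat \<Rightarrow> bool" where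
  "conf4 S ed v x f1 w1 f2 w2 \<longleftrightarrow> f1 = f2 \<or> (big_nbrs S ed v = 0 \<and> w1 \<noteq> x \<and> w2 \<noteq> x) \<or>
     (far_end S ed f1 w1 = far_end S ed f2 w2 \<and> far_end S ed f1 w1 \<noteq> v \<and> far_end S ed f1 w1 \<noteq> x)"

lemma inc_third:
  assumes G: "numbered_graph n S ed" and ij: "i \<in> inc S ed v" "j \<in> inc S ed v" "i \<noteq> j" and d: "deg S ed v \<le> 3"
  shows "inc S ed v = {i, j, third S ed v i j}" "deg S ed v = 3 \<Longrightarrow> third S ed v i j \<notin> {i, j}"
    "deg S ed v \<noteq> 3 \<Longrightarrow> third S ed v i j = i"
proof -
  have fin: "finite (inc S ed v)" by (rule finite_inc[OF G])
  have c2: "card {i, j} = 2" using ij by simp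
  have cD: "card (inc S ed v - {i, j}) = deg S ed v - 2"
    unfolding deg_def c2[symmetric] by (rule card_Diff_subset) (use ij in auto)
  have d2: "2 \<le> deg S ed v" unfolding deg_def c2[symmetric] by (rule card_mono[OF fin]) (use ij in auto)
  have "inc S ed v = {i, j, third S ed v i j} \<and> (deg S ed v = 3 \<longrightarrow> third S ed v i j \<notin> {i, j})"
  proof (cases "deg S ed v = 3")
    case True
    then have "card (inc S ed v - {i, j}) = 1" using cD by simp
    then obtain e where e: "inc S ed v - {i, j} = {e}" by (rule card_1_singletonE)
    then have I: "inc S ed v = {i, j, e}" "e \<notin> {i, j}" using ij by auto
    then have "third S ed v i j = e" using True ij(3) unfolding third_def by simp
    then show ?thesis using I by simp
  next
    case False
    then have "card (inc S ed v - {i, j}) = 0" using cD d d2 by simp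
    then have "inc S ed v - {i, j} = {}" using fin by simp
    then show ?thesis using False ij unfolding third_def by auto
  qed
  then show "inc S ed v = {i, j, third S ed v i j}" "deg S ed v = 3 \<Longrightarrow> third S ed v i j \<notin> {i, j}" by blast+
  show "deg S ed v \<noteq> 3 \<Longrightarrow> third S ed v i j = i" unfolding third_def by simp
qed

text \<open>The configuration comes from \<open>subcubic_configuration\<close>. The additional
  condition on stars is met for a suitable choice: if \<open>y1\<close> or \<open>y2\<close> is
  adjacent to \<open>x\<close>, it forms a triangle with \<open>x\<close> and \<open>v\<close>, and
  another pair of edges at \<open>v\<close> shows this triangle.\<close>

lemma ex_conf4:
  assumes I: "step_inv 3 True n S ed" and no: "\<And>e u. \<not> single_step 3 True S ed e u" and ne: "S \<noteq> {}"
  shows "\<exists>v i j. pre_conf S ed v i j \<and> conf4 S ed v (oth ed (third S ed v i j) v)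
    (nxt S ed i (oth ed i v)) (oth ed (nxt S ed i (oth ed i v)) (oth ed i v))
    (nxt S ed j (oth ed j v)) (oth ed (nxt S ed j (oth ed j v)) (oth ed j v))"
proof -
  have G: "numbered_graph n S ed" and d3: "\<And>v. deg S ed v \<le> 3" using I unfolding step_inv_def by auto
  note ns = no_single_step[OF I no]
  let ?E = "ed ` S"
  have se: "simple_edges ?E" by (rule simple_edges_ed[OF G])
  obtain v y1 y2 where y: "y1 \<in> nbrs ?E v" "y2 \<in> nbrs ?E v" "y1 \<noteq> y2" "card (nbrs ?E y1) = 2" "card (nbrs ?E y2) = 2"
    and alt: "y1 \<in> nbrs ?E y2 \<or> (\<forall>x\<in>nbrs ?E v. card (nbrs ?E x) < 3) \<or>
     (\<exists>W. W \<noteq> v \<and> W \<notin> nbrs ?E v \<and> chain_to ?E v y1 W \<and> chain_to ?E v y2 W)"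
  proof -
    have "\<exists>v y1 y2. y1 \<in> nbrs ?E v \<and> y2 \<in> nbrs ?E v \<and> y1 \<noteq> y2 \<and>
      card (nbrs ?E y1) = 2 \<and> card (nbrs ?E y2) = 2 \<and>
      (y1 \<in> nbrs ?E y2 \<or> (\<forall>x\<in>nbrs ?E v. card (nbrs ?E x) < 3) \<or>
       (\<exists>W. W \<noteq> v \<and> W \<notin> nbrs ?E v \<and> chain_to ?E v y1 W \<and> chain_to ?E v y2 W))"
      by (rule subcubic_configuration[OF se ns(1)])
        (use ne ns(2) vertices_ed[OF G] card_nbrs_ed[OF G] d3 in auto)
    then show ?thesis by (elim exE conjE) (rule that)
  qed
  obtain i where i: "i \<in> S" "v \<in> ed i" "oth ed i v = y1" "i \<in> inc S ed v" using nbrs_index[OF G y(1)] by metis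
  obtain j where j: "j \<in> S" "v \<in> ed j" "oth ed j v = y2" "j \<in> inc S ed v" using nbrs_index[OF G y(2)] by metis
  have ij: "i \<noteq> j" using i j y(3) by auto
  have pc: "pre_conf S ed v i j"
    using i j ij y(4,5) unfolding pre_conf_def card_nbrs_ed[OF G] by simp
  define f1 where "f1 = nxt S ed i y1"
  define f2 where "f2 = nxt S ed j y2"
  define w1 where "w1 = oth ed f1 y1"
  define w2 where "w2 = oth ed f2 y2"
  define x where "x = oth ed (third S ed v i j) v"
  note u = pre_conf_unpack[OF G pc, unfolded i(3) j(3), folded f1_def f2_def, folded w1_def w2_def]
  note th = inc_third[OF G i(4) j(4) ij d3]
  let ?goal = "\<exists>v i j. pre_conf S ed v i j \<and> conf4 S ed v (oth ed (third S ed v i j) v)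
    (nxt S ed i (oth ed i v)) (oth ed (nxt S ed i (oth ed i v)) (oth ed i v))
    (nxt S ed j (oth ed j v)) (oth ed (nxt S ed j (oth ed j v)) (oth ed j v))"
  have fin: ?goal if "conf4 S ed v x f1 w1 f2 w2"
    by (rule exI[of _ v], rule exI[of _ i], rule exI[of _ j])
      (use pc that in \<open>simp add: i(3) j(3) f1_def f2_def w1_def w2_def x_def\<close>)
  have tri: ?goal if t: "pre_conf S ed v a b" "nxt S ed a (oth ed a v) = nxt S ed b (oth ed b v)" for a b
    by (rule exI[of _ v], rule exI[of _ a], rule exI[of _ b]) (use t in \<open>simp add: conf4_def\<close>)
  have nb: "nbrs ?E y1 = {v, w1}" "nbrs ?E y2 = {v, w2}"
    unfolding nbrs_ed[OF G] u(1,2) using oth_eq[of ed i y1 v] oth_eq[of ed j y2 v] u(3,4,13) w1_def w2_def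
    by (auto simp: insert_commute)
  show ?thesis
  proof (cases "f1 = f2")
    case True then show ?thesis using fin unfolding conf4_def by blast
  next
    case ff: False
    then have nw: "w1 \<noteq> y2" "w2 \<noteq> y1" using u by auto
    have "y1 \<notin> nbrs ?E y2" using nb nw u(13) by auto
    then consider "\<forall>x\<in>nbrs ?E v. card (nbrs ?E x) < 3"
      | W where "W \<noteq> v" "W \<notin> nbrs ?E v" "chain_to ?E v y1 W" "chain_to ?E v y2 W" using alt by blast
    then show ?thesis
    proof cases
      case 1
      have "nbrs ?E v \<inter> {t. 3 \<le> card (nbrs ?E t)} = {}" using 1 by auto
      then have b0: "big_nbrs S ed v = 0" unfolding card_big_nbrs[OF G, symmetric] by simp
      show ?thesis
      proof (cases "w1 \<noteq> x \<and> w2 \<noteq> x")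
        case True then show ?thesis using fin b0 unfolding conf4_def by blast
      next
        case False
        let ?e = "third S ed v i j"
        have eI: "?e \<in> inc S ed v" using th(1) by auto
        then have eS: "?e \<in> S" "v \<in> ed ?e" unfolding inc_def by auto
        note o = ed_oth[OF G eS, folded x_def]
        have "x \<in> nbrs ?E v" unfolding nbrs_ed[OF G] x_def using eI by auto
        then have "deg S ed x < 3" using 1 card_nbrs_ed[OF G] by metis
        moreover have "2 \<le> deg S ed x" using ns(2)[of x] o(5) by auto
        ultimately have dx: "deg S ed x = 2" by linarith
        have e3: "?e \<noteq> i \<and> ?e \<noteq> j"
        proof (cases "deg S ed v = 3")
          case True then show ?thesis using th(2) by auto
        next
          case n3: False
          then have "x = y1" using th(3) i(3) unfolding x_def by simp
          then show ?thesis using False nw u(14) by auto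
        qed
        have ix: "inc S ed x = {?e, nxt S ed ?e x}" using inc_nxt[OF G o(5) dx] by auto
        from False consider "w1 = x" | "w2 = x" by blast
        then show ?thesis
        proof cases
          case 1
          then have "f1 \<in> inc S ed x" using u(27) by simp
          moreover have "f1 \<noteq> ?e" using u(1,9) o(1) u(5) u(13,16) by (auto simp: doubleton_eq_iff)
          ultimately have "nxt S ed ?e x = f1" using ix by auto
          then show ?thesis using tri[of i ?e] pc e3 eS dx i(3) unfolding pre_conf_def f1_def x_def by auto
        next
          case 2
          then have "f2 \<in> inc S ed x" using u(28) by simp
          moreover have "f2 \<noteq> ?e" using o(1) u(6) u(13,17) by (auto simp: doubleton_eq_iff)
          ultimately have "nxt S ed ?e x = f2" using ix by auto
          then show ?thesis using tri[of j ?e] pc e3 eS dx j(3) unfolding pre_conf_def f2_def x_def by auto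
        qed
      qed
    next
      case (2 W)
      have fe: "far_end S ed f w = W"
        if nby: "nbrs ?E y = {v, w}" and c: "chain_to ?E v y W" and f: "f \<in> inc S ed w" "ed f = {y, w}" "w \<noteq> y" "w \<noteq> v" for y f w
        using c unfolding chain_to_def
      proof (elim disjE exE conjE)
        assume "nbrs ?E y = {v, W}" "card (nbrs ?E W) \<noteq> 2"
        then have "w = W" "deg S ed W \<noteq> 2" using nby f(4) card_nbrs_ed[OF G] by (auto simp: doubleton_eq_iff)
        then show ?thesis unfolding far_end_def by simp
      next
        fix w' assume a: "nbrs ?E y = {v, w'}" "nbrs ?E w' = {y, W}" "w' \<noteq> v" "W \<noteq> y"
        then have w: "w' = w" using nby f(4) by (auto simp: doubleton_eq_iff)
        have "deg S ed w = 2" using a w card_nbrs_ed[OF G, of w] by simp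
        note nx = inc_nxt[OF G f(1) this]
        have "oth ed f w = y" using oth_eq[of ed f w y] f(2,3) by (simp add: insert_commute)
        then have "{y, oth ed (nxt S ed f w) w} = {y, W}"
          using a(2) w nx(1) unfolding nbrs_ed[OF G] by auto
        then show ?thesis using \<open>deg S ed w = 2\<close> a(4) unfolding far_end_def by (auto simp: doubleton_eq_iff)
      qed
      have "far_end S ed f1 w1 = W" by (rule fe[OF nb(1) 2(3) u(27,5,14,16)])
      moreover have "far_end S ed f2 w2 = W" by (rule fe[OF nb(2) 2(4) u(28,6,15,17)])
      moreover have "x \<in> nbrs ?E v" unfolding nbrs_ed[OF G] x_def using th(1) by auto
      ultimately have "conf4 S ed v x f1 w1 f2 w2" using 2(1,2) unfolding conf4_def by metis
      then show ?thesis by (rule fin)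
    qed
  qed
qed

lemma conf4_recolourable:
  assumes I: "step_inv 3 True n S ed" and no: "\<And>e u. \<not> single_step 3 True S ed e u"
    and pc: "pre_conf S ed v i j"
  defines "y1 \<equiv> oth ed i v" and "y2 \<equiv> oth ed j v"
  defines "f1 \<equiv> nxt S ed i y1" and "f2 \<equiv> nxt S ed j y2"
  defines "w1 \<equiv> oth ed f1 y1" and "w2 \<equiv> oth ed f2 y2"
  defines "e3 \<equiv> third S ed v i j" defines "x \<equiv> oth ed e3 v"
  defines "l1 \<equiv> far_edge S ed f1 w1" and "l2 \<equiv> far_edge S ed f2 w2" and "W \<equiv> far_end S ed f1 w1"
  assumes c: "conf4 S ed v x f1 w1 f2 w2"
  shows "f1 = f2 \<Longrightarrow> recolourable n S ed {i, j, f1} {v, y1, y2}"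
    "f1 \<noteq> f2 \<Longrightarrow> big_nbrs S ed v = 0 \<and> w1 \<noteq> x \<and> w2 \<noteq> x \<Longrightarrow> recolourable n S ed {i, j, e3} {v, y1, y2, x}"
    "f1 \<noteq> f2 \<Longrightarrow> \<not> (big_nbrs S ed v = 0 \<and> w1 \<noteq> x \<and> w2 \<noteq> x) \<Longrightarrow>
       recolourable n S ed {i, j, f1, f2, l1, l2} {v, y1, y2, w1, w2, W}"
    "{f1, f2, e3} \<subseteq> S" "l1 \<in> S" "l2 \<in> S"
proof -
  have G: "numbered_graph n S ed" and d3: "\<And>v. deg S ed v \<le> 3" using I unfolding step_inv_def by auto
  note ns = no_single_step[OF I no]
  note u = pre_conf_unpack[OF G pc, folded y1_def y2_def, folded f1_def f2_def, folded w1_def w2_def]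
  have iS: "i \<in> S" "j \<in> S" "i \<noteq> j" using pc unfolding pre_conf_def by auto
  note th = inc_third[OF G u(20,21) iS(3) d3, folded e3_def]
  have eI: "e3 \<in> inc S ed v" using th(1) by auto
  then have eS: "e3 \<in> S" "v \<in> ed e3" unfolding inc_def by auto
  note o = ed_oth[OF G eS, folded x_def]
  show "{f1, f2, e3} \<subseteq> S" using u eS by auto
  have lS: "far_edge S ed f w \<in> S" if "f \<in> S" "f \<in> inc S ed w" for f w
    using that inc_nxt(3)[OF G that(2)] unfolding far_edge_def by auto
  show "l1 \<in> S" "l2 \<in> S" using lS u(7,8,27,28) unfolding l1_def l2_def by blast+
  have cv3: "card (inc S ed v) \<le> 3" using d3 unfolding deg_def by simp
  show "recolourable n S ed {i, j, f1} {v, y1, y2}" if ff: "f1 = f2"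
  proof (rule recolourable_triangle[OF G])
    show "ed f1 = {y1, y2}" using u(5,18) ff by auto
  qed (use u iS ff cv3 in auto)
  \<comment> \<open>If \<open>v\<close> has degree 2, the third arm of the star is a copy of the
    first one.\<close>
  have dup: "e3 = i \<and> x = y1 \<or> distinct [i, j, e3] \<and> distinct [v, y1, y2, x]"
  proof (cases "deg S ed v = 3")
    case True
    then have e: "e3 \<noteq> i" "e3 \<noteq> j" using th(2) by auto
    then have "x \<noteq> y1" "x \<noteq> y2" using inj_ed[OF G eS(1)] iS o(1) u(3,4) by metis+
    then show ?thesis using e iS o(2) u(13) by auto
  next
    case False then show ?thesis using th(3) unfolding x_def y1_def by auto
  qed
  show "recolourable n S ed {i, j, e3} {v, y1, y2, x}" if ff: "f1 \<noteq> f2" and b: "big_nbrs S ed v = 0 \<and> w1 \<noteq> x \<and> w2 \<noteq> x"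
  proof -
    have "{l \<in> inc S ed v. 3 \<le> deg S ed (oth ed l v)} = {}"
      using b finite_inc[OF G, of v] unfolding big_nbrs_def by auto
    then have "\<not> 3 \<le> deg S ed x" using eI unfolding x_def by blast
    moreover have "2 \<le> deg S ed x" using ns(2)[of x] o(5) by auto
    ultimately have dx: "deg S ed x = 2" by linarith
    define f3 where "f3 = nxt S ed e3 x"
    define w3 where "w3 = oth ed f3 x"
    note nx = inc_nxt[OF G o(5) dx, folded f3_def]
    note of3 = ed_oth[OF G nx(3,4), folded w3_def]
    have nw: "w1 \<noteq> y2" "w2 \<noteq> y1" using u ff by auto
    have w3v: "w3 \<noteq> v" using inj_ed[OF G eS(1) nx(3)] o(1) of3(1) nx(2) by (auto simp: insert_commute)
    have w3y: "w3 \<noteq> y1 \<and> w3 \<noteq> y2 \<and> f3 \<noteq> i \<and> f3 \<noteq> j"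
    proof (cases "e3 = i \<and> x = y1")
      case True
      then have "f3 = f1" "w3 = w1" unfolding f3_def f1_def w3_def w1_def by auto
      then show ?thesis using nw u by auto
    next
      case False
      then have d: "distinct [i, j, e3]" "distinct [v, y1, y2, x]" using dup by auto
      have fi: "f3 \<noteq> i" "f3 \<noteq> j" using nx(4) u(3,4) d by auto
      have "f3 \<noteq> f1" "f3 \<noteq> f2" using nx(4) u(5,6) d b by auto
      then have "f3 \<notin> inc S ed y1" "f3 \<notin> inc S ed y2" using fi u(1,2) by auto
      then show ?thesis using fi of3(5) by auto
    qed
    have e3f: "e3 \<noteq> f1" "e3 \<noteq> f2" using eS(2) u(5,6,13,16,17) by auto
    show ?thesis
    proof (rule recolourable_star[OF G th(1) u(1,2) nx(1) u(3,4) o(1) u(5,6) of3(1)])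
      show "{w1, w2, w3} \<inter> {v, y1, y2, x} = {}" using u(14-17) nw b w3v w3y of3(2) by auto
      show "{f1, f2, f3} \<inter> {i, j, e3} = {}" using u(9-12) e3f w3y nx(2) by auto
    qed (use u(13) iS dup in auto)
  qed
  show "recolourable n S ed {i, j, f1, f2, l1, l2} {v, y1, y2, w1, w2, W}"
    if ff: "f1 \<noteq> f2" and nb: "\<not> (big_nbrs S ed v = 0 \<and> w1 \<noteq> x \<and> w2 \<noteq> x)"
  proof -
    have W: "far_end S ed f2 w2 = W" "W \<noteq> v" "W \<noteq> x" using c ff nb unfolding conf4_def W_def by auto
    have nw: "w1 \<noteq> y2" "w2 \<noteq> y1" using u ff by auto
    have chain: "chain_ix S ed v y w W e f (far_edge S ed f w) \<and> far_edge S ed f w \<in> inc S ed W \<and>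
        (w = W \<and> deg S ed w \<noteq> 2 \<or> w \<noteq> W \<and> deg S ed w = 2)"
      if h: "ed e = {v, y}" "inc S ed y = {e, f}" "ed f = {y, w}" "f \<noteq> e" "f \<in> S" "w \<noteq> y" "w \<noteq> v" "v \<noteq> y" "far_end S ed f w = W" "f \<in> inc S ed w" for e f y w
    proof (cases "deg S ed w = 2")
      case False
      then have "w = W" "far_edge S ed f w = f" using h(9) unfolding far_end_def far_edge_def by auto
      then show ?thesis using h False unfolding chain_ix_def by auto
    next
      case True
      let ?l = "nxt S ed f w"
      have l: "far_edge S ed f w = ?l" "oth ed ?l w = W" using h(9) True unfolding far_end_def far_edge_def by auto
      note nx = inc_nxt[OF G h(10) True] and ol = ed_oth[OF G inc_nxt(3,4)[OF G h(10) True], unfolded l(2)]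
      have "W \<noteq> y" using inj_ed[OF G h(5) nx(3)] h(3) ol(1) nx(2) by (auto simp: insert_commute)
      have le: "?l \<noteq> e" using nx(4) h(1,6,7) by auto
      have wW: "w \<noteq> W" using ol(2) by auto
      show ?thesis
        unfolding chain_ix_def l(1)
        using h(1-4,6-8) ol(1,5) nx(1,2) le wW W(2) \<open>W \<noteq> y\<close> True by auto
    qed
    have A: "chain_ix S ed v y1 w1 W i f1 l1 \<and> l1 \<in> inc S ed W \<and> (w1 = W \<and> deg S ed w1 \<noteq> 2 \<or> w1 \<noteq> W \<and> deg S ed w1 = 2)"
      unfolding l1_def by (rule chain) (use u W_def in auto)
    have B: "chain_ix S ed v y2 w2 W j f2 l2 \<and> l2 \<in> inc S ed W \<and> (w2 = W \<and> deg S ed w2 \<noteq> 2 \<or> w2 \<noteq> W \<and> deg S ed w2 = 2)"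
      unfolding l2_def by (rule chain) (use u W in auto)
    \<comment> \<open>A common second vertex of degree 2 would have just the edges \<open>f1\<close>
      and \<open>f2\<close>, so the first chain would continue along \<open>f2\<close> and end in
      \<open>y2\<close>.\<close>
    have ww: "w1 \<noteq> w2" if n: "w1 \<noteq> W"
    proof
      assume e: "w1 = w2"
      then have "inc S ed w1 = {f1, l1}" "inc S ed w2 = {f2, l2}" using A B n unfolding chain_ix_def by auto
      then have "l1 = f2" using e ff by (auto simp: doubleton_eq_iff)
      then have "ed f2 = {w1, W}" using A n unfolding chain_ix_def by auto
      then have "W = y2" using u(6) e u(15) by (auto simp: doubleton_eq_iff)
      moreover have "W \<noteq> y2" using B unfolding chain_ix_def by auto
      ultimately show False by blast
    qed
    have vd: "v \<noteq> y1" "v \<noteq> y2" "y1 \<noteq> y2" using u(13) by auto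
    have WW: "W \<noteq> y1" "W \<noteq> y2" "W \<noteq> v" using A B unfolding chain_ix_def by auto
    have el1: "ed l1 = (if w1 = W then {y1, W} else {w1, W})" "ed l2 = (if w2 = W then {y2, W} else {w2, W})"
      using A B unfolding chain_ix_def by auto
    have zz: "(if w1 = W then y1 else w1) \<noteq> (if w2 = W then y2 else w2)" using vd nw ww by auto
    have l12: "l1 \<noteq> l2" using el1 zz WW by (auto simp: doubleton_eq_iff split: if_splits)
    have l1': "l1 \<noteq> i" "l1 \<noteq> j" "l2 \<noteq> i" "l2 \<noteq> j" using A B u(3,4) WW unfolding inc_def by auto
    have f1l2: "f1 \<noteq> l2" "f2 \<noteq> l1"
    proof -
      show "f1 \<noteq> l2"
      proof
        assume "f1 = l2"
        then have "{y1, w1} = (if w2 = W then {y2, W} else {w2, W})" using u(5) el1(2) by simp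
        then show False using vd WW nw ww by (auto simp: doubleton_eq_iff split: if_splits)
      qed
      show "f2 \<noteq> l1"
      proof
        assume "f2 = l1"
        then have "{y2, w2} = (if w1 = W then {y1, W} else {w1, W})" using u(6) el1(1) by simp
        then show False using vd WW nw ww by (auto simp: doubleton_eq_iff split: if_splits)
      qed
    qed
    have disj: "inc S ed v \<inter> inc S ed W = {}"
    proof (rule ccontr)
      assume "\<not> ?thesis"
      then obtain l where l: "l \<in> inc S ed v" "W \<in> ed l" unfolding inc_def by auto
      then have "W \<in> ed i \<or> W \<in> ed j \<or> W \<in> ed e3" using th(1) by auto
      then show False using u(3,4) o(1) WW W by auto
    qed
    have cW: "card (inc S ed W) \<le> 3" using d3 unfolding deg_def by simp
    show ?thesis
      by (rule recolourable_double_chain[OF G conjunct1[OF A] conjunct1[OF B] u(20,21) cv3 _ _ cW])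
        (use A B iS l12 l1' f1l2 u(9-12) ff vd nw ww disj in \<open>auto simp: chain_ix_def\<close>)
  qed
qed

section \<open>The algorithm\<close>

lemma same_offD: "same_off C s t \<Longrightarrow> a \<notin> temps \<Longrightarrow> (a, i) \<notin> C \<Longrightarrow> t a i = s a i"
  unfolding same_off_def by simp

definition EqA :: "aexp \<Rightarrow> aexp \<Rightarrow> bexp" where "EqA x y = Conj (Neg (Less x y)) (Neg (Less y x))"
definition OrB :: "bexp \<Rightarrow> bexp \<Rightarrow> bexp" where "OrB b c = Neg (Conj (Neg b) (Neg c))"

lemma bval_EqA [simp]: "bval (EqA x y) s \<longleftrightarrow> aval x s = aval y s" by (auto simp: EqA_def)
lemma bval_OrB [simp]: "bval (OrB b c) s \<longleftrightarrow> bval b s \<or> bval c s" by (auto simp: OrB_def)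

text \<open>
  Arrays 3 and 4 hold the colours, array 5 marks the edges present, arrays 6 to 8 tabulate the degrees, the sums of
  the incident edges and the numbers of neighbours of degree at least 3.  Variables: 9 flag, 10 and 14 loop
  counters, 11 number of colours, 12 maximum degree, 13 number of reductions made, 15 constantly 0,
  16 to 18 candidate (shifted by 1), 19 search bound, 20 to 33 current reduction.  Arrays 60 to 73 store the reductions.
\<close>
definition alv :: "store \<Rightarrow> nat set" where "alv s = {i. i < s 0 1 \<and> 0 < s 5 i}"
definition eds :: "store \<Rightarrow> nat \<Rightarrow> nat set" where "eds s i = (if i < s 0 1 then {s 1 i, s 2 i} else {})"

lemma alv_eds_cong:
  assumes "s 0 = t 0" "s 1 = t 1" "s 2 = t 2" "s 5 = t 5" shows "alv s = alv t" "eds s = eds t"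
  using assms by (auto simp: alv_def eds_def fun_eq_iff)

abbreviation nE :: aexp where "nE \<equiv> Load 0 (Const 0)"
abbreviation mE :: aexp where "mE \<equiv> Load 0 (Const 1)"

section \<open>Completing a partial colouring by search\<close>

definition shares :: "aexp \<Rightarrow> aexp \<Rightarrow> bexp" where
  "shares i e = OrB (OrB (EqA (Load 1 i) (Load 1 e)) (EqA (Load 1 i) (Load 2 e)))
     (OrB (EqA (Load 2 i) (Load 1 e)) (EqA (Load 2 i) (Load 2 e)))"

definition vconf :: "aexp \<Rightarrow> bexp" where
  "vconf i = OrB (Conj (Less (Const 0) (Load 4 (Load 1 i))) (EqA (Load 4 (Load 1 i)) (Load 4 (Load 2 i))))
     (Conj (Less (Const 0) (Load 3 i)) (OrB (EqA (Load 3 i) (Load 4 (Load 1 i))) (EqA (Load 3 i) (Load 4 (Load 2 i)))))"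

fun econf :: "aexp \<Rightarrow> nat list \<Rightarrow> bexp" where
  "econf i [] = Less (Const 0) (Const 0)"
| "econf i (e # es) = OrB (Conj (Neg (EqA i (var e))) (Conj (shares i (var e)) (EqA (Load 3 i) (Load 3 (var e))))) (econf i es)"

definition chk :: "nat list \<Rightarrow> com" where
  "chk es = Seq (Store 9 (Const 0) (Const 1)) (FOR 10 mE
     (Cond (Conj (Less (Const 0) (Load 5 (var 10))) (OrB (vconf (var 10)) (econf (var 10) es))) (Store 9 (Const 0) (Const 0)) Skip))"

text \<open>Edges are compared only with the few listed ones, so that testing a colouring takes
  linear time. Pairs of edges outside the list keep colours that are known to be compatible.\<close>

definition okc :: "nat list \<Rightarrow> store \<Rightarrow> nat \<Rightarrow> bool" where
  "okc es s i \<longleftrightarrow> (s 4 (s 1 i) = s 4 (s 2 i) \<longrightarrow> s 4 (s 1 i) = 0) \<and>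
     (s 3 i = s 4 (s 1 i) \<or> s 3 i = s 4 (s 2 i) \<longrightarrow> s 3 i = 0) \<and>
     (\<forall>e\<in>set es. i \<noteq> s e 0 \<and> {s 1 i, s 2 i} \<inter> {s 1 (s e 0), s 2 (s e 0)} \<noteq> {} \<longrightarrow> s 3 i \<noteq> s 3 (s e 0))"

lemma okcD: "okc es s i \<Longrightarrow> e \<in> set es \<Longrightarrow> i \<noteq> s e 0 \<Longrightarrow> {s 1 i, s 2 i} \<inter> {s 1 (s e 0), s 2 (s e 0)} \<noteq> {} \<Longrightarrow> s 3 i \<noteq> s 3 (s e 0)"
  unfolding okc_def by blast

lemma bval_shares: "bval (shares i e) s \<longleftrightarrow> {s 1 (aval i s), s 2 (aval i s)} \<inter> {s 1 (aval e s), s 2 (aval e s)} \<noteq> {}"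
  unfolding shares_def by auto

lemma bval_econf: "bval (econf i es) s \<longleftrightarrow> (\<exists>e\<in>set es. aval i s \<noteq> s e 0 \<and>
    {s 1 (aval i s), s 2 (aval i s)} \<inter> {s 1 (s e 0), s 2 (s e 0)} \<noteq> {} \<and> s 3 (aval i s) = s 3 (s e 0))"
  by (induction es) (auto simp: bval_shares)

lemma bval_conf: "bval (OrB (vconf i) (econf i es)) s \<longleftrightarrow> \<not> okc es s (aval i s)"
  unfolding okc_def bval_OrB bval_econf unfolding vconf_def by auto

definition chk_time :: "nat list \<Rightarrow> nat \<Rightarrow> nat" where
  "chk_time es m = m * (bcost (econf (var 10) es) + 200) + 20"

lemma run_chk:
  assumes es: "set es \<inter> {9, 10} = {}" and m: "s 0 1 = m"
  shows "run (chk es) s (chk_time es m) (\<lambda>s'. eqx {9, 10} s s' \<and> s' 9 0 = of_bool (\<forall>i\<in>alv s. okc es s i))"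
proof -
  let ?body = "Cond (Conj (Less (Const 0) (Load 5 (var 10))) (OrB (vconf (var 10)) (econf (var 10) es))) (Store 9 (Const 0) (Const 0)) Skip"
  define P where "P i s' \<longleftrightarrow> s' 10 0 = i \<and> eqx {9, 10} s s' \<and> s' 9 0 = of_bool (\<forall>j<i. 0 < s 5 j \<longrightarrow> okc es s j)" for i s'
  have okeq: "okc es s' j = okc es s j" if "eqx {9, 10} s s'" for s' j
  proof -
    have "s' a = s a" if "a \<notin> {9, 10}" for a using \<open>eqx {9, 10} s s'\<close> that unfolding eqx_def by auto
    moreover have "e \<notin> {9, 10}" if "e \<in> set es" for e using es that by auto
    ultimately show ?thesis unfolding okc_def by simp
  qed
  have 1: "run (FOR 10 mE ?body) (ev (Store 9 (Const 0) (Const 1)) s) (m * (cost ?body + 12 + acost mE) + 12 + acost mE) (P m)"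
  proof (rule run_for)
    show "P 0 (set0 10 0 (ev (Store 9 (Const 0) (Const 1)) s))" unfolding P_def eqx_def set0_def by auto
  next
    fix i s' assume "P i s'" then show "aval mE s' = m \<and> s' 10 0 = i" using m unfolding P_def eqx_def by auto
  next
    fix i s' assume h: "i < m" "P i s'"
    have e: "eqx {9, 10} s s'" "s' 10 0 = i" "s' 9 0 = of_bool (\<forall>j<i. 0 < s 5 j \<longrightarrow> okc es s j)" using h unfolding P_def by auto
    have b: "bval (Conj (Less (Const 0) (Load 5 (var 10))) (OrB (vconf (var 10)) (econf (var 10) es))) s' \<longleftrightarrow> 0 < s 5 i \<and> \<not> okc es s i"
      using e(2) okeq[OF e(1), of i] eqxD[OF e(1), of 5] bval_conf[of "var 10" es s'] by simp
    have all: "(\<forall>j<Suc i. 0 < s 5 j \<longrightarrow> okc es s j) \<longleftrightarrow> (\<forall>j<i. 0 < s 5 j \<longrightarrow> okc es s j) \<and> (0 < s 5 i \<longrightarrow> okc es s i)"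
      using less_Suc_eq by auto
    show "run ?body s' (cost ?body) (\<lambda>s'. s' 10 0 = i \<and> P (Suc i) (set0 10 (Suc i) s'))"
    proof (rule run_ev')
      have "ev ?body s' = (if 0 < s 5 i \<and> \<not> okc es s i then set0 9 0 s' else s')"
        unfolding ev.simps b by (simp add: set0_def)
      then show "ev ?body s' 10 0 = i \<and> P (Suc i) (set0 10 (Suc i) (ev ?body s'))"
        using e all unfolding P_def eqx_def set0_def by auto
    qed simp
  qed
  have "run (chk es) s (cost (Store 9 (Const 0) (Const 1)) + (m * (cost ?body + 12 + acost mE) + 12 + acost mE)) (P m)"
    unfolding chk_def by (rule run_SeqI[OF run_ev]) (use 1 in simp_all)
  then show ?thesis
  proof (rule run_weaken)
    show "cost (Store 9 (Const 0) (Const 1)) + (m * (cost ?body + 12 + acost mE) + 12 + acost mE) \<le> chk_time es m"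
      unfolding chk_time_def by (simp add: OrB_def vconf_def EqA_def algebra_simps)
  next
    fix s' assume "P m s'"
    moreover have "(\<forall>j<m. 0 < s 5 j \<longrightarrow> okc es s j) \<longleftrightarrow> (\<forall>i\<in>alv s. okc es s i)" unfolding alv_def m by auto
    ultimately show "eqx {9, 10} s s' \<and> s' 9 0 = of_bool (\<forall>i\<in>alv s. okc es s i)" unfolding P_def by simp
  qed
qed

definition extend :: "nat list \<Rightarrow> nat list \<Rightarrow> com" where
  "extend es vs = Seq (Store 9 (Const 0) (Const 0)) (srch 0 (map (Pair 3) es @ map (Pair 4) vs) 11 (chk es))"

text \<open>Colour 0 is exempt in \<open>proper\<close> but not when an edge is compared with a
  listed one in \<open>okc\<close>; therefore the listed edges have to be coloured.\<close>

lemma proper_okc: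
  assumes P: "proper (alv s) (eds s) (s 3) (s 4)" and e: "\<And>e. e \<in> set es \<Longrightarrow> s e 0 \<in> alv s \<and> 0 < s 3 (s e 0)"
    and G: "numbered_graph n (alv s) (eds s)" and i: "i \<in> alv s"
  shows "okc es s i"
proof -
  have ed: "eds s j = {s 1 j, s 2 j}" if "j \<in> alv s" for j using that unfolding alv_def eds_def by auto
  have ne: "s 1 i \<noteq> s 2 i" using G i ed[OF i] unfolding numbered_graph_def by force
  have in1: "i \<in> inc (alv s) (eds s) (s 1 i)" "i \<in> inc (alv s) (eds s) (s 2 i)" using i ed[OF i] unfolding inc_def by auto
  have "s 3 i \<noteq> s 3 (s e 0)" if h: "e \<in> set es" "i \<noteq> s e 0" "{s 1 i, s 2 i} \<inter> {s 1 (s e 0), s 2 (s e 0)} \<noteq> {}" for e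
  proof -
    obtain x where "x \<in> {s 1 i, s 2 i}" "x \<in> {s 1 (s e 0), s 2 (s e 0)}" using h(3) by blast
    then have "i \<in> inc (alv s) (eds s) x" "s e 0 \<in> inc (alv s) (eds s) x"
      using ed[OF i] ed[of "s e 0"] e[OF h(1)] i unfolding inc_def by auto
    then show ?thesis using proper_edges[OF P, of i x "s e 0"] h(2) e[OF h(1)] by auto
  qed
  then show ?thesis unfolding okc_def
    using proper_ends[OF P in1(1)] proper_ends[OF P in1(2)] proper_nbrs[OF P i, of "s 1 i" "s 2 i"] ed[OF i] ne by auto
qed

text \<open>Two edges outside the list have their colours from the proper colouring
  \<open>ce\<close>; all other conflicts are covered by the test.\<close>

lemma okc_proper:
  assumes ok: "\<And>i. i \<in> alv s \<Longrightarrow> okc es s i" and P: "proper (alv s) (eds s) ce cv"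
    and e: "\<And>i. i \<notin> (\<lambda>e. s e 0) ` set es \<Longrightarrow> s 3 i = ce i" and G: "numbered_graph n (alv s) (eds s)"
  shows "proper (alv s) (eds s) (s 3) (s 4)"
  unfolding proper_def
proof (intro conjI allI ballI impI)
  have ed: "eds s j = {s 1 j, s 2 j}" if "j \<in> alv s" for j using that unfolding alv_def eds_def by auto
  {
    fix v i j assume h: "i \<in> inc (alv s) (eds s) v" "j \<in> inc (alv s) (eds s) v" "i \<noteq> j \<and> s 3 i = s 3 j"
    have a: "i \<in> alv s" "j \<in> alv s" "v \<in> eds s i" "v \<in> eds s j" using h unfolding inc_def by auto
    have sh: "{s 1 i, s 2 i} \<inter> {s 1 j, s 2 j} \<noteq> {}" "{s 1 j, s 2 j} \<inter> {s 1 i, s 2 i} \<noteq> {}" using a ed by auto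
    show "s 3 i = 0"
    proof (cases "i \<in> (\<lambda>e. s e 0) ` set es \<or> j \<in> (\<lambda>e. s e 0) ` set es")
      case True
      then obtain e where e: "e \<in> set es" "i = s e 0 \<or> j = s e 0" by blast
      show ?thesis using okcD[OF ok[OF a(1)] e(1)] okcD[OF ok[OF a(2)] e(1)] e(2) sh h(3) by metis
    next
      case False
      then show ?thesis using proper_edges[OF P h(1,2)] h(3) e[of i] e[of j] by auto
    qed
  next
    fix v i assume h: "i \<in> inc (alv s) (eds s) v" "s 3 i = s 4 v"
    then have a: "i \<in> alv s" "v \<in> eds s i" unfolding inc_def by auto
    then show "s 3 i = 0" using ok[OF a(1)] ed[OF a(1)] h(2) unfolding okc_def by auto
  next
    fix i u v assume h: "i \<in> alv s" "u \<in> eds s i" "v \<in> eds s i" "u \<noteq> v \<and> s 4 u = s 4 v"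
    then show "s 4 u = 0" using ok[OF h(1)] ed[OF h(1)] unfolding okc_def by auto
  }
qed

definition extend_time :: "nat list \<Rightarrow> nat list \<Rightarrow> nat \<Rightarrow> nat \<Rightarrow> nat" where
  "extend_time es vs K m = 3 + srch_time K (chk_time es m) (length es + length vs)"

text \<open>The colouring \<open>ce\<close>, \<open>cv\<close> only guarantees that the search
  succeeds; the colouring that is found may be a different one.\<close>

lemma run_extend:
  assumes sl: "set es \<subseteq> {20..<32}" "set vs \<subseteq> {20..<32}" "length es + length vs \<le> 20"
    and G: "numbered_graph n (alv s) (eds s)" and P: "proper (alv s) (eds s) (s 3) (s 4)"
    and K: "s 11 0 = K" and m: "s 0 1 = m" and al: "\<And>e. e \<in> set es \<Longrightarrow> s e 0 \<in> alv s"
    and tgt: "proper (alv s) (eds s) ce cv" "\<And>i. i \<notin> (\<lambda>e. s e 0) ` set es \<Longrightarrow> ce i = s 3 i"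
      "\<And>v. v \<notin> (\<lambda>e. s e 0) ` set vs \<Longrightarrow> cv v = s 4 v"
      "\<And>e. e \<in> set es \<Longrightarrow> 1 \<le> ce (s e 0) \<and> ce (s e 0) \<le> K" "\<And>e. e \<in> set vs \<Longrightarrow> 1 \<le> cv (s e 0) \<and> cv (s e 0) \<le> K"
  shows "run (extend es vs) s (extend_time es vs K m) (\<lambda>s'. eqx ({3, 4} \<union> temps) s s' \<and>
    proper (alv s) (eds s) (s' 3) (s' 4) \<and>
    (\<forall>i. i \<notin> (\<lambda>e. s e 0) ` set es \<longrightarrow> s' 3 i = s 3 i) \<and> (\<forall>v. v \<notin> (\<lambda>e. s e 0) ` set vs \<longrightarrow> s' 4 v = s 4 v) \<and>
    (\<forall>e\<in>set es. 1 \<le> s' 3 (s e 0) \<and> s' 3 (s e 0) \<le> K) \<and> (\<forall>e\<in>set vs. 1 \<le> s' 4 (s e 0) \<and> s' 4 (s e 0) \<le> K))"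
proof -
  let ?sl = "map (Pair 3) es @ map (Pair 4) vs :: (nat \<times> nat) list"
  have tmp: "3 \<notin> temps" "4 \<notin> temps" "11 \<notin> temps" "0 \<notin> temps" "\<And>a. a \<in> {20..<32} \<Longrightarrow> a \<notin> temps" unfolding temps_def by auto
  have gs: "good_slots ?sl" unfolding good_slots_def using sl tmp by fastforce
  define OK where "OK s = (\<forall>i\<in>alv s. okc es s i)" for s
  define s0 where "s0 = set0 9 0 s"
  have e9: "set es \<inter> {9, 10} = {}" using sl(1) by fastforce
  have esT: "e \<notin> temps" if "e \<in> set es" for e using that sl(1) tmp(5) by blast
  have run1: "run (srch 0 ?sl 11 (chk es)) s0 (srch_time K (chk_time es m) (length ?sl)) (\<lambda>s'. same_off (cells ?sl s0) s0 s' \<and> (\<forall>a\<in>{40..<40 + 0}. s' a = s0 a) \<and>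
     ((s' 9 0 = 1 \<and> OK s' \<and> (\<forall>(a, b)\<in>set ?sl. 1 \<le> s' a (s0 b 0) \<and> s' a (s0 b 0) \<le> K)) \<or>
      (s' 9 0 = 0 \<and> (\<forall>cs. length cs = length ?sl \<and> set cs \<subseteq> {1..K} \<longrightarrow> \<not> OK (wr ?sl cs s0)))))"
  proof (rule run_srch[where J = "\<lambda>t. t 0 1 = m" and sl0 = ?sl])
    fix t :: store assume "t 0 1 = m"
    then show "run (chk es) t (chk_time es m) (\<lambda>s'. eqx {9, 10} t s' \<and> s' 9 0 = of_bool (OK t))"
      unfolding OK_def by (rule run_chk[OF e9])
  next
    fix t u assume h: "eqx temps t u"
    then have "t a = u a" if "a \<notin> temps" for a using that unfolding eqx_def by blast
    then have "t 0 = u 0" "t 1 = u 1" "t 2 = u 2" "t 3 = u 3" "t 4 = u 4" "t 5 = u 5" "\<And>e. e \<in> set es \<Longrightarrow> t e = u e"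
      using esT unfolding temps_def by auto
    then show "OK t = OK u" unfolding OK_def okc_def alv_def by auto
  next
    fix t u assume h: "t 0 1 = m" "same_off (cells ?sl t) t u"
    have "(0, 1) \<notin> cells ?sl t" by (rule not_in_cells) auto
    then show "u 0 1 = m" using h tmp(4) unfolding same_off_def by metis
  qed (use gs sl tmp K m in \<open>auto simp: s0_def set0_def\<close>)
  have s0: "s0 a = s a" if "a \<noteq> 9" for a using that unfolding s0_def set0_def by simp
  have se: "s0 e 0 = s e 0" if "e \<in> set es \<union> set vs" for e using s0[of e] that sl by fastforce
  define t where "t = s0(3 := ce, 4 := cv)"
  have teq: "t a = s a" if "a \<noteq> 9" "a \<noteq> 3" "a \<noteq> 4" for a using that s0 unfolding t_def by simp
  have tal: "alv t = alv s" "eds t = eds s" using alv_eds_cong[of t s] teq by auto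
  have off: "same_off (cells ?sl s0) s0 t"
    unfolding same_off_def
  proof (intro allI impI)
    fix a i assume h: "a \<notin> temps \<and> (a, i) \<notin> cells ?sl s0"
    have "i \<notin> (\<lambda>e. s e 0) ` set es" if "a = 3" using h that se unfolding mem_cells by auto
    moreover have "i \<notin> (\<lambda>e. s e 0) ` set vs" if "a = 4" using h that se unfolding mem_cells by auto
    ultimately show "s0 a i = t a i" using tgt(2,3) s0 unfolding t_def by auto
  qed
  let ?cs = "map (\<lambda>(a, b). t a (s0 b 0)) ?sl"
  have "same_off {} (wr ?sl ?cs s0) t" by (rule wr_target[OF gs off])
  then have eqt: "eqx temps (wr ?sl ?cs s0) t" by (simp add: same_off_eqx)
  have tes: "t e 0 = s e 0" if "e \<in> set es" for e using teq[of e] that sl(1) by fastforce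
  have OKt: "OK t" unfolding OK_def
  proof
    fix i assume i: "i \<in> alv t"
    have t34: "t 3 = ce" "t 4 = cv" unfolding t_def by simp_all
    show "okc es t i"
    proof (rule proper_okc[of t es n])
      fix e assume e: "e \<in> set es"
      show "t e 0 \<in> alv t \<and> 0 < t 3 (t e 0)" using tes[OF e] al[OF e] tgt(4)[OF e] t34 tal by simp
    qed (use tgt(1) t34 tal G i in simp_all)
  qed
  have OKw: "OK (wr ?sl ?cs s0)"
  proof -
    have eq: "wr ?sl ?cs s0 a = t a" if "a \<notin> temps" for a using eqt that unfolding eqx_def by blast
    then have "wr ?sl ?cs s0 0 = t 0" "wr ?sl ?cs s0 1 = t 1" "wr ?sl ?cs s0 2 = t 2" "wr ?sl ?cs s0 3 = t 3" "wr ?sl ?cs s0 4 = t 4" "wr ?sl ?cs s0 5 = t 5"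
      "\<And>e. e \<in> set es \<Longrightarrow> wr ?sl ?cs s0 e = t e" using esT unfolding temps_def by auto
    then show ?thesis using OKt unfolding OK_def okc_def alv_def by auto
  qed
  have cs: "length ?cs = length ?sl" "set ?cs \<subseteq> {1..K}" using tgt(4,5) se unfolding t_def by auto
  have fin: "run (extend es vs) s (cost (Store 9 (Const 0) (Const 0)) + srch_time K (chk_time es m) (length ?sl)) (\<lambda>s'. same_off (cells ?sl s0) s0 s' \<and> OK s' \<and> (\<forall>(a, b)\<in>set ?sl. 1 \<le> s' a (s0 b 0) \<and> s' a (s0 b 0) \<le> K))"
    unfolding extend_def
  proof (rule run_SeqI[OF run_ev])
    fix s1 assume "s1 = ev (Store 9 (Const 0) (Const 0)) s"
    then have e: "s1 = s0" unfolding s0_def set0_def by simp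
    show "run (srch 0 ?sl 11 (chk es)) s1 (srch_time K (chk_time es m) (length ?sl)) (\<lambda>s'. same_off (cells ?sl s0) s0 s' \<and> OK s' \<and> (\<forall>(a, b)\<in>set ?sl. 1 \<le> s' a (s0 b 0) \<and> s' a (s0 b 0) \<le> K))"
      unfolding e by (rule run_weaken[OF run1 order_refl]) (use OKw cs in blast)
  qed simp
  show ?thesis
  proof (rule run_weaken[OF fin])
    show "cost (Store 9 (Const 0) (Const 0)) + srch_time K (chk_time es m) (length ?sl) \<le> extend_time es vs K m"
      unfolding extend_time_def by simp
  next
    fix s' assume h: "same_off (cells ?sl s0) s0 s' \<and> OK s' \<and> (\<forall>(a, b)\<in>set ?sl. 1 \<le> s' a (s0 b 0) \<and> s' a (s0 b 0) \<le> K)"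
    have eqa: "s' a = s a" if "a \<notin> {3, 4} \<union> temps" for a
    proof
      fix i
      have "(a, i) \<notin> cells ?sl s0" by (rule not_in_cells) (use that in auto)
      moreover have "a \<noteq> 9" using that unfolding temps_def by auto
      moreover have "a \<notin> temps" using that by simp
      ultimately show "s' a i = s a i" using same_offD[OF conjunct1[OF h]] s0[of a] by metis
    qed
    have al': "alv s' = alv s" "eds s' = eds s" using alv_eds_cong[of s' s] eqa unfolding temps_def by auto
    have es': "s' e 0 = s e 0" if "e \<in> set es \<union> set vs" for e
    proof -
      have "e \<in> {20..<32}" using that sl by blast
      then show ?thesis using eqa[of e] tmp(5)[of e] by auto
    qed
    have e3: "s' 3 i = s 3 i" if "i \<notin> (\<lambda>e. s e 0) ` set es" for i
    proof -
      have "(3, i) \<notin> cells ?sl s0" using that se unfolding mem_cells by auto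
      then show ?thesis using same_offD[OF conjunct1[OF h] tmp(1)] s0[of 3] by simp
    qed
    have e4: "s' 4 i = s 4 i" if "i \<notin> (\<lambda>e. s e 0) ` set vs" for i
    proof -
      have "(4, i) \<notin> cells ?sl s0" using that se unfolding mem_cells by auto
      then show ?thesis using same_offD[OF conjunct1[OF h] tmp(2)] s0[of 4] by simp
    qed
    have pr: "proper (alv s') (eds s') (s' 3) (s' 4)"
    proof (rule okc_proper)
      show "okc es s' i" if "i \<in> alv s'" for i using h that unfolding OK_def by blast
      show "proper (alv s') (eds s') (s 3) (s 4)" unfolding al' by (rule P)
      show "s' 3 i = s 3 i" if "i \<notin> (\<lambda>e. s' e 0) ` set es" for i using e3[of i] that es' by force
      show "numbered_graph n (alv s') (eds s')" unfolding al' by (rule G)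
    qed
    have v0: "1 \<le> s' a (s0 b 0) \<and> s' a (s0 b 0) \<le> K" if "(a, b) \<in> set ?sl" for a b
      using bspec[OF conjunct2[OF conjunct2[OF h]] that] by simp
    have v3: "1 \<le> s' 3 (s e 0) \<and> s' 3 (s e 0) \<le> K" if "e \<in> set es" for e using v0[of 3 e] se[of e] that by simp
    have v4: "1 \<le> s' 4 (s e 0) \<and> s' 4 (s e 0) \<le> K" if "e \<in> set vs" for e using v0[of 4 e] se[of e] that by simp
    have vals: "\<forall>e\<in>set es. 1 \<le> s' 3 (s e 0) \<and> s' 3 (s e 0) \<le> K" "\<forall>e\<in>set vs. 1 \<le> s' 4 (s e 0) \<and> s' 4 (s e 0) \<le> K"
      using v3 v4 by blast+
    show "eqx ({3, 4} \<union> temps) s s' \<and> proper (alv s) (eds s) (s' 3) (s' 4) \<and>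
      (\<forall>i. i \<notin> (\<lambda>e. s e 0) ` set es \<longrightarrow> s' 3 i = s 3 i) \<and> (\<forall>v. v \<notin> (\<lambda>e. s e 0) ` set vs \<longrightarrow> s' 4 v = s 4 v) \<and>
      (\<forall>e\<in>set es. 1 \<le> s' 3 (s e 0) \<and> s' 3 (s e 0) \<le> K) \<and> (\<forall>e\<in>set vs. 1 \<le> s' 4 (s e 0) \<and> s' 4 (s e 0) \<le> K)"
      using eqa pr vals e3 e4 unfolding al' eqx_def by auto
  qed
qed

section \<open>Tabulating degrees, sums of incident edges and numbers of big neighbours\<close>

definition tab0 :: com where
  "tab0 = Seq (Store 6 (var 10) (Const 0)) (Seq (Store 7 (var 10) (Const 0)) (Store 8 (var 10) (Const 0)))"

definition bump :: "nat \<Rightarrow> aexp \<Rightarrow> aexp \<Rightarrow> com" where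
  "bump a i x = Store a i (Add (Load a i) x)"

definition tab1 :: com where
  "tab1 = Cond (Less (Const 0) (Load 5 (var 10)))
     (Seq (Seq (bump 6 (Load 1 (var 10)) (Const 1)) (bump 6 (Load 2 (var 10)) (Const 1)))
          (Seq (bump 7 (Load 1 (var 10)) (var 10)) (bump 7 (Load 2 (var 10)) (var 10)))) Skip"

definition tab2 :: com where
  "tab2 = Cond (Less (Const 0) (Load 5 (var 10)))
     (Seq (Cond (Less (Const 2) (Load 6 (Load 2 (var 10)))) (bump 8 (Load 1 (var 10)) (Const 1)) Skip)
          (Cond (Less (Const 2) (Load 6 (Load 1 (var 10)))) (bump 8 (Load 2 (var 10)) (Const 1)) Skip)) Skip"

text \<open>Counting big neighbours needs the complete table of degrees, hence a pass of its own
  over the edges.\<close>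

definition tab :: com where
  "tab = Seq (FOR 10 nE tab0) (Seq (FOR 10 mE tab1) (FOR 10 mE tab2))"

definition tabs :: "store \<Rightarrow> bool" where
  "tabs s \<longleftrightarrow> (\<forall>v<s 0 0. s 6 v = deg (alv s) (eds s) v \<and> s 7 v = \<Sum>(inc (alv s) (eds s) v) \<and>
     s 8 v = big_nbrs (alv s) (eds s) v)"

definition tab_time :: "nat \<Rightarrow> nat \<Rightarrow> nat" where
  "tab_time n m = n * (cost tab0 + 14) + 14 + (m * (cost tab1 + 14) + 14 + (m * (cost tab2 + 14) + 14))"

lemma inc_less_Suc:
  "{j \<in> inc S ed v. j < Suc i} = (if i \<in> inc S ed v then insert i {j \<in> inc S ed v. j < i} else {j \<in> inc S ed v. j < i})"
  by (auto simp: less_Suc_eq)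

lemma run_tab:
  assumes G: "numbered_graph n (alv s) (eds s)" and n: "s 0 0 = n" and m: "s 0 1 = m"
  shows "run tab s (tab_time n m) (\<lambda>s'. eqx {6, 7, 8, 10} s s' \<and> tabs s')"
proof -
  let ?S = "alv s" and ?e = "eds s" and ?M = "{6, 7, 8, 10}"
  let ?I = "\<lambda>v i. {j \<in> inc ?S ?e v. j < i}"
  let ?J = "\<lambda>v i. {j \<in> inc ?S ?e v. j < i \<and> 3 \<le> deg ?S ?e (oth ?e j v)}"
  have fin: "finite (inc ?S ?e v)" for v by (rule finite_inc[OF G])
  define P0 where "P0 i s' \<longleftrightarrow> s' 10 0 = i \<and> eqx ?M s s' \<and> (\<forall>v<i. s' 6 v = 0 \<and> s' 7 v = 0 \<and> s' 8 v = 0)" for i s'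
  define P1 where "P1 i s' \<longleftrightarrow> s' 10 0 = i \<and> eqx ?M s s' \<and> (\<forall>v<n. s' 6 v = card (?I v i) \<and> s' 7 v = \<Sum>(?I v i) \<and> s' 8 v = 0)" for i s'
  define P2 where "P2 i s' \<longleftrightarrow> s' 10 0 = i \<and> eqx ?M s s' \<and> (\<forall>v<n. s' 6 v = deg ?S ?e v \<and> s' 7 v = \<Sum>(inc ?S ?e v) \<and> s' 8 v = card (?J v i))" for i s'
  have c: "s' 0 = s 0 \<and> s' 1 = s 1 \<and> s' 2 = s 2 \<and> s' 5 = s 5" if "eqx ?M s s'" for s' using that unfolding eqx_def by auto
  have ends: "s 1 i < n \<and> s 2 i < n \<and> s 1 i \<noteq> s 2 i \<and> ?e i = {s 1 i, s 2 i}" if "i \<in> ?S" for i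
  proof -
    have e: "?e i = {s 1 i, s 2 i}" using that unfolding alv_def eds_def by auto
    have "card (?e i) = 2" "?e i \<subseteq> {..<n}" using G that unfolding numbered_graph_def by auto
    then show ?thesis using e by (cases "s 1 i = s 2 i") auto
  qed
  have r0: "run (FOR 10 nE tab0) s (n * (cost tab0 + 12 + acost nE) + 12 + acost nE) (P0 n)"
  proof (rule run_for)
    show "P0 0 (set0 10 0 s)" unfolding P0_def eqx_def set0_def by auto
  next
    fix i s' assume "P0 i s'" then show "aval nE s' = n \<and> s' 10 0 = i" using n c[of s'] unfolding P0_def by auto
  next
    fix i s' assume h: "i < n" "P0 i s'"
    show "run tab0 s' (cost tab0) (\<lambda>s'. s' 10 0 = i \<and> P0 (Suc i) (set0 10 (Suc i) s'))"
      by (rule run_ev') (use h in \<open>auto simp: tab0_def P0_def eqx_def set0_def less_Suc_eq\<close>)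
  qed
  have r1: "run (FOR 10 mE tab1) s1 (m * (cost tab1 + 12 + acost mE) + 12 + acost mE) (P1 m)" if "P0 n s1" for s1
  proof (rule run_for)
    show "P1 0 (set0 10 0 s1)" using that unfolding P0_def P1_def eqx_def set0_def by auto
  next
    fix i s' assume "P1 i s'" then show "aval mE s' = m \<and> s' 10 0 = i" using m c[of s'] unfolding P1_def by auto
  next
    fix i s' assume h: "i < m" "P1 i s'"
    have e: "s' 10 0 = i" "eqx ?M s s'" "\<And>v. v < n \<Longrightarrow> s' 6 v = card (?I v i) \<and> s' 7 v = \<Sum>(?I v i) \<and> s' 8 v = 0" using h unfolding P1_def by auto
    note cc = c[OF e(2)]
    show "run tab1 s' (cost tab1) (\<lambda>s'. s' 10 0 = i \<and> P1 (Suc i) (set0 10 (Suc i) s'))"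
    proof (rule run_ev')
      show "ev tab1 s' 10 0 = i \<and> P1 (Suc i) (set0 10 (Suc i) (ev tab1 s'))"
      proof (cases "i \<in> ?S")
        case True
        note en = ends[OF True]
        have al: "0 < s 5 i" using True unfolding alv_def by auto
        let ?t = "ev tab1 s'"
        have t: "?t = s'(6 := (s' 6)(s 1 i := Suc (s' 6 (s 1 i)), s 2 i := Suc (s' 6 (s 2 i))),
             7 := (s' 7)(s 1 i := s' 7 (s 1 i) + i, s 2 i := s' 7 (s 2 i) + i))"
          using cc al e(1) en unfolding tab1_def bump_def by (auto simp: fun_eq_iff)
        have inc: "i \<in> inc ?S ?e v \<longleftrightarrow> v = s 1 i \<or> v = s 2 i" for v using True en unfolding inc_def by auto
        have ni: "finite (?I v i)" "i \<notin> ?I v i" for v using fin by auto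
        have v: "?t 6 v = card (?I v (Suc i)) \<and> ?t 7 v = \<Sum>(?I v (Suc i)) \<and> ?t 8 v = 0" if "v < n" for v
          using e(3)[OF that] en unfolding t inc_less_Suc inc by (auto simp: ni)
        show ?thesis unfolding P1_def using v e(1,2) unfolding t eqx_def set0_def by auto
      next
        case False
        then have "ev tab1 s' = s'" using cc h(1) m e(1) unfolding tab1_def alv_def by simp
        moreover have "?I v (Suc i) = ?I v i" for v using False unfolding inc_less_Suc by (auto simp: inc_def)
        ultimately show ?thesis using e unfolding P1_def eqx_def set0_def by auto
      qed
    qed (simp add: tab1_def bump_def)
  qed
  have full: "?I v m = inc ?S ?e v" for v using m unfolding inc_def alv_def by auto
  have r2: "run (FOR 10 mE tab2) s1 (m * (cost tab2 + 12 + acost mE) + 12 + acost mE) (P2 m)" if "P1 m s1" for s1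
  proof (rule run_for)
    show "P2 0 (set0 10 0 s1)" using that unfolding P1_def P2_def eqx_def set0_def full deg_def by auto
  next
    fix i s' assume "P2 i s'" then show "aval mE s' = m \<and> s' 10 0 = i" using m c[of s'] unfolding P2_def by auto
  next
    fix i s' assume h: "i < m" "P2 i s'"
    have e: "s' 10 0 = i" "eqx ?M s s'" "\<And>v. v < n \<Longrightarrow> s' 6 v = deg ?S ?e v \<and> s' 7 v = \<Sum>(inc ?S ?e v) \<and> s' 8 v = card (?J v i)" using h unfolding P2_def by auto
    note cc = c[OF e(2)]
    show "run tab2 s' (cost tab2) (\<lambda>s'. s' 10 0 = i \<and> P2 (Suc i) (set0 10 (Suc i) s'))"
    proof (rule run_ev')
      show "ev tab2 s' 10 0 = i \<and> P2 (Suc i) (set0 10 (Suc i) (ev tab2 s'))"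
      proof (cases "i \<in> ?S")
        case True
        note en = ends[OF True]
        have al: "0 < s 5 i" using True unfolding alv_def by auto
        let ?t = "ev tab2 s'"
        let ?a = "s 1 i" and ?b = "s 2 i"
        have ot: "oth ?e i ?a = ?b" "oth ?e i ?b = ?a" using oth_eq[of ?e i ?a ?b] oth_eq[of ?e i ?b ?a] en by (auto simp: insert_commute)
        have t: "?t = s'(8 := (s' 8)(?a := s' 8 ?a + of_bool (3 \<le> deg ?S ?e ?b), ?b := s' 8 ?b + of_bool (3 \<le> deg ?S ?e ?a)))"
          using cc al e(1) en e(3)[of ?a] e(3)[of ?b] unfolding tab2_def bump_def by (auto simp: fun_eq_iff)
        have inc: "i \<in> inc ?S ?e v \<longleftrightarrow> v = ?a \<or> v = ?b" for v using True en unfolding inc_def by auto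
        have J: "?J v (Suc i) = (if i \<in> inc ?S ?e v \<and> 3 \<le> deg ?S ?e (oth ?e i v) then insert i (?J v i) else ?J v i)" for v
          by (auto simp: less_Suc_eq)
        have ni: "finite (?J v i)" "i \<notin> ?J v i" for v using fin by auto
        have v: "?t 6 v = deg ?S ?e v \<and> ?t 7 v = \<Sum>(inc ?S ?e v) \<and> ?t 8 v = card (?J v (Suc i))" if "v < n" for v
          using e(3)[OF that] en ot unfolding t J inc by (auto simp: ni)
        show ?thesis unfolding P2_def using v e(1,2) unfolding t eqx_def set0_def by auto
      next
        case False
        then have "ev tab2 s' = s'" using cc h(1) m e(1) unfolding tab2_def alv_def by simp
        moreover have "?J v (Suc i) = ?J v i" for v using False by (auto simp: inc_def less_Suc_eq)
        ultimately show ?thesis using e unfolding P2_def eqx_def set0_def by auto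
      qed
    qed (simp add: tab2_def bump_def)
  qed
  have "run tab s (n * (cost tab0 + 12 + acost nE) + 12 + acost nE + ((m * (cost tab1 + 12 + acost mE) + 12 + acost mE) + (m * (cost tab2 + 12 + acost mE) + 12 + acost mE))) (P2 m)"
    unfolding tab_def by (rule run_SeqI[OF r0], rule run_SeqI[OF r1]) (use r2 in auto)
  then show ?thesis
  proof (rule run_weaken)
    fix s' assume h: "P2 m s'"
    have J: "?J v m = {j \<in> inc ?S ?e v. 3 \<le> deg ?S ?e (oth ?e j v)}" for v
      using m unfolding inc_def alv_def by auto
    have q: "eqx ?M s s'" "\<And>v. v < n \<Longrightarrow> s' 6 v = deg ?S ?e v \<and> s' 7 v = \<Sum>(inc ?S ?e v) \<and> s' 8 v = card (?J v m)"
      using h unfolding P2_def by blast+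
    note cc = c[OF q(1)]
    have a: "alv s' = ?S" "eds s' = ?e" "s' 0 0 = n" using cc n alv_eds_cong[of s' s] by simp_all
    have "tabs s'" unfolding tabs_def a big_nbrs_def using q(2) unfolding J by blast
    then show "eqx ?M s s' \<and> tabs s'" using q(1) by blast
  qed (simp add: tab_time_def algebra_simps)
qed

section \<open>Testing candidates for a reduction\<close>

definition othE :: "aexp \<Rightarrow> aexp \<Rightarrow> aexp" where "othE i v = Sub (Add (Load 1 i) (Load 2 i)) v"
definition nxtE :: "aexp \<Rightarrow> aexp \<Rightarrow> aexp" where "nxtE i y = Sub (Load 7 y) i"
text \<open>Arithmetic expressions of the machine have no conditional. Case distinctions on degrees
  are therefore made between Boolean expressions, and \<open>conf4X\<close> multiplies out the cases
  for the ends of the two chains.\<close>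

definition IfB :: "bexp \<Rightarrow> bexp \<Rightarrow> bexp \<Rightarrow> bexp" where "IfB c a b = OrB (Conj c a) (Conj (Neg c) b)"
definition AndL :: "bexp list \<Rightarrow> bexp" where "AndL bs = foldr Conj bs (Less (Const 0) (Const 1))"

lemma bval_IfB: "bval (IfB c a b) s = bval (if bval c s then a else b) s" by (auto simp: IfB_def)
lemma bval_AndL [simp]: "bval (AndL bs) s \<longleftrightarrow> (\<forall>b\<in>set bs. bval b s)" unfolding AndL_def by (induction bs) auto

abbreviation "vE \<equiv> Sub (var 16) (Const 1)"
abbreviation "iE \<equiv> Sub (var 17) (Const 1)"
abbreviation "jE \<equiv> Sub (var 18) (Const 1)"

text \<open>Candidates for vertices and edges are drawn from the same range up to
  \<open>n + m\<close>. This test discards numbers that do not stand for an edge present, or for one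
  of its ends.\<close>

definition onE :: "aexp \<Rightarrow> aexp \<Rightarrow> bexp" where
  "onE v i = AndL [Less i mE, Less (Const 0) (Load 5 i), OrB (EqA (Load 1 i) v) (EqA (Load 2 i) v)]"

lemma bval_onE: "bval (onE v i) s \<longleftrightarrow> aval i s \<in> alv s \<and> aval v s \<in> eds s (aval i s)"
  unfolding onE_def alv_def eds_def by auto

definition singleB :: "bool \<Rightarrow> bexp" where
  "singleB tot = AndL [onE vE iE, Less (Load 6 vE) (Const 3),
     Less (Add (Load 6 vE) (Load 6 (othE iE vE))) (Add (var 12) (Const 2)),
     if tot then OrB (Neg (Less (var 12) (Const 4))) (Less (Load 6 vE) (Const 2)) else Less (Const 0) (Const 1)]"

lemma aval_othE:
  assumes G: "numbered_graph n (alv s) (eds s)" and "aval i s \<in> alv s"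
  shows "aval (othE i v) s = oth (eds s) (aval i s) (aval v s)"
proof -
  let ?i = "aval i s"
  have e: "eds s ?i = {s 1 ?i, s 2 ?i}" using assms unfolding alv_def eds_def by auto
  have "card (eds s ?i) = 2" using assms unfolding numbered_graph_def by auto
  then have "s 1 ?i \<noteq> s 2 ?i" unfolding e by auto
  then show ?thesis unfolding othE_def oth_def e by simp
qed

lemma bval_singleB:
  assumes G: "numbered_graph n (alv s) (eds s)" and T: "tabs s" and n: "s 0 0 = n" and k: "s 12 0 = k"
  shows "bval (singleB tot) s \<longleftrightarrow> single_step k tot (alv s) (eds s) (s 17 0 - 1) (s 16 0 - 1)"
proof -
  let ?S = "alv s" and ?e = "eds s" and ?i = "s 17 0 - 1" and ?u = "s 16 0 - 1"
  show ?thesis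
  proof (cases "?i \<in> ?S \<and> ?u \<in> ?e ?i")
    case False
    then have "\<not> single_step k tot ?S ?e ?i ?u" unfolding single_step_def by auto
    moreover have "\<not> bval (onE vE iE) s" using False by (simp add: bval_onE)
    ultimately show ?thesis unfolding singleB_def by auto
  next
    case True
    note o = ed_oth[OF G, of ?i ?u]
    have e: "?e ?i = {?u, oth ?e ?i ?u}" "oth ?e ?i ?u \<noteq> ?u" "oth ?e ?i ?u < n" "?u < n" "?i \<in> inc ?S ?e ?u" using o True by auto
    have ov: "aval (othE iE vE) s = oth ?e ?i ?u" using aval_othE[OF G, of iE vE] True by simp
    have d: "s 6 ?u = deg ?S ?e ?u" "s 6 (oth ?e ?i ?u) = deg ?S ?e (oth ?e ?i ?u)" using T e n unfolding tabs_def by auto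
    have one: "1 \<le> deg ?S ?e ?u" using deg_pos[OF G e(5)] .
    have uniq: "v = oth ?e ?i ?u" if "?e ?i = {v, ?u}" "v \<noteq> ?u" for v using that e(1,2) by (auto simp: doubleton_eq_iff)
    have "single_step k tot ?S ?e ?i ?u \<longleftrightarrow> deg ?S ?e (oth ?e ?i ?u) + deg ?S ?e ?u \<le> k + 1 \<and> deg ?S ?e ?u \<le> 2 \<and> (tot \<and> k < 4 \<longrightarrow> deg ?S ?e ?u = 1)"
      unfolding single_step_def deg_def[symmetric] using uniq True e(1,2) by (auto simp: insert_commute)
    moreover have "bval (singleB tot) s \<longleftrightarrow> deg ?S ?e ?u < 3 \<and> deg ?S ?e ?u + deg ?S ?e (oth ?e ?i ?u) < k + 2 \<and> (tot \<longrightarrow> \<not> k < 4 \<or> deg ?S ?e ?u < 2)"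
      unfolding singleB_def using True ov d k by (auto simp: bval_onE)
    ultimately show ?thesis using one by auto
  qed
qed

abbreviation "y1E \<equiv> othE iE vE"
abbreviation "y2E \<equiv> othE jE vE"
abbreviation "f1E \<equiv> nxtE iE y1E"
abbreviation "f2E \<equiv> nxtE jE y2E"
abbreviation "w1E \<equiv> othE f1E y1E"
abbreviation "w2E \<equiv> othE f2E y2E"
abbreviation "e3E \<equiv> Sub (Load 7 vE) (Add iE jE)"
abbreviation "l1E \<equiv> nxtE f1E w1E"
abbreviation "l2E \<equiv> nxtE f2E w2E"
abbreviation "is2 a \<equiv> EqA (Load 6 a) (Const 2)"

definition preB :: bexp where
  "preB = AndL [onE vE iE, onE vE jE, Neg (EqA iE jE), is2 y1E, is2 y2E]"

definition starB :: "aexp \<Rightarrow> bexp" where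
  "starB x = AndL [EqA (Load 8 vE) (Const 0), Neg (EqA w1E x), Neg (EqA w2E x)]"

definition chainB :: "aexp \<Rightarrow> aexp \<Rightarrow> aexp \<Rightarrow> bexp" where
  "chainB x W1 W2 = AndL [EqA W1 W2, Neg (EqA W1 vE), Neg (EqA W1 x)]"

definition conf4X :: "aexp \<Rightarrow> bexp" where
  "conf4X x = OrB (EqA f1E f2E) (OrB (starB x)
     (IfB (is2 w1E) (IfB (is2 w2E) (chainB x (othE l1E w1E) (othE l2E w2E)) (chainB x (othE l1E w1E) w2E))
        (IfB (is2 w2E) (chainB x w1E (othE l2E w2E)) (chainB x w1E w2E))))"

definition conf4B :: bexp where
  "conf4B = IfB (EqA (Load 6 vE) (Const 3)) (conf4X (othE e3E vE)) (conf4X y1E)"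

definition confB :: "bool \<Rightarrow> bexp" where
  "confB tot = Conj preB (if tot then IfB (Less (var 12) (Const 4)) conf4B (Less (Load 8 vE) (Const 2)) else Less (Load 8 vE) (Const 2))"

text \<open>The tables are correct at vertices below \<open>n\<close>, and the differences of sums
  are correct for actual ends and incident edges; \<open>pre_conf\<close> guarantees both. The flag
  \<open>three\<close> makes the degree bound available where the third edge at \<open>v\<close> is
  evaluated.\<close>

lemma conf_values:
  assumes G: "numbered_graph n (alv s) (eds s)" and T: "tabs s" and n: "s 0 0 = n" and d3: "three \<Longrightarrow> deg (alv s) (eds s) (s 16 0 - 1) \<le> 3"
  defines "S \<equiv> alv s" and "e \<equiv> eds s" and "v \<equiv> s 16 0 - 1" and "i \<equiv> s 17 0 - 1" and "j \<equiv> s 18 0 - 1"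
  defines "y1 \<equiv> oth e i v" and "y2 \<equiv> oth e j v"
  defines "f1 \<equiv> nxt S e i y1" and "f2 \<equiv> nxt S e j y2"
  defines "w1 \<equiv> oth e f1 y1" and "w2 \<equiv> oth e f2 y2"
  assumes pc: "pre_conf S e v i j"
  shows "aval y1E s = y1" "aval y2E s = y2" "aval f1E s = f1" "aval f2E s = f2" "aval w1E s = w1" "aval w2E s = w2"
    "s 6 v = deg S e v" "s 8 v = big_nbrs S e v" "s 6 w1 = deg S e w1" "s 6 w2 = deg S e w2"
    "deg S e w1 = 2 \<Longrightarrow> aval l1E s = nxt S e f1 w1 \<and> aval (othE l1E w1E) s = oth e (nxt S e f1 w1) w1"
    "deg S e w2 = 2 \<Longrightarrow> aval l2E s = nxt S e f2 w2 \<and> aval (othE l2E w2E) s = oth e (nxt S e f2 w2) w2"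
    "deg S e v = 3 \<Longrightarrow> aval e3E s = third S e v i j"
    "three \<Longrightarrow> deg S e v = 3 \<Longrightarrow> aval (othE e3E vE) s = oth e (third S e v i j) v"
    "v < n" "y1 < n" "y2 < n" "w1 < n" "w2 < n" "f2 < s 0 1"
proof -
  note G' = G[folded S_def e_def]
  note u = pre_conf_unpack[OF G' pc, folded y1_def y2_def, folded f1_def f2_def, folded w1_def w2_def]
  show lt: "v < n" "y1 < n" "y2 < n" "w1 < n" "w2 < n" using u by auto
  show "f2 < s 0 1" using u(8) unfolding S_def alv_def by auto
  have iS: "i \<in> S" "j \<in> S" "i \<noteq> j" using pc unfolding pre_conf_def by auto
  have oE: "aval (othE a b) s = oth e (aval a s) (aval b s)" if "aval a s \<in> S" for a b
    using aval_othE[OF G] that unfolding S_def e_def by auto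
  have v: "aval vE s = v" "aval iE s = i" "aval jE s = j" unfolding v_def i_def j_def by auto
  have t: "s 6 x = deg S e x" "s 7 x = \<Sum>(inc S e x)" "s 8 x = big_nbrs S e x" if "x < n" for x
    using T n that unfolding tabs_def S_def e_def by auto
  show y: "aval y1E s = y1" "aval y2E s = y2" using oE[of iE vE] oE[of jE vE] iS v unfolding y1_def y2_def by simp_all
  have nE': "aval (nxtE a b) s = nxt S e (aval a s) (aval b s)" if "aval b s < n" for a b
    using t(2)[OF that] unfolding nxtE_def nxt_def by simp
  show f: "aval f1E s = f1" "aval f2E s = f2" using nE'[of y1E iE] nE'[of y2E jE] y lt v unfolding f1_def f2_def by simp_all
  show w: "aval w1E s = w1" "aval w2E s = w2" using oE[of f1E y1E] oE[of f2E y2E] f y u(7,8) unfolding w1_def w2_def by simp_all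
  show "s 6 v = deg S e v" "s 8 v = big_nbrs S e v" "s 6 w1 = deg S e w1" "s 6 w2 = deg S e w2" using t lt by auto
  show "aval l1E s = nxt S e f1 w1 \<and> aval (othE l1E w1E) s = oth e (nxt S e f1 w1) w1" if d: "deg S e w1 = 2"
  proof -
    have l: "aval l1E s = nxt S e f1 w1" using nE'[of w1E f1E] w f lt by simp
    have "nxt S e f1 w1 \<in> S" using inc_nxt(3)[OF G' u(27) d] .
    then show ?thesis using oE[of l1E w1E] l w by simp
  qed
  show "aval l2E s = nxt S e f2 w2 \<and> aval (othE l2E w2E) s = oth e (nxt S e f2 w2) w2" if d: "deg S e w2 = 2"
  proof -
    have l: "aval l2E s = nxt S e f2 w2" using nE'[of w2E f2E] w f lt by simp
    have "nxt S e f2 w2 \<in> S" using inc_nxt(3)[OF G' u(28) d] .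
    then show ?thesis using oE[of l2E w2E] l w by simp
  qed
  show e3: "aval e3E s = third S e v i j" if "deg S e v = 3"
    using that t(2)[OF lt(1)] v unfolding third_def by simp
  show "aval (othE e3E vE) s = oth e (third S e v i j) v" if "three" "deg S e v = 3"
  proof -
    have "deg S e v \<le> 3" using that by simp
    then have "third S e v i j \<in> inc S e v" using inc_third(1)[OF G' u(20,21) iS(3)] by auto
    then have "third S e v i j \<in> S" unfolding inc_def by auto
    then show ?thesis using oE[of e3E vE] e3[OF that(2)] v by simp
  qed
qed

lemma bval_confB:
  assumes G: "numbered_graph n (alv s) (eds s)" and T: "tabs s" and n: "s 0 0 = n" and k: "s 12 0 = k"
    and dk: "\<And>v. deg (alv s) (eds s) v \<le> k" "3 \<le> k"
  defines "S \<equiv> alv s" and "e \<equiv> eds s" and "v \<equiv> s 16 0 - 1" and "i \<equiv> s 17 0 - 1" and "j \<equiv> s 18 0 - 1"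
  defines "y1 \<equiv> oth e i v" and "y2 \<equiv> oth e j v"
  defines "f1 \<equiv> nxt S e i y1" and "f2 \<equiv> nxt S e j y2"
  defines "w1 \<equiv> oth e f1 y1" and "w2 \<equiv> oth e f2 y2"
  shows "bval (confB tot) s \<longleftrightarrow> pre_conf S e v i j \<and>
    (if tot \<and> k < 4 then conf4 S e v (oth e (third S e v i j) v) f1 w1 f2 w2 else big_nbrs S e v \<le> 1)"
proof (cases "pre_conf S e v i j")
  case False
  have "bval preB s \<longleftrightarrow> pre_conf S e v i j"
  proof (cases "bval (onE vE iE) s \<and> bval (onE vE jE) s")
    case True
    then have a: "i \<in> S" "j \<in> S" "v \<in> e i" "v \<in> e j" by (auto simp: bval_onE S_def e_def v_def i_def j_def)
    have "aval y1E s = y1" "aval y2E s = y2"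
      using aval_othE[OF G, of iE vE] aval_othE[OF G, of jE vE] a unfolding S_def e_def y1_def y2_def v_def i_def j_def by auto
    moreover have "y1 < n" "y2 < n" using ed_oth(3)[OF G] a unfolding S_def e_def y1_def y2_def by auto
    ultimately show ?thesis using True a T n unfolding preB_def pre_conf_def tabs_def
      by (auto simp: S_def e_def y1_def y2_def i_def j_def v_def)
  next
    case F: False
    then show ?thesis unfolding preB_def pre_conf_def by (auto simp: bval_onE S_def e_def v_def i_def j_def)
  qed
  then show ?thesis using False unfolding confB_def by simp
next
  case True
  have d3: "tot \<and> k < 4 \<Longrightarrow> deg (alv s) (eds s) (s 16 0 - 1) \<le> 3" using dk(1)[of "s 16 0 - 1"] by simp
  note cv = conf_values[OF G T n d3, folded S_def e_def v_def i_def j_def, folded y1_def y2_def, folded f1_def f2_def, folded w1_def w2_def, OF _ True]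
  have vE': "aval vE s = v" unfolding v_def by simp
  have iS: "i \<in> S" "j \<in> S" "i \<noteq> j" "v \<in> e i" "v \<in> e j" "deg S e y1 = 2" "deg S e y2 = 2"
    using True unfolding pre_conf_def y1_def y2_def by auto
  have "s 6 y1 = 2" "s 6 y2 = 2" using T n cv(16,17) iS unfolding tabs_def S_def e_def by auto
  then have pre: "bval preB s" unfolding preB_def using iS cv(1,2)
    by (auto simp: bval_onE S_def e_def v_def i_def j_def)
  have X: "bval (conf4X x) s \<longleftrightarrow> conf4 S e v (aval x s) f1 w1 f2 w2" for x
    unfolding conf4X_def conf4_def starB_def chainB_def far_end_def
    using cv(3-12) vE' by (auto simp: bval_IfB)
  show ?thesis
  proof (cases "tot \<and> k < 4")
    case tk: True
    have "bval conf4B s \<longleftrightarrow> conf4 S e v (oth e (third S e v i j) v) f1 w1 f2 w2"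
    proof (cases "deg S e v = 3")
      case True
      then show ?thesis unfolding conf4B_def bval_IfB using X cv(7) cv(14)[OF tk True] vE' by simp
    next
      case False
      then have "oth e (third S e v i j) v = y1" unfolding third_def y1_def by simp
      then show ?thesis unfolding conf4B_def bval_IfB using X cv(1,7) vE' False by simp
    qed
    then show ?thesis using True tk pre k unfolding confB_def by (simp add: bval_IfB)
  next
    case False
    then show ?thesis using True pre k cv(8) vE' unfolding confB_def by (auto simp: bval_IfB)
  qed
qed

section \<open>Recording reductions on a stack\<close>

fun seqs :: "com list \<Rightarrow> com" where
  "seqs [] = Skip" | "seqs (p # ps) = Seq p (seqs ps)"

lemma loop_free_seqs [simp]: "loop_free (seqs ps) \<longleftrightarrow> (\<forall>p\<in>set ps. loop_free p)"
  by (induction ps) auto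

definition assign :: "nat \<Rightarrow> aexp \<Rightarrow> com" where "assign a e = Store a (Const 0) e"

lemma ev_assign: "ev (assign a e) s = set0 a (aval e s) s"
  unfolding assign_def set0_def by simp

lemma loop_free_assign [simp]: "loop_free (assign a e)" unfolding assign_def by simp

primrec reads :: "aexp \<Rightarrow> nat set" where
  "reads (Const c) = {}" | "reads (Load a i) = insert a (reads i)"
| "reads (Add x y) = reads x \<union> reads y" | "reads (Sub x y) = reads x \<union> reads y"

lemma aval_cong: "(\<And>a. a \<in> reads e \<Longrightarrow> s a = t a) \<Longrightarrow> aval e s = aval e t"
  by (induction e) auto

text \<open>A reduction step is described by 14 numbers: the removed edges (0 to 5), the vertices whose colours are
  revised (6 to 11), the edge whose end was moved (12, the number of edges if there is none) and its other end (13).\<close>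
definition slots :: "aexp list \<Rightarrow> com" where
  "slots es = seqs (map (\<lambda>j. assign (20 + j) (es ! j)) [0..<14])"

definition loaded :: "store \<Rightarrow> store \<Rightarrow> nat list \<Rightarrow> bool" where
  "loaded s t xs \<longleftrightarrow> eqx {20..<34} s t \<and> length xs = 14 \<and> (\<forall>j<14. t (20 + j) 0 = xs ! j)"

text \<open>No expression reads a variable that is assigned here, so the successive assignments act
  like a simultaneous one.\<close>

lemma slots_ev:
  assumes l: "length es = 14" and r: "\<forall>e\<in>set es. reads e \<inter> {20..<34} = {}"
  shows "loaded s (ev (slots es) s) (map (\<lambda>e. aval e s) es)"
proof -
  have *: "eqx {20..<34} s (ev (seqs (map (\<lambda>j. assign (20 + j) (es ! j)) js)) s) \<and>
    (\<forall>j<14. ev (seqs (map (\<lambda>j. assign (20 + j) (es ! j)) js)) s (20 + j) 0 = (if j \<in> set js then aval (es ! j) s else s (20 + j) 0))"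
    if "set js \<subseteq> {..<14}" for js s
    using that
  proof (induction js arbitrary: s)
    case (Cons i js)
    let ?s = "set0 (20 + i) (aval (es ! i) s) s"
    have i: "i < 14" "set js \<subseteq> {..<14}" using Cons.prems by auto
    have e: "eqx {20..<34} s ?s" unfolding eqx_def set0_def using i by auto
    have a: "aval (es ! j) ?s = aval (es ! j) s" if "j < 14" for j
    proof (rule aval_cong)
      fix a assume "a \<in> reads (es ! j)"
      moreover have "es ! j \<in> set es" using l that by simp
      ultimately have "a \<notin> {20..<34}" using r by blast
      then show "?s a = s a" using e unfolding eqx_def by auto
    qed
    have b: "?s (20 + j) 0 = (if j = i then aval (es ! i) s else s (20 + j) 0)" for j unfolding set0_def by simp
    show ?case using Cons.IH[OF i(2), of ?s] eqx_trans[OF e] a b i by (auto simp: ev_assign)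
  qed simp
  show ?thesis unfolding loaded_def slots_def using *[of "[0..<14]" s] l by (simp add: subset_eq)
qed

lemma loop_free_slots [simp]: "loop_free (slots es)" unfolding slots_def by auto

text \<open>Lists of fewer than six edges or vertices are padded by repetition. Entry 12 is
  \<open>m\<close>, which means that no edge is moved.\<close>

definition single_slots :: com where
  "single_slots = slots [iE, iE, iE, iE, iE, iE, vE, vE, vE, vE, vE, vE, mE, Const 0]"

text \<open>If an edge is moved, it is \<open>f2\<close>: its end \<open>y2\<close>, which is entry
  7, is replaced by \<open>y1\<close>, which is entry 6, and its other end \<open>w2\<close> is
  entry 13.\<close>

definition pair_slots :: com where
  "pair_slots = Cond (EqA w1E w2E) (slots [iE, jE, iE, iE, iE, iE, y1E, y2E, y1E, y1E, y1E, y1E, mE, Const 0])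
     (slots [iE, jE, iE, iE, iE, iE, y1E, y2E, y1E, y1E, y1E, y1E, f2E, w2E])"

definition star_slots :: "aexp \<Rightarrow> aexp \<Rightarrow> com" where
  "star_slots e x = slots [iE, jE, e, e, e, e, vE, y1E, y2E, x, x, x, mE, Const 0]"

definition chain_slots :: "aexp \<Rightarrow> aexp \<Rightarrow> aexp \<Rightarrow> com" where
  "chain_slots l1 l2 W = slots [iE, jE, f1E, f2E, l1, l2, vE, y1E, y2E, w1E, w2E, W, mE, Const 0]"

definition chains_slots :: com where
  "chains_slots = Cond (is2 w1E) (Cond (is2 w2E) (chain_slots l1E l2E (othE l1E w1E)) (chain_slots l1E f2E (othE l1E w1E)))
     (Cond (is2 w2E) (chain_slots f1E l2E w1E) (chain_slots f1E f2E w1E))"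

definition conf4_slots :: com where
  "conf4_slots = Cond (EqA f1E f2E) (star_slots f1E y1E)
       (Cond (EqA (Load 6 vE) (Const 3))
          (Cond (starB (othE e3E vE)) (star_slots e3E (othE e3E vE)) chains_slots)
          (Cond (starB y1E) (star_slots iE y1E) chains_slots))"

text \<open>If no edge is moved, entry 12 is the number of edges, and the last two assignments hit
  the cell after the last edge, which represents nothing.\<close>

definition push :: com where
  "push = seqs (map (\<lambda>j. Store (60 + j) (var 13) (var (20 + j))) [0..<14] @ [assign 13 (Add (var 13) (Const 1))] @
     map (\<lambda>j. Store 5 (var (20 + j)) (Const 0)) [0..<6] @ [Store 1 (var 32) (var 26), Store 2 (var 32) (var 33)])"

definition flag :: "bexp \<Rightarrow> com" where "flag b = Cond b (assign 9 (Const 1)) (assign 9 (Const 0))"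

definition conf_slots :: "bool \<Rightarrow> com" where
  "conf_slots tot = (if tot then Cond (Less (var 12) (Const 4)) conf4_slots pair_slots else pair_slots)"

text \<open>Variable 15 is 0, so the slots are cells 0, that is, plain variables.\<close>

definition find :: "nat list \<Rightarrow> bexp \<Rightarrow> com" where
  "find as b = srch 0 (map (\<lambda>a. (a, 15)) as) 19 (flag b)"

text \<open>Configurations are searched for only after the search for a removable edge has failed;
  only then is the graph known to be chordless and without vertices of degree 1.\<close>

definition reduce :: "bool \<Rightarrow> com" where
  "reduce tot = Seq tab (Seq (assign 9 (Const 0)) (Seq (find [16, 17] (singleB tot))
     (Cond (Less (Const 0) (var 9)) (Seq single_slots push)
       (Seq (find [16, 17, 18] (confB tot))
          (Cond (Less (Const 0) (var 9)) (Seq (conf_slots tot) push) Skip)))))"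

definition removed :: "nat list \<Rightarrow> nat set" where "removed xs = set (take 6 xs)"
definition revised :: "nat list \<Rightarrow> nat set" where "revised xs = set (take 6 (drop 6 xs))"

text \<open>What the way back has to know about a reduction, with \<open>ed\<close> the ends before
  and \<open>ed'\<close> the ends after it. With four colours this is recolourability of the removed
  part, otherwise it is a single or a pair step between the two graphs.\<close>

definition stepok :: "bool \<Rightarrow> nat \<Rightarrow> nat \<Rightarrow> nat set \<Rightarrow> (nat \<Rightarrow> nat set) \<Rightarrow> nat list \<Rightarrow> (nat \<Rightarrow> nat set) \<Rightarrow> bool" where
  "stepok tot k n S ed xs ed' \<longleftrightarrow> numbered_graph n S ed \<and> removed xs \<subseteq> S \<and>
     (if tot \<and> k < 4 then recolourable n S ed (removed xs) (revised xs) \<and> (\<forall>i\<in>S - removed xs. ed' i = ed i)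
      else removed xs = {xs ! 0, xs ! 1} \<and> revised xs = {xs ! 6, xs ! 7} \<and>
        (xs ! 0 = xs ! 1 \<and> xs ! 6 = xs ! 7 \<and> single_step k tot S ed (xs ! 0) (xs ! 6) \<and> (\<forall>i\<in>S - removed xs. ed' i = ed i) \<or>
        pair_step k tot S ed (xs ! 0) (xs ! 1) (xs ! 6) (xs ! 7) ed'))"

text \<open>Describes both directions: with entry 6 of the record in place of \<open>u\<close> the
  edge \<open>g\<close> is moved, with entry 7 it is moved back.\<close>

definition merged :: "nat \<Rightarrow> nat \<Rightarrow> nat \<Rightarrow> nat \<Rightarrow> (nat \<Rightarrow> nat set) \<Rightarrow> nat \<Rightarrow> nat set" where
  "merged m g u w ed i = (if i = g \<and> g < m then {u, w} else ed i)"

lemma merged_none [simp]: "merged m m u w ed = ed" unfolding merged_def by auto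

definition stk :: "store \<Rightarrow> nat \<Rightarrow> nat list" where "stk s d = map (\<lambda>j. s (60 + j) d) [0..<14]"

lemma upt_slots: "[0..<14] = [0, 1, 2, 3, 4, 5, 6, 7, 8, 9, 10, 11, 12, 13]" "[0..<6] = [0, 1, 2, 3, 4, 5]"
  by (simp_all add: upt_rec)

lemma loaded_list:
  assumes "loaded s t xs"
  shows "xs = [t 20 0, t 21 0, t 22 0, t 23 0, t 24 0, t 25 0, t 26 0, t 27 0, t 28 0, t 29 0, t 30 0, t 31 0, t 32 0, t 33 0]"
proof -
  have "xs = map (\<lambda>j. t (20 + j) 0) [0..<14]" by (rule nth_equalityI) (use assms in \<open>auto simp: loaded_def\<close>)
  then show ?thesis by (simp add: upt_slots)
qed

lemma push_effect:
  assumes m: "s 0 1 = m" and l: "loaded r s xs"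
  defines "t \<equiv> ev push s"
  shows "alv t = alv s - removed xs" "eds t = merged m (xs ! 12) (xs ! 6) (xs ! 13) (eds s)"
    "t 13 0 = Suc (s 13 0)" "\<And>a. a \<notin> {1, 2, 5, 13} \<union> {60..<74} \<Longrightarrow> t a = s a"
    "stk t (s 13 0) = xs" "\<And>d. d \<noteq> s 13 0 \<Longrightarrow> stk t d = stk s d"
proof -
  note x = loaded_list[OF l]
  have t: "t = s(60 := (s 60)(s 13 0 := s 20 0), 61 := (s 61)(s 13 0 := s 21 0), 62 := (s 62)(s 13 0 := s 22 0),
     63 := (s 63)(s 13 0 := s 23 0), 64 := (s 64)(s 13 0 := s 24 0), 65 := (s 65)(s 13 0 := s 25 0),
     66 := (s 66)(s 13 0 := s 26 0), 67 := (s 67)(s 13 0 := s 27 0), 68 := (s 68)(s 13 0 := s 28 0),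
     69 := (s 69)(s 13 0 := s 29 0), 70 := (s 70)(s 13 0 := s 30 0), 71 := (s 71)(s 13 0 := s 31 0),
     72 := (s 72)(s 13 0 := s 32 0), 73 := (s 73)(s 13 0 := s 33 0), 13 := (s 13)(0 := Suc (s 13 0)),
     5 := (s 5)(s 20 0 := 0, s 21 0 := 0, s 22 0 := 0, s 23 0 := 0, s 24 0 := 0, s 25 0 := 0),
     1 := (s 1)(s 32 0 := s 26 0), 2 := (s 2)(s 32 0 := s 33 0))"
    unfolding t_def push_def upt_slots by (simp add: assign_def)
  show "alv t = alv s - removed xs" unfolding alv_def t removed_def x by auto
  show "eds t = merged m (xs ! 12) (xs ! 6) (xs ! 13) (eds s)" unfolding eds_def t merged_def x using m by (auto simp: fun_eq_iff)
  show "t 13 0 = Suc (s 13 0)" unfolding t by simp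
  show "t a = s a" if "a \<notin> {1, 2, 5, 13} \<union> {60..<74}" for a using that unfolding t by auto
  show "stk t (s 13 0) = xs" unfolding stk_def upt_slots x by (simp add: t)
  show "stk t d = stk s d" if "d \<noteq> s 13 0" for d using that unfolding stk_def upt_slots by (simp add: t)
qed

definition entry :: "bool \<Rightarrow> nat \<Rightarrow> nat \<Rightarrow> nat \<Rightarrow> nat set \<Rightarrow> (nat \<Rightarrow> nat set) \<Rightarrow> nat list \<Rightarrow> bool" where
  "entry tot k n m S ed xs \<longleftrightarrow> (let ed' = merged m (xs ! 12) (xs ! 6) (xs ! 13) ed in
     stepok tot k n S ed xs ed' \<and> step_inv k tot n (S - removed xs) ed' \<and>
     ed = merged m (xs ! 12) (xs ! 7) (xs ! 13) ed' \<and> removed xs \<noteq> {})"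

lemma merged_same: "ed g = {u, w} \<Longrightarrow> merged m g u w (merged m g u' w ed) = ed"
  unfolding merged_def by (auto simp: fun_eq_iff)

lemma entry_single:
  assumes I: "step_inv k tot n S ed" and st: "single_step k tot S ed e u" and k: "3 \<le> k"
  shows "entry tot k n m S ed [e, e, e, e, e, e, u, u, u, u, u, u, m, w]"
proof -
  have G: "numbered_graph n S ed" and e: "e \<in> S" using I st unfolding step_inv_def single_step_def by auto
  have r: "recolourable n S ed {e} {u}" if "tot \<and> k < 4"
  proof -
    have "k = 3" "tot" using that k by auto
    then show ?thesis using recolourable_single[OF _ G] st by simp
  qed
  have "step_inv k tot n (S - {e}) ed" by (rule step_inv_subset[OF I]) auto
  then show ?thesis using r G e st unfolding entry_def stepok_def removed_def revised_def by (auto simp: Let_def)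
qed

lemma entry_four:
  assumes I: "step_inv 3 True n S ed" and r: "recolourable n S ed R U" "R \<subseteq> S" "R \<noteq> {}"
    and x: "removed xs = R" "revised xs = U" "xs ! 12 = m"
  shows "entry True 3 n m S ed xs"
proof -
  have G: "numbered_graph n S ed" using I unfolding step_inv_def by auto
  have "step_inv 3 True n (S - R) ed" by (rule step_inv_subset[OF I]) auto
  then show ?thesis using r G x unfolding entry_def stepok_def by (auto simp: Let_def)
qed

definition conf :: "nat \<Rightarrow> bool \<Rightarrow> nat set \<Rightarrow> (nat \<Rightarrow> nat set) \<Rightarrow> nat \<Rightarrow> nat \<Rightarrow> nat \<Rightarrow> bool" where
  "conf k tot S e v i j \<longleftrightarrow> pre_conf S e v i j \<and>
    (if tot \<and> k < 4 then conf4 S e v (oth e (third S e v i j) v) (nxt S e i (oth e i v)) (oth e (nxt S e i (oth e i v)) (oth e i v))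
       (nxt S e j (oth e j v)) (oth e (nxt S e j (oth e j v)) (oth e j v)) else big_nbrs S e v \<le> 1)"

lemma reads_E: "reads (othE a b) = {1, 2} \<union> reads a \<union> reads b" "reads (nxtE a b) = insert 7 (reads a \<union> reads b)"
  unfolding othE_def nxtE_def by auto

lemma pair_entry:
  assumes I: "step_inv k tot n (alv s) (eds s)" and no: "\<And>e u. \<not> single_step k tot (alv s) (eds s) e u"
    and k: "3 \<le> k" "tot \<longrightarrow> 4 \<le> k" and T: "tabs s" and n: "s 0 0 = n" and m: "s 0 1 = m"
    and c: "conf k tot (alv s) (eds s) (s 16 0 - 1) (s 17 0 - 1) (s 18 0 - 1)"
  shows "\<exists>xs. loaded s (ev pair_slots s) xs \<and> entry tot k n m (alv s) (eds s) xs"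
proof -
  define S e v i j where d: "S = alv s" "e = eds s" "v = s 16 0 - 1" "i = s 17 0 - 1" "j = s 18 0 - 1"
  define y1 y2 where y: "y1 = oth e i v" "y2 = oth e j v"
  define f1 f2 where f: "f1 = nxt S e i y1" "f2 = nxt S e j y2"
  define w1 w2 where w: "w1 = oth e f1 y1" "w2 = oth e f2 y2"
  have G: "numbered_graph n (alv s) (eds s)" using I unfolding step_inv_def by auto
  have pc: "pre_conf S e v i j" "big_nbrs S e v \<le> 1" using c k(2) unfolding conf_def d by (auto split: if_splits)
  note cv0 = conf_values[where three = False, OF G T n, folded d, folded y, folded f, folded w, OF _ pc(1)]
  have cv: "aval y1E s = y1" "aval y2E s = y2" "aval f1E s = f1" "aval f2E s = f2" "aval w1E s = w1" "aval w2E s = w2" "f2 < s 0 1"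
    by (rule cv0(1), erule FalseE, rule cv0(2), erule FalseE, rule cv0(3), erule FalseE, rule cv0(4), erule FalseE,
      rule cv0(5), erule FalseE, rule cv0(6), erule FalseE, rule cv0(20), erule FalseE)
  note ps = pair_conf_step[OF I[folded d] no[folded d] k pc, folded y, folded f, folded w]
  have sx: "s 16 0 - 1 = v" "s 17 0 - 1 = i" "s 18 0 - 1 = j" unfolding d by auto
  have f2m: "f2 < m" using cv(7) m by simp
  let ?ed = "if w1 = w2 then e else e(f2 := {y1, w2})"
  show ?thesis
  proof (cases "w1 = w2")
    case True
    let ?xs = "[i, j, i, i, i, i, y1, y2, y1, y1, y1, y1, m, 0]"
    have ld: "loaded s (ev pair_slots s) ?xs"
    proof -
      have r: "\<forall>e\<in>set [iE, jE, iE, iE, iE, iE, y1E, y2E, y1E, y1E, y1E, y1E, mE, Const 0]. reads e \<inter> {20..<34} = {}"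
        by (simp add: reads_E)
      have "ev pair_slots s = ev (slots [iE, jE, iE, iE, iE, iE, y1E, y2E, y1E, y1E, y1E, y1E, mE, Const 0]) s" unfolding pair_slots_def ev.simps bval_EqA cv(5,6) using True by simp
      then show ?thesis using slots_ev[OF _ r, of s] m unfolding list.map cv(1-6) aval.simps sx by simp
    qed
    have "entry tot k n m S e ?xs"
      using ps True k G[folded d] pc(1) unfolding entry_def stepok_def removed_def revised_def
      by (auto simp: pre_conf_def insert_commute Let_def)
    then show ?thesis using ld unfolding d by blast
  next
    case False
    let ?xs = "[i, j, i, i, i, i, y1, y2, y1, y1, y1, y1, f2, w2]"
    have ld: "loaded s (ev pair_slots s) ?xs"
    proof -
      have r: "\<forall>e\<in>set [iE, jE, iE, iE, iE, iE, y1E, y2E, y1E, y1E, y1E, y1E, f2E, w2E]. reads e \<inter> {20..<34} = {}"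
        by (simp add: reads_E)
      have "ev pair_slots s = ev (slots [iE, jE, iE, iE, iE, iE, y1E, y2E, y1E, y1E, y1E, y1E, f2E, w2E]) s" unfolding pair_slots_def ev.simps bval_EqA cv(5,6) using False by simp
      then show ?thesis using slots_ev[OF _ r, of s] m unfolding list.map cv(1-6) aval.simps sx by simp
    qed
    have mg: "merged m f2 y1 w2 e = e(f2 := {y1, w2})" using f2m unfolding merged_def by auto
    have "entry tot k n m S e ?xs"
    proof -
      have "e = merged m f2 y2 w2 (merged m f2 y1 w2 e)" using merged_same[of e f2 y2 w2 m y1] ps(3) by simp
      moreover have "removed ?xs = {i, j}" "revised ?xs = {y1, y2}" unfolding removed_def revised_def by auto
      moreover have nk: "\<not> (tot \<and> k < 4)" using k(2) by auto
      ultimately show ?thesis using ps(1,2) False G[folded d] pc(1) mg unfolding entry_def stepok_def if_not_P[OF nk]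
        by (simp add: pre_conf_def Let_def)
    qed
    then show ?thesis using ld unfolding d by blast
  qed
qed

lemma conf4_entry:
  assumes I: "step_inv 3 True n (alv s) (eds s)" and no: "\<And>e u. \<not> single_step 3 True (alv s) (eds s) e u"
    and T: "tabs s" and n: "s 0 0 = n" and m: "s 0 1 = m"
    and c: "conf 3 True (alv s) (eds s) (s 16 0 - 1) (s 17 0 - 1) (s 18 0 - 1)"
  shows "\<exists>xs. loaded s (ev conf4_slots s) xs \<and> entry True 3 n m (alv s) (eds s) xs"
proof -
  define S e v i j where d: "S = alv s" "e = eds s" "v = s 16 0 - 1" "i = s 17 0 - 1" "j = s 18 0 - 1"
  define y1 y2 where y: "y1 = oth e i v" "y2 = oth e j v"
  define f1 f2 where f: "f1 = nxt S e i y1" "f2 = nxt S e j y2"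
  define w1 w2 where w: "w1 = oth e f1 y1" "w2 = oth e f2 y2"
  define e3 where e3: "e3 = third S e v i j"
  define x where x: "x = oth e e3 v"
  define l1 l2 W where l: "l1 = far_edge S e f1 w1" "l2 = far_edge S e f2 w2" "W = far_end S e f1 w1"
  have G: "numbered_graph n (alv s) (eds s)" and d3: "\<And>v. deg (alv s) (eds s) v \<le> 3" using I unfolding step_inv_def by auto
  have pc: "pre_conf S e v i j" and c4: "conf4 S e v x f1 w1 f2 w2"
    using c unfolding conf_def x e3 w f y d by auto
  note cv = conf_values[where three = True, OF G T n d3, folded d, folded y, folded f, folded w, folded e3, folded x, OF pc]
  note rc = conf4_recolourable[OF I[folded d] no[folded d] pc, folded y, folded f, folded w, folded e3, folded x, folded l, OF c4]
  have ij: "i \<in> S" "j \<in> S" using pc unfolding pre_conf_def by auto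
  have sx: "s 16 0 - 1 = v" "s 17 0 - 1 = i" "s 18 0 - 1 = j" unfolding d by auto
  have star: "loaded s (ev (star_slots a b) s) [i, j, aval a s, aval a s, aval a s, aval a s, v, y1, y2, aval b s, aval b s, aval b s, m, 0]"
    if "reads a \<inter> {20..<34} = {}" "reads b \<inter> {20..<34} = {}" for a b
  proof -
    have r: "\<forall>e\<in>set [iE, jE, a, a, a, a, vE, y1E, y2E, b, b, b, mE, Const 0]. reads e \<inter> {20..<34} = {}"
      using that by (simp add: reads_E)
    show ?thesis using slots_ev[OF _ r, of s] m unfolding star_slots_def list.map cv(1,2) aval.simps sx by simp
  qed
  have chain: "loaded s (ev (chain_slots a b c) s) [i, j, f1, f2, aval a s, aval b s, v, y1, y2, w1, w2, aval c s, m, 0]"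
    if "reads a \<inter> {20..<34} = {}" "reads b \<inter> {20..<34} = {}" "reads c \<inter> {20..<34} = {}" for a b c
  proof -
    have r: "\<forall>e\<in>set [iE, jE, f1E, f2E, a, b, vE, y1E, y2E, w1E, w2E, c, mE, Const 0]. reads e \<inter> {20..<34} = {}"
      using that by (simp add: reads_E)
    show ?thesis using slots_ev[OF _ r, of s] m unfolding chain_slots_def list.map cv(1-6) aval.simps sx by simp
  qed
  have chains: "loaded s (ev chains_slots s) [i, j, f1, f2, l1, l2, v, y1, y2, w1, w2, W, m, 0]"
    unfolding chains_slots_def l far_edge_def far_end_def
    using chain[of l1E l2E "othE l1E w1E"] chain[of l1E f2E "othE l1E w1E"] chain[of f1E l2E w1E] chain[of f1E f2E w1E] cv(3-6,9-12)
    by (cases "deg S e w1 = 2"; cases "deg S e w2 = 2"; simp add: reads_E)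
  have "\<exists>xs. loaded s (ev conf4_slots s) xs \<and> entry True 3 n m S e xs"
  proof (cases "f1 = f2")
    case True
    have "loaded s (ev conf4_slots s) [i, j, f1, f1, f1, f1, v, y1, y2, y1, y1, y1, m, 0]"
      using star[of f1E y1E] True cv(1,3,4) unfolding conf4_slots_def by (simp add: reads_E)
    moreover have "entry True 3 n m S e [i, j, f1, f1, f1, f1, v, y1, y2, y1, y1, y1, m, 0]"
      by (rule entry_four[OF I[folded d] rc(1)[OF True]]) (use ij rc(4) in \<open>auto simp: removed_def revised_def\<close>)
    ultimately show ?thesis by blast
  next
    case F: False
    let ?b = "big_nbrs S e v = 0 \<and> w1 \<noteq> x \<and> w2 \<noteq> x"
    have e3': "deg S e v \<noteq> 3 \<Longrightarrow> e3 = i \<and> x = y1" unfolding x e3 third_def y by simp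
    have sb: "bval (starB a) s \<longleftrightarrow> big_nbrs S e v = 0 \<and> w1 \<noteq> aval a s \<and> w2 \<noteq> aval a s" for a
      using cv(5,6) cv(8)[unfolded d(3)] unfolding starB_def d(3) by simp
    have ev4: "ev conf4_slots s = (if deg S e v = 3 then if ?b then ev (star_slots e3E (othE e3E vE)) s else ev chains_slots s
        else if ?b then ev (star_slots iE y1E) s else ev chains_slots s)"
      using F cv(14) e3' unfolding conf4_slots_def ev.simps bval_EqA sb aval.simps sx cv(1,3,4,7) by auto
    show ?thesis
    proof (cases ?b)
      case True
      have "loaded s (ev conf4_slots s) [i, j, e3, e3, e3, e3, v, y1, y2, x, x, x, m, 0]"
      proof (cases "deg S e v = 3")
        case D: True
        show ?thesis using star[of e3E "othE e3E vE", unfolded cv(13)[OF D] cv(14)[OF TrueI D]] D True unfolding ev4 by (simp add: reads_E)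
      next
        case D: False
        show ?thesis using star[of iE y1E, unfolded cv(1) aval.simps sx] D True e3'[OF D] unfolding ev4 by (simp add: reads_E)
      qed
      moreover have "entry True 3 n m S e [i, j, e3, e3, e3, e3, v, y1, y2, x, x, x, m, 0]"
        by (rule entry_four[OF I[folded d] rc(2)[OF F True]]) (use ij rc(4) in \<open>auto simp: removed_def revised_def\<close>)
      ultimately show ?thesis by blast
    next
      case False
      have "loaded s (ev conf4_slots s) [i, j, f1, f2, l1, l2, v, y1, y2, w1, w2, W, m, 0]"
        using chains unfolding ev4 if_not_P[OF False] by simp
      moreover have "entry True 3 n m S e [i, j, f1, f2, l1, l2, v, y1, y2, w1, w2, W, m, 0]"
        by (rule entry_four[OF I[folded d] rc(3)[OF F False]]) (use ij rc(4-6) in \<open>auto simp: removed_def revised_def\<close>)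
      ultimately show ?thesis by blast
    qed
  qed
  then show ?thesis unfolding d .
qed

lemma conf_entry:
  assumes I: "step_inv k tot n (alv s) (eds s)" and no: "\<And>e u. \<not> single_step k tot (alv s) (eds s) e u"
    and k: "3 \<le> k" "s 12 0 = k" and T: "tabs s" and n: "s 0 0 = n" and m: "s 0 1 = m"
    and c: "conf k tot (alv s) (eds s) (s 16 0 - 1) (s 17 0 - 1) (s 18 0 - 1)"
  shows "\<exists>xs. loaded s (ev (conf_slots tot) s) xs \<and> entry tot k n m (alv s) (eds s) xs"
proof (cases "tot \<and> k < 4")
  case True
  then have tk: "tot = True" "k = 3" using k by auto
  show ?thesis using conf4_entry[OF I[unfolded tk] no[unfolded tk] T n m c[unfolded tk]] k(2) unfolding conf_slots_def tk by simp
next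
  case False
  then have "tot \<longrightarrow> 4 \<le> k" by auto
  from pair_entry[OF I no k(1) this T n m c] show ?thesis using False k(2) unfolding conf_slots_def by (cases tot) simp_all
qed

lemma run_find:
  assumes as: "set as \<subseteq> {16, 17, 18}" "length as \<le> 3" and s: "s 9 0 = 0" "s 19 0 = B"
    and b: "\<And>t. eqx ({16, 17, 18} \<union> temps) s t \<Longrightarrow> bval b t \<longleftrightarrow> Q (t 16 0) (t 17 0) (t 18 0)"
  shows "run (find as b) s (srch_time B (cost (flag b)) (length as)) (\<lambda>s'. eqx ({16, 17, 18} \<union> temps) s s' \<and>
    (s' 9 0 = 1 \<and> Q (s' 16 0) (s' 17 0) (s' 18 0) \<or>
     s' 9 0 = 0 \<and> (\<forall>cs w. length cs = length as \<and> set cs \<subseteq> {1..B} \<and> w = wr (map (\<lambda>a. (a, 15)) as) cs s \<longrightarrow> \<not> Q (w 16 0) (w 17 0) (w 18 0))))"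
proof -
  let ?sl = "map (\<lambda>a. (a, 15)) as :: (nat \<times> nat) list" and ?M = "{16, 17, 18} \<union> temps"
  have gs: "good_slots ?sl" unfolding good_slots_def temps_def using as(1) by force
  have J: "eqx ?M s u" if h: "eqx ?M s t" "same_off (cells ?sl t) t u" for t u
    unfolding eqx_def
  proof (intro allI impI)
    fix a assume a: "a \<notin> ?M"
    have "t a i = u a i" for i
    proof -
      have "(a, i) \<notin> cells ?sl t" by (rule not_in_cells) (use a as(1) in auto)
      then show ?thesis using h(2) a unfolding same_off_def by auto
    qed
    then show "s a = u a" using h(1) a unfolding eqx_def by auto
  qed
  have "run (srch 0 ?sl 19 (flag b)) s (srch_time B (cost (flag b)) (length ?sl)) (\<lambda>s'. same_off (cells ?sl s) s s' \<and> (\<forall>a\<in>{40..<40 + 0}. s' a = s a) \<and>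
     ((s' 9 0 = 1 \<and> Q (s' 16 0) (s' 17 0) (s' 18 0) \<and> (\<forall>(a, b)\<in>set ?sl. 1 \<le> s' a (s b 0) \<and> s' a (s b 0) \<le> B)) \<or>
      (s' 9 0 = 0 \<and> (\<forall>cs. length cs = length ?sl \<and> set cs \<subseteq> {1..B} \<longrightarrow> \<not> Q (wr ?sl cs s 16 0) (wr ?sl cs s 17 0) (wr ?sl cs s 18 0)))))"
  proof (rule run_srch[where J = "eqx ?M s" and sl0 = ?sl and OK = "\<lambda>t. Q (t 16 0) (t 17 0) (t 18 0)"])
    fix t assume t: "eqx ?M s t"
    show "run (flag b) t (cost (flag b)) (\<lambda>s'. eqx {9, 10} t s' \<and> s' 9 0 = of_bool (Q (t 16 0) (t 17 0) (t 18 0)))"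
      by (rule run_ev') (use b[OF t] in \<open>auto simp: flag_def ev_assign set0_def eqx_def\<close>)
  next
    fix t u assume "eqx temps t u"
    then have "t 16 = u 16" "t 17 = u 17" "t 18 = u 18" unfolding eqx_def temps_def by auto
    then show "Q (t 16 0) (t 17 0) (t 18 0) = Q (u 16 0) (u 17 0) (u 18 0)" by simp
  next
    fix t u assume "eqx ?M s t" "same_off (cells ?sl t) t u" then show "eqx ?M s u" by (rule J)
  qed (use gs as s in \<open>auto simp: temps_def\<close>)
  then show ?thesis unfolding find_def
    by (rule run_weaken) (use J[of s] in auto)
qed

lemma tabs_cong:
  assumes "eqx M s t" "tabs s" "M \<inter> {0, 1, 2, 5, 6, 7, 8} = {}" shows "tabs t"
proof -
  have e: "t a = s a" if "a \<in> {0, 1, 2, 5, 6, 7, 8}" for a using assms(1,3) that unfolding eqx_def by (metis disjoint_iff)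
  have "alv t = alv s" "eds t = eds s" using alv_eds_cong[of t s] e by auto
  then show ?thesis using assms(2) e unfolding tabs_def by auto
qed

definition reduce_time :: "bool \<Rightarrow> nat \<Rightarrow> nat \<Rightarrow> nat" where
  "reduce_time tot n m = tab_time n m + (3 + (srch_time (n + m) (cost (flag (singleB tot))) 2 + (5 + (cost (Seq single_slots push) +
     (srch_time (n + m) (cost (flag (confB tot))) 3 + (5 + (cost (Seq (conf_slots tot) push) + 1)))))))"

definition pushed :: "bool \<Rightarrow> nat \<Rightarrow> nat \<Rightarrow> nat \<Rightarrow> store \<Rightarrow> store \<Rightarrow> bool" where
  "pushed tot k n m s t \<longleftrightarrow> (\<exists>xs. removed xs \<subseteq> alv s \<and> removed xs \<noteq> {} \<and> alv t = alv s - removed xs \<and>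
     eds s = merged m (xs ! 12) (xs ! 7) (xs ! 13) (eds t) \<and> stepok tot k n (alv s) (eds s) xs (eds t) \<and>
     t 13 0 = Suc (s 13 0) \<and> stk t (s 13 0) = xs \<and> (\<forall>d. d \<noteq> s 13 0 \<longrightarrow> stk t d = stk s d))"

text \<open>Neither the colours nor the parameters set up by the initialisation belong to it, so
  they survive all reductions.\<close>

definition workspace :: "nat set" where
  "workspace = {1, 2, 5, 6, 7, 8, 13, 16, 17, 18} \<union> temps \<union> {20..<34} \<union> {60..<74}"

lemma pushed_entry:
  assumes e: "entry tot k n m (alv r) (eds r) xs" and l: "loaded r s xs" and m: "r 0 1 = m"
  shows "pushed tot k n m r (ev push s) \<and> step_inv k tot n (alv (ev push s)) (eds (ev push s)) \<and> eqx workspace r (ev push s)"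
proof -
  have q: "eqx {20..<34} r s" using l unfolding loaded_def by simp
  have a: "s a = r a" if "a \<notin> {20..<34}" for a using q that unfolding eqx_def by auto
  have c: "alv s = alv r" "eds s = eds r" "s 13 = r 13" "s 0 1 = m" using alv_eds_cong[of s r] a m by auto
  have st: "stk s d = stk r d" for d using a unfolding stk_def by auto
  note p = push_effect[OF c(4) l, unfolded c st]
  have "eqx workspace r (ev push s)" unfolding eqx_def
  proof (intro allI impI)
    fix b assume "b \<notin> workspace"
    then show "r b = ev push s b" using p(4)[of b] a[of b] unfolding workspace_def by auto
  qed
  moreover have "stepok tot k n (alv r) (eds r) xs (eds (ev push s))" "step_inv k tot n (alv r - removed xs) (eds (ev push s))"
    "eds r = merged m (xs ! 12) (xs ! 7) (xs ! 13) (eds (ev push s))" "removed xs \<noteq> {}"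
    using e unfolding entry_def p(2) Let_def by blast+
  moreover from this(1) have "removed xs \<subseteq> alv r" unfolding stepok_def by blast
  ultimately show ?thesis unfolding pushed_def p(1) using p(3,5,6) by blast
qed

lemma loop_free_push [simp]: "loop_free push" unfolding push_def by auto
lemma loop_free_conf_slots [simp]: "loop_free (conf_slots tot)"
  unfolding conf_slots_def pair_slots_def conf4_slots_def chains_slots_def chain_slots_def star_slots_def by auto

lemma pushed_cong:
  assumes "pushed tot k n m r t" "eqx M s r" "M \<inter> ({0, 1, 2, 5, 13} \<union> {60..<74}) = {}"
  shows "pushed tot k n m s t"
proof -
  have e: "r a = s a" if "a \<in> {0, 1, 2, 5, 13} \<union> {60..<74}" for a using assms(2,3) that unfolding eqx_def by (metis disjoint_iff)
  have c: "alv r = alv s" "eds r = eds s" "r 13 = s 13" using alv_eds_cong[of r s] e by auto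
  have st: "stk r = stk s" using e unfolding stk_def by (auto simp: fun_eq_iff)
  show ?thesis using assms(1) unfolding pushed_def c st .
qed

text \<open>The searches fail only for the graph without edges: if no edge is removable,
  \<open>ex_pair_conf\<close> or \<open>ex_conf4\<close> provides a configuration, and its three
  numbers, shifted by 1, lie within the search bound \<open>n + m\<close>.\<close>

lemma run_reduce:
  assumes I: "step_inv k tot n (alv s) (eds s)"
    and c: "s 0 0 = n" "s 0 1 = m" "s 12 0 = k" "s 19 0 = n + m" "s 15 0 = 0" and k: "3 \<le> k"
  shows "run (reduce tot) s (reduce_time tot n m) (\<lambda>t. eqx workspace s t \<and> step_inv k tot n (alv t) (eds t) \<and>
    (pushed tot k n m s t \<or> alv s = {} \<and> alv t = {} \<and> eds t = eds s \<and> t 13 0 = s 13 0 \<and> stk t = stk s))"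
    (is "run _ _ _ ?Q")
proof -
  let ?S = "alv s" and ?e = "eds s"
  have G: "numbered_graph n ?S ?e" and dk: "\<And>v. deg ?S ?e v \<le> k" using I unfolding step_inv_def by auto
  define M where "M = {6, 7, 8, 10, 16, 17, 18} \<union> temps"
  have Mw: "M \<subseteq> workspace" "{16, 17, 18} \<union> temps \<subseteq> M" "{6, 7, 8, 10} \<subseteq> M" "9 \<in> M" unfolding M_def workspace_def temps_def by auto
  have Mn: "a \<notin> M" if "a \<in> {0, 1, 2, 5, 12, 13, 15, 19} \<union> {60..<74}" for a using that unfolding M_def temps_def by auto
  have mono: "eqx B s t" if "eqx A s t" "A \<subseteq> B" for A B s t using that unfolding eqx_def by blast
  have keep: "alv t = ?S" "eds t = ?e" "t 0 0 = n" "t 0 1 = m" "t 12 0 = k" "t 19 0 = n + m" "t 15 0 = 0" "t 13 = s 13" "stk t = stk s" if h: "eqx M s t" for t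
  proof -
    have e: "t a = s a" if "a \<in> {0, 1, 2, 5, 12, 13, 15, 19} \<union> {60..<74}" for a using h Mn[OF that] unfolding eqx_def by auto
    show "alv t = ?S" "eds t = ?e" "t 0 0 = n" "t 0 1 = m" "t 12 0 = k" "t 19 0 = n + m" "t 15 0 = 0" "t 13 = s 13"
      using alv_eds_cong[of t s] e c by auto
    show "stk t = stk s" using e unfolding stk_def by (auto simp: fun_eq_iff)
  qed
  have alvlt: "i < m" if "i \<in> ?S" for i using that c(2) unfolding alv_def by auto
  have tabs': "tabs u" if "tabs t" "eqx ({16, 17, 18} \<union> temps) t u" for t u
    by (rule tabs_cong[OF that(2,1)]) (auto simp: temps_def)
  define st where "st u e \<longleftrightarrow> single_step k tot ?S ?e (e - 1) (u - 1)" for u e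
  define cf where "cf u x y \<longleftrightarrow> conf k tot ?S ?e (u - 1) (x - 1) (y - 1)" for u x y
  have finish: "?Q (ev push (ev p t))" if "loaded t (ev p t) xs" "entry tot k n m ?S ?e xs" "eqx M s t" for p t xs
  proof -
    note kt = keep[OF that(3)]
    have "pushed tot k n m t (ev push (ev p t)) \<and> step_inv k tot n (alv (ev push (ev p t))) (eds (ev push (ev p t))) \<and> eqx workspace t (ev push (ev p t))"
      by (rule pushed_entry[OF _ that(1) kt(4)]) (use that(2) kt in simp)
    moreover have "M \<inter> ({0, 1, 2, 5, 13} \<union> {60..<74}) = {}" using Mn by blast
    ultimately show ?thesis using pushed_cong[OF _ that(3)] eqx_trans[OF mono[OF that(3) Mw(1)]] by blast
  qed
  have r3: "run (Cond (Less (Const 0) (var 9)) (Seq (conf_slots tot) push) Skip) t (5 + (cost (Seq (conf_slots tot) push) + 1)) ?Q"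
    if t: "eqx M s t" "tabs t" and ns: "\<And>e u. \<not> single_step k tot ?S ?e e u"
      and fl: "t 9 0 = 1 \<and> cf (t 16 0) (t 17 0) (t 18 0) \<or> t 9 0 = 0 \<and> ?S = {}" for t
  proof -
    note kt = keep[OF t(1)]
    have "run (Cond (Less (Const 0) (var 9)) (Seq (conf_slots tot) push) Skip) t (cost (Cond (Less (Const 0) (var 9)) (Seq (conf_slots tot) push) Skip)) ?Q"
    proof (rule run_ev')
      show "?Q (ev (Cond (Less (Const 0) (var 9)) (Seq (conf_slots tot) push) Skip) t)"
      proof (cases "t 9 0 = 1")
        case True
        then have cc: "conf k tot ?S ?e (t 16 0 - 1) (t 17 0 - 1) (t 18 0 - 1)" using fl unfolding cf_def by simp
        obtain xs where "loaded t (ev (conf_slots tot) t) xs" "entry tot k n m ?S ?e xs"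
          using conf_entry[of k tot n t m, unfolded kt(1,2), OF I ns k kt(5) t(2) kt(3,4) cc] by blast
        from finish[OF this t(1)] show ?thesis using True by simp
      next
        case False
        then have "t 9 0 = 0" "?S = {}" using fl by auto
        then show ?thesis using kt I mono[OF t(1) Mw(1)] by simp
      qed
    qed simp
    then show ?thesis by (rule run_weaken) simp_all
  qed
  have r2: "run (Seq (find [16, 17, 18] (confB tot)) (Cond (Less (Const 0) (var 9)) (Seq (conf_slots tot) push) Skip)) t
      (srch_time (n + m) (cost (flag (confB tot))) 3 + (5 + (cost (Seq (conf_slots tot) push) + 1))) ?Q"
    if t: "eqx M s t" "tabs t" "t 9 0 = 0" and ns: "\<And>e u. \<not> single_step k tot ?S ?e e u" for t
  proof -
    note kt = keep[OF t(1)]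
    have b: "bval (confB tot) u \<longleftrightarrow> cf (u 16 0) (u 17 0) (u 18 0)" if u: "eqx ({16, 17, 18} \<union> temps) t u" for u
    proof -
      have "eqx M s u" using eqx_trans[OF t(1) mono[OF u Mw(2)]] .
      note ku = keep[OF this]
      show ?thesis using bval_confB[of n u k tot, unfolded ku(1,2), OF G tabs'[OF t(2) u] ku(3,5) dk k]
        unfolding cf_def conf_def by simp
    qed
    have l: "length [16, 17, 18::nat] = 3" by simp
    have f: "run (find [16, 17, 18] (confB tot)) t (srch_time (n + m) (cost (flag (confB tot))) 3) (\<lambda>s'. eqx ({16, 17, 18} \<union> temps) t s' \<and>
      (s' 9 0 = 1 \<and> cf (s' 16 0) (s' 17 0) (s' 18 0) \<or>
       s' 9 0 = 0 \<and> (\<forall>cs w. length cs = length [16, 17, 18::nat] \<and> set cs \<subseteq> {1..n + m} \<and> w = wr (map (\<lambda>a. (a, 15)) [16, 17, 18]) cs t \<longrightarrow> \<not> cf (w 16 0) (w 17 0) (w 18 0))))"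
      using run_find[of "[16, 17, 18]" t "n + m" "confB tot" cf, OF _ _ t(3) kt(6) b] unfolding l by simp
    show ?thesis
    proof (rule run_SeqI[OF f], rule r3)
      fix u assume h: "eqx ({16, 17, 18} \<union> temps) t u \<and>
      (u 9 0 = 1 \<and> cf (u 16 0) (u 17 0) (u 18 0) \<or>
       u 9 0 = 0 \<and> (\<forall>cs w. length cs = length [16, 17, 18::nat] \<and> set cs \<subseteq> {1..n + m} \<and> w = wr (map (\<lambda>a. (a, 15)) [16, 17, 18]) cs t \<longrightarrow> \<not> cf (w 16 0) (w 17 0) (w 18 0)))"
      then show "eqx M s u" using eqx_trans[OF t(1) mono[OF _ Mw(2)]] by blast
      show "tabs u" using tabs'[OF t(2)] h by blast
      show "u 9 0 = 1 \<and> cf (u 16 0) (u 17 0) (u 18 0) \<or> u 9 0 = 0 \<and> ?S = {}"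
      proof (cases "u 9 0 = 1 \<and> cf (u 16 0) (u 17 0) (u 18 0)")
        case False
        then have z: "u 9 0 = 0" and al: "\<And>cs w. length cs = length [16, 17, 18::nat] \<Longrightarrow> set cs \<subseteq> {1..n + m} \<Longrightarrow> w = wr (map (\<lambda>a. (a, 15)) [16, 17, 18]) cs t \<Longrightarrow> \<not> cf (w 16 0) (w 17 0) (w 18 0)"
          using h by blast+
        have "?S = {}"
        proof (rule ccontr)
          assume ne: "?S \<noteq> {}"
          have "\<exists>v i j. conf k tot ?S ?e v i j"
          proof (cases "tot \<and> k < 4")
            case True
            then have tk: "tot = True" "k = 3" using k by auto
            show ?thesis using ex_conf4[OF I[unfolded tk] ns[unfolded tk] ne] unfolding conf_def tk by simp
          next
            case False
            then have "tot \<longrightarrow> 4 \<le> k" by auto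
            from ex_pair_conf[OF I ns ne k this] show ?thesis using False unfolding conf_def by auto
          qed
          then obtain v i j where cc: "conf k tot ?S ?e v i j" by blast
          then have pc: "i \<in> ?S" "j \<in> ?S" "v \<in> ?e i" unfolding conf_def pre_conf_def by auto
          then have "v < n" using ed_oth(4)[OF G] by blast
          then have "set [Suc v, Suc i, Suc j] \<subseteq> {1..n + m}" using alvlt pc by fastforce
          from al[OF _ this refl] show False using cc kt(7) by (simp add: cf_def)
        qed
        then show ?thesis using z by simp
      qed simp
    qed (use ns in blast)
  qed
  have r1: "run (Seq (find [16, 17] (singleB tot)) (Cond (Less (Const 0) (var 9)) (Seq single_slots push)
       (Seq (find [16, 17, 18] (confB tot)) (Cond (Less (Const 0) (var 9)) (Seq (conf_slots tot) push) Skip)))) t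
      (srch_time (n + m) (cost (flag (singleB tot))) 2 + (5 + (cost (Seq single_slots push) +
     (srch_time (n + m) (cost (flag (confB tot))) 3 + (5 + (cost (Seq (conf_slots tot) push) + 1)))))) ?Q"
    if t: "eqx M s t" "tabs t" "t 9 0 = 0" for t
  proof -
    note kt = keep[OF t(1)]
    have b: "bval (singleB tot) u \<longleftrightarrow> st (u 16 0) (u 17 0)" if u: "eqx ({16, 17, 18} \<union> temps) t u" for u
    proof -
      have "eqx M s u" using eqx_trans[OF t(1) mono[OF u Mw(2)]] .
      note ku = keep[OF this]
      show ?thesis using bval_singleB[of n u k tot, unfolded ku(1,2), OF G tabs'[OF t(2) u] ku(3,5)] unfolding st_def by simp
    qed
    have l: "length [16, 17::nat] = 2" by simp
    have f: "run (find [16, 17] (singleB tot)) t (srch_time (n + m) (cost (flag (singleB tot))) 2) (\<lambda>s'. eqx ({16, 17, 18} \<union> temps) t s' \<and>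
      (s' 9 0 = 1 \<and> st (s' 16 0) (s' 17 0) \<or>
       s' 9 0 = 0 \<and> (\<forall>cs w. length cs = length [16, 17::nat] \<and> set cs \<subseteq> {1..n + m} \<and> w = wr (map (\<lambda>a. (a, 15)) [16, 17]) cs t \<longrightarrow> \<not> st (w 16 0) (w 17 0))))"
      using run_find[of "[16, 17]" t "n + m" "singleB tot" "\<lambda>x y z. st x y", OF _ _ t(3) kt(6) b] unfolding l by simp
    show ?thesis
    proof (rule run_SeqI[OF f])
      fix u assume h: "eqx ({16, 17, 18} \<union> temps) t u \<and>
      (u 9 0 = 1 \<and> st (u 16 0) (u 17 0) \<or>
       u 9 0 = 0 \<and> (\<forall>cs w. length cs = length [16, 17::nat] \<and> set cs \<subseteq> {1..n + m} \<and> w = wr (map (\<lambda>a. (a, 15)) [16, 17]) cs t \<longrightarrow> \<not> st (w 16 0) (w 17 0)))"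
      then have u: "eqx M s u" "tabs u" using eqx_trans[OF t(1) mono[OF _ Mw(2)]] tabs'[OF t(2)] by blast+
      note ku = keep[OF u(1)]
      let ?T1 = "cost (Seq single_slots push)" and ?T2 = "srch_time (n + m) (cost (flag (confB tot))) 3 + (5 + (cost (Seq (conf_slots tot) push) + 1))"
      have "run (Cond (Less (Const 0) (var 9)) (Seq single_slots push)
       (Seq (find [16, 17, 18] (confB tot)) (Cond (Less (Const 0) (var 9)) (Seq (conf_slots tot) push) Skip))) u (1 + bcost (Less (Const 0) (var 9)) + (?T1 + ?T2)) ?Q"
      proof (rule run_Cond)
        assume "bval (Less (Const 0) (var 9)) u"
        then have ss: "single_step k tot ?S ?e (u 17 0 - 1) (u 16 0 - 1)" using h unfolding st_def by auto
        let ?xs = "[u 17 0 - 1, u 17 0 - 1, u 17 0 - 1, u 17 0 - 1, u 17 0 - 1, u 17 0 - 1, u 16 0 - 1, u 16 0 - 1, u 16 0 - 1, u 16 0 - 1, u 16 0 - 1, u 16 0 - 1, m, 0]"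
        have ld: "loaded u (ev single_slots u) ?xs"
          using slots_ev[of "[iE, iE, iE, iE, iE, iE, vE, vE, vE, vE, vE, vE, mE, Const 0]" u] ku(4) unfolding single_slots_def by simp
        have "run (Seq single_slots push) u ?T1 ?Q"
          by (rule run_ev') (use finish[OF ld entry_single[OF I ss k] u(1)] in \<open>simp_all add: single_slots_def\<close>)
        then show "run (Seq single_slots push) u (?T1 + ?T2) ?Q" by (rule run_weaken) simp_all
      next
        assume "\<not> bval (Less (Const 0) (var 9)) u"
        then have z: "u 9 0 = 0" by simp
        then have al: "\<And>cs w. length cs = length [16, 17::nat] \<Longrightarrow> set cs \<subseteq> {1..n + m} \<Longrightarrow> w = wr (map (\<lambda>a. (a, 15)) [16, 17]) cs t \<Longrightarrow> \<not> st (w 16 0) (w 17 0)"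
          using h by auto
        have ns: "\<not> single_step k tot ?S ?e x y" for x y
        proof
          assume ss: "single_step k tot ?S ?e x y"
          then have "x \<in> ?S" "y \<in> ?e x" unfolding single_step_def by auto
          then have "set [Suc y, Suc x] \<subseteq> {1..n + m}" using alvlt ed_oth(4)[OF G] by fastforce
          from al[OF _ this refl] show False using ss kt(7) by (simp add: st_def)
        qed
        show "run (Seq (find [16, 17, 18] (confB tot)) (Cond (Less (Const 0) (var 9)) (Seq (conf_slots tot) push) Skip)) u (?T1 + ?T2) ?Q"
          by (rule run_weaken[OF r2[OF u z ns]]) simp_all
      qed
      then show "run (Cond (Less (Const 0) (var 9)) (Seq single_slots push)
       (Seq (find [16, 17, 18] (confB tot)) (Cond (Less (Const 0) (var 9)) (Seq (conf_slots tot) push) Skip))) u (5 + (?T1 + ?T2)) ?Q" by simp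
    qed
  qed
  show ?thesis unfolding reduce_def reduce_time_def
  proof (rule run_SeqI[OF run_tab[OF G c(1,2)]])
    fix t assume h: "eqx {6, 7, 8, 10} s t \<and> tabs t"
    show "run (Seq (assign 9 (Const 0)) (Seq (find [16, 17] (singleB tot)) (Cond (Less (Const 0) (var 9)) (Seq single_slots push)
       (Seq (find [16, 17, 18] (confB tot)) (Cond (Less (Const 0) (var 9)) (Seq (conf_slots tot) push) Skip))))) t
      (3 + (srch_time (n + m) (cost (flag (singleB tot))) 2 + (5 + (cost (Seq single_slots push) +
     (srch_time (n + m) (cost (flag (confB tot))) 3 + (5 + (cost (Seq (conf_slots tot) push) + 1))))))) ?Q"
    proof (rule run_SeqI)
      show "run (assign 9 (Const 0)) t 3 (\<lambda>u. u = set0 9 0 t)"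
        using run_ev[of "assign 9 (Const 0)" t] by (simp add: assign_def set0_def numeral_3_eq_3)
      fix u assume u: "u = set0 9 0 t"
      have "eqx M t u" "eqx {9} t u" unfolding u eqx_def set0_def using Mw(4) by auto
      then have "eqx M s u" "tabs u" using eqx_trans[OF mono[of "{6, 7, 8, 10}" s t M]] h Mw(3) tabs_cong[of "{9}" t u] by auto
      then show "run (Seq (find [16, 17] (singleB tot)) (Cond (Less (Const 0) (var 9)) (Seq single_slots push)
       (Seq (find [16, 17, 18] (confB tot)) (Cond (Less (Const 0) (var 9)) (Seq (conf_slots tot) push) Skip)))) u
      (srch_time (n + m) (cost (flag (singleB tot))) 2 + (5 + (cost (Seq single_slots push) +
     (srch_time (n + m) (cost (flag (confB tot))) 3 + (5 + (cost (Seq (conf_slots tot) push) + 1)))))) ?Q"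
        by (rule r1) (simp add: u set0_def)
    qed
  qed
qed

section \<open>Undoing reductions and extending the colouring\<close>

definition undo :: com where
  "undo = seqs ([assign 13 (Sub (var 13) (Const 1))] @ map (\<lambda>j. assign (20 + j) (Load (60 + j) (var 13))) [0..<14] @
     [Store 1 (var 32) (var 27), Store 2 (var 32) (var 33)] @ map (\<lambda>j. Store 5 (var (20 + j)) (Const 1)) [0..<6] @
     map (\<lambda>j. Store 3 (var (20 + j)) (Const 0)) [0..<6] @ map (\<lambda>j. Store 4 (var (26 + j)) (Const 0)) [0..<6])"

lemma loop_free_undo [simp]: "loop_free undo" unfolding undo_def by auto

lemma fun_upd_six:
  "f(a := z, b := z, c := z, d := z, e := z, g := z) = (\<lambda>i. if i \<in> {a, b, c, d, e, g} then z else f i)"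
  by (rule ext) simp

lemma undo_effect:
  assumes m: "s 0 1 = m" and d: "s 13 0 = Suc d" and R: "removed (stk s d) \<subseteq> {..<m}"
  defines "xs \<equiv> stk s d" and "t \<equiv> ev undo s"
  shows "alv t = alv s \<union> removed xs" "eds t = merged m (xs ! 12) (xs ! 7) (xs ! 13) (eds s)"
    "t 13 0 = d" "t 3 = (\<lambda>i. if i \<in> removed xs then 0 else s 3 i)" "t 4 = (\<lambda>i. if i \<in> revised xs then 0 else s 4 i)"
    "loaded t t xs" "\<And>a. a \<notin> {1, 2, 3, 4, 5, 13} \<union> {20..<34} \<Longrightarrow> t a = s a"
proof -
  have x: "xs = [s 60 d, s 61 d, s 62 d, s 63 d, s 64 d, s 65 d, s 66 d, s 67 d, s 68 d, s 69 d, s 70 d, s 71 d, s 72 d, s 73 d]"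
    unfolding xs_def stk_def upt_slots by simp
  have t: "t = s(13 := (s 13)(0 := d), 20 := (s 20)(0 := s 60 d), 21 := (s 21)(0 := s 61 d), 22 := (s 22)(0 := s 62 d),
     23 := (s 23)(0 := s 63 d), 24 := (s 24)(0 := s 64 d), 25 := (s 25)(0 := s 65 d), 26 := (s 26)(0 := s 66 d),
     27 := (s 27)(0 := s 67 d), 28 := (s 28)(0 := s 68 d), 29 := (s 29)(0 := s 69 d), 30 := (s 30)(0 := s 70 d),
     31 := (s 31)(0 := s 71 d), 32 := (s 32)(0 := s 72 d), 33 := (s 33)(0 := s 73 d),
     1 := (s 1)(s 72 d := s 67 d), 2 := (s 2)(s 72 d := s 73 d),
     5 := (s 5)(s 60 d := 1, s 61 d := 1, s 62 d := 1, s 63 d := 1, s 64 d := 1, s 65 d := 1),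
     3 := (s 3)(s 60 d := 0, s 61 d := 0, s 62 d := 0, s 63 d := 0, s 64 d := 0, s 65 d := 0),
     4 := (s 4)(s 66 d := 0, s 67 d := 0, s 68 d := 0, s 69 d := 0, s 70 d := 0, s 71 d := 0))"
    unfolding t_def undo_def upt_slots using d by (simp add: assign_def)
  have lt: "s 60 d < m" "s 61 d < m" "s 62 d < m" "s 63 d < m" "s 64 d < m" "s 65 d < m"
    using R unfolding xs_def[symmetric] removed_def x by auto
  have t5: "0 < t 5 i \<longleftrightarrow> 0 < s 5 i \<or> i \<in> removed xs" for i unfolding removed_def x t by auto
  have t0: "t 0 = s 0" unfolding t by simp
  show "alv t = alv s \<union> removed xs"
    unfolding alv_def t5 t0 using m R xs_def by auto
  show "eds t = merged m (xs ! 12) (xs ! 7) (xs ! 13) (eds s)" unfolding eds_def t merged_def x using m by (auto simp: fun_eq_iff)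
  show "t 13 0 = d" unfolding t by simp
  show "t 3 = (\<lambda>i. if i \<in> removed xs then 0 else s 3 i)" 
  proof -
    have "t 3 = (s 3)(s 60 d := 0, s 61 d := 0, s 62 d := 0, s 63 d := 0, s 64 d := 0, s 65 d := 0)" unfolding t by simp
    moreover have "removed xs = {s 60 d, s 61 d, s 62 d, s 63 d, s 64 d, s 65 d}" unfolding removed_def x by simp
    ultimately show ?thesis by (simp only: fun_upd_six)
  qed
  show "t 4 = (\<lambda>i. if i \<in> revised xs then 0 else s 4 i)" 
  proof -
    have "t 4 = (s 4)(s 66 d := 0, s 67 d := 0, s 68 d := 0, s 69 d := 0, s 70 d := 0, s 71 d := 0)" unfolding t by simp
    moreover have "revised xs = {s 66 d, s 67 d, s 68 d, s 69 d, s 70 d, s 71 d}" unfolding revised_def x by simp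
    ultimately show ?thesis by (simp only: fun_upd_six)
  qed
  have ld: "\<forall>j\<in>{0, 1, 2, 3, 4, 5, 6, 7, 8, 9, 10, 11, 12, 13}. t (20 + j) 0 = xs ! j" unfolding x t by simp
  have j14: "j \<in> {0, 1, 2, 3, 4, 5, 6, 7, 8, 9, 10, 11, 12, 13}" if "j < 14" for j :: nat
  proof -
    have "j \<in> set [0..<14]" using that by simp
    then show ?thesis unfolding upt_slots by simp
  qed
  have "t (20 + j) 0 = xs ! j" if "j < 14" for j using bspec[OF ld j14[OF that]] .
  moreover have "length xs = 14" by (simp add: x)
  ultimately show "loaded t t xs" unfolding loaded_def by simp
  show "t a = s a" if "a \<notin> {1, 2, 3, 4, 5, 13} \<union> {20..<34}" for a using that unfolding t by auto
qed

lemma proper_cong: "(\<And>i. i \<in> S \<Longrightarrow> ed' i = ed i) \<Longrightarrow> proper S ed' ce cv = proper S ed ce cv"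
proof -
  assume a: "\<And>i. i \<in> S \<Longrightarrow> ed' i = ed i"
  then have "inc S ed' = inc S ed" unfolding inc_def by (auto simp: fun_eq_iff)
  then show ?thesis unfolding proper_def using a by simp
qed

text \<open>With four colours, up to six edges and six vertices are searched jointly, since the
  number of combinations is constant. With \<open>K\<close> colours in general, two edges cost
  \<open>K ^ 2\<close> tests of linear time, which is still cubic. Adding two vertices to the same
  search would cost \<open>K ^ 4\<close> tests, so they are coloured afterwards one by one, which
  greedy colouring permits.\<close>

definition colour :: "bool \<Rightarrow> com" where
  "colour tot = (if tot then Cond (Less (var 12) (Const 4)) (extend [20..<26] [26..<32])
     (Seq (extend [20, 21] []) (Seq (extend [] [26]) (extend [] [27]))) else extend [20, 21] [])"

definition colour_time :: "bool \<Rightarrow> nat \<Rightarrow> nat \<Rightarrow> nat" where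
  "colour_time tot k m = 5 + (if tot \<and> k < 4 then extend_time [20..<26] [26..<32] 4 m
     else extend_time [20, 21] [] (k + of_bool tot) m + (extend_time [] [26] (k + of_bool tot) m + extend_time [] [27] (k + of_bool tot) m))"

text \<open>A vertex of degree at most 2 has at most four forbidden colours.\<close>

lemma run_vertex:
  assumes a: "a \<in> {20..<32}" and G: "numbered_graph n (alv s) (eds s)" and P: "proper (alv s) (eds s) (s 3) (s 4)"
    and K: "s 11 0 = K" and m: "s 0 1 = m" and d: "card (inc (alv s) (eds s) (s a 0)) \<le> 2" "5 \<le> K"
  shows "run (extend [] [a]) s (extend_time [] [a] K m) (\<lambda>s'. eqx ({3, 4} \<union> temps) s s' \<and>
    proper (alv s) (eds s) (s' 3) (s' 4) \<and> s' 3 = s 3 \<and> (\<forall>v. v \<noteq> s a 0 \<longrightarrow> s' 4 v = s 4 v) \<and> 1 \<le> s' 4 (s a 0) \<and> s' 4 (s a 0) \<le> K)"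
proof -
  have "2 * card (inc (alv s) (eds s) (s a 0)) < K" using d by simp
  from ex_vertex_colour[OF P G this] obtain c where c: "1 \<le> c" "c \<le> K" "proper (alv s) (eds s) (s 3) ((s 4)(s a 0 := c))" by blast
  have "run (extend [] [a]) s (extend_time [] [a] K m) (\<lambda>s'. eqx ({3, 4} \<union> temps) s s' \<and>
    proper (alv s) (eds s) (s' 3) (s' 4) \<and>
    (\<forall>i. i \<notin> (\<lambda>e. s e 0) ` set [] \<longrightarrow> s' 3 i = s 3 i) \<and> (\<forall>v. v \<notin> (\<lambda>e. s e 0) ` set [a] \<longrightarrow> s' 4 v = s 4 v) \<and>
    (\<forall>e\<in>set []. 1 \<le> s' 3 (s e 0) \<and> s' 3 (s e 0) \<le> K) \<and> (\<forall>e\<in>set [a]. 1 \<le> s' 4 (s e 0) \<and> s' 4 (s e 0) \<le> K))"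
    by (rule run_extend[OF _ _ _ G P K m _ c(3)]) (use a c in auto)
  then show ?thesis by (rule run_weaken) (auto simp: fun_eq_iff)
qed

lemma run_colour:
  assumes ok: "stepok tot k n (alv t) (eds t) xs ed'" and k: "3 \<le> k"
    and P: "proper (alv t - removed xs) ed' ce cv" and C: "coloured tot (k + of_bool tot) n (alv t - removed xs) ce cv"
    and t3: "t 3 = (\<lambda>i. if i \<in> removed xs then 0 else ce i)" and t4: "t 4 = (\<lambda>i. if i \<in> revised xs then 0 else cv i)"
    and c: "t 11 0 = k + of_bool tot" "t 0 1 = m" "t 12 0 = k" and ld: "loaded t t xs"
  shows "run (colour tot) t (colour_time tot k m) (\<lambda>t'. eqx ({3, 4} \<union> temps) t t' \<and>
    proper (alv t) (eds t) (t' 3) (t' 4) \<and> coloured tot (k + of_bool tot) n (alv t) (t' 3) (t' 4))"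
proof -
  let ?S = "alv t" and ?e = "eds t" and ?R = "removed xs" and ?U = "revised xs" and ?K = "k + of_bool tot"
  note x = loaded_list[OF ld]
  have G: "numbered_graph n ?S ?e" and RS: "?R \<subseteq> ?S" using ok unfolding stepok_def by auto
  have R: "(\<lambda>e. t e 0) ` set [20..<26] = ?R" and U: "(\<lambda>e. t e 0) ` set [26..<32] = ?U"
    unfolding removed_def revised_def by (subst x, simp add: upt_rec, fast?)+
  show ?thesis
  proof (cases "tot \<and> k < 4")
    case True
    then have tk: "tot = True" "k = 3" using k by auto
    have rc: "recolourable n ?S ?e ?R ?U" "\<And>i. i \<in> ?S - ?R \<Longrightarrow> ed' i = ?e i" using ok True unfolding stepok_def by auto
    have "proper (?S - ?R) ?e ce cv" using P proper_cong[of "?S - ?R" ed' ?e ce cv] rc(2) by blast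
    moreover have "coloured True 4 n (?S - ?R) ce cv" using C tk by simp
    ultimately have P0: "proper ?S ?e (t 3) (t 4)" and ex: "\<exists>ce' cv'. (\<forall>i. i \<notin> ?R \<longrightarrow> ce' i = ce i) \<and> (\<forall>v. v \<notin> ?U \<longrightarrow> cv' v = cv v) \<and>
        (\<forall>i\<in>?R. colour4 (ce' i)) \<and> (\<forall>v\<in>?U. colour4 (cv' v)) \<and> proper ?S ?e ce' cv'"
      using rc(1) unfolding recolourable_def t3 t4 by blast+
    from ex obtain ce' cv' where q: "\<And>i. i \<notin> ?R \<Longrightarrow> ce' i = ce i" "\<And>v. v \<notin> ?U \<Longrightarrow> cv' v = cv v"
        "\<And>i. i \<in> ?R \<Longrightarrow> colour4 (ce' i)" "\<And>v. v \<in> ?U \<Longrightarrow> colour4 (cv' v)" "proper ?S ?e ce' cv'" by (elim exE conjE) (rule that, simp_all)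
    have r: "run (extend [20..<26] [26..<32]) t (extend_time [20..<26] [26..<32] 4 m) (\<lambda>s'. eqx ({3, 4} \<union> temps) t s' \<and>
      proper ?S ?e (s' 3) (s' 4) \<and>
      (\<forall>i. i \<notin> (\<lambda>e. t e 0) ` set [20..<26] \<longrightarrow> s' 3 i = t 3 i) \<and> (\<forall>v. v \<notin> (\<lambda>e. t e 0) ` set [26..<32] \<longrightarrow> s' 4 v = t 4 v) \<and>
      (\<forall>e\<in>set [20..<26]. 1 \<le> s' 3 (t e 0) \<and> s' 3 (t e 0) \<le> 4) \<and> (\<forall>e\<in>set [26..<32]. 1 \<le> s' 4 (t e 0) \<and> s' 4 (t e 0) \<le> 4))"
    proof (rule run_extend[OF _ _ _ G P0 _ c(2) _ q(5)])
      show "t e 0 \<in> ?S" if "e \<in> set [20..<26]" for e using RS R that by blast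
      show "ce' i = t 3 i" if "i \<notin> (\<lambda>e. t e 0) ` set [20..<26]" for i using that q(1) unfolding R t3 by simp
      show "cv' i = t 4 i" if "i \<notin> (\<lambda>e. t e 0) ` set [26..<32]" for i using that q(2) unfolding U t4 by simp
      show "1 \<le> ce' (t e 0) \<and> ce' (t e 0) \<le> 4" if "e \<in> set [20..<26]" for e
        using q(3)[of "t e 0"] R that unfolding colour4_def by blast
      show "1 \<le> cv' (t e 0) \<and> cv' (t e 0) \<le> 4" if "e \<in> set [26..<32]" for e
        using q(4)[of "t e 0"] U that unfolding colour4_def by blast
    qed (use c tk in auto)
    have r': "run (extend [20..<26] [26..<32]) t (extend_time [20..<26] [26..<32] 4 m) (\<lambda>t'. eqx ({3, 4} \<union> temps) t t' \<and>
      proper ?S ?e (t' 3) (t' 4) \<and> coloured tot ?K n ?S (t' 3) (t' 4))"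
    proof (rule run_weaken[OF r order_refl])
      fix s' assume h: "eqx ({3, 4} \<union> temps) t s' \<and>
      proper ?S ?e (s' 3) (s' 4) \<and>
      (\<forall>i. i \<notin> (\<lambda>e. t e 0) ` set [20..<26] \<longrightarrow> s' 3 i = t 3 i) \<and> (\<forall>v. v \<notin> (\<lambda>e. t e 0) ` set [26..<32] \<longrightarrow> s' 4 v = t 4 v) \<and>
      (\<forall>e\<in>set [20..<26]. 1 \<le> s' 3 (t e 0) \<and> s' 3 (t e 0) \<le> 4) \<and> (\<forall>e\<in>set [26..<32]. 1 \<le> s' 4 (t e 0) \<and> s' 4 (t e 0) \<le> 4)"
      have v3: "1 \<le> s' 3 i \<and> s' 3 i \<le> 4" if "i \<in> ?S" for i
      proof (cases "i \<in> ?R")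
        case True
        then obtain e where "e \<in> set [20..<26]" "i = t e 0" using R by blast
        then show ?thesis using h by blast
      next
        case False
        then have "s' 3 i = ce i" using h unfolding R t3 by simp
        then show ?thesis using C False that tk unfolding coloured_def by simp
      qed
      have v4: "1 \<le> s' 4 i \<and> s' 4 i \<le> 4" if "i < n" for i
      proof (cases "i \<in> ?U")
        case True
        then obtain e where "e \<in> set [26..<32]" "i = t e 0" using U by blast
        then show ?thesis using h by blast
      next
        case False
        then have "s' 4 i = cv i" using h unfolding U t4 by simp
        then show ?thesis using C that tk unfolding coloured_def by simp
      qed
      show "eqx ({3, 4} \<union> temps) t s' \<and> proper ?S ?e (s' 3) (s' 4) \<and> coloured tot ?K n ?S (s' 3) (s' 4)"
        using h v3 v4 tk unfolding coloured_def by simp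
    qed
    have "run (colour tot) t (1 + bcost (Less (var 12) (Const 4)) + extend_time [20..<26] [26..<32] 4 m) (\<lambda>t'. eqx ({3, 4} \<union> temps) t t' \<and>
      proper ?S ?e (t' 3) (t' 4) \<and> coloured tot ?K n ?S (t' 3) (t' 4))"
      unfolding colour_def tk if_True by (rule run_Cond) (use r' c tk in auto)
    then show ?thesis by (rule run_weaken) (use tk in \<open>simp_all add: colour_time_def\<close>)
  next
    case False
    have R2: "?R = {xs ! 0, xs ! 1}" and U2: "?U = {xs ! 6, xs ! 7}" using ok False unfolding stepok_def by auto
    have tx: "t 20 0 = xs ! 0" "t 21 0 = xs ! 1" "t 26 0 = xs ! 6" "t 27 0 = xs ! 7" by (subst x, simp)+
    have st: "xs ! 0 = xs ! 1 \<and> xs ! 6 = xs ! 7 \<and> single_step k tot ?S ?e (xs ! 0) (xs ! 6) \<and> (\<forall>i\<in>?S - ?R. ed' i = ?e i) \<or>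
        pair_step k tot ?S ?e (xs ! 0) (xs ! 1) (xs ! 6) (xs ! 7) ed'" using ok False unfolding stepok_def by auto
    have main: "proper ?S ?e (t 3) (t 4) \<and> (\<exists>ce1. proper ?S ?e ce1 (t 4) \<and> (\<forall>i. i \<notin> ?R \<longrightarrow> ce1 i = t 3 i) \<and> (\<forall>i\<in>?R. 1 \<le> ce1 i \<and> ce1 i \<le> ?K)) \<and>
        card (inc ?S ?e (xs ! 6)) \<le> 2 \<and> card (inc ?S ?e (xs ! 7)) \<le> 2"
      using st
    proof
      assume h: "xs ! 0 = xs ! 1 \<and> xs ! 6 = xs ! 7 \<and> single_step k tot ?S ?e (xs ! 0) (xs ! 6) \<and> (\<forall>i\<in>?S - ?R. ed' i = ?e i)"
      have R1: "?R = {xs ! 0}" "?U = {xs ! 6}" using R2 U2 h by auto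
      have P': "proper (?S - {xs ! 0}) ?e ce cv" using P proper_cong[of "?S - ?R" ed' ?e ce cv] h R1 by auto
      have C': "coloured tot ?K n (?S - {xs ! 0}) ce cv" using C R1 by simp
      have f: "t 3 = ce(xs ! 0 := 0)" "t 4 = cv(xs ! 6 := 0)" unfolding t3 t4 R1 by auto
      from single_step_edge[OF _ G P' C'] h obtain cc where cc: "1 \<le> cc" "cc \<le> ?K" "proper ?S ?e (ce(xs ! 0 := cc)) (t 4)" "proper ?S ?e (t 3) (t 4)"
        unfolding f by blast
      have "card (inc ?S ?e (xs ! 6)) \<le> 2" using h unfolding single_step_def by blast
      moreover have "\<exists>ce1. proper ?S ?e ce1 (t 4) \<and> (\<forall>i. i \<notin> ?R \<longrightarrow> ce1 i = t 3 i) \<and> (\<forall>i\<in>?R. 1 \<le> ce1 i \<and> ce1 i \<le> ?K)"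
        by (rule exI[of _ "ce(xs ! 0 := cc)"]) (use cc f(1) R1 in auto)
      ultimately show ?thesis using cc(4) h by simp
    next
      assume h: "pair_step k tot ?S ?e (xs ! 0) (xs ! 1) (xs ! 6) (xs ! 7) ed'"
      have f: "t 3 = ce(xs ! 0 := 0, xs ! 1 := 0)" "t 4 = cv(xs ! 6 := 0, xs ! 7 := 0)" unfolding t3 t4 R2 U2 by auto
      from pair_step_edges[OF h G P[unfolded R2] C[unfolded R2]] obtain cc dd where
        cc: "1 \<le> cc" "cc \<le> ?K" "1 \<le> dd" "dd \<le> ?K" "proper ?S ?e (ce(xs ! 0 := cc, xs ! 1 := dd)) (t 4)" "proper ?S ?e (t 3) (t 4)"
        unfolding f by blast
      obtain f1 f2 where "inc ?S ?e (xs ! 6) = {xs ! 0, f1}" "inc ?S ?e (xs ! 7) = {xs ! 1, f2}" using h unfolding pair_step_def by (elim exE conjE) (rule that)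
      then have "card (inc ?S ?e (xs ! 6)) \<le> 2" "card (inc ?S ?e (xs ! 7)) \<le> 2" by (simp_all add: card_insert_if)
      moreover have "\<exists>ce1. proper ?S ?e ce1 (t 4) \<and> (\<forall>i. i \<notin> ?R \<longrightarrow> ce1 i = t 3 i) \<and> (\<forall>i\<in>?R. 1 \<le> ce1 i \<and> ce1 i \<le> ?K)"
        by (rule exI[of _ "ce(xs ! 0 := cc, xs ! 1 := dd)"]) (use cc f(1) R2 in auto)
      ultimately show ?thesis using cc(6) by simp
    qed
    then have P0: "proper ?S ?e (t 3) (t 4)" and d2: "card (inc ?S ?e (xs ! 6)) \<le> 2" "card (inc ?S ?e (xs ! 7)) \<le> 2" by blast+
    from main obtain ce1 where "proper ?S ?e ce1 (t 4) \<and> (\<forall>i. i \<notin> ?R \<longrightarrow> ce1 i = t 3 i) \<and> (\<forall>i\<in>?R. 1 \<le> ce1 i \<and> ce1 i \<le> ?K)" by blast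
    then have q: "proper ?S ?e ce1 (t 4)" "\<And>i. i \<notin> ?R \<Longrightarrow> ce1 i = t 3 i" "\<And>i. i \<in> ?R \<Longrightarrow> 1 \<le> ce1 i \<and> ce1 i \<le> ?K"
      by blast+
    have im: "(\<lambda>e. t e 0) ` set [20, 21] = ?R" using tx R2 by simp
    have r: "run (extend [20, 21] []) t (extend_time [20, 21] [] ?K m) (\<lambda>s'. eqx ({3, 4} \<union> temps) t s' \<and>
      proper ?S ?e (s' 3) (s' 4) \<and>
      (\<forall>i. i \<notin> (\<lambda>e. t e 0) ` set [20, 21] \<longrightarrow> s' 3 i = t 3 i) \<and> (\<forall>v. v \<notin> (\<lambda>e. t e 0) ` set [] \<longrightarrow> s' 4 v = t 4 v) \<and>
      (\<forall>e\<in>set [20, 21]. 1 \<le> s' 3 (t e 0) \<and> s' 3 (t e 0) \<le> ?K) \<and> (\<forall>e\<in>set []. 1 \<le> s' 4 (t e 0) \<and> s' 4 (t e 0) \<le> ?K))"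
    proof (rule run_extend[OF _ _ _ G P0 c(1,2) _ q(1)])
      show "t e 0 \<in> ?S" if "e \<in> set [20, 21]" for e using RS im that by blast
      show "ce1 i = t 3 i" if "i \<notin> (\<lambda>e. t e 0) ` set [20, 21]" for i using that q(2) unfolding im by simp
      show "1 \<le> ce1 (t e 0) \<and> ce1 (t e 0) \<le> ?K" if "e \<in> set [20, 21]" for e using q(3)[of "t e 0"] im that by blast
    qed auto
    have r1: "run (extend [20, 21] []) t (extend_time [20, 21] [] ?K m) (\<lambda>s'. eqx ({3, 4} \<union> temps) t s' \<and>
      proper ?S ?e (s' 3) (s' 4) \<and> (\<forall>i\<in>?S. 1 \<le> s' 3 i \<and> s' 3 i \<le> ?K) \<and> s' 4 = t 4)"
    proof (rule run_weaken[OF r order_refl])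
      fix s' assume h: "eqx ({3, 4} \<union> temps) t s' \<and>
      proper ?S ?e (s' 3) (s' 4) \<and>
      (\<forall>i. i \<notin> (\<lambda>e. t e 0) ` set [20, 21] \<longrightarrow> s' 3 i = t 3 i) \<and> (\<forall>v. v \<notin> (\<lambda>e. t e 0) ` set [] \<longrightarrow> s' 4 v = t 4 v) \<and>
      (\<forall>e\<in>set [20, 21]. 1 \<le> s' 3 (t e 0) \<and> s' 3 (t e 0) \<le> ?K) \<and> (\<forall>e\<in>set []. 1 \<le> s' 4 (t e 0) \<and> s' 4 (t e 0) \<le> ?K)"
      have "1 \<le> s' 3 i \<and> s' 3 i \<le> ?K" if "i \<in> ?S" for i
      proof (cases "i \<in> ?R")
        case True
        then obtain e where "e \<in> set [20, 21]" "i = t e 0" using im by blast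
        then show ?thesis using h by blast
      next
        case False
        then have "s' 3 i = ce i" using h unfolding im t3 by simp
        then show ?thesis using C False that unfolding coloured_def by simp
      qed
      then show "eqx ({3, 4} \<union> temps) t s' \<and> proper ?S ?e (s' 3) (s' 4) \<and> (\<forall>i\<in>?S. 1 \<le> s' 3 i \<and> s' 3 i \<le> ?K) \<and> s' 4 = t 4"
        using h by (auto simp: fun_eq_iff)
    qed
    have cv: "if tot then 1 \<le> cv v \<and> cv v \<le> ?K else cv v = 0" if "v < n" for v using C that unfolding coloured_def by auto
    show ?thesis
    proof (cases tot)
      case nt: False
      have "run (colour tot) t (extend_time [20, 21] [] ?K m) (\<lambda>s'. eqx ({3, 4} \<union> temps) t s' \<and>
        proper ?S ?e (s' 3) (s' 4) \<and> (\<forall>i\<in>?S. 1 \<le> s' 3 i \<and> s' 3 i \<le> ?K) \<and> s' 4 = t 4)" using r1 nt unfolding colour_def by simp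
      then show ?thesis by (rule run_weaken) (use nt cv in \<open>auto simp: colour_time_def coloured_def t4\<close>)
    next
      case tt: True
      then have k4: "4 \<le> k" "5 \<le> ?K" using False by auto
      let ?Q = "\<lambda>s'. eqx ({3, 4} \<union> temps) t s' \<and> proper ?S ?e (s' 3) (s' 4) \<and> coloured tot ?K n ?S (s' 3) (s' 4)"
      have ke: "alv u = ?S" "eds u = ?e" "u 11 0 = ?K" "u 0 1 = m" "u 26 0 = xs ! 6" "u 27 0 = xs ! 7" if h: "eqx ({3, 4} \<union> temps) t u" for u
      proof -
        have "u a = t a" if "a \<in> {0, 1, 2, 5, 11, 26, 27}" for a using h that unfolding eqx_def temps_def by auto
        then show "alv u = ?S" "eds u = ?e" "u 11 0 = ?K" "u 0 1 = m" "u 26 0 = xs ! 6" "u 27 0 = xs ! 7" using alv_eds_cong[of u t] c tx by auto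
      qed
      have r2: "run (Seq (extend [20, 21] []) (Seq (extend [] [26]) (extend [] [27]))) t
        (extend_time [20, 21] [] ?K m + (extend_time [] [26] ?K m + extend_time [] [27] ?K m)) ?Q"
      proof (rule run_SeqI[OF r1])
        fix u assume hu: "eqx ({3, 4} \<union> temps) t u \<and>
          proper ?S ?e (u 3) (u 4) \<and> (\<forall>i\<in>?S. 1 \<le> u 3 i \<and> u 3 i \<le> ?K) \<and> u 4 = t 4"
        note ku = ke[OF conjunct1[OF hu]]
        show "run (Seq (extend [] [26]) (extend [] [27])) u (extend_time [] [26] ?K m + extend_time [] [27] ?K m) ?Q"
        proof (rule run_SeqI[OF run_vertex[of 26 n u ?K m, unfolded ku, OF _ G _ refl refl d2(1) k4(2)]])
          show "proper ?S ?e (u 3) (u 4)" using hu by blast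
          fix w assume hw: "eqx ({3, 4} \<union> temps) u w \<and> proper ?S ?e (w 3) (w 4) \<and> w 3 = u 3 \<and>
             (\<forall>v. v \<noteq> xs ! 6 \<longrightarrow> w 4 v = u 4 v) \<and> 1 \<le> w 4 (xs ! 6) \<and> w 4 (xs ! 6) \<le> ?K"
          have tw: "eqx ({3, 4} \<union> temps) t w" using eqx_trans hu hw by blast
          note kw = ke[OF tw]
          show "run (extend [] [27]) w (extend_time [] [27] ?K m) ?Q"
          proof (rule run_weaken[OF run_vertex[of 27 n w ?K m, unfolded kw, OF _ G _ refl refl d2(2) k4(2)] order_refl])
            show "proper ?S ?e (w 3) (w 4)" using hw by blast
            fix z assume hz: "eqx ({3, 4} \<union> temps) w z \<and> proper ?S ?e (z 3) (z 4) \<and> z 3 = w 3 \<and>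
             (\<forall>v. v \<noteq> xs ! 7 \<longrightarrow> z 4 v = w 4 v) \<and> 1 \<le> z 4 (xs ! 7) \<and> z 4 (xs ! 7) \<le> ?K"
            have "1 \<le> z 4 v \<and> z 4 v \<le> ?K" if v: "v < n" for v
            proof (cases "v = xs ! 7 \<or> v = xs ! 6")
              case True
              then show ?thesis using hz hw by (cases "v = xs ! 7") auto
            next
              case False
              then have "z 4 v = t 4 v" using hz hw hu by simp
              then show ?thesis using cv[OF v] tt False unfolding t4 U2 by simp
            qed
            moreover have "1 \<le> z 3 i \<and> z 3 i \<le> ?K" if "i \<in> ?S" for i using hz hw hu that by simp
            ultimately show "?Q z" using eqx_trans[OF tw] hz tt unfolding coloured_def by auto
          qed simp
        qed simp
      qed
      have "run (colour tot) t (1 + bcost (Less (var 12) (Const 4)) +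
          (extend_time [20, 21] [] ?K m + (extend_time [] [26] ?K m + extend_time [] [27] ?K m))) ?Q"
        using tt unfolding colour_def if_P[OF tt] by - (rule run_Cond, use r2 c k4 in auto)
      then show ?thesis by (rule run_weaken) (use k4 in \<open>simp_all add: colour_time_def\<close>)
    qed
  qed
qed

text \<open>The stack is read from its top: reviving the removed edges and moving an edge back
  yields the graph before the last reduction, and the bottom of the stack is the input
  graph.\<close>

fun hist :: "bool \<Rightarrow> nat \<Rightarrow> nat \<Rightarrow> nat \<Rightarrow> (nat \<Rightarrow> nat set) \<Rightarrow> nat \<Rightarrow> (nat \<Rightarrow> nat list) \<Rightarrow> nat set \<Rightarrow> (nat \<Rightarrow> nat set) \<Rightarrow> bool" where
  "hist tot k n m ed0 0 st S ed \<longleftrightarrow> S = {..<m} \<and> ed = ed0"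
| "hist tot k n m ed0 (Suc d) st S ed \<longleftrightarrow> S \<inter> removed (st d) = {} \<and> removed (st d) \<subseteq> {..<m} \<and>
     stepok tot k n (S \<union> removed (st d)) (merged m (st d ! 12) (st d ! 7) (st d ! 13) ed) (st d) ed \<and>
     hist tot k n m ed0 d st (S \<union> removed (st d)) (merged m (st d ! 12) (st d ! 7) (st d ! 13) ed)"

lemma hist_cong:
  "(\<And>d'. d' < d \<Longrightarrow> st d' = st' d') \<Longrightarrow> hist tot k n m ed0 d st S ed = hist tot k n m ed0 d st' S ed"
  by (induction d arbitrary: S ed) simp_all

lemma hist_pushed:
  assumes H: "hist tot k n m ed0 (s 13 0) (stk s) (alv s) (eds s)" and p: "pushed tot k n m s t" and m: "s 0 1 = m"
  shows "hist tot k n m ed0 (t 13 0) (stk t) (alv t) (eds t)"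
proof -
  obtain xs where x: "removed xs \<subseteq> alv s" "alv t = alv s - removed xs"
     "eds s = merged m (xs ! 12) (xs ! 7) (xs ! 13) (eds t)" "stepok tot k n (alv s) (eds s) xs (eds t)"
     "t 13 0 = Suc (s 13 0)" "stk t (s 13 0) = xs" "\<forall>d. d \<noteq> s 13 0 \<longrightarrow> stk t d = stk s d"
    using p unfolding pushed_def by blast
  have u: "alv t \<union> removed xs = alv s" using x(1,2) by auto
  have "removed xs \<subseteq> {..<m}" using x(1) m unfolding alv_def by auto
  moreover have "hist tot k n m ed0 (s 13 0) (stk t) (alv s) (eds s)" using H hist_cong[of "s 13 0" "stk s" "stk t"] x(7) by auto
  moreover have "alv t \<inter> removed xs = {}" using x(2) by blast
  ultimately show ?thesis unfolding x(5) hist.simps x(6) u x(3)[symmetric] using x(4) by blast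
qed

definition undo_inv :: "bool \<Rightarrow> nat \<Rightarrow> nat \<Rightarrow> nat \<Rightarrow> (nat \<Rightarrow> nat set) \<Rightarrow> store \<Rightarrow> bool" where
  "undo_inv tot k n m ed0 s \<longleftrightarrow> hist tot k n m ed0 (s 13 0) (stk s) (alv s) (eds s) \<and> proper (alv s) (eds s) (s 3) (s 4) \<and>
     coloured tot (k + of_bool tot) n (alv s) (s 3) (s 4) \<and> s 0 0 = n \<and> s 0 1 = m \<and> s 11 0 = k + of_bool tot \<and> s 12 0 = k"

lemma run_undo_colour:
  assumes I: "undo_inv tot k n m ed0 s" and d: "s 13 0 = Suc d" and k: "3 \<le> k"
  shows "run (Seq undo (colour tot)) s (cost undo + colour_time tot k m) (\<lambda>t. undo_inv tot k n m ed0 t \<and> t 13 0 = d)"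
proof (rule run_SeqI[OF run_ev])
  fix t assume t: "t = ev undo s"
  let ?xs = "stk s d"
  let ?e1 = "merged m (?xs ! 12) (?xs ! 7) (?xs ! 13) (eds s)"
  have h: "alv s \<inter> removed ?xs = {}" "removed ?xs \<subseteq> {..<m}" "stepok tot k n (alv s \<union> removed ?xs) ?e1 ?xs (eds s)"
    "hist tot k n m ed0 d (stk s) (alv s \<union> removed ?xs) ?e1"
    and P: "proper (alv s) (eds s) (s 3) (s 4)" and C: "coloured tot (k + of_bool tot) n (alv s) (s 3) (s 4)"
    and c: "s 0 0 = n" "s 0 1 = m" "s 11 0 = k + of_bool tot" "s 12 0 = k"
    using I unfolding undo_inv_def d by auto
  note u = undo_effect[OF c(2) d h(2), folded t]
  have cc: "t 0 0 = n" "t 0 1 = m" "t 11 0 = k + of_bool tot" "t 12 0 = k" using c u(7) by auto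
  have st: "stk t = stk s" using u(7) unfolding stk_def by (auto simp: fun_eq_iff)
  have df: "alv t - removed ?xs = alv s" using u(1) h(1) by auto
  have "run (colour tot) t (colour_time tot k m) (\<lambda>t'. eqx ({3, 4} \<union> temps) t t' \<and>
    proper (alv t) (eds t) (t' 3) (t' 4) \<and> coloured tot (k + of_bool tot) n (alv t) (t' 3) (t' 4))"
    by (rule run_colour[OF _ k _ _ u(4,5) cc(3,2,4) u(6)]) (use h(3) P C u(1,2) df in auto)
  then show "run (colour tot) t (colour_time tot k m) (\<lambda>t. undo_inv tot k n m ed0 t \<and> t 13 0 = d)"
  proof (rule run_weaken[OF _ order_refl])
    fix z assume z: "eqx ({3, 4} \<union> temps) t z \<and>
      proper (alv t) (eds t) (z 3) (z 4) \<and> coloured tot (k + of_bool tot) n (alv t) (z 3) (z 4)"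
    have e: "z a = t a" if "a \<in> {0, 1, 2, 5, 11, 12, 13} \<union> {60..<74}" for a
      using z that unfolding eqx_def temps_def by auto
    have az: "alv z = alv t" "eds z = eds t" using alv_eds_cong[of z t] e by auto
    have "stk z = stk t" using e unfolding stk_def by (auto simp: fun_eq_iff)
    then show "undo_inv tot k n m ed0 z \<and> z 13 0 = d"
      using h(4) z e cc u(1,2,3) st unfolding undo_inv_def az by simp
  qed
qed simp

section \<open>Running time and correctness\<close>

definition maxc :: com where
  "maxc = Cond (Less (var 12) (Load 6 (var 10))) (assign 12 (Load 6 (var 10))) Skip"

text \<open>All vertices start with colour 1, or 0 for edge colourings. As the reductions do not
  touch colours, this is the colouring of the edgeless graph from which the undoing starts.\<close>

definition init :: "bool \<Rightarrow> com" where
  "init tot = Seq (FOR 10 mE (Store 5 (var 10) (Const 1))) (Seq tab (Seq (FOR 10 nE maxc)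
     (Seq (FOR 10 nE (Store 4 (var 10) (Const (of_bool tot))))
       (Seq (assign 11 (Add (var 12) (Const (of_bool tot)))) (assign 19 (Add nE mE))))))"

definition init_time :: "nat \<Rightarrow> nat \<Rightarrow> nat" where
  "init_time n m = (m * 18 + 14) + (tab_time n m + ((n * (cost maxc + 14) + 14) + ((n * 18 + 14) + 14)))"

text \<open>Every reduction removes at least one edge, so \<open>m\<close> rounds suffice; surplus
  rounds find no edge and leave the graph and the stack as they are. Variable 13 controls the
  undoing, since the number of reductions made may be smaller than \<open>m\<close>.\<close>

definition prog :: "bool \<Rightarrow> com" where
  "prog tot = Seq (init tot) (Seq (FOR 14 mE (reduce tot)) (While (Less (Const 0) (var 13)) (Seq undo (colour tot))))"

definition prog_time :: "bool \<Rightarrow> nat \<Rightarrow> nat \<Rightarrow> nat \<Rightarrow> nat" where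
  "prog_time tot n m k = init_time n m + ((m * (reduce_time tot n m + 14) + 14) + (m * (cost undo + colour_time tot k m + 5) + 5))"

lemma Max_insert_upto: "Max (insert 0 (f ` {..<Suc i})) = max (f i) (Max (insert 0 (f ` {..<i})))" for f :: "nat \<Rightarrow> nat"
proof -
  have "insert 0 (f ` {..<Suc i}) = insert (f i) (insert 0 (f ` {..<i}))" by (auto simp: lessThan_Suc)
  then show ?thesis by (simp only:) (rule Max_insert, auto)
qed

lemma run_init:
  assumes c: "s 0 0 = n" "s 0 1 = m" and z: "\<And>a. a \<in> {4, 5, 12, 13, 15} \<Longrightarrow> s a = (\<lambda>_. 0)"
    and G: "numbered_graph n {..<m} (eds s)" and k: "k = Max (insert 0 (deg {..<m} (eds s) ` {..<n}))"
  shows "run (init tot) s (init_time n m) (\<lambda>t. alv t = {..<m} \<and> eds t = eds s \<and> t 0 0 = n \<and> t 0 1 = m \<and> t 12 0 = k \<and>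
    t 11 0 = k + of_bool tot \<and> t 19 0 = n + m \<and> t 15 0 = 0 \<and> t 13 0 = 0 \<and> (\<forall>v<n. t 4 v = of_bool tot))"
proof -
  define B1 where "B1 i t \<longleftrightarrow> t 10 0 = i \<and> eqx {5, 10} s t \<and> (\<forall>j. t 5 j = of_bool (j < i))" for i t
  have r1: "run (FOR 10 mE (Store 5 (var 10) (Const 1))) s (m * (cost (Store 5 (var 10) (Const 1)) + 12 + acost mE) + 12 + acost mE) (B1 m)"
  proof (rule run_for)
    show "B1 0 (set0 10 0 s)" unfolding B1_def eqx_def set0_def using z[of 5] by auto
  next
    fix i t assume "B1 i t" then show "aval mE t = m \<and> t 10 0 = i" using c unfolding B1_def eqx_def by auto
  next
    fix i t assume h: "i < m" "B1 i t"
    show "run (Store 5 (var 10) (Const 1)) t (cost (Store 5 (var 10) (Const 1))) (\<lambda>s'. s' 10 0 = i \<and> B1 (Suc i) (set0 10 (Suc i) s'))"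
      by (rule run_ev') (use h in \<open>auto simp: B1_def eqx_def set0_def less_Suc_eq\<close>)
  qed
  define C1 where "C1 t \<longleftrightarrow> alv t = {..<m} \<and> eds t = eds s \<and> t 0 0 = n \<and> t 0 1 = m \<and> t 15 0 = 0 \<and> t 13 0 = 0" for t
  have C1_cong: "C1 u" if h: "C1 t" "eqx M t u" "M \<inter> {0, 1, 2, 5, 13, 15} = {}" for M t u
  proof -
    have e: "u a = t a" if "a \<in> {0, 1, 2, 5, 13, 15}" for a using h(2,3) that unfolding eqx_def by (metis disjoint_iff)
    then show ?thesis using h(1) alv_eds_cong[of u t] unfolding C1_def by simp
  qed
  have f1: "C1 t \<and> t 12 = (\<lambda>_. 0) \<and> t 4 = (\<lambda>_. 0)" if "B1 m t" for t
  proof -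
    have e: "t a = s a" if "a \<in> {0, 1, 2, 4, 12, 13, 15}" for a using \<open>B1 m t\<close> that unfolding B1_def eqx_def by auto
    have "alv t = {..<m}" using \<open>B1 m t\<close> e[of 0] c unfolding B1_def alv_def by auto
    moreover have "eds t = eds s" unfolding eds_def using e by (auto simp: fun_eq_iff)
    ultimately show ?thesis unfolding C1_def using e z c by simp
  qed
  have r2: "run tab t (tab_time n m) (\<lambda>u. C1 u \<and> u 12 = (\<lambda>_. 0) \<and> u 4 = (\<lambda>_. 0) \<and> tabs u)" if "B1 m t" for t
  proof -
    have h: "C1 t" "t 12 = (\<lambda>_. 0)" "t 4 = (\<lambda>_. 0)" using f1[OF that] by auto
    have "numbered_graph n (alv t) (eds t)" "t 0 0 = n" "t 0 1 = m" using h(1) G unfolding C1_def by auto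
    from run_tab[OF this] show ?thesis
      by (rule run_weaken[OF _ order_refl]) (use h C1_cong[OF h(1), of "{6, 7, 8, 10}"] in \<open>auto simp: eqx_def\<close>)
  qed
  let ?M = "\<lambda>i. Max (insert 0 (deg {..<m} (eds s) ` {..<i}))"
  define B2 where "B2 i t \<longleftrightarrow> t 10 0 = i \<and> C1 t \<and> t 4 = (\<lambda>_. 0) \<and> (\<forall>v<n. t 6 v = deg {..<m} (eds s) v) \<and> t 12 0 = ?M i" for i t
  have r3: "run (FOR 10 nE maxc) u (n * (cost maxc + 12 + acost nE) + 12 + acost nE) (B2 n)"
    if h: "C1 u" "u 12 = (\<lambda>_. 0)" "u 4 = (\<lambda>_. 0)" "tabs u" for u
  proof (rule run_for)
    have "\<forall>v<n. u 6 v = deg {..<m} (eds s) v" using h(1,4) unfolding C1_def tabs_def by simp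
    moreover have "C1 (set0 10 0 u)" by (rule C1_cong[OF h(1), of "{10}"]) (auto simp: eqx_def set0_def)
    ultimately show "B2 0 (set0 10 0 u)" unfolding B2_def using h by (simp add: set0_def)
  next
    fix i t assume "B2 i t" then show "aval nE t = n \<and> t 10 0 = i" unfolding B2_def C1_def by auto
  next
    fix i t assume h: "i < n" "B2 i t"
    have t6: "t 6 i = deg {..<m} (eds s) i" using h unfolding B2_def by auto
    have "C1 (set0 10 (Suc i) (ev maxc t))"
      by (rule C1_cong[of t "{10, 12}"]) (use h in \<open>auto simp: B2_def eqx_def set0_def maxc_def ev_assign\<close>)
    moreover have "ev maxc t 12 0 = ?M (Suc i)"
    proof -
      have t10: "t 10 0 = i" and t12: "t 12 0 = ?M i" using h unfolding B2_def by auto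
      have "ev maxc t 12 0 = max (t 6 i) (t 12 0)" using t10 unfolding maxc_def by (auto simp: ev_assign set0_def max_def)
      then show ?thesis unfolding t6 t12 Max_insert_upto .
    qed
    moreover have "ev maxc t a = t a" if "a \<noteq> 12" for a using that unfolding maxc_def by (auto simp: ev_assign set0_def)
    ultimately show "run maxc t (cost maxc) (\<lambda>s'. s' 10 0 = i \<and> B2 (Suc i) (set0 10 (Suc i) s'))"
      by - (rule run_ev', use h in \<open>auto simp: maxc_def B2_def set0_def\<close>)
  qed
  define B3 where "B3 i t \<longleftrightarrow> t 10 0 = i \<and> C1 t \<and> t 12 0 = k \<and> (\<forall>v<i. t 4 v = of_bool tot)" for i t
  let ?b = "Store 4 (var 10) (Const (of_bool tot))"
  have r4: "run (FOR 10 nE ?b) u (n * (cost ?b + 12 + acost nE) + 12 + acost nE) (B3 n)" if h: "B2 n u" for u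
  proof (rule run_for)
    have "C1 (set0 10 0 u)" by (rule C1_cong[of u "{10}"]) (use h in \<open>auto simp: B2_def eqx_def set0_def\<close>)
    then show "B3 0 (set0 10 0 u)" unfolding B3_def using h k by (simp add: set0_def B2_def)
  next
    fix i t assume "B3 i t" then show "aval nE t = n \<and> t 10 0 = i" unfolding B3_def C1_def by auto
  next
    fix i t assume h: "i < n" "B3 i t"
    have "C1 (set0 10 (Suc i) (ev ?b t))"
      by (rule C1_cong[of t "{4, 10}"]) (use h in \<open>auto simp: B3_def eqx_def set0_def\<close>)
    then show "run ?b t (cost ?b) (\<lambda>s'. s' 10 0 = i \<and> B3 (Suc i) (set0 10 (Suc i) s'))"
      by - (rule run_ev', use h in \<open>auto simp: B3_def set0_def less_Suc_eq\<close>)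
  qed
  let ?e = "Seq (assign 11 (Add (var 12) (Const (of_bool tot)))) (assign 19 (Add nE mE))"
  let ?Q = "\<lambda>t. alv t = {..<m} \<and> eds t = eds s \<and> t 0 0 = n \<and> t 0 1 = m \<and> t 12 0 = k \<and>
    t 11 0 = k + of_bool tot \<and> t 19 0 = n + m \<and> t 15 0 = 0 \<and> t 13 0 = 0 \<and> (\<forall>v<n. t 4 v = of_bool tot)"
  have r5: "run ?e u (cost ?e) ?Q" if h: "B3 n u" for u
  proof (rule run_ev')
    have "C1 (ev ?e u)" by (rule C1_cong[of u "{11, 19}"]) (use h in \<open>auto simp: B3_def eqx_def set0_def ev_assign\<close>)
    then show "?Q (ev ?e u)" using h unfolding B3_def C1_def by (auto simp: ev_assign set0_def)
  qed simp
  have "run (init tot) s ((m * (cost (Store 5 (var 10) (Const 1)) + 12 + acost mE) + 12 + acost mE) + (tab_time n m +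
     ((n * (cost maxc + 12 + acost nE) + 12 + acost nE) + ((n * (cost ?b + 12 + acost nE) + 12 + acost nE) + cost ?e)))) ?Q"
    unfolding init_def
    by (rule run_SeqI[OF r1], rule run_SeqI[OF r2], assumption, rule run_SeqI[OF r3], blast, blast, blast, blast, rule run_SeqI[OF r4], assumption, rule r5)
  then show ?thesis by (rule run_weaken) (simp_all add: init_time_def assign_def add.commute[of 14])
qed

lemma run_prog:
  assumes c: "s 0 0 = n" "s 0 1 = m" and z: "\<And>a. a \<in> {4, 5, 12, 13, 15} \<Longrightarrow> s a = (\<lambda>_. 0)"
    and G: "numbered_graph n {..<m} (eds s)" and k: "k = Max (insert 0 (deg {..<m} (eds s) ` {..<n}))"
    and ch: "chordless (eds s ` {..<m})" and k3: "3 \<le> k"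
  shows "run (prog tot) s (prog_time tot n m k) (\<lambda>t. proper {..<m} (eds s) (t 3) (t 4) \<and>
    coloured tot (k + of_bool tot) n {..<m} (t 3) (t 4))"
proof -
  let ?S = "{..<m}" and ?e = "eds s" and ?K = "k + of_bool tot"
  have dk: "deg ?S ?e v \<le> k" for v
  proof (cases "v < n")
    case True
    then show ?thesis unfolding k by (intro Max_ge) auto
  next
    case False
    then have "inc ?S ?e v = {}" using G unfolding numbered_graph_def inc_def by fastforce
    then show ?thesis unfolding deg_def by simp
  qed
  have I0: "step_inv k tot n ?S ?e" unfolding step_inv_def using G dk ch by (intro conjI exI[of _ "{}"]) auto
  define L where "L i t \<longleftrightarrow> t 14 0 = i \<and> step_inv k tot n (alv t) (eds t) \<and> t 0 0 = n \<and> t 0 1 = m \<and> t 12 0 = k \<and>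
     t 11 0 = ?K \<and> t 19 0 = n + m \<and> t 15 0 = 0 \<and> (\<forall>v<n. t 4 v = of_bool tot) \<and>
     hist tot k n m ?e (t 13 0) (stk t) (alv t) (eds t) \<and> t 13 0 \<le> i \<and> card (alv t) \<le> m - i" for i t
  have set14: "alv (set0 14 x t) = alv t" "eds (set0 14 x t) = eds t" "stk (set0 14 x t) = stk t" for x t
    using alv_eds_cong[of "set0 14 x t" t] unfolding stk_def by (auto simp: set0_def fun_eq_iff)
  let ?A = "\<lambda>t. alv t = ?S \<and> eds t = ?e \<and> t 0 0 = n \<and> t 0 1 = m \<and> t 12 0 = k \<and>
    t 11 0 = ?K \<and> t 19 0 = n + m \<and> t 15 0 = 0 \<and> t 13 0 = 0 \<and> (\<forall>v<n. t 4 v = of_bool tot)"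
  have r1: "run (init tot) s (init_time n m) ?A" by (rule run_init[OF c z G k])
  have r2: "run (FOR 14 mE (reduce tot)) t (m * (reduce_time tot n m + 12 + acost mE) + 12 + acost mE) (L m)" if t: "?A t" for t
  proof (rule run_for)
    show "L 0 (set0 14 0 t)" unfolding L_def set14 using t I0 by (simp add: set0_def)
  next
    fix i u assume "L i u" then show "aval mE u = m \<and> u 14 0 = i" unfolding L_def by simp
  next
    fix i u assume i: "i < m" and u: "L i u"
    have ui: "step_inv k tot n (alv u) (eds u)" "u 0 0 = n" "u 0 1 = m" "u 12 0 = k" "u 19 0 = n + m" "u 15 0 = 0"
      and H: "hist tot k n m ?e (u 13 0) (stk u) (alv u) (eds u)" using u unfolding L_def by auto
    have fin: "finite (alv u)" using ui(1) unfolding step_inv_def numbered_graph_def by auto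
    show "run (reduce tot) u (reduce_time tot n m) (\<lambda>s'. s' 14 0 = i \<and> L (Suc i) (set0 14 (Suc i) s'))"
    proof (rule run_weaken[OF run_reduce[OF ui k3] order_refl])
      fix w assume w: "eqx workspace u w \<and> step_inv k tot n (alv w) (eds w) \<and>
        (pushed tot k n m u w \<or> alv u = {} \<and> alv w = {} \<and> eds w = eds u \<and> w 13 0 = u 13 0 \<and> stk w = stk u)"
      have e: "w a = u a" if "a \<in> {0, 4, 11, 12, 14, 15, 19}" for a using w that unfolding eqx_def workspace_def temps_def by auto
      have "hist tot k n m ?e (w 13 0) (stk w) (alv w) (eds w) \<and> w 13 0 \<le> Suc i \<and> card (alv w) \<le> m - Suc i"
      proof (cases "pushed tot k n m u w")
        case True
        obtain xs where x: "removed xs \<subseteq> alv u" "removed xs \<noteq> {}" "alv w = alv u - removed xs" "w 13 0 = Suc (u 13 0)"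
          using True unfolding pushed_def by blast
        have "alv w \<subset> alv u" using x(1-3) by blast
        then have "card (alv w) < card (alv u)" using fin by (simp add: psubset_card_mono)
        then show ?thesis using hist_pushed[OF H True ui(3)] x(4) u unfolding L_def by auto
      next
        case False
        then show ?thesis using w H u unfolding L_def by auto
      qed
      then show "w 14 0 = i \<and> L (Suc i) (set0 14 (Suc i) w)" using w e u unfolding L_def set14 by (simp add: set0_def)
    qed
  qed
  have r3: "run (While (Less (Const 0) (var 13)) (Seq undo (colour tot))) t (m * (cost undo + colour_time tot k m + 5) + 5)
    (\<lambda>t. proper ?S ?e (t 3) (t 4) \<and> coloured tot ?K n ?S (t 3) (t 4))" if t: "L m t" for t
  proof -
    have "finite (alv t)" "card (alv t) = 0" using t unfolding L_def step_inv_def numbered_graph_def by auto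
    then have e: "alv t = {}" by simp
    have "undo_inv tot k n m ?e t" using t unfolding undo_inv_def L_def e by (auto simp: proper_def inc_def coloured_def)
    then have P0: "undo_inv tot k n m ?e t \<and> t 13 0 + 0 = t 13 0" by simp
    have D: "t 13 0 \<le> m" using t unfolding L_def by simp
    have "run (While (Less (Const 0) (var 13)) (Seq undo (colour tot))) t
      ((m - 0) * ((cost undo + colour_time tot k m) + 1 + bcost (Less (Const 0) (var 13))) + 1 + bcost (Less (Const 0) (var 13)))
      (\<lambda>s'. \<exists>i\<le>m. (undo_inv tot k n m ?e s' \<and> s' 13 0 + i = t 13 0) \<and> \<not> bval (Less (Const 0) (var 13)) s')"
    \<comment> \<open>The loop index counts the reductions undone; together with the height of the
      stack it stays equal to the initial height, which is at most \<open>m\<close>.\<close>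
    proof (rule run_while[where P = "\<lambda>i u. undo_inv tot k n m ?e u \<and> u 13 0 + i = t 13 0"])
      fix i u assume u: "undo_inv tot k n m ?e u \<and> u 13 0 + i = t 13 0" and b: "bval (Less (Const 0) (var 13)) u"
      then obtain d where d: "u 13 0 = Suc d" by (cases "u 13 0") auto
      have "run (Seq undo (colour tot)) u (cost undo + colour_time tot k m) (\<lambda>t. undo_inv tot k n m ?e t \<and> t 13 0 = d)"
        by (rule run_undo_colour[of tot k n m ?e u d]) (use u d k3 in blast)+
      then have "run (Seq undo (colour tot)) u (cost undo + colour_time tot k m) (\<lambda>w. undo_inv tot k n m ?e w \<and> w 13 0 + Suc i = t 13 0)"
        by (rule run_weaken) (use u d in auto)
      then show "i < m \<and> run (Seq undo (colour tot)) u (cost undo + colour_time tot k m) (\<lambda>w. undo_inv tot k n m ?e w \<and> w 13 0 + Suc i = t 13 0)"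
        using u d D by simp
    qed (use P0 in simp_all)
    then show ?thesis
    proof (rule run_weaken)
      fix u assume "\<exists>i\<le>m. (undo_inv tot k n m ?e u \<and> u 13 0 + i = t 13 0) \<and> \<not> bval (Less (Const 0) (var 13)) u"
      then show "proper ?S ?e (u 3) (u 4) \<and> coloured tot ?K n ?S (u 3) (u 4)" unfolding undo_inv_def by auto
    qed (simp add: algebra_simps)
  qed
  have "run (prog tot) s (init_time n m + ((m * (reduce_time tot n m + 12 + acost mE) + 12 + acost mE) +
      (m * (cost undo + colour_time tot k m + 5) + 5))) (\<lambda>t. proper ?S ?e (t 3) (t 4) \<and> coloured tot ?K n ?S (t 3) (t 4))"
    unfolding prog_def by (rule run_SeqI[OF r1], rule run_SeqI[OF r2], assumption, rule r3)
  then show ?thesis by (rule run_weaken) (simp_all add: prog_time_def)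
qed

section \<open>Cubic time bounds for chordless graphs\<close>

definition cubic :: "(nat \<Rightarrow> nat \<Rightarrow> nat \<Rightarrow> nat) \<Rightarrow> bool" where
  "cubic f \<longleftrightarrow> (\<exists>C. \<forall>n m k. 1 \<le> n \<and> 1 \<le> m \<and> m \<le> 2 * n \<and> k \<le> m \<longrightarrow> f n m k \<le> C * n ^ 3)"

lemma cubicI: "(\<And>n m k. 1 \<le> n \<Longrightarrow> 1 \<le> m \<Longrightarrow> m \<le> 2 * n \<Longrightarrow> k \<le> m \<Longrightarrow> f n m k \<le> C * n ^ 3) \<Longrightarrow> cubic f"
  unfolding cubic_def by blast

lemma cubic_const: "cubic (\<lambda>n m k. c)"
  by (rule cubicI[of _ c]) simp

lemma le_cube: "n \<le> n ^ 3" for n :: nat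
  by (cases n) (simp_all add: power3_eq_cube)

lemma cubic_n: "cubic (\<lambda>n m k. n * c)"
  by (rule cubicI[of _ c]) (use le_cube in \<open>simp add: mult.commute\<close>)

lemma cubic_m: "cubic (\<lambda>n m k. m * c)"
proof (rule cubicI[of _ "2 * c"])
  fix n m k :: nat assume "m \<le> 2 * n"
  then have "m * c \<le> (2 * n) * c" by (rule mult_right_mono) simp
  also have "\<dots> \<le> 2 * c * n ^ 3" using mult_left_mono[OF le_cube[of n], of "2 * c"] by (simp add: mult_ac)
  finally show "m * c \<le> 2 * c * n ^ 3" .
qed

lemma cubic_add: "cubic f \<Longrightarrow> cubic g \<Longrightarrow> cubic (\<lambda>n m k. f n m k + g n m k)"
proof -
  assume "cubic f" "cubic g"
  then obtain C D where "\<And>n m k. 1 \<le> n \<and> 1 \<le> m \<and> m \<le> 2 * n \<and> k \<le> m \<Longrightarrow> f n m k \<le> C * n ^ 3"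
    "\<And>n m k. 1 \<le> n \<and> 1 \<le> m \<and> m \<le> 2 * n \<and> k \<le> m \<Longrightarrow> g n m k \<le> D * n ^ 3" unfolding cubic_def by blast
  then show ?thesis by (intro cubicI[of _ "C + D"]) (simp add: add_mono distrib_right)
qed

lemma cubic_mono: "cubic g \<Longrightarrow> (\<And>n m k. f n m k \<le> g n m k) \<Longrightarrow> cubic f"
  unfolding cubic_def by (meson le_trans)

lemma srch_time_le: "srch_time B T l \<le> (B + 1) ^ l * (T + 40 * l)"
proof (induction l)
  case (Suc l)
  have "srch_time B T l + 40 \<le> (B + 1) ^ l * (T + 40 * l) + (B + 1) ^ l * 40" using Suc.IH one_le_power[of "B + 1" l] by linarith
  also have "\<dots> = (B + 1) ^ l * (T + 40 * Suc l)" by (simp add: algebra_simps)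
  finally have "(B + 1) * (srch_time B T l + 40) \<le> (B + 1) * ((B + 1) ^ l * (T + 40 * Suc l))" by (rule mult_left_mono) simp
  then show ?case by (simp only: srch_time.simps power_Suc mult.assoc)
qed simp

text \<open>Nested loops of depth \<open>l\<close> with linearly many rounds each leave room for a
  test of order \<open>n ^ (3 - l)\<close>: constant time for triples of candidates, linear time for
  the colours of one or two elements.\<close>

lemma cubic_srch:
  assumes "l \<le> 3" "\<And>n m k. 1 \<le> n \<Longrightarrow> 1 \<le> m \<Longrightarrow> m \<le> 2 * n \<Longrightarrow> k \<le> m \<Longrightarrow> B n m k + 1 \<le> 4 * n \<and> T n m k \<le> c * n ^ (3 - l)"
  shows "cubic (\<lambda>n m k. srch_time (B n m k) (T n m k) l)"
proof (rule cubicI[of _ "4 ^ l * (c + 40 * l)"])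
  fix n m k :: nat assume h: "1 \<le> n" "1 \<le> m" "m \<le> 2 * n" "k \<le> m"
  note a = assms(2)[OF h]
  have "srch_time (B n m k) (T n m k) l \<le> (B n m k + 1) ^ l * (T n m k + 40 * l)" by (rule srch_time_le)
  also have "\<dots> \<le> (4 * n) ^ l * (c * n ^ (3 - l) + 40 * l * n ^ (3 - l))"
  proof (rule mult_mono)
    show "(B n m k + 1) ^ l \<le> (4 * n) ^ l" by (rule power_mono) (use a in auto)
    have "1 \<le> n ^ (3 - l)" using h(1) by simp
    then have "40 * l * 1 \<le> 40 * l * n ^ (3 - l)" by (rule mult_left_mono) simp
    then show "T n m k + 40 * l \<le> c * n ^ (3 - l) + 40 * l * n ^ (3 - l)" using a by linarith
  qed auto
  also have "\<dots> = 4 ^ l * (c + 40 * l) * (n ^ l * n ^ (3 - l))" by (simp add: power_mult_distrib algebra_simps)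
  also have "n ^ l * n ^ (3 - l) = n ^ 3" using assms(1) by (simp flip: power_add)
  finally show "srch_time (B n m k) (T n m k) l \<le> 4 ^ l * (c + 40 * l) * n ^ 3" .
qed

lemma chk_time_le:
  assumes "1 \<le> n" "m \<le> 2 * n" shows "chk_time es m \<le> (2 * (bcost (econf (var 10) es) + 200) + 20) * n"
proof -
  have "m * (bcost (econf (var 10) es) + 200) \<le> 2 * n * (bcost (econf (var 10) es) + 200)" by (rule mult_right_mono) (use assms in auto)
  then show ?thesis using assms(1) unfolding chk_time_def by (simp add: algebra_simps)
qed

lemma cubic_extend:
  assumes "length es + length vs \<in> {1, 2}" "b \<le> 1"
  shows "cubic (\<lambda>n m k. extend_time es vs (k + b) m)"
  unfolding extend_time_def
proof (rule cubic_add[OF cubic_const cubic_srch])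
  fix n m k :: nat assume h: "1 \<le> n" "1 \<le> m" "m \<le> 2 * n" "k \<le> m"
  let ?c = "2 * (bcost (econf (var 10) es) + 200) + 20"
  have "n ^ 1 \<le> n ^ (3 - (length es + length vs))" by (rule power_increasing) (use assms h in auto)
  then have "?c * n \<le> ?c * n ^ (3 - (length es + length vs))" by (intro mult_left_mono) simp_all
  then show "k + b + 1 \<le> 4 * n \<and> chk_time es m \<le> ?c * n ^ (3 - (length es + length vs))"
    using chk_time_le[OF h(1,3), of es] h assms(2) by linarith
qed (use assms in auto)

text \<open>Only four values are tried in each slot, so a fixed number of slots contributes a
  constant factor to the linear cost of a test.\<close>

lemma cubic_extend4: "cubic (\<lambda>n m k. extend_time es vs 4 m)"
  unfolding extend_time_def
proof (rule cubic_add[OF cubic_const])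
  let ?l = "length es + length vs" and ?c = "2 * (bcost (econf (var 10) es) + 200) + 20"
  show "cubic (\<lambda>n m k. srch_time 4 (chk_time es m) ?l)"
  proof (rule cubicI)
    fix n m k :: nat assume h: "1 \<le> n" "1 \<le> m" "m \<le> 2 * n" "k \<le> m"
    have "srch_time 4 (chk_time es m) ?l \<le> (4 + 1) ^ ?l * (chk_time es m + 40 * ?l)" by (rule srch_time_le)
    also have "\<dots> \<le> (4 + 1) ^ ?l * ((?c + 40 * ?l) * n)"
    proof (rule mult_left_mono)
      have "40 * ?l * 1 \<le> 40 * ?l * n" by (rule mult_left_mono) (use h in auto)
      then show "chk_time es m + 40 * ?l \<le> (?c + 40 * ?l) * n" using chk_time_le[OF h(1,3), of es] unfolding distrib_right by linarith
    qed simp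
    also have "\<dots> \<le> (4 + 1) ^ ?l * ((?c + 40 * ?l) * n ^ 3)" by (intro mult_left_mono le_cube) simp_all
    finally show "srch_time 4 (chk_time es m) ?l \<le> (4 + 1) ^ ?l * (?c + 40 * ?l) * n ^ 3" by (simp only: mult.assoc)
  qed
qed

lemma cubic_tab: "cubic (\<lambda>n m k. tab_time n m)"
  unfolding tab_time_def by (intro cubic_add cubic_const cubic_n cubic_m)

lemma cubic_find: "l \<in> {2, 3} \<Longrightarrow> cubic (\<lambda>n m k. srch_time (n + m) c l)"
proof (rule cubic_srch[where c = c])
  fix n m k :: nat assume "l \<in> {2, 3}" and h: "1 \<le> n" "1 \<le> m" "m \<le> 2 * n" "k \<le> m"
  have "c * 1 \<le> c * n ^ (3 - l)" by (rule mult_left_mono) (use h in auto)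
  then show "n + m + 1 \<le> 4 * n \<and> c \<le> c * n ^ (3 - l)" using h by auto
qed auto

text \<open>There are \<open>m\<close> rounds of reduction and at most \<open>m\<close> of undoing,
  each of cubic cost. The cubic cost of the initialisation is absorbed because \<open>m\<close> is
  at least 1.\<close>

lemma prog_time_le:
  "\<exists>C. \<forall>n m k. 1 \<le> n \<and> 1 \<le> m \<and> m \<le> 2 * n \<and> k \<le> m \<longrightarrow> prog_time tot n m k \<le> C * (n ^ 3 * m)"
proof -
  have r: "cubic (\<lambda>n m k. reduce_time tot n m + 14)"
    unfolding reduce_time_def by (intro cubic_add cubic_const cubic_tab cubic_find) auto
  have "cubic (\<lambda>n m k. 5 + (extend_time [20..<26] [26..<32] 4 m + (extend_time [20, 21] [] (k + of_bool tot) m +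
      (extend_time [] [26] (k + of_bool tot) m + extend_time [] [27] (k + of_bool tot) m))))"
    by (intro cubic_add cubic_const cubic_extend4 cubic_extend) auto
  then have "cubic (\<lambda>n m k. colour_time tot k m)" by (rule cubic_mono) (simp add: colour_time_def)
  then have u: "cubic (\<lambda>n m k. cost undo + colour_time tot k m + 5)" by (intro cubic_add cubic_const)
  have i: "cubic (\<lambda>n m k. init_time n m + 14 + 5)"
    unfolding init_time_def by (intro cubic_add cubic_const cubic_n cubic_m cubic_tab)
  obtain A where A: "\<And>n m k. 1 \<le> n \<and> 1 \<le> m \<and> m \<le> 2 * n \<and> k \<le> m \<Longrightarrow> reduce_time tot n m + 14 \<le> A * n ^ 3" using r unfolding cubic_def by blast
  obtain B where B: "\<And>n m k. 1 \<le> n \<and> 1 \<le> m \<and> m \<le> 2 * n \<and> k \<le> m \<Longrightarrow> cost undo + colour_time tot k m + 5 \<le> B * n ^ 3" using u unfolding cubic_def by blast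
  obtain D where D: "\<And>n m k. 1 \<le> n \<and> 1 \<le> m \<and> m \<le> 2 * n \<and> k \<le> m \<Longrightarrow> init_time n m + 14 + 5 \<le> D * n ^ 3" using i unfolding cubic_def by blast
  show ?thesis
  proof (rule exI[of _ "D + A + B"], intro allI impI)
    fix n m k :: nat assume h: "1 \<le> n \<and> 1 \<le> m \<and> m \<le> 2 * n \<and> k \<le> m"
    have "m * (reduce_time tot n m + 14) \<le> m * (A * n ^ 3)" "m * (cost undo + colour_time tot k m + 5) \<le> m * (B * n ^ 3)"
      using A[OF h] B[OF h] by (auto intro: mult_left_mono)
    moreover have "D * n ^ 3 * 1 \<le> D * n ^ 3 * m" by (rule mult_left_mono) (use h in auto)
    ultimately have "prog_time tot n m k \<le> D * n ^ 3 * m + m * (A * n ^ 3) + m * (B * n ^ 3)"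
      using D[OF h] unfolding prog_time_def by linarith
    then show "prog_time tot n m k \<le> (D + A + B) * (n ^ 3 * m)" by (simp add: algebra_simps)
  qed
qed

section \<open>From the input list to the output colouring\<close>

lemma eds_input: "i < length es \<Longrightarrow> eds (input_store n es) i = edge_of (es ! i)"
  unfolding eds_def input_store_def edge_of_def by simp

lemma input_graph:
  assumes g: "fin_simple_graph {..<n} E" and l: "edge_list E es"
  defines "ed \<equiv> eds (input_store n es)" and "m \<equiv> length es"
  shows "numbered_graph n {..<m} ed" "ed ` {..<m} = E" "m = card E" "vdegree E v = deg {..<m} ed v"
proof -
  have ei: "ed i = map edge_of es ! i" if "i < m" for i using eds_input[of i es n] that unfolding ed_def m_def by simp
  have ds: "distinct (map edge_of es)" "set (map edge_of es) = E" using l unfolding edge_list_def by auto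
  show im: "ed ` {..<m} = E"
  proof -
    have "E = (\<lambda>i. map edge_of es ! i) ` {..<m}" unfolding ds(2)[symmetric] m_def set_conv_nth by (auto simp del: nth_map)
    then show ?thesis using ei by auto
  qed
  have inj: "inj_on ed {..<m}"
  proof (rule inj_onI)
    fix x y assume "x \<in> {..<m}" "y \<in> {..<m}" "ed x = ed y"
    then show "x = y" using nth_eq_iff_index_eq[OF ds(1), of x y] ei[of x] ei[of y] unfolding m_def by simp
  qed
  show "m = card E" using card_image[OF inj] im by simp
  show G: "numbered_graph n {..<m} ed" unfolding numbered_graph_def using inj g im unfolding fin_simple_graph_def by blast
  have "{e \<in> E. v \<in> e} = ed ` inc {..<m} ed v" unfolding im[symmetric] inc_def by auto
  moreover have "inj_on ed (inc {..<m} ed v)" using inj by (rule inj_on_subset) (auto simp: inc_def)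
  ultimately show "vdegree E v = deg {..<m} ed v" unfolding vdegree_def deg_def by (simp add: card_image)
qed

text \<open>All edges, and for total colourings all vertices, have positive colours, so the
  exemption of colour 0 in \<open>proper\<close> does not apply to them. The number
  \<open>ix e\<close> of an edge is well defined because the list names each edge once.\<close>

lemma proper_colourings:
  assumes g: "fin_simple_graph {..<n} E" and l: "edge_list E es"
    and P: "proper {..<length es} (eds (input_store n es)) (s 3) (s 4)" and C: "coloured tot K n {..<length es} (s 3) (s 4)"
  shows "outputs_edge_colouring E es K s" "tot \<Longrightarrow> outputs_total_colouring n E es K s"
proof -
  let ?ed = "eds (input_store n es)" and ?S = "{..<length es}"
  note I = input_graph[OF g l]
  have inj: "inj_on ?ed ?S" using I(1) unfolding numbered_graph_def by blast
  define ix where "ix = the_inv_into ?S ?ed"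
  have ix: "ix (?ed i) = i" if "i < length es" for i unfolding ix_def using the_inv_into_f_f[OF inj] that by simp
  have ob: "\<exists>i<length es. e = ?ed i" if "e \<in> E" for e using that I(2) by auto
  have r: "1 \<le> s 3 (ix e) \<and> s 3 (ix e) \<le> K" if "e \<in> E" for e
  proof -
    obtain i where "i < length es" "e = ?ed i" using ob \<open>e \<in> E\<close> by blast
    then show ?thesis using C ix unfolding coloured_def by auto
  qed
  have adj: "s 3 (ix e) \<noteq> s 3 (ix f)" if h: "e \<in> E" "f \<in> E" "adjacent_edges e f" for e f
  proof -
    obtain i where i: "i < length es" "e = ?ed i" using ob h by blast
    obtain j where j: "j < length es" "f = ?ed j" using ob h by blast
    obtain v where v: "v \<in> e" "v \<in> f" and ne: "e \<noteq> f" using h(3) unfolding adjacent_edges_def by blast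
    have "i \<in> inc ?S ?ed v" "j \<in> inc ?S ?ed v" "i \<noteq> j" using i j v ne unfolding inc_def by auto
    then show ?thesis using proper_edges[OF P, of i v j] r[OF h(1)] ix i j by auto
  qed
  show "outputs_edge_colouring E es K s" unfolding outputs_edge_colouring_def edge_colouring_def
    by (rule exI[of _ "\<lambda>e. s 3 (ix e)"]) (use r adj ix eds_input[of _ es n] in auto)
  assume tot
  then have rv: "1 \<le> s 4 v \<and> s 4 v \<le> K" if "v < n" for v using C that unfolding coloured_def by simp
  define c where "c x = (case x of Vertex v \<Rightarrow> s 4 v | Edge e \<Rightarrow> s 3 (ix e))" for x
  have ve: "s 3 (ix e) \<noteq> s 4 v" if h: "e \<in> E" "v \<in> e" for e v
  proof -
    obtain i where i: "i < length es" "e = ?ed i" using ob h by blast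
    then have "i \<in> inc ?S ?ed v" using h unfolding inc_def by simp
    then show ?thesis using proper_ends[OF P, of i v] r[OF h(1)] ix i by auto
  qed
  have vv: "s 4 u \<noteq> s 4 v" if h: "{u, v} \<in> E" "u < n" for u v
  proof -
    obtain i where i: "i < length es" "{u, v} = ?ed i" using ob h by blast
    have "card {u, v} = 2" using g h unfolding fin_simple_graph_def by blast
    then have "u \<noteq> v" by auto
    then show ?thesis using proper_nbrs[OF P, of i u v] rv[OF h(2)] i by auto
  qed
  have "total_colouring {..<n} E K c" unfolding total_colouring_def
  proof (intro conjI ballI impI)
    fix x assume "x \<in> elements {..<n} E"
    then show "c x \<in> {1..K}" using r rv unfolding elements_def c_def by auto
  next
    fix x y assume h: "x \<in> elements {..<n} E" "y \<in> elements {..<n} E" "adjacent_elements E x y"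
    show "c x \<noteq> c y"
    proof (cases x)
      case x: (Vertex u)
      show ?thesis
      proof (cases y)
        case (Vertex v)
        then show ?thesis using vv[of u v] h x unfolding elements_def c_def by auto
      next
        case (Edge e)
        then show ?thesis using ve[of e u] h x unfolding elements_def c_def by auto
      qed
    next
      case x: (Edge e)
      show ?thesis
      proof (cases y)
        case (Vertex v)
        then show ?thesis using ve[of e v] h x unfolding elements_def c_def by auto
      next
        case (Edge f)
        then show ?thesis using adj[of e f] h x unfolding elements_def c_def by auto
      qed
    qed
  qed
  then show "outputs_total_colouring n E es K s" unfolding outputs_total_colouring_def
    by (intro exI[of _ c]) (use ix eds_input[of _ es n] in \<open>auto simp: c_def\<close>)
qed

text \<open>\<open>chordless_card_edges\<close> bounds \<open>m\<close> by \<open>2 * n\<close>, and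
  a vertex of maximum degree gives at most \<open>m\<close> for \<open>k\<close>; these are the
  conditions under which the time bounds are cubic.\<close>

lemma prog_correct:
  "\<exists>C. \<forall>n E es. fin_simple_graph {..<n} E \<and> chordless E \<and> 3 \<le> max_degree {..<n} E \<and> edge_list E es \<longrightarrow>
     (\<exists>t s. exec (prog tot) (input_store n es) t s \<and> t \<le> C * (card {..<n} ^ 3 * card E) \<and>
        outputs_edge_colouring E es (max_degree {..<n} E + of_bool tot) s \<and>
        (tot \<longrightarrow> outputs_total_colouring n E es (max_degree {..<n} E + of_bool tot) s))"
proof -
  obtain C where C: "\<And>n m k. 1 \<le> n \<and> 1 \<le> m \<and> m \<le> 2 * n \<and> k \<le> m \<Longrightarrow> prog_time tot n m k \<le> C * (n ^ 3 * m)"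
    using prog_time_le[of tot] by blast
  show ?thesis
  proof (rule exI[of _ C], intro allI impI, elim conjE)
    fix n :: nat and E :: "nat set set" and es :: "(nat \<times> nat) list"
    assume g: "fin_simple_graph {..<n} E" and ch: "chordless E" and k3: "3 \<le> max_degree {..<n} E" and l: "edge_list E es"
    define k m s0 where d: "k = max_degree {..<n} E" "m = length es" "s0 = input_store n es"
    note I = input_graph[OF g l, folded d]
    have k: "k = Max (insert 0 (deg {..<m} (eds s0) ` {..<n}))" unfolding d(1) max_degree_def I(4) ..
    have "run (prog tot) s0 (prog_time tot n m k) (\<lambda>t. proper {..<m} (eds s0) (t 3) (t 4) \<and> coloured tot (k + of_bool tot) n {..<m} (t 3) (t 4))"
      by (rule run_prog[OF _ _ _ I(1) k]) (use ch I(2) k3 in \<open>auto simp: d input_store_def\<close>)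
    then obtain t s where e: "exec (prog tot) s0 t s" "t \<le> prog_time tot n m k"
      "proper {..<m} (eds s0) (s 3) (s 4)" "coloured tot (k + of_bool tot) n {..<m} (s 3) (s 4)" unfolding run_def by blast
    have fE: "finite E" unfolding I(2)[symmetric] by simp
    have "k \<in> insert 0 (vdegree E ` {..<n})" unfolding d(1) max_degree_def by (rule Max_in) auto
    then obtain v where v: "v < n" "k = vdegree E v" using k3 d(1) by auto
    have km: "k \<le> m" unfolding v(2) vdegree_def I(3) by (rule card_mono) (use fE in auto)
    have "simple_edges E" using g fE unfolding simple_edges_def fin_simple_graph_def by auto
    moreover have "\<Union>E \<subseteq> {..<n}" using g unfolding fin_simple_graph_def by auto
    ultimately have "m \<le> 2 * n" using chordless_card_edges[of "{..<n}" E] ch I(3) by simp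
    then have "prog_time tot n m k \<le> C * (n ^ 3 * m)" using v(1) km k3 d(1) by (intro C) auto
    then have "t \<le> C * (card {..<n} ^ 3 * card E)" using e(2) I(3) by simp
    moreover note proper_colourings[OF g l e(3)[unfolded d] e(4)[unfolded d]]
    ultimately show "\<exists>t s. exec (prog tot) (input_store n es) t s \<and> t \<le> C * (card {..<n} ^ 3 * card E) \<and>
        outputs_edge_colouring E es (max_degree {..<n} E + of_bool tot) s \<and>
        (tot \<longrightarrow> outputs_total_colouring n E es (max_degree {..<n} E + of_bool tot) s)"
      using e(1) unfolding d by blast
  qed
qed

lemma ex_edge_list:
  assumes "fin_simple_graph V E" shows "\<exists>es. edge_list E es"
proof -
  have "E \<subseteq> Pow V" "finite V" using assms unfolding fin_simple_graph_def by auto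
  then have "finite E" using finite_subset by blast
  then obtain L where L: "set L = E" "distinct L" using finite_distinct_list by blast
  have p: "\<exists>p. edge_of p = e" if "e \<in> E" for e
  proof -
    have "card e = 2" using assms that unfolding fin_simple_graph_def by blast
    then obtain x y where "e = {x, y}" unfolding card_2_iff by blast
    then show ?thesis unfolding edge_of_def by (intro exI[of _ "(x, y)"]) simp
  qed
  have "edge_of (SOME p. edge_of p = e) = e" if "e \<in> E" for e by (rule someI_ex[OF p[OF that]])
  then have "map edge_of (map (\<lambda>e. SOME p. edge_of p = e) L) = L" unfolding map_map by (intro map_idI) (simp add: L(1))
  then show ?thesis unfolding edge_list_def using L by metis
qed

section \<open>Transport to graphs on arbitrary vertices\<close>

lemma cycle_edges_map: "vs \<noteq> [] \<Longrightarrow> cycle_edges (map g vs) = (`) g ` cycle_edges vs"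
proof -
  assume ne: "vs \<noteq> []"
  have "{{map g vs ! i, map g vs ! Suc i} | i. Suc i < length (map g vs)} = (`) g ` {{vs ! i, vs ! Suc i} | i. Suc i < length vs}"
  proof (intro set_eqI iffI)
    fix x assume "x \<in> {{map g vs ! i, map g vs ! Suc i} | i. Suc i < length (map g vs)}"
    then obtain i where "Suc i < length vs" "x = g ` {vs ! i, vs ! Suc i}" by auto
    then show "x \<in> (`) g ` {{vs ! i, vs ! Suc i} | i. Suc i < length vs}" by blast
  next
    fix x assume "x \<in> (`) g ` {{vs ! i, vs ! Suc i} | i. Suc i < length vs}"
    then obtain i where "Suc i < length vs" "x = g ` {vs ! i, vs ! Suc i}" by blast
    then have "x = {map g vs ! i, map g vs ! Suc i}" "Suc i < length (map g vs)" by auto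
    then show "x \<in> {{map g vs ! i, map g vs ! Suc i} | i. Suc i < length (map g vs)}" by blast
  qed
  then show ?thesis unfolding cycle_edges_def image_Un using ne by (simp add: last_map hd_map)
qed

lemma cycle_vertices: "2 \<le> length vs \<Longrightarrow> set vs \<subseteq> \<Union>(cycle_edges vs)"
proof
  fix x assume l: "2 \<le> length vs" and "x \<in> set vs"
  then obtain i where i: "i < length vs" "x = vs ! i" by (auto simp: in_set_conv_nth)
  show "x \<in> \<Union>(cycle_edges vs)"
  proof (cases "Suc i < length vs")
    case True
    then have "{vs ! i, vs ! Suc i} \<in> cycle_edges vs" unfolding cycle_edges_def by blast
    then show ?thesis using i by blast
  next
    case False
    then have "i = length vs - 1" using i by linarith
    moreover have "vs \<noteq> []" using l by auto
    ultimately have "x = last vs" using i last_conv_nth[of vs] by simp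
    then show ?thesis unfolding cycle_edges_def by blast
  qed
qed

lemma chordless_image:
  assumes h: "inj_on h V" and E: "\<And>e. e \<in> E \<Longrightarrow> e \<subseteq> V" and ch: "chordless E"
  shows "chordless ((`) h ` E)"
  unfolding chordless_def
proof (intro allI impI notI)
  fix vs assume c: "is_cycle ((`) h ` E) vs" and "\<exists>e. is_chord ((`) h ` E) vs e"
  then obtain e where e: "is_chord ((`) h ` E) vs e" by blast
  let ?g = "inv_into V h"
  have gh: "?g ` (h ` a) = a" if "a \<in> E" for a
  proof -
    have "?g ` h ` a = (\<lambda>x. ?g (h x)) ` a" by (simp add: image_image)
    also have "\<dots> = (\<lambda>x. x) ` a" by (rule image_cong) (use E[OF that] inv_into_f_f[OF h] in auto)
    finally show ?thesis by simp
  qed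
  have hg: "h ` (?g ` a) = a" if "a \<in> (`) h ` E" for a
  proof -
    obtain b where "b \<in> E" "a = h ` b" using \<open>a \<in> (`) h ` E\<close> by blast
    then show ?thesis by (simp only: gh)
  qed
  have l: "3 \<le> length vs" "distinct vs" "cycle_edges vs \<subseteq> (`) h ` E" using c unfolding is_cycle_def by auto
  have "\<Union>(cycle_edges vs) \<subseteq> h ` V" using l(3) E by fastforce
  then have vs: "set vs \<subseteq> h ` V" using cycle_vertices[of vs] l(1) by auto
  have ce: "cycle_edges (map ?g vs) = (`) ?g ` cycle_edges vs" by (rule cycle_edges_map) (use l(1) in auto)
  have gE: "(`) ?g ` ((`) h ` E) = E"
  proof (intro equalityI subsetI)
    fix x assume "x \<in> (`) ?g ` ((`) h ` E)"
    then obtain a where "a \<in> E" "x = ?g ` h ` a" by blast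
    then show "x \<in> E" by (simp only: gh)
  next
    fix a assume a: "a \<in> E"
    then have "?g ` h ` a \<in> (`) ?g ` ((`) h ` E)" by blast
    then show "a \<in> (`) ?g ` ((`) h ` E)" unfolding gh[OF a] .
  qed
  have "is_cycle E (map ?g vs)" unfolding is_cycle_def
  proof (intro conjI)
    show "distinct (map ?g vs)" using l(2) inj_on_subset[OF inj_on_inv_into[OF order_refl] vs] by (simp add: distinct_map)
    show "cycle_edges (map ?g vs) \<subseteq> E" unfolding ce using image_mono[OF l(3), of "(`) ?g"] gE by simp
  qed (use l(1) in simp)
  moreover have "is_chord E (map ?g vs) (?g ` e)" unfolding is_chord_def
  proof (intro conjI)
    have eE: "e \<in> (`) h ` E" "e \<subseteq> set vs" "e \<notin> cycle_edges vs" using e unfolding is_chord_def by auto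
    show "?g ` e \<in> E" using eE(1) gE by blast
    show "?g ` e \<subseteq> set (map ?g vs)" using eE(2) by auto
    show "?g ` e \<notin> cycle_edges (map ?g vs)"
    proof
      assume "?g ` e \<in> cycle_edges (map ?g vs)"
      then obtain a where a: "a \<in> cycle_edges vs" "?g ` e = ?g ` a" unfolding ce by blast
      have "a \<in> (`) h ` E" using a(1) l(3) by blast
      then have "e = a" using hg[OF eE(1)] hg[of a] a(2) by metis
      then show False using a eE(3) by simp
    qed
  qed
  ultimately show False using ch unfolding chordless_def by blast
qed

lemma image_graph:
  assumes g: "fin_simple_graph V E" and h: "inj_on h V"
  shows "fin_simple_graph (h ` V) ((`) h ` E)" "max_degree (h ` V) ((`) h ` E) = max_degree V E"
proof -
  have E: "e \<subseteq> V" "card e = 2" if "e \<in> E" for e using g that unfolding fin_simple_graph_def by auto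
  show "fin_simple_graph (h ` V) ((`) h ` E)" unfolding fin_simple_graph_def
  proof (intro conjI ballI)
    show "finite (h ` V)" using g unfolding fin_simple_graph_def by simp
    fix e' assume "e' \<in> (`) h ` E"
    then obtain e where e: "e \<in> E" "e' = h ` e" by blast
    show "e' \<subseteq> h ` V" using e E by blast
    show "card e' = 2" using card_image[OF inj_on_subset[OF h E(1)[OF e(1)]]] E(2)[OF e(1)] e(2) by simp
  qed
  have "vdegree ((`) h ` E) (h v) = vdegree E v" if v: "v \<in> V" for v
  proof -
    have "{e \<in> (`) h ` E. h v \<in> e} = (`) h ` {e \<in> E. v \<in> e}"
      using inj_on_image_mem_iff[OF h v E(1)] by blast
    moreover have "inj_on ((`) h) {e \<in> E. v \<in> e}"
      by (rule inj_on_subset[OF inj_on_image_Pow[OF h]]) (use E(1) in auto)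
    ultimately show ?thesis unfolding vdegree_def by (simp add: card_image)
  qed
  then have "vdegree ((`) h ` E) ` h ` V = vdegree E ` V" unfolding image_image by (rule image_cong[OF refl])
  then show "max_degree (h ` V) ((`) h ` E) = max_degree V E" unfolding max_degree_def by simp
qed

lemma colourable_image:
  assumes g: "fin_simple_graph V E" and h: "inj_on h V"
  shows "edge_colourable ((`) h ` E) k \<Longrightarrow> edge_colourable E k"
    "total_colourable (h ` V) ((`) h ` E) k \<Longrightarrow> total_colourable V E k"
proof -
  have E: "e \<subseteq> V" if "e \<in> E" for e using g that unfolding fin_simple_graph_def by auto
  have adj: "adjacent_edges (h ` e) (h ` f)" if "e \<in> E" "f \<in> E" "adjacent_edges e f" for e f
  proof -
    have "h ` e \<noteq> h ` f" using that inj_on_image_eq_iff[OF h E E, of e f] unfolding adjacent_edges_def by auto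
    moreover have "h ` e \<inter> h ` f \<noteq> {}" using that(3) unfolding adjacent_edges_def by blast
    ultimately show ?thesis unfolding adjacent_edges_def by blast
  qed
  show "edge_colourable E k" if ec: "edge_colourable ((`) h ` E) k"
  proof -
    obtain c where c: "edge_colouring ((`) h ` E) k c" using ec unfolding edge_colourable_def by blast
    have "edge_colouring E k (\<lambda>e. c (h ` e))" using c adj unfolding edge_colouring_def by simp
    then show ?thesis unfolding edge_colourable_def by blast
  qed
  show "total_colourable V E k" if tc: "total_colourable (h ` V) ((`) h ` E) k"
  proof -
    obtain c where c: "total_colouring (h ` V) ((`) h ` E) k c" using tc unfolding total_colourable_def by blast
    define r where "r x = (case x of Vertex v \<Rightarrow> Vertex (h v) | Edge e \<Rightarrow> Edge (h ` e))" for x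
    have el: "r x \<in> elements (h ` V) ((`) h ` E)" if "x \<in> elements V E" for x
      using that unfolding elements_def r_def by auto
    have ad: "adjacent_elements ((`) h ` E) (r x) (r y)" if xy: "x \<in> elements V E" "y \<in> elements V E" "adjacent_elements E x y" for x y
    proof (cases x)
      case x: (Vertex u)
      show ?thesis
      proof (cases y)
        case (Vertex v)
        then have "{u, v} \<in> E" using x xy by simp
        then have "h ` {u, v} \<in> (`) h ` E" by (rule imageI)
        then show ?thesis using Vertex x unfolding r_def by simp
      next
        case (Edge e) then show ?thesis using x xy unfolding r_def by simp
      qed
    next
      case x: (Edge e)
      show ?thesis
      proof (cases y)
        case (Vertex v) then show ?thesis using x xy unfolding r_def by simp
      next
        case (Edge f)
        then have "e \<in> E" "f \<in> E" "adjacent_edges e f" using x xy unfolding elements_def by auto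
        then show ?thesis using adj Edge x unfolding r_def by simp
      qed
    qed
    have "total_colouring V E k (\<lambda>x. c (r x))" using c el ad unfolding total_colouring_def by blast
    then show ?thesis unfolding total_colourable_def by blast
  qed
qed

text \<open>The graph is copied to the vertices below \<open>card V\<close>, where the output of the
  program on some list of the edges is a colouring of the desired kind.\<close>

lemma chordless_colourable:
  assumes g: "fin_simple_graph V E" and ch: "chordless E" and k: "3 \<le> max_degree V E"
  shows "edge_colourable E (max_degree V E)" "total_colourable V E (max_degree V E + 1)"
proof -
  have E: "e \<subseteq> V" if "e \<in> E" for e using g that unfolding fin_simple_graph_def by auto
  have "finite V" using g unfolding fin_simple_graph_def by simp
  then obtain h where "bij_betw h V {..<card V}" using ex_bij_betw_finite_nat[of V] by (auto simp: atLeast0LessThan)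
  then have h: "inj_on h V" "h ` V = {..<card V}" unfolding bij_betw_def by auto
  let ?n = "card V" and ?E = "(`) h ` E"
  note im = image_graph[OF g h(1), unfolded h(2)]
  obtain es where es: "edge_list ?E es" using ex_edge_list[OF im(1)] by blast
  have pre: "fin_simple_graph {..<?n} ?E \<and> chordless ?E \<and> 3 \<le> max_degree {..<?n} ?E \<and> edge_list ?E es"
    using im chordless_image[OF h(1) E ch] k es by simp
  have a: "\<exists>s. outputs_edge_colouring ?E es (max_degree {..<?n} ?E + of_bool tot) s \<and>
     (tot \<longrightarrow> outputs_total_colouring ?n ?E es (max_degree {..<?n} ?E + of_bool tot) s)" for tot
    using prog_correct[of tot] pre by blast
  have "edge_colourable ?E (max_degree V E)" using a[of False] im(2) unfolding outputs_edge_colouring_def edge_colourable_def by auto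
  then show "edge_colourable E (max_degree V E)" by (rule colourable_image(1)[OF g h(1)])
  have "total_colourable (h ` V) ?E (max_degree V E + 1)" using a[of True] im(2) h(2)
    unfolding outputs_total_colouring_def total_colourable_def by auto
  then show "total_colourable V E (max_degree V E + 1)" by (rule colourable_image(2)[OF g h(1)])
qed

theorem theorem1:
  shows "(\<forall>(V :: 'a set) E.
            fin_simple_graph V E \<and> chordless E \<and> 3 \<le> max_degree V E \<longrightarrow>
              edge_colourable E (max_degree V E) \<and>
              total_colourable V E (max_degree V E + 1)) \<and>
         (\<exists>p K. \<forall>(n :: nat) E es.
            fin_simple_graph {..<n} E \<and> chordless E \<and> 3 \<le> max_degree {..<n} E \<and>
            edge_list E es \<longrightarrow>
              (\<exists>t s. exec p (input_store n es) t s \<and>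
                     t \<le> K * (card {..<n} ^ 3 * card E) \<and>
                     outputs_edge_colouring E es (max_degree {..<n} E) s)) \<and>
         (\<exists>p K. \<forall>(n :: nat) E es.
            fin_simple_graph {..<n} E \<and> chordless E \<and> 3 \<le> max_degree {..<n} E \<and>
            edge_list E es \<longrightarrow>
              (\<exists>t s. exec p (input_store n es) t s \<and>
                     t \<le> K * (card {..<n} ^ 3 * card E) \<and>
                     outputs_total_colouring n E es (max_degree {..<n} E + 1) s))"
proof (intro conjI)
  show "\<forall>(V :: 'a set) E. fin_simple_graph V E \<and> chordless E \<and> 3 \<le> max_degree V E \<longrightarrow>
      edge_colourable E (max_degree V E) \<and> total_colourable V E (max_degree V E + 1)"
    using chordless_colourable by blast
next
  obtain C where C: "\<forall>n E es. fin_simple_graph {..<n} E \<and> chordless E \<and> 3 \<le> max_degree {..<n} E \<and> edge_list E es \<longrightarrow>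
     (\<exists>t s. exec (prog False) (input_store n es) t s \<and> t \<le> C * (card {..<n} ^ 3 * card E) \<and>
        outputs_edge_colouring E es (max_degree {..<n} E + of_bool False) s \<and>
        (False \<longrightarrow> outputs_total_colouring n E es (max_degree {..<n} E + of_bool False) s))"
    using prog_correct[of False] by blast
  show "\<exists>p K. \<forall>(n :: nat) E es. fin_simple_graph {..<n} E \<and> chordless E \<and> 3 \<le> max_degree {..<n} E \<and> edge_list E es \<longrightarrow>
      (\<exists>t s. exec p (input_store n es) t s \<and> t \<le> K * (card {..<n} ^ 3 * card E) \<and>
         outputs_edge_colouring E es (max_degree {..<n} E) s)"
    by (rule exI[of _ "prog False"], rule exI[of _ C]) (use C in simp)
next
  obtain C where C: "\<forall>n E es. fin_simple_graph {..<n} E \<and> chordless E \<and> 3 \<le> max_degree {..<n} E \<and> edge_list E es \<longrightarrow>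
     (\<exists>t s. exec (prog True) (input_store n es) t s \<and> t \<le> C * (card {..<n} ^ 3 * card E) \<and>
        outputs_edge_colouring E es (max_degree {..<n} E + of_bool True) s \<and>
        (True \<longrightarrow> outputs_total_colouring n E es (max_degree {..<n} E + of_bool True) s))"
    using prog_correct[of True] by blast
  show "\<exists>p K. \<forall>(n :: nat) E es. fin_simple_graph {..<n} E \<and> chordless E \<and> 3 \<le> max_degree {..<n} E \<and> edge_list E es \<longrightarrow>
      (\<exists>t s. exec p (input_store n es) t s \<and> t \<le> K * (card {..<n} ^ 3 * card E) \<and>
         outputs_total_colouring n E es (max_degree {..<n} E + 1) s)"
    by (rule exI[of _ "prog True"], rule exI[of _ C]) (use C[unfolded of_bool_eq] in blast)
qed

end
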